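(* Suppose that $f(X)\in L^p$ and $\tilde f(X_1,\dots,X_{\tilde d})\in L^p$ for every $p<\infty$, and that $\mu>0$. For either choice of sign $\pm$ let $$\tilde V_\pm(x):=\frac{\tilde U_{N_\pm(x)}-\mu^{-\tilde d}\,\tilde\mu\,(\tilde d!)^{-1}x^{\tilde d}}{x^{\tilde d-1/2}}.$$ (i) As $x\to\infty$, $\tilde V_\pm(x)\overset{\mathrm d}{\longrightarrow}N(0,\gamma^2)$ holds with convergence of all moments and absolute moments (i.e., every moment of positive integer order and every absolute moment of positive real order of $\tilde V_\pm(x)$ converges to that of the limit). (ii) If furthermore $f(X)$ is integer-valued and $f(X)\ge0$, then the conclusion of (i) (convergence in distribution to $N(0,\gamma^2)$ together with convergence of all moments and absolute moments) holds also for $\tilde V_\pm(x)$ conditioned on $R(x)=k$, for every fixed integer $k\ge1$, as $x\to\infty$ through the integers, and for $\tilde V_\pm(x)$ conditioned on $U_{N_-(x)}=x$, as $x\to\infty$ through the integers. (In both cases only those $x$ are considered for which the conditioning event has positive probability.)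
   Context: $X,X_1,X_2,\dots$ is an i.i.d. sequence of random variables with values in an arbitrary measurable space $(S,\mathcal S)$; $\tilde d\ge1$ is a fixed integer, and $f:S\to\mathbb R$, $\tilde f:S^{\tilde d}\to\mathbb R$ are measurable (no symmetry assumed). For $n\ge0$, $U_n:=\sum_{i=1}^nf(X_i)$ and $\tilde U_n:=\sum_{1\le i_1<\dots<i_{\tilde d}\le n}\tilde f(X_{i_1},\dots,X_{i_{\tilde d}})$; $\mu:=\mathbb Ef(X)$, $\tilde\mu:=\mathbb E\tilde f(X_1,\dots,X_{\tilde d})$, and $\tilde f_i(x):=\mathbb E\tilde f(X_1,\dots,X_{i-1},x,X_{i+1},\dots,X_{\tilde d})-\tilde\mu$ for $1\le i\le\tilde d$. For $x>0$, $N_-(x):=\sup\{n\ge0:U_n\le x\}$, $N_+(x):=\inf\{n\ge0:U_n>x\}$ (a.s. finite when $\mu>0$), and the overshoot is $R(x):=U_{N_+(x)}-x$. The constant $\gamma^2$ is $$\gamma^2:=\mu^{1-2\tilde d}\sum_{i,j=1}^{\tilde d}\frac{(i+j-2)!\,(2\tilde d-i-j)!}{(i-1)!\,(j-1)!\,(\tilde d-i)!\,(\tilde d-j)!\,(2\tilde d-1)!}\operatorname{Cov}\bigl(\tilde f_i(X),\tilde f_j(X)\bigr)-2\frac{\mu^{-2\tilde d}\tilde\mu}{(\tilde d-1)!\,\tilde d!}\sum_{i=1}^{\tilde d}\operatorname{Cov}\bigl(f(X),\tilde f_i(X)\bigr)+\frac{\mu^{-2\tilde d-1}\tilde\mu^2}{(\tilde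 d-1)!^2}\operatorname{Var}\bigl(f(X)\bigr),$$ and $N(0,0)$ is the point mass at $0$. *)

theory Defs
  imports "HOL-Probability.Probability"
begin

section \<open>Convergence in distribution with all moments\<close>

text \<open>The library's \<^const>\<open>weak_conv_m\<close> is about sequences; here the index runs along
  an arbitrary filter.\<close>

definition weak_conv_along :: "('i \<Rightarrow> real measure) \<Rightarrow> real measure \<Rightarrow> 'i filter \<Rightarrow> bool" where
  "weak_conv_along \<mu> L F \<longleftrightarrow>
     (\<forall>y. isCont (cdf L) y \<longrightarrow> ((\<lambda>i. cdf (\<mu> i) y) \<longlongrightarrow> cdf L y) F)"

lemma weak_conv_along_sequentially: "weak_conv_along \<mu> L sequentially \<longleftrightarrow> weak_conv_m \<mu> L"
  by (simp add: weak_conv_along_def weak_conv_m_def weak_conv_def)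

text \<open>\<open>g\<close>-moments. The integrability clauses are needed because the Bochner integral of a
  non-integrable function is \<open>0\<close>.\<close>

definition moment_conv_along ::
  "(real \<Rightarrow> real) \<Rightarrow> ('i \<Rightarrow> real measure) \<Rightarrow> real measure \<Rightarrow> 'i filter \<Rightarrow> bool" where
  "moment_conv_along g \<mu> L F \<longleftrightarrow>
     (\<forall>\<^sub>F i in F. integrable (\<mu> i) g) \<and> integrable L g \<and>
     ((\<lambda>i. \<integral>y. g y \<partial>\<mu> i) \<longlongrightarrow> (\<integral>y. g y \<partial>L)) F"

definition conv_dist_all_moments ::
  "('i \<Rightarrow> real measure) \<Rightarrow> real measure \<Rightarrow> 'i filter \<Rightarrow> bool" where
  "conv_dist_all_moments \<mu> L F \<longleftrightarrow>
     weak_conv_along \<mu> L F \<and>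
     (\<forall>k::nat. k \<ge> 1 \<longrightarrow> moment_conv_along (\<lambda>y. y ^ k) \<mu> L F) \<and>
     (\<forall>r::real. r > 0 \<longrightarrow> moment_conv_along (\<lambda>y. \<bar>y\<bar> powr r) \<mu> L F)"

text \<open>The normal law with mean \<open>m\<close> and variance (not standard deviation) \<open>v \<ge> 0\<close>,
  degenerate for \<open>v = 0\<close>.\<close>

definition normal_law :: "real \<Rightarrow> real \<Rightarrow> real measure" where
  "normal_law m v =
     (if v > 0 then density lborel (\<lambda>y. ennreal (normal_density m (sqrt v) y))
      else return borel m)"

definition covariance :: "'a measure \<Rightarrow> ('a \<Rightarrow> real) \<Rightarrow> ('a \<Rightarrow> real) \<Rightarrow> real" where
  "covariance M Y Z =
     (\<integral>\<omega>. (Y \<omega> - (\<integral>\<omega>'. Y \<omega>' \<partial>M)) * (Z \<omega> - (\<integral>\<omega>'. Z \<omega>' \<partial>M)) \<partial>M)"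

section \<open>Asymmetric U-statistics and renewal times\<close>

text \<open>A family \<open>X :: nat \<Rightarrow> 'a \<Rightarrow> 'b\<close> encodes the generic variable as \<open>X 0\<close> and the sequence as
  \<open>X 1, X 2, \<dots>\<close>. An element \<open>(x\<^sub>1, \<dots>, x\<^sub>d)\<close> of \<open>S\<^sup>d\<close> is an extensional function on \<open>{1..d}\<close>,
  i.e. an element of the space of \<open>PiM {1..d} (\<lambda>_. S)\<close>.\<close>

definition U_sum :: "(nat \<Rightarrow> 'a \<Rightarrow> 'b) \<Rightarrow> ('b \<Rightarrow> real) \<Rightarrow> nat \<Rightarrow> 'a \<Rightarrow> real" where
  "U_sum X f n \<omega> = (\<Sum>i=1..n. f (X i \<omega>))"

definition U_stat ::
  "(nat \<Rightarrow> 'a \<Rightarrow> 'b) \<Rightarrow> nat \<Rightarrow> ((nat \<Rightarrow> 'b) \<Rightarrow> real) \<Rightarrow> nat \<Rightarrow> 'a \<Rightarrow> real" where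
  "U_stat X d g n \<omega> =
     (\<Sum>s \<in> {s \<in> {1..d} \<rightarrow>\<^sub>E {1..n}. strict_mono_on {1..d} s}. g (\<lambda>j\<in>{1..d}. X (s j) \<omega>))"

text \<open>\<open>Sup\<close> and \<open>Inf\<close> are those of type \<open>nat\<close>. When the expectation of \<open>f (X 0)\<close> is positive,
  the first set is almost surely finite and the second almost surely nonempty; on the exceptional
  null set, where the mathematical value is infinite, \<open>Sup\<close> and \<open>Inf\<close> return an
  arbitrary fixed number.\<close>

definition N_minus :: "(nat \<Rightarrow> 'a \<Rightarrow> 'b) \<Rightarrow> ('b \<Rightarrow> real) \<Rightarrow> real \<Rightarrow> 'a \<Rightarrow> nat" where
  "N_minus X f x \<omega> = Sup {n. U_sum X f n \<omega> \<le> x}"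

definition N_plus :: "(nat \<Rightarrow> 'a \<Rightarrow> 'b) \<Rightarrow> ('b \<Rightarrow> real) \<Rightarrow> real \<Rightarrow> 'a \<Rightarrow> nat" where
  "N_plus X f x \<omega> = Inf {n. U_sum X f n \<omega> > x}"

definition overshoot :: "(nat \<Rightarrow> 'a \<Rightarrow> 'b) \<Rightarrow> ('b \<Rightarrow> real) \<Rightarrow> real \<Rightarrow> 'a \<Rightarrow> real" where
  "overshoot X f x \<omega> = U_sum X f (N_plus X f x \<omega>) \<omega> - x"

definition mean1 :: "'a measure \<Rightarrow> (nat \<Rightarrow> 'a \<Rightarrow> 'b) \<Rightarrow> ('b \<Rightarrow> real) \<Rightarrow> real" where
  "mean1 M X f = (\<integral>\<omega>. f (X 0 \<omega>) \<partial>M)"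

definition mean_tuple ::
  "'a measure \<Rightarrow> (nat \<Rightarrow> 'a \<Rightarrow> 'b) \<Rightarrow> nat \<Rightarrow> ((nat \<Rightarrow> 'b) \<Rightarrow> real) \<Rightarrow> real" where
  "mean_tuple M X d g = (\<integral>\<omega>. g (\<lambda>j\<in>{1..d}. X j \<omega>) \<partial>M)"

definition projection ::
  "'a measure \<Rightarrow> (nat \<Rightarrow> 'a \<Rightarrow> 'b) \<Rightarrow> nat \<Rightarrow> ((nat \<Rightarrow> 'b) \<Rightarrow> real) \<Rightarrow> nat \<Rightarrow> 'b \<Rightarrow> real" where
  "projection M X d g i x =
     (\<integral>\<omega>. g (\<lambda>j\<in>{1..d}. if j = i then x else X j \<omega>) \<partial>M) - mean_tuple M X d g"

definition gamma_sq ::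
  "'a measure \<Rightarrow> (nat \<Rightarrow> 'a \<Rightarrow> 'b) \<Rightarrow> nat \<Rightarrow> ('b \<Rightarrow> real) \<Rightarrow> ((nat \<Rightarrow> 'b) \<Rightarrow> real) \<Rightarrow> real" where
  "gamma_sq M X d f g =
     (let \<mu> = mean1 M X f; \<mu>' = mean_tuple M X d g;
          h = (\<lambda>i \<omega>. projection M X d g i (X 0 \<omega>))
      in \<mu> powi (1 - 2 * int d) *
           (\<Sum>i=1..d. \<Sum>j=1..d.
              (fact (i + j - 2) * fact (2 * d - i - j)) /
              (fact (i - 1) * fact (j - 1) * fact (d - i) * fact (d - j) * fact (2 * d - 1)) *
              covariance M (h i) (h j))
         - 2 * (\<mu> powi (- 2 * int d) * \<mu>' / (fact (d - 1) * fact d)) *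
             (\<Sum>i=1..d. covariance M (\<lambda>\<omega>. f (X 0 \<omega>)) (h i))
         + \<mu> powi (- 2 * int d - 1) * \<mu>'\<^sup>2 / (fact (d - 1))\<^sup>2 *
             prob_space.variance M (\<lambda>\<omega>. f (X 0 \<omega>)))"

text \<open>\<open>N\<close> stands for \<open>N_minus X f\<close> or \<open>N_plus X f\<close>.\<close>

definition V_norm ::
  "'a measure \<Rightarrow> (nat \<Rightarrow> 'a \<Rightarrow> 'b) \<Rightarrow> nat \<Rightarrow> ('b \<Rightarrow> real) \<Rightarrow> ((nat \<Rightarrow> 'b) \<Rightarrow> real) \<Rightarrow>
   (real \<Rightarrow> 'a \<Rightarrow> nat) \<Rightarrow> real \<Rightarrow> 'a \<Rightarrow> real" where
  "V_norm M X d f g N x \<omega> =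
     (U_stat X d g (N x \<omega>) \<omega>
        - mean1 M X f powi (- int d) * mean_tuple M X d g * inverse (fact d) * x ^ d)
     / x powr (real d - 1 / 2)"

text \<open>The law of \<open>Y x\<close> conditioned on the event \<open>A x\<close>, as \<open>x \<rightarrow> \<infinity>\<close> through those
  integers for which \<open>A x\<close> has positive probability.\<close>

definition cond_conv_dist_all_moments ::
  "'a measure \<Rightarrow> (real \<Rightarrow> 'a \<Rightarrow> bool) \<Rightarrow> (real \<Rightarrow> 'a \<Rightarrow> real) \<Rightarrow> real measure \<Rightarrow> bool" where
  "cond_conv_dist_all_moments M A Y L \<longleftrightarrow>
     conv_dist_all_moments
       (\<lambda>x. distr (uniform_measure M {\<omega> \<in> space M. A x \<omega>}) borel (Y x)) L
       (inf at_top (principal {x. x \<in> \<int> \<and> measure M {\<omega> \<in> space M. A x \<omega>} > 0}))"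

end

(* Centre the walk and the U-statistic: T n = U n - mu * n, and Z n is the U-statistic of the kernel
   minus its mean. Decomposing Z into martingale differences bounds all its even moments, and a
   Borel-Cantelli argument turns this into increments of T and Z that are controlled for all
   m <= n at once, by a random constant K with finite moments of all orders. On such a path V(x),
   taken at either renewal time, differs by O(K^B x^(-1/16)) from a linear expression Y(x) evaluated
   at the deterministic time m = (x - x^(3/4)) / mu. The Hajek projection makes Y(x) a weighted sum
   of independent variables, whence the normal limit; the moments of V(x) are bounded, so they
   converge as well.

   For the conditional statements, Y(x) depends on the first m variables only, and U m is still far
   below x. Given these variables, the conditioning event is the same event for a fresh walk started
   at U m, of probability a(x - U m). By a renewal theorem a(z) tends to a positive constant
   along the admissible residue class, or vanishes for all large z, so conditioning does not
   change the limit law of Y(x). *)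
theory Submission
  imports Defs "HOL-Real_Asymp.Real_Asymp"
begin

section \<open>Moments of martingale sums\<close>

text \<open>The conditioning events look at the path up to the renewal time itself, so the limit law
  has to be extracted earlier, where the event still has almost all of its randomness ahead. The
  exponents follow from one slack, \<open>1 / 16\<close>, in the increment bounds. The walk
  fluctuates by \<open>x powr (1 / 2 + 1 / 16)\<close>, so a gap \<open>x powr a\<close> with
  \<open>a > 9 / 16\<close> keeps it below \<open>x\<close>. Over this gap the centred processes
  move by the exponent \<open>a / 2 + 1 / 16\<close>, which has to stay below \<open>1 / 2\<close>.
  Any \<open>a\<close> between \<open>9 / 16\<close> and \<open>7 / 8\<close> would do;
  \<open>a = 3 / 4\<close> leaves the error \<open>x powr (- (1 / 16))\<close>. The slack itself
  pays for the union over all pairs \<open>m < n\<close>: it decays faster than any fixed power of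
  \<open>n\<close> once the moment order is large, which is where the existence of all moments
  enters. The kernel is not symmetric, so it is decomposed by averaging its last argument only. The
  positions inside a tuple then stay distinguishable, an observation enters the projection with a
  different binomial weight for each position, and the sums of products of two weights become the
  Beta integrals in the variance.\<close>

lemma even_power_split:
  fixes x :: "'a :: monoid_mult"
  assumes "k \<ge> 1"
  shows "x ^ (2 * k) = x ^ (2 * k - 2) * x\<^sup>2"
proof -
  obtain m where "k = Suc m" using assms by (cases k) auto
  then have "2 * k = (2 * k - 2) + 2" by simp
  then show ?thesis by (metis power_add)
qed

text \<open>Replace the smaller of the two bases by the larger one. This crude form of Young's
  inequality suffices because only orders of magnitude of moments matter.\<close>

lemma abs_mixed_power_le:
  fixes a b :: real
  shows "\<bar>a\<bar> ^ p * \<bar>b\<bar> ^ q \<le> \<bar>a\<bar> ^ (p + q) + \<bar>b\<bar> ^ (p + q)"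
proof (cases "\<bar>a\<bar> \<le> \<bar>b\<bar>")
  case True
  have "\<bar>a\<bar> ^ p * \<bar>b\<bar> ^ q \<le> \<bar>b\<bar> ^ p * \<bar>b\<bar> ^ q"
    by (intro mult_right_mono power_mono True) auto
  then show ?thesis by (simp add: power_add add_increasing)
next
  case False
  have "\<bar>a\<bar> ^ p * \<bar>b\<bar> ^ q \<le> \<bar>a\<bar> ^ p * \<bar>a\<bar> ^ q"
    using False by (intro mult_left_mono power_mono) auto
  then show ?thesis by (simp add: power_add add_increasing2)
qed

text \<open>The term linear in \<open>D\<close> is kept exactly, since its expectation vanishes when
  \<open>D\<close> is a martingale difference. Every later term of the expansion contains
  \<open>D\<^sup>2\<close>; its remaining factor has total degree \<open>2 * k - 2\<close> and is
  split by \<open>abs_mixed_power_le\<close>, and the binomial coefficients add up to at most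
  \<open>4 ^ k\<close>.\<close>

lemma binomial_even_power_bound:
  fixes s D :: real
  assumes "k \<ge> 1"
  shows "(s + D) ^ (2 * k) \<le> s ^ (2 * k) + 2 * real k * (s ^ (2 * k - 1) * D)
           + 4 ^ k * (s ^ (2 * k - 2) * D\<^sup>2 + D ^ (2 * k))"
proof -
  define m where "m = s ^ (2 * k - 2) * D\<^sup>2 + D ^ (2 * k)"
  define t where "t j = real (2 * k choose j) * D ^ j * s ^ (2 * k - j)" for j
  have ev: "even (2 * k - 2)" by simp
  have m0: "m \<ge> 0" unfolding m_def using ev by (simp add: zero_le_even_power)
  have tb: "t j \<le> real (2 * k choose j) * m" if j: "j \<in> {2..2*k}" for j
  proof -
    obtain r where r: "j = r + 2" using j by (metis atLeastAtMost_iff le_add_diff_inverse2)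
    have "D ^ j * s ^ (2 * k - j) \<le> \<bar>D\<bar> ^ j * \<bar>s\<bar> ^ (2 * k - j)"
      by (metis abs_ge_self abs_mult power_abs)
    also have "\<dots> = \<bar>D\<bar> ^ 2 * (\<bar>D\<bar> ^ r * \<bar>s\<bar> ^ (2 * k - j))"
      by (simp add: r power_add power2_eq_square)
    also have "\<dots> \<le> \<bar>D\<bar> ^ 2 * (\<bar>D\<bar> ^ (r + (2 * k - j)) + \<bar>s\<bar> ^ (r + (2 * k - j)))"
      by (intro mult_left_mono abs_mixed_power_le) auto
    also have "r + (2 * k - j) = 2 * k - 2" using r j by auto
    also have "\<bar>D\<bar> ^ 2 * (\<bar>D\<bar> ^ (2 * k - 2) + \<bar>s\<bar> ^ (2 * k - 2)) = m"
    proof -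
      have "\<bar>D\<bar> ^ 2 * \<bar>D\<bar> ^ (2 * k - 2) = \<bar>D\<bar> ^ (2 * k)"
        using even_power_split[OF assms, of "\<bar>D\<bar>"] by (simp only: mult.commute)
      then have "\<bar>D\<bar> ^ 2 * \<bar>D\<bar> ^ (2 * k - 2) = D ^ (2 * k)"
        by (simp add: power_even_abs)
      moreover have "\<bar>s\<bar> ^ (2 * k - 2) = s ^ (2 * k - 2)" using ev by (simp add: power_even_abs)
      ultimately show ?thesis by (simp add: m_def algebra_simps)
    qed
    finally have "D ^ j * s ^ (2 * k - j) \<le> m" .
    then show ?thesis unfolding t_def
      by (simp add: mult.assoc mult_left_mono)
  qed
  have "(s + D) ^ (2 * k) = (D + s) ^ (2 * k)" by (simp add: add.commute)
  also have "\<dots> = (\<Sum>j\<le>2*k. t j)" by (simp add: binomial_ring t_def)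
  also have "{..2*k} = insert 0 (insert 1 {2..2*k})" using assms by auto
  also have "(\<Sum>j\<in>insert 0 (insert 1 {2..2*k}). t j) = t 0 + t 1 + (\<Sum>j\<in>{2..2*k}. t j)" by simp
  also have "(\<Sum>j\<in>{2..2*k}. t j) \<le> (\<Sum>j\<in>{2..2*k}. real (2 * k choose j) * m)"
    by (intro sum_mono tb)
  also have "\<dots> \<le> (\<Sum>j\<le>2*k. real (2 * k choose j) * m)"
    by (intro sum_mono2) (auto simp: m0)
  also have "\<dots> = real (\<Sum>j\<le>2*k. 2 * k choose j) * m" by (simp add: sum_distrib_right)
  also have "\<dots> = 4 ^ k * m" by (simp add: choose_row_sum power_mult)
  finally show ?thesis by (simp add: t_def m_def algebra_simps)
qed

text \<open>Convexity of the even power, applied to the average of the \<open>a i\<close>.\<close>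

lemma power_sum_le:
  fixes a :: "'i \<Rightarrow> real"
  assumes "k \<ge> 1" "finite A"
  shows "(\<Sum>i\<in>A. a i) ^ (2 * k) \<le> real (card A) ^ (2 * k - 1) * (\<Sum>i\<in>A. a i ^ (2 * k))"
proof (cases "A = {}")
  case True
  then show ?thesis using assms by (simp add: zero_power)
next
  case False
  define n where "n = real (card A)"
  have n: "n > 0" using False assms by (simp add: n_def card_gt_0_iff)
  have "(\<Sum>i\<in>A. (1 / n) *\<^sub>R a i) ^ (2 * k) \<le> (\<Sum>i\<in>A. (1 / n) * a i ^ (2 * k))"
    by (rule convex_on_sum[where f = "\<lambda>x. x ^ (2 * k)" and C = UNIV])
       (use assms n False in \<open>auto intro!: convex_power_even simp: n_def\<close>)
  then have "((\<Sum>i\<in>A. a i) / n) ^ (2 * k) \<le> (\<Sum>i\<in>A. a i ^ (2 * k)) / n"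
    by (simp add: sum_divide_distrib)
  then have "(\<Sum>i\<in>A. a i) ^ (2 * k) \<le> n ^ (2 * k) * ((\<Sum>i\<in>A. a i ^ (2 * k)) / n)"
    using n by (simp add: power_divide field_simps)
  also have "n ^ (2 * k) = n ^ (2 * k - 1) * n"
    using assms by (metis One_nat_def add_diff_cancel_right' mult.commute mult_2_right
      not_one_le_zero power_eq_if mult_is_0 numeral_2_eq_2 nat.simps(3))
  finally show ?thesis using n by (simp add: n_def)
qed

lemma diff_even_power_le:
  fixes a b :: real
  assumes "k \<ge> 1"
  shows "(a + b) ^ (2 * k) \<le> 4 ^ k * (a ^ (2 * k) + b ^ (2 * k))"
    and "(a - b) ^ (2 * k) \<le> 4 ^ k * (a ^ (2 * k) + b ^ (2 * k))"
proof -
  have *: "(a + b) ^ (2 * k) \<le> 4 ^ k * (a ^ (2 * k) + b ^ (2 * k))" for b :: real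
  proof -
    define c where "c i = (if i = (0::nat) then a else b)" for i
    have s: "sum F {..<2::nat} = F 0 + F 1" for F :: "nat \<Rightarrow> real"
      by (simp add: numeral_2_eq_2)
    have "(a + b) ^ (2 * k) = (\<Sum>i<2. c i) ^ (2 * k)" by (simp add: s c_def)
    also have "\<dots> \<le> 2 ^ (2 * k - 1) * (\<Sum>i<2. c i ^ (2 * k))"
      using power_sum_le[OF assms, of "{..<2::nat}" c] by simp
    also have "\<dots> = 2 ^ (2 * k - 1) * (a ^ (2 * k) + b ^ (2 * k))" by (simp add: s c_def)
    also have "\<dots> \<le> 2 ^ (2 * k) * (a ^ (2 * k) + b ^ (2 * k))"
      by (intro mult_right_mono power_increasing) (auto simp: zero_le_even_power)
    finally show ?thesis by (simp add: power_mult)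
  qed
  show "(a + b) ^ (2 * k) \<le> 4 ^ k * (a ^ (2 * k) + b ^ (2 * k))" by (rule *)
  show "(a - b) ^ (2 * k) \<le> 4 ^ k * (a ^ (2 * k) + b ^ (2 * k))" using *[of "- b"] by simp
qed

lemma integrable_power_sum:
  fixes F :: "'i \<Rightarrow> 'a \<Rightarrow> real"
  assumes "k \<ge> 1" "finite A" "\<And>i. i \<in> A \<Longrightarrow> F i \<in> borel_measurable M"
    and "\<And>i. i \<in> A \<Longrightarrow> integrable M (\<lambda>x. F i x ^ (2 * k))"
  shows "integrable M (\<lambda>x. (\<Sum>i\<in>A. F i x) ^ (2 * k))"
proof (rule Bochner_Integration.integrable_bound)
  show "integrable M (\<lambda>x. real (card A) ^ (2 * k - 1) * (\<Sum>i\<in>A. F i x ^ (2 * k)))"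
    using assms by auto
  show "(\<lambda>x. (\<Sum>i\<in>A. F i x) ^ (2 * k)) \<in> borel_measurable M"
    using assms by auto
  show "AE x in M. norm ((\<Sum>i\<in>A. F i x) ^ (2 * k))
      \<le> norm (real (card A) ^ (2 * k - 1) * (\<Sum>i\<in>A. F i x ^ (2 * k)))"
    using power_sum_le[OF assms(1,2)]
    by (auto simp: zero_le_even_power sum_nonneg abs_mult)
qed

lemma integrable_power_add:
  fixes F G :: "'a \<Rightarrow> real"
  assumes "k \<ge> 1" "F \<in> borel_measurable M" "G \<in> borel_measurable M"
    and "integrable M (\<lambda>x. F x ^ (2 * k))" "integrable M (\<lambda>x. G x ^ (2 * k))"
  shows "integrable M (\<lambda>x. (F x + G x) ^ (2 * k))"
    and "integrable M (\<lambda>x. (F x - G x) ^ (2 * k))"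
proof -
  have "integrable M (\<lambda>x. 4 ^ k * (F x ^ (2 * k) + G x ^ (2 * k)))"
    using assms by auto
  then show "integrable M (\<lambda>x. (F x + G x) ^ (2 * k))"
      "integrable M (\<lambda>x. (F x - G x) ^ (2 * k))"
    by (rule Bochner_Integration.integrable_bound;
        use assms diff_even_power_le[OF assms(1)] in
          \<open>auto simp: zero_le_even_power abs_mult\<close>)+
qed

text \<open>An even \<open>p + q\<close> makes both dominating powers nonnegative, so that their sum
  is a dominating function.\<close>

lemma integrable_power_mixed:
  fixes F G :: "'a \<Rightarrow> real"
  assumes "F \<in> borel_measurable M" "G \<in> borel_measurable M" "even (p + q)"
    and "integrable M (\<lambda>x. F x ^ (p + q))" "integrable M (\<lambda>x. G x ^ (p + q))"
  shows "integrable M (\<lambda>x. F x ^ p * G x ^ q)"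
proof (rule Bochner_Integration.integrable_bound)
  show "integrable M (\<lambda>x. F x ^ (p + q) + G x ^ (p + q))" using assms by auto
  show "(\<lambda>x. F x ^ p * G x ^ q) \<in> borel_measurable M" using assms by auto
  show "AE x in M. norm (F x ^ p * G x ^ q) \<le> norm (F x ^ (p + q) + G x ^ (p + q))"
    using abs_mixed_power_le[of _ p _ q] assms(3)
    by (auto simp: abs_mult power_abs power_even_abs zero_le_even_power)
qed

text \<open>The factor \<open>exp (4 ^ k)\<close> comes from a discrete Gronwall argument;
  \<open>2 * 4 ^ k\<close> is the weight of the new increment in a single step.\<close>

definition mart_const :: "nat \<Rightarrow> real" where
  "mart_const k = exp (4 ^ k) * 2 * 4 ^ k"

lemma mart_const_nonneg: "mart_const k \<ge> 0" by (simp add: mart_const_def)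

text \<open>An elementary substitute for Burkholder's inequality. The martingale property enters
  only through \<open>orth\<close>, which removes the linear term of the expansion. What remains is
  a recursion for the moment of order \<open>2 * k\<close> with growth factor
  \<open>1 + c / N\<close>, which stays bounded over \<open>N\<close> steps. The order
  \<open>N ^ k\<close> instead of \<open>N ^ (2 * k)\<close> is the gain from cancellation.\<close>

lemma martingale_moment:
  fixes D :: "nat \<Rightarrow> 'a \<Rightarrow> real"
  assumes k: "k \<ge> 1"
    and meas: "\<And>i. i < N \<Longrightarrow> D i \<in> borel_measurable M"
    and int: "\<And>i. i < N \<Longrightarrow> integrable M (\<lambda>x. D i x ^ (2 * k))"
    and bound: "\<And>i. i < N \<Longrightarrow> (\<integral>x. D i x ^ (2 * k) \<partial>M) \<le> B"
    and orth: "\<And>i. i < N \<Longrightarrow> (\<integral>x. (\<Sum>j<i. D j x) ^ (2 * k - 1) * D i x \<partial>M) = 0"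
  shows "(\<integral>x. (\<Sum>j<N. D j x) ^ (2 * k) \<partial>M) \<le> mart_const k * real N ^ k * B"
proof (cases "N = 0")
  case True
  then show ?thesis using k by (simp add: zero_power)
next
  case False
  define n where "n = real N"
  have n: "n \<ge> 1" using False by (simp add: n_def)
  define c :: real where "c = 4 ^ k"
  have c0: "c \<ge> 1" by (simp add: c_def)
  define S where "S i x = (\<Sum>j<i. D j x)" for i x
  have "0 \<le> (\<integral>x. D 0 x ^ (2 * k) \<partial>M)"
    by (intro Bochner_Integration.integral_nonneg) (simp add: zero_le_even_power)
  with bound[of 0] False have B0: "B \<ge> 0" by linarith
  have Smeas: "S i \<in> borel_measurable M" if "i \<le> N" for i
    unfolding S_def using that meas by auto
  have Sint: "integrable M (\<lambda>x. S i x ^ (2 * k))" if "i \<le> N" for i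
    unfolding S_def using that meas int by (intro integrable_power_sum k) auto
  \<comment> \<open>According to whether \<open>n * d\<^sup>2 \<le> s\<^sup>2\<close>, the mixed
    term goes into \<open>s ^ (2 * k)\<close> with factor \<open>1 / n\<close> or into
    \<open>d ^ (2 * k)\<close> with factor \<open>n ^ (k - 1)\<close>. The threshold is the total
    number \<open>n\<close> of steps, so that all growth factors multiply to at most
    \<open>exp c\<close>.\<close>
  have point: "(s + d) ^ (2 * k) \<le> (1 + c / n) * s ^ (2 * k) + 2 * real k * (s ^ (2 * k - 1) * d)
      + (2 * c * n ^ (k - 1)) * d ^ (2 * k)" for s d :: real
  proof -
    have dk: "0 \<le> d ^ (2 * k)" by (simp add: zero_le_even_power)
    have s2: "s ^ (2 * k) = s ^ (2 * k - 2) * s\<^sup>2"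
      by (rule even_power_split[OF k])
    have d2: "d ^ (2 * k) = (d\<^sup>2) ^ (k - 1) * d\<^sup>2"
      using k by (metis One_nat_def le_simps(3) mult.commute power_mult power_minus_mult)
    have "s ^ (2 * k - 2) * d\<^sup>2 \<le> s ^ (2 * k) / n + n ^ (k - 1) * d ^ (2 * k)"
    proof (cases "n * d\<^sup>2 \<le> s\<^sup>2")
      case True
      then have "d\<^sup>2 \<le> s\<^sup>2 / n" using n by (simp add: field_simps)
      then have "s ^ (2 * k - 2) * d\<^sup>2 \<le> s ^ (2 * k - 2) * (s\<^sup>2 / n)"
        by (intro mult_left_mono) (auto simp: zero_le_even_power)
      also have "\<dots> = s ^ (2 * k) / n" by (simp add: s2)
      finally show ?thesis using n dk by (simp add: add_increasing2)
    next
      case False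
      have "s ^ (2 * k - 2) = (s\<^sup>2) ^ (k - 1)"
        by (metis One_nat_def diff_mult_distrib2 mult_2 nat_1_add_1 power_mult numeral_2_eq_2)
      also have "\<dots> \<le> (n * d\<^sup>2) ^ (k - 1)" using False by (intro power_mono) auto
      finally have "s ^ (2 * k - 2) * d\<^sup>2 \<le> (n * d\<^sup>2) ^ (k - 1) * d\<^sup>2"
        by (intro mult_right_mono) auto
      also have "\<dots> = n ^ (k - 1) * d ^ (2 * k)" by (simp add: d2 power_mult_distrib)
      finally show ?thesis using n by (simp add: add_increasing zero_le_even_power)
    qed
    then have "c * (s ^ (2 * k - 2) * d\<^sup>2) \<le> c * (s ^ (2 * k) / n + n ^ (k - 1) * d ^ (2 * k))"
      using c0 by (intro mult_left_mono) auto
    moreover have "c * d ^ (2 * k) \<le> c * (n ^ (k - 1) * d ^ (2 * k))"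
      using c0 dk n by (intro mult_left_mono) (auto simp: mult_le_cancel_right1 dest: not_le_imp_less)
    moreover have "(s + d) ^ (2 * k) \<le> s ^ (2 * k) + 2 * real k * (s ^ (2 * k - 1) * d)
        + (c * (s ^ (2 * k - 2) * d\<^sup>2) + c * d ^ (2 * k))"
      using binomial_even_power_bound[OF k, of s d] unfolding c_def distrib_left by simp
    ultimately have "(s + d) ^ (2 * k) \<le> s ^ (2 * k) + 2 * real k * (s ^ (2 * k - 1) * d)
        + c * (s ^ (2 * k) / n + n ^ (k - 1) * d ^ (2 * k)) + c * (n ^ (k - 1) * d ^ (2 * k))"
      by linarith
    also have "\<dots> = (1 + c / n) * s ^ (2 * k) + 2 * real k * (s ^ (2 * k - 1) * d)
      + (2 * c * n ^ (k - 1)) * d ^ (2 * k)"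
      by (simp add: algebra_simps)
    finally show ?thesis .
  qed
  have step: "(\<integral>x. S (Suc i) x ^ (2 * k) \<partial>M)
      \<le> (1 + c / n) * (\<integral>x. S i x ^ (2 * k) \<partial>M) + 2 * c * n ^ (k - 1) * B" if i: "i < N" for i
  proof -
    have mix: "integrable M (\<lambda>x. S i x ^ (2 * k - 1) * D i x)"
      using integrable_power_mixed[of "S i" M "D i" "2 * k - 1" 1] Smeas[of i] meas[of i] Sint[of i] int[of i] i k
      by simp
    have "(\<integral>x. S (Suc i) x ^ (2 * k) \<partial>M) \<le> (\<integral>x. (1 + c / n) * S i x ^ (2 * k)
        + 2 * real k * (S i x ^ (2 * k - 1) * D i x) + (2 * c * n ^ (k - 1)) * D i x ^ (2 * k) \<partial>M)"
      using Sint[of "Suc i"] Sint[of i] int[of i] i mix point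
      by (intro integral_mono) (auto simp: S_def)
    also have "\<dots> = (1 + c / n) * (\<integral>x. S i x ^ (2 * k) \<partial>M)
        + 2 * real k * (\<integral>x. S i x ^ (2 * k - 1) * D i x \<partial>M)
        + (2 * c * n ^ (k - 1)) * (\<integral>x. D i x ^ (2 * k) \<partial>M)"
      using Sint[of i] int[of i] i mix by simp
    also have "(\<integral>x. S i x ^ (2 * k - 1) * D i x \<partial>M) = 0" using orth[OF i] by (simp add: S_def)
    also have "(2 * c * n ^ (k - 1)) * (\<integral>x. D i x ^ (2 * k) \<partial>M) \<le> (2 * c * n ^ (k - 1)) * B"
      using c0 n by (intro mult_left_mono bound i) auto
    finally show ?thesis by simp
  qed
  have ind: "(\<integral>x. S i x ^ (2 * k) \<partial>M) \<le> (1 + c / n) ^ i * (real i * (2 * c * n ^ (k - 1) * B))"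
    if "i \<le> N" for i
    using that
  proof (induction i)
    case 0
    then show ?case using k by (simp add: S_def zero_power)
  next
    case (Suc i)
    define E where "E = 2 * c * n ^ (k - 1) * B"
    have E0: "E \<ge> 0" using c0 n B0 by (simp add: E_def)
    have one: "1 \<le> (1 + c / n) ^ Suc i" using c0 n by (intro one_le_power) auto
    have "(\<integral>x. S (Suc i) x ^ (2 * k) \<partial>M) \<le> (1 + c / n) * ((1 + c / n) ^ i * (real i * E)) + E"
      using step[of i] Suc mult_left_mono[of "\<integral>x. S i x ^ (2 * k) \<partial>M" "(1 + c / n) ^ i * (real i * E)" "1 + c / n"] c0 n
      by (auto simp: E_def)
    also have "\<dots> \<le> (1 + c / n) ^ Suc i * (real i * E) + (1 + c / n) ^ Suc i * E"
      using mult_right_mono[OF one E0] by simp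
    also have "\<dots> = (1 + c / n) ^ Suc i * (real (Suc i) * E)"
      unfolding of_nat_Suc distrib_left distrib_right by simp
    finally show ?case by (simp add: E_def)
  qed
  have "(1 + c / n) ^ N \<le> exp (c / n) ^ N"
    using c0 n by (intro power_mono) auto
  also have "\<dots> = exp c" using n by (simp flip: exp_of_nat_mult add: n_def)
  finally have ex: "(1 + c / n) ^ N \<le> exp c" .
  have "(\<integral>x. S N x ^ (2 * k) \<partial>M) \<le> (1 + c / n) ^ N * (n * (2 * c * n ^ (k - 1) * B))"
    using ind[of N] by (simp add: n_def)
  also have "\<dots> \<le> exp c * (n * (2 * c * n ^ (k - 1) * B))"
    using ex c0 n B0 by (intro mult_right_mono) auto
  also have "\<dots> = mart_const k * n ^ k * B"
    using k by (simp add: mart_const_def c_def power_eq_if[of n k])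
  finally show ?thesis by (simp add: S_def n_def)
qed

declare One_nat_def [simp del]

section \<open>The canonical space of an i.i.d. sequence\<close>

text \<open>Jensen's inequality in a form that is also true of default values: a non-integrable
  \<open>F\<close> has integral \<open>0\<close>, and a non-integrable power makes the right-hand
  side infinite. It can therefore be applied to every section of a kernel, although only almost
  every section is integrable.\<close>

lemma (in prob_space) power_integral_le_nn_integral:
  fixes F :: "'a \<Rightarrow> real"
  assumes [measurable]: "F \<in> borel_measurable M" and k: "k \<ge> 1"
  shows "ennreal ((\<integral>x. F x \<partial>M) ^ (2 * k)) \<le> (\<integral>\<^sup>+x. ennreal (F x ^ (2 * k)) \<partial>M)"
proof (cases "integrable M (\<lambda>x. F x ^ (2 * k))")
  case True
  show ?thesis
  proof (cases "integrable M F")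
    case False
    then show ?thesis using k by (simp add: not_integrable_integral_eq zero_power)
  next
    case int: True
    have "(\<integral>x. F x \<partial>M) ^ (2 * k) \<le> (\<integral>x. F x ^ (2 * k) \<partial>M)"
      by (rule jensens_inequality[OF int, of UNIV undefined undefined "\<lambda>x. x ^ (2 * k)"])
        (use True in \<open>simp_all add: convex_power_even\<close>)
    then have "ennreal ((\<integral>x. F x \<partial>M) ^ (2 * k)) \<le> ennreal (\<integral>x. F x ^ (2 * k) \<partial>M)"
      by (rule ennreal_leI)
    also have "\<dots> = (\<integral>\<^sup>+x. ennreal (F x ^ (2 * k)) \<partial>M)"
      using True by (intro nn_integral_eq_integral[symmetric]) (auto simp: zero_le_even_power)
    finally show ?thesis .
  qed
next
  case False
  have "(\<integral>\<^sup>+x. ennreal (F x ^ (2 * k)) \<partial>M) = \<infinity>"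
  proof (rule ccontr)
    assume "(\<integral>\<^sup>+x. ennreal (F x ^ (2 * k)) \<partial>M) \<noteq> \<infinity>"
    then have "(\<integral>\<^sup>+x. ennreal (F x ^ (2 * k)) \<partial>M) < \<infinity>"
      using top.not_eq_extremum infinity_ennreal_def by metis
    moreover have "AE x in M. 0 \<le> F x ^ (2 * k)" by (simp add: zero_le_even_power)
    moreover have "(\<lambda>x. F x ^ (2 * k)) \<in> borel_measurable M" by measurable
    ultimately show False
      using False integrableI_nonneg[of "\<lambda>x. F x ^ (2 * k)" M] by blast
  qed
  then show ?thesis by simp
qed

section \<open>Increasing index tuples, sorted by their largest entry\<close>

definition increasing_tuples :: "nat \<Rightarrow> nat \<Rightarrow> (nat \<Rightarrow> nat) set" where
  "increasing_tuples d n = {s \<in> {1..d} \<rightarrow>\<^sub>E {..<n}. strict_mono_on {1..d} s}"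

lemma finite_increasing_tuples [simp]: "finite (increasing_tuples d n)"
  unfolding increasing_tuples_def by (rule finite_subset[OF _ finite_PiE[of "{1..d}" "\<lambda>_. {..<n}"]]) auto

lemma card_increasing_tuples_le: "card (increasing_tuples d n) \<le> n ^ d"
proof -
  have "card (increasing_tuples d n) \<le> card ({1..d} \<rightarrow>\<^sub>E {..<n})"
    unfolding increasing_tuples_def by (intro card_mono finite_PiE) auto
  then show ?thesis by (simp add: card_PiE)
qed

lemma increasing_tuples_0: "increasing_tuples 0 n = {\<lambda>_. undefined}"
  by (auto simp: increasing_tuples_def strict_mono_on_def)

lemma increasing_tuples_empty: "d > 0 \<Longrightarrow> increasing_tuples d 0 = {}"
  by (force simp: increasing_tuples_def PiE_iff)

lemma increasing_tuples_less: "s \<in> increasing_tuples d n \<Longrightarrow> j \<in> {1..d} \<Longrightarrow> s j < n"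
  by (auto simp: increasing_tuples_def PiE_iff)

lemma increasing_tuples_inj: "s \<in> increasing_tuples d n \<Longrightarrow> inj_on s {1..d}"
  by (auto simp: increasing_tuples_def strict_mono_on_imp_inj_on)

text \<open>Sort the tuples by their last entry \<open>i\<close>, which is the largest; the other
  entries form a shorter tuple below \<open>i\<close>. This exposes the martingale structure,
  because the coordinate \<open>i\<close> is independent of everything that the shorter tuple
  selects.\<close>

lemma sum_increasing_tuples_Suc:
  fixes F :: "(nat \<Rightarrow> nat) \<Rightarrow> 'c::comm_monoid_add"
  shows "(\<Sum>s\<in>increasing_tuples (Suc d) n. F s)
    = (\<Sum>i<n. \<Sum>s\<in>increasing_tuples d i. F (s(Suc d := i)))"
proof -
  have "(\<Sum>i<n. \<Sum>s\<in>increasing_tuples d i. F (s(Suc d := i)))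
      = (\<Sum>(i, s)\<in>Sigma {..<n} (increasing_tuples d). F (s(Suc d := i)))"
    by (rule sum.Sigma) auto
  also have "\<dots> = (\<Sum>s\<in>increasing_tuples (Suc d) n. F s)"
  proof (rule sum.reindex_bij_witness[where
        i = "\<lambda>s. (s (Suc d), restrict s {1..d})" and j = "\<lambda>(i, s). s(Suc d := i)"])
    fix a assume a: "a \<in> Sigma {..<n} (increasing_tuples d)"
    obtain i s where as: "a = (i, s)" by (cases a)
    have i: "i < n" and s: "s \<in> increasing_tuples d i" using a as by auto
    from s have ext: "s \<in> extensional {1..d}" and lt: "\<And>j. j \<in> {1..d} \<Longrightarrow> s j < i"
      and sm: "\<And>j l. j \<in> {1..d} \<Longrightarrow> l \<in> {1..d} \<Longrightarrow> j < l \<Longrightarrow> s j < s l"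
      by (auto simp: increasing_tuples_def PiE_iff strict_mono_on_def)
    show "((case a of (i, s) \<Rightarrow> s(Suc d := i)) (Suc d),
        restrict (case a of (i, s) \<Rightarrow> s(Suc d := i)) {1..d}) = a"
      using extensional_restrict[OF ext] by (simp add: as restrict_fupd)
    have "s(Suc d := i) \<in> {1..Suc d} \<rightarrow>\<^sub>E {..<n}"
    proof (rule PiE_I)
      fix j assume "j \<in> {1..Suc d}"
      then show "(s(Suc d := i)) j \<in> {..<n}" using lt[of j] i by (cases "j = Suc d") auto
    next
      fix j assume "j \<notin> {1..Suc d}"
      then have "j \<noteq> Suc d" "j \<notin> {1..d}" by auto
      then show "(s(Suc d := i)) j = undefined" using ext by (simp add: extensional_def)
    qed
    moreover have "strict_mono_on {1..Suc d} (s(Suc d := i))"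
    proof (rule strict_mono_onI)
      fix j l assume "j \<in> {1..Suc d}" "l \<in> {1..Suc d}" "j < l"
      then show "(s(Suc d := i)) j < (s(Suc d := i)) l"
        using lt[of j] sm[of j l] by (cases "l = Suc d") auto
    qed
    ultimately show "(case a of (i, s) \<Rightarrow> s(Suc d := i)) \<in> increasing_tuples (Suc d) n"
      by (simp add: as increasing_tuples_def)
    show "F (case a of (i, s) \<Rightarrow> s(Suc d := i)) = (case a of (i, s) \<Rightarrow> F (s(Suc d := i)))"
      by (simp add: as)
  next
    fix s assume s: "s \<in> increasing_tuples (Suc d) n"
    then have ext: "s \<in> extensional {1..Suc d}" and lt: "\<And>j. j \<in> {1..Suc d} \<Longrightarrow> s j < n"
      and sm: "\<And>j l. j \<in> {1..Suc d} \<Longrightarrow> l \<in> {1..Suc d} \<Longrightarrow> j < l \<Longrightarrow> s j < s l"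
      by (auto simp: increasing_tuples_def PiE_iff strict_mono_on_def)
    show "(case (s (Suc d), restrict s {1..d}) of (i, s) \<Rightarrow> s(Suc d := i)) = s"
    proof
      fix x show "(case (s (Suc d), restrict s {1..d}) of (i, s) \<Rightarrow> s(Suc d := i)) x = s x"
        using extensional_arb[OF ext, of x] by (cases "x \<in> {1..Suc d}") auto
    qed
    have "restrict s {1..d} \<in> {1..d} \<rightarrow>\<^sub>E {..<s (Suc d)}"
      using sm[of _ "Suc d"] by (intro PiE_I) auto
    moreover have "strict_mono_on {1..d} (restrict s {1..d})"
      using sm by (intro strict_mono_onI) auto
    ultimately show "(s (Suc d), restrict s {1..d}) \<in> Sigma {..<n} (increasing_tuples d)"
      using lt[of "Suc d"] by (auto simp: increasing_tuples_def)
  qed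
  finally show ?thesis ..
qed

section \<open>The sequence space, fresh coordinates and U-statistics on it\<close>

locale iid_sequence = sequence_space \<nu> for \<nu> :: "'b measure"
begin

abbreviation kernel_space :: "nat \<Rightarrow> (nat \<Rightarrow> 'b) measure" where
  "kernel_space d \<equiv> PiM {1..d} (\<lambda>_. \<nu>)"

lemma prob_nu: "prob_space \<nu>"
  by (rule M.prob_space_axioms)

lemma sigma_finite_nu: "sigma_finite_measure \<nu>"
  by (rule M.sigma_finite_measure_axioms)

lemma prob_space_kernel_space: "prob_space (kernel_space d)"
  by (intro prob_space_PiM prob_nu)

lemma pair_prob: "pair_prob_space S \<nu>" "pair_prob_space (kernel_space d) \<nu>" "pair_prob_space S S"
  by (auto simp: pair_prob_space_def pair_sigma_finite_def prob_space_imp_sigma_finite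
      prob_space_kernel_space prob_nu P.prob_space_axioms)

text \<open>A function of the first \<open>i\<close> coordinates is independent of the coordinate \<open>i\<close>.\<close>

lemma distr_fresh:
  "distr (S \<Otimes>\<^sub>M S) (S \<Otimes>\<^sub>M \<nu>) (\<lambda>(w, w'). (w, w' 0)) = S \<Otimes>\<^sub>M \<nu>"
proof -
  interpret SS: pair_prob_space S S by (rule pair_prob)
  have "S \<Otimes>\<^sub>M \<nu> = distr S S (\<lambda>w. w) \<Otimes>\<^sub>M distr S \<nu> (\<lambda>w. w 0)"
    by (simp add: distr_PiM_component[where M = "\<lambda>_. \<nu>"] prob_nu)
  also have "\<dots> = distr (S \<Otimes>\<^sub>M S) (S \<Otimes>\<^sub>M \<nu>) (\<lambda>(w, w'). (w, w' 0))"
    by (rule pair_measure_distr)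
      (auto simp: distr_PiM_component[where M = "\<lambda>_. \<nu>"] prob_nu
        sigma_finite_nu)
  finally show ?thesis ..
qed

context
  fixes F :: "(nat \<Rightarrow> 'b) \<Rightarrow> 'b \<Rightarrow> 'c :: {second_countable_topology, banach}" and i :: nat
  assumes dep: "\<And>w w' y. (\<And>j. j < i \<Longrightarrow> w j = w' j) \<Longrightarrow> F w y = F w' y"
begin

lemma fresh_aux: "F (comb_seq i w w') (comb_seq i w w' i) = F w (w' 0)"
  using dep[of "comb_seq i w w'" w] by (simp add: comb_seq_def)

text \<open>The glued sequence \<open>comb_seq i w w'\<close> follows \<open>w\<close> before
  \<open>i\<close> and has the entry \<open>w' 0\<close> at \<open>i\<close>. Gluing preserves the
  law \<open>S\<close>, and \<open>F\<close> looks only at the first \<open>i\<close> entries of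
  \<open>w\<close>, so the integral over one sequence becomes an integral over an independent
  pair.\<close>

lemma fresh_integral:
  assumes [measurable]: "case_prod F \<in> borel_measurable (S \<Otimes>\<^sub>M \<nu>)"
  shows "(\<integral>w. F w (w i) \<partial>S) = (\<integral>(w, y). F w y \<partial>(S \<Otimes>\<^sub>M \<nu>))"
    and "integrable S (\<lambda>w. F w (w i)) \<longleftrightarrow> integrable (S \<Otimes>\<^sub>M \<nu>) (case_prod F)"
proof -
  have [measurable]: "(\<lambda>w. F w (w i)) \<in> borel_measurable S"
    using measurable_compose[OF _ assms, of "\<lambda>w. (w, w i)" S] by simp
  have eq: "(\<lambda>p. F (case_prod (comb_seq i) p) (case_prod (comb_seq i) p i))
      = (\<lambda>p. case_prod F (case p of (w, w') \<Rightarrow> (w, w' 0)))"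
    using fresh_aux by (auto simp: fun_eq_iff)
  have m1: "(\<lambda>(w, w'). comb_seq i w w') \<in> measurable (S \<Otimes>\<^sub>M S) S"
    by (rule measurable_comb_seq)
  have m2: "(\<lambda>(w, w'). (w, w' 0)) \<in> measurable (S \<Otimes>\<^sub>M S) (S \<Otimes>\<^sub>M \<nu>)"
    by measurable
  show "(\<integral>w. F w (w i) \<partial>S) = (\<integral>(w, y). F w y \<partial>(S \<Otimes>\<^sub>M \<nu>))"
    by (subst PiM_comb_seq[of i, symmetric], subst integral_distr[OF m1], simp,
        subst distr_fresh[symmetric], subst integral_distr[OF m2], simp, simp only: eq)
  show "integrable S (\<lambda>w. F w (w i)) \<longleftrightarrow> integrable (S \<Otimes>\<^sub>M \<nu>) (case_prod F)"
    by (subst PiM_comb_seq[of i, symmetric], subst integrable_distr_eq[OF m1], simp,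
        subst distr_fresh[symmetric], subst integrable_distr_eq[OF m2], simp, simp only: eq)
qed

end

text \<open>The same gluing for nonnegative functions, which serves to identify laws and to estimate
  moments before integrability is known.\<close>

lemma fresh_nn_integral:
  fixes F :: "(nat \<Rightarrow> 'b) \<Rightarrow> 'b \<Rightarrow> ennreal"
  assumes dep: "\<And>w w' y. (\<And>j. j < i \<Longrightarrow> w j = w' j) \<Longrightarrow> F w y = F w' y"
  assumes [measurable]: "case_prod F \<in> borel_measurable (S \<Otimes>\<^sub>M \<nu>)"
  shows "(\<integral>\<^sup>+w. F w (w i) \<partial>S) = (\<integral>\<^sup>+p. case_prod F p \<partial>(S \<Otimes>\<^sub>M \<nu>))"
proof -
  have [measurable]: "(\<lambda>w. F w (w i)) \<in> borel_measurable S"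
    using measurable_compose[OF _ assms(2), of "\<lambda>w. (w, w i)" S] by simp
  have "F (comb_seq i w w') (comb_seq i w w' i) = F w (w' 0)" for w w'
    using dep[of "comb_seq i w w'" w] by (simp add: comb_seq_def)
  then have eq: "(\<lambda>p. F (case_prod (comb_seq i) p) (case_prod (comb_seq i) p i))
      = (\<lambda>p. case_prod F (case p of (w, w') \<Rightarrow> (w, w' 0)))"
    by (auto simp: fun_eq_iff)
  have m1: "(\<lambda>(w, w'). comb_seq i w w') \<in> measurable (S \<Otimes>\<^sub>M S) S"
    by (rule measurable_comb_seq)
  have m2: "(\<lambda>(w, w'). (w, w' 0)) \<in> measurable (S \<Otimes>\<^sub>M S) (S \<Otimes>\<^sub>M \<nu>)"
    by measurable
  show ?thesis
    by (subst PiM_comb_seq[of i, symmetric], subst nn_integral_distr[OF m1], simp,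
        subst distr_fresh[symmetric], subst nn_integral_distr[OF m2], simp, simp only: eq)
qed

definition pick :: "nat \<Rightarrow> (nat \<Rightarrow> nat) \<Rightarrow> (nat \<Rightarrow> 'b) \<Rightarrow> nat \<Rightarrow> 'b" where
  "pick d s w = (\<lambda>j\<in>{1..d}. w (s j))"

lemma measurable_pick [measurable]: "pick d s \<in> measurable S (kernel_space d)"
  unfolding pick_def by measurable

lemma pick_cong: "s \<in> increasing_tuples d n \<Longrightarrow> (\<And>j. j < n \<Longrightarrow> w j = w' j) \<Longrightarrow> pick d s w = pick d s w'"
  by (auto simp: pick_def fun_eq_iff increasing_tuples_less)

lemma pick_upd: "pick (Suc d) (s(Suc d := i)) w = (pick d s w)(Suc d := w i)"
  by (auto simp: pick_def fun_eq_iff)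

lemma distr_pick:
  assumes "s \<in> increasing_tuples d n"
  shows "distr S (kernel_space d) (pick d s) = kernel_space d"
  using distr_PiM_reindex[of UNIV "\<lambda>_. \<nu>" s "{1..d}"] increasing_tuples_inj[OF assms]
  by (simp add: prob_nu pick_def[abs_def])

lemma kernel_space_Suc:
  "distr (kernel_space d \<Otimes>\<^sub>M \<nu>) (kernel_space (Suc d)) (\<lambda>(t, y). t(Suc d := y)) = kernel_space (Suc d)"
proof -
  interpret KN: pair_prob_space "kernel_space d" \<nu> by (rule pair_prob)
  have ins: "insert (Suc d) {1..d} = {1..Suc d}" by auto
  have m: "(\<lambda>(x, t). t(Suc d := x)) \<in> measurable (\<nu> \<Otimes>\<^sub>M kernel_space d) (kernel_space (Suc d))"
    unfolding ins[symmetric] by measurable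
  have "kernel_space (Suc d) = distr (\<nu> \<Otimes>\<^sub>M kernel_space d) (kernel_space (Suc d)) (\<lambda>(x, t). t(Suc d := x))"
    using distr_pair_PiM_eq_PiM[of "{1..d}" "\<lambda>_. \<nu>" "Suc d"] ins
    by (simp add: prob_nu)
  also have "\<nu> \<Otimes>\<^sub>M kernel_space d
      = distr (kernel_space d \<Otimes>\<^sub>M \<nu>) (\<nu> \<Otimes>\<^sub>M kernel_space d) (\<lambda>(x, y). (y, x))"
    using pair_sigma_finite.distr_pair_swap[of \<nu> "kernel_space d"]
    by (simp add: pair_sigma_finite_def sigma_finite_nu KN.M1.sigma_finite_measure_axioms)
  also have "distr \<dots> (kernel_space (Suc d)) (\<lambda>(x, t). t(Suc d := x))
      = distr (kernel_space d \<Otimes>\<^sub>M \<nu>) (kernel_space (Suc d)) (\<lambda>(t, y). t(Suc d := y))"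
    by (subst distr_distr[OF m]) (auto simp: o_def split_beta')
  finally show ?thesis ..
qed

lemma measurable_upd_last [measurable]:
  "(\<lambda>(t, y). t(Suc d := y)) \<in> measurable (kernel_space d \<Otimes>\<^sub>M \<nu>) (kernel_space (Suc d))"
proof -
  have ins: "insert (Suc d) {1..d} = {1..Suc d}" by auto
  show ?thesis unfolding ins[symmetric] by measurable
qed

lemma measurable_upd [measurable]:
  assumes "j \<in> {1..d}"
  shows "(\<lambda>(t, y). t(j := y)) \<in> measurable (kernel_space d \<Otimes>\<^sub>M \<nu>) (kernel_space d)"
proof -
  have ins: "insert j {1..d} = {1..d}" using assms by auto
  have "(\<lambda>(t, y). t(j := y)) \<in> measurable (kernel_space d \<Otimes>\<^sub>M \<nu>) (PiM (insert j {1..d}) (\<lambda>_. \<nu>))"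
    by measurable
  then show ?thesis unfolding ins .
qed

text \<open>The overwritten coordinate is lost, so only the marginal on the other coordinates
  enters; inserting an independent value in its place restores the product law.\<close>

lemma kernel_space_upd:
  assumes j: "j \<in> {1..d}"
  shows "distr (kernel_space d \<Otimes>\<^sub>M \<nu>) (kernel_space d) (\<lambda>(t, y). t(j := y)) = kernel_space d"
proof -
  define J where "J = {1..d} - {j}"
  have ins: "insert j J = {1..d}" using j by (auto simp: J_def)
  interpret KN: pair_prob_space "kernel_space d" \<nu> by (rule pair_prob)
  have pJ: "prob_space (PiM J (\<lambda>_. \<nu>))" by (intro prob_space_PiM prob_nu)
  have r: "distr (kernel_space d) (PiM J (\<lambda>_. \<nu>)) (\<lambda>t. restrict t J) = PiM J (\<lambda>_. \<nu>)"
    using distr_PiM_reindex[of "{1..d}" "\<lambda>_. \<nu>" "\<lambda>x. x" J]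
    by (simp add: prob_nu J_def restrict_def Pi_def)
  have mr [measurable]: "(\<lambda>t. restrict t J) \<in> measurable (kernel_space d) (PiM J (\<lambda>_. \<nu>))"
    by (rule measurable_restrict_subset) (auto simp: J_def)
  have m: "(\<lambda>(x, t). t(j := x)) \<in> measurable (\<nu> \<Otimes>\<^sub>M PiM J (\<lambda>_. \<nu>)) (kernel_space d)"
    unfolding ins[symmetric] by measurable
  have m': "(\<lambda>(t, x). t(j := x)) \<in> measurable (PiM J (\<lambda>_. \<nu>) \<Otimes>\<^sub>M \<nu>) (kernel_space d)"
    unfolding ins[symmetric] by measurable
  have "kernel_space d = distr (\<nu> \<Otimes>\<^sub>M PiM J (\<lambda>_. \<nu>)) (kernel_space d) (\<lambda>(x, t). t(j := x))"
    using distr_pair_PiM_eq_PiM[of J "\<lambda>_. \<nu>" j] ins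
    by (simp add: prob_nu)
  also have "\<nu> \<Otimes>\<^sub>M PiM J (\<lambda>_. \<nu>)
      = distr (PiM J (\<lambda>_. \<nu>) \<Otimes>\<^sub>M \<nu>) (\<nu> \<Otimes>\<^sub>M PiM J (\<lambda>_. \<nu>)) (\<lambda>(x, y). (y, x))"
    using pair_sigma_finite.distr_pair_swap[of \<nu> "PiM J (\<lambda>_. \<nu>)"]
    by (simp add: pair_sigma_finite_def sigma_finite_nu pJ prob_space_imp_sigma_finite)
  also have "distr \<dots> (kernel_space d) (\<lambda>(x, t). t(j := x))
      = distr (PiM J (\<lambda>_. \<nu>) \<Otimes>\<^sub>M \<nu>) (kernel_space d) (\<lambda>(t, x). t(j := x))"
    by (subst distr_distr[OF m]) (auto simp: o_def split_beta')
  also have "PiM J (\<lambda>_. \<nu>) \<Otimes>\<^sub>M \<nu>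
      = distr (kernel_space d) (PiM J (\<lambda>_. \<nu>)) (\<lambda>t. restrict t J) \<Otimes>\<^sub>M distr \<nu> \<nu> (\<lambda>x. x)"
    by (simp add: r)
  also have "\<dots> = distr (kernel_space d \<Otimes>\<^sub>M \<nu>) (PiM J (\<lambda>_. \<nu>) \<Otimes>\<^sub>M \<nu>) (\<lambda>(t, x). (restrict t J, x))"
    by (rule pair_measure_distr) (auto simp: sigma_finite_nu)
  also have "distr \<dots> (kernel_space d) (\<lambda>(t, x). t(j := x))
     = distr (kernel_space d \<Otimes>\<^sub>M \<nu>) (kernel_space d) (\<lambda>(t, x). (restrict t J)(j := x))"
    by (subst distr_distr[OF m']) (auto simp: o_def split_beta')
  also have "\<dots> = distr (kernel_space d \<Otimes>\<^sub>M \<nu>) (kernel_space d) (\<lambda>(t, x). t(j := x))"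
  proof (rule distr_cong)
    fix p assume "p \<in> space (kernel_space d \<Otimes>\<^sub>M \<nu>)"
    then have "fst p \<in> extensional {1..d}"
      by (auto simp: space_pair_measure space_PiM PiE_iff)
    then show "(case p of (t, x) \<Rightarrow> (restrict t J)(j := x)) = (case p of (t, x) \<Rightarrow> t(j := x))"
      by (auto simp: fun_eq_iff J_def extensional_def restrict_def split: prod.splits)
  qed auto
  finally show ?thesis ..
qed

text \<open>The statistic \<open>U_stat\<close> with the sample indexed from \<open>0\<close>, as
  the sequence space has it; \<open>U_stat_eq_ustat\<close> matches the two.\<close>

definition ustat :: "nat \<Rightarrow> ((nat \<Rightarrow> 'b) \<Rightarrow> real) \<Rightarrow> nat \<Rightarrow> (nat \<Rightarrow> 'b) \<Rightarrow> real" where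
  "ustat d g n w = (\<Sum>s\<in>increasing_tuples d n. g (pick d s w))"

lemma measurable_ustat [measurable]:
  "g \<in> borel_measurable (kernel_space d) \<Longrightarrow> ustat d g n \<in> borel_measurable S"
  unfolding ustat_def[abs_def]
  by (intro borel_measurable_sum measurable_compose[OF measurable_pick])

lemma ustat_Suc:
  "ustat (Suc d) g n w = (\<Sum>i<n. \<Sum>s\<in>increasing_tuples d i. g ((pick d s w)(Suc d := w i)))"
  by (simp add: ustat_def sum_increasing_tuples_Suc pick_upd)

lemma ustat_cong: "(\<And>j. j < n \<Longrightarrow> w j = w' j) \<Longrightarrow> ustat d g n w = ustat d g n w'"
  unfolding ustat_def by (intro sum.cong refl arg_cong[where f = g] pick_cong)

end

context iid_sequence
begin

section \<open>Moments of U-statistics\<close>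

lemma integral_pick:
  fixes F :: "(nat \<Rightarrow> 'b) \<Rightarrow> real"
  assumes "s \<in> increasing_tuples d n" "F \<in> borel_measurable (kernel_space d)"
  shows "(\<integral>w. F (pick d s w) \<partial>S) = (\<integral>t. F t \<partial>kernel_space d)"
    and "integrable S (\<lambda>w. F (pick d s w)) \<longleftrightarrow> integrable (kernel_space d) F"
  using integral_distr[OF measurable_pick[of d s], of F] integrable_distr_eq[OF measurable_pick[of d s], of F]
    assms by (simp_all add: distr_pick)

text \<open>A tuple with entries below \<open>i\<close> selects coordinates before \<open>i\<close>,
  and these are independent of \<open>w i\<close>.\<close>

lemma distr_pick_fresh:
  assumes s: "s \<in> increasing_tuples d i"
  shows "distr S (kernel_space d \<Otimes>\<^sub>M \<nu>) (\<lambda>w. (pick d s w, w i)) = kernel_space d \<Otimes>\<^sub>M \<nu>"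
proof (rule measure_eqI)
  fix A assume "A \<in> sets (distr S (kernel_space d \<Otimes>\<^sub>M \<nu>) (\<lambda>w. (pick d s w, w i)))"
  then have A [measurable]: "A \<in> sets (kernel_space d \<Otimes>\<^sub>M \<nu>)" by simp
  have m: "(\<lambda>(w, y). (pick d s w, y)) \<in> measurable (S \<Otimes>\<^sub>M \<nu>) (kernel_space d \<Otimes>\<^sub>M \<nu>)"
    by measurable
  have "emeasure (distr S (kernel_space d \<Otimes>\<^sub>M \<nu>) (\<lambda>w. (pick d s w, w i))) A
      = (\<integral>\<^sup>+p. indicator A p \<partial>distr S (kernel_space d \<Otimes>\<^sub>M \<nu>) (\<lambda>w. (pick d s w, w i)))"
    by simp
  also have "\<dots> = (\<integral>\<^sup>+w. indicator A (pick d s w, w i) \<partial>S)"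
    by (subst nn_integral_distr) auto
  also have "\<dots> = (\<integral>\<^sup>+p. (\<lambda>(w, y). indicator A (pick d s w, y)) p \<partial>(S \<Otimes>\<^sub>M \<nu>))"
  proof (rule fresh_nn_integral)
    fix w w' :: "nat \<Rightarrow> 'b" and y :: 'b assume "\<And>j. j < i \<Longrightarrow> w j = w' j"
    then show "(indicator A (pick d s w, y) :: ennreal) = indicator A (pick d s w', y)"
      using pick_cong[OF s, of w w'] by simp
  qed measurable
  also have "\<dots> = (\<integral>\<^sup>+p. indicator A ((\<lambda>(w, y). (pick d s w, y)) p) \<partial>(S \<Otimes>\<^sub>M \<nu>))"
    by (simp add: split_beta')
  also have "\<dots> = (\<integral>\<^sup>+p. indicator A p \<partial>distr (S \<Otimes>\<^sub>M \<nu>) (kernel_space d \<Otimes>\<^sub>M \<nu>) (\<lambda>(w, y). (pick d s w, y)))"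
    using m by (subst nn_integral_distr) auto
  also have "distr (S \<Otimes>\<^sub>M \<nu>) (kernel_space d \<Otimes>\<^sub>M \<nu>) (\<lambda>(w, y). (pick d s w, y))
     = distr S (kernel_space d) (pick d s) \<Otimes>\<^sub>M distr \<nu> \<nu> (\<lambda>y. y)"
    by (rule pair_measure_distr[symmetric]) (auto simp: sigma_finite_nu)
  also have "\<dots> = kernel_space d \<Otimes>\<^sub>M \<nu>" using s by (simp add: distr_pick)
  finally show "emeasure (distr S (kernel_space d \<Otimes>\<^sub>M \<nu>) (\<lambda>w. (pick d s w, w i))) A
      = emeasure (kernel_space d \<Otimes>\<^sub>M \<nu>) A" by simp
qed simp

lemma integral_pick_fresh:
  fixes F :: "(nat \<Rightarrow> 'b) \<times> 'b \<Rightarrow> real"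
  assumes "s \<in> increasing_tuples d i" "F \<in> borel_measurable (kernel_space d \<Otimes>\<^sub>M \<nu>)"
  shows "(\<integral>w. F (pick d s w, w i) \<partial>S) = (\<integral>p. F p \<partial>(kernel_space d \<Otimes>\<^sub>M \<nu>))"
    and "integrable S (\<lambda>w. F (pick d s w, w i)) \<longleftrightarrow> integrable (kernel_space d \<Otimes>\<^sub>M \<nu>) F"
proof -
  have m: "(\<lambda>w. (pick d s w, w i)) \<in> measurable S (kernel_space d \<Otimes>\<^sub>M \<nu>)" by measurable
  show "(\<integral>w. F (pick d s w, w i) \<partial>S) = (\<integral>p. F p \<partial>(kernel_space d \<Otimes>\<^sub>M \<nu>))"
    using integral_distr[OF m, of F] assms by (simp add: distr_pick_fresh)
  show "integrable S (\<lambda>w. F (pick d s w, w i)) \<longleftrightarrow> integrable (kernel_space d \<Otimes>\<^sub>M \<nu>) F"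
    using integrable_distr_eq[OF m, of F] assms by (simp add: distr_pick_fresh)
qed

section \<open>The change of a U-statistic when one observation is added\<close>

definition increment :: "nat \<Rightarrow> ((nat \<Rightarrow> 'b) \<Rightarrow> 'b \<Rightarrow> real) \<Rightarrow> nat \<Rightarrow> (nat \<Rightarrow> 'b) \<Rightarrow> real" where
  "increment d h i w = (\<Sum>s\<in>increasing_tuples d i. h (pick d s w) (w i))"

lemma increment_cong: "(\<And>j. j \<le> i \<Longrightarrow> w j = w' j) \<Longrightarrow> increment d h i w = increment d h i w'"
  unfolding increment_def
  by (intro sum.cong refl arg_cong2[where f = h] pick_cong) auto

context
  fixes h :: "(nat \<Rightarrow> 'b) \<Rightarrow> 'b \<Rightarrow> real" and d k :: nat
  assumes h [measurable]: "case_prod h \<in> borel_measurable (kernel_space d \<Otimes>\<^sub>M \<nu>)"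
    and k: "k \<ge> 1"
    and hint: "integrable (kernel_space d \<Otimes>\<^sub>M \<nu>) (\<lambda>(t, y). h t y ^ (2 * k))"
begin

lemma measurable_h_pick [measurable]: "(\<lambda>w. h (pick d s w) (w i)) \<in> borel_measurable S"
  using measurable_compose[OF _ h, of "\<lambda>w. (pick d s w, w i)" S] by simp

lemma measurable_increment [measurable]: "increment d h i \<in> borel_measurable S"
  unfolding increment_def[abs_def] by measurable

lemma integrable_h_pick:
  assumes "s \<in> increasing_tuples d i"
  shows "integrable S (\<lambda>w. h (pick d s w) (w i) ^ (2 * k))"
  using integral_pick_fresh(2)[OF assms, of "\<lambda>(t, y). h t y ^ (2 * k)"] hint by simp

lemma integrable_increment: "integrable S (\<lambda>w. increment d h i w ^ (2 * k))"
  unfolding increment_def by (intro integrable_power_sum k integrable_h_pick) auto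

text \<open>No cancellation is used inside one increment: at most \<open>i ^ d\<close> tuples
  contribute, all with the same law. Cancellation comes from summing over \<open>i\<close>.\<close>

lemma increment_moment_le:
  "(\<integral>w. increment d h i w ^ (2 * k) \<partial>S)
    \<le> real i ^ (2 * k * d) * (\<integral>(t, y). h t y ^ (2 * k) \<partial>(kernel_space d \<Otimes>\<^sub>M \<nu>))"
proof -
  define H where "H = (\<integral>(t, y). h t y ^ (2 * k) \<partial>(kernel_space d \<Otimes>\<^sub>M \<nu>))"
  define c where "c = real (card (increasing_tuples d i))"
  have H: "H \<ge> 0" unfolding H_def by (intro Bochner_Integration.integral_nonneg) (auto simp: zero_le_even_power)
  have "(\<integral>w. increment d h i w ^ (2 * k) \<partial>S)
      \<le> (\<integral>w. c ^ (2 * k - 1) * (\<Sum>s\<in>increasing_tuples d i. h (pick d s w) (w i) ^ (2 * k)) \<partial>S)"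
    using integrable_increment power_sum_le[OF k, of "increasing_tuples d i"]
    by (intro integral_mono Bochner_Integration.integrable_mult_right Bochner_Integration.integrable_sum
        integrable_h_pick) (auto simp: increment_def c_def)
  also have "\<dots> = c ^ (2 * k - 1) * (\<Sum>s\<in>increasing_tuples d i. \<integral>w. h (pick d s w) (w i) ^ (2 * k) \<partial>S)"
    by (simp add: integrable_h_pick Bochner_Integration.integral_sum)
  also have "\<dots> = c ^ (2 * k - 1) * (\<Sum>s\<in>increasing_tuples d i. H)"
    using integral_pick_fresh(1)[of _ d i "\<lambda>(t, y). h t y ^ (2 * k)"]
    by (simp add: H_def)
  also have "\<dots> = c ^ (2 * k) * H"
  proof -
    have "2 * k = Suc (2 * k - 1)" using k by simp
    then have "c ^ (2 * k) = c ^ (2 * k - 1) * c" by (metis power_Suc2)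
    then show ?thesis by (simp add: c_def)
  qed
  also have "c \<le> real i ^ d" unfolding c_def using card_increasing_tuples_le[of d i]
    by (metis of_nat_le_iff of_nat_power)
  then have "c ^ (2 * k) * H \<le> (real i ^ d) ^ (2 * k) * H"
    by (intro mult_right_mono power_mono H) (auto simp: c_def)
  also have "(real i ^ d) ^ (2 * k) = real i ^ (2 * k * d)"
    by (simp add: mult.commute flip: power_mult)
  finally show ?thesis by (simp add: H_def)
qed

text \<open>\<open>Q\<close> and the selected arguments depend on coordinates before
  \<open>i\<close>. Fubini thus integrates the fresh coordinate first, and this inner integral is
  \<open>0\<close>.\<close>

lemma increment_orthogonal:
  assumes zero: "\<And>t. (\<integral>y. h t y \<partial>\<nu>) = 0"
    and Q [measurable]: "Q \<in> borel_measurable S"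
    and dep: "\<And>w w'. (\<And>j. j < i \<Longrightarrow> w j = w' j) \<Longrightarrow> Q w = Q w'"
    and Qint: "\<And>s. s \<in> increasing_tuples d i \<Longrightarrow> integrable S (\<lambda>w. Q w * h (pick d s w) (w i))"
  shows "(\<integral>w. Q w * increment d h i w \<partial>S) = 0"
proof -
  interpret SN: pair_prob_space S \<nu> by (rule pair_prob)
  have "(\<integral>w. Q w * h (pick d s w) (w i) \<partial>S) = 0" if s: "s \<in> increasing_tuples d i" for s
  proof -
    have m [measurable]: "(\<lambda>(w, y). Q w * h (pick d s w) y) \<in> borel_measurable (S \<Otimes>\<^sub>M \<nu>)"
      using measurable_compose[OF _ h, of "\<lambda>(w, y). (pick d s w, y)" "S \<Otimes>\<^sub>M \<nu>"]
      by (simp add: split_beta')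
    have dep': "Q w * h (pick d s w) y = Q w' * h (pick d s w') y" if "\<And>j. j < i \<Longrightarrow> w j = w' j" for w w' y
      using dep[OF that] pick_cong[OF s that] by simp
    have "integrable (S \<Otimes>\<^sub>M \<nu>) (\<lambda>(w, y). Q w * h (pick d s w) y)"
      using fresh_integral(2)[of i "\<lambda>w y. Q w * h (pick d s w) y", OF dep' m] Qint[OF s] by simp
    moreover have "(\<integral>w. Q w * h (pick d s w) (w i) \<partial>S)
        = (\<integral>(w, y). Q w * h (pick d s w) y \<partial>(S \<Otimes>\<^sub>M \<nu>))"
      by (rule fresh_integral(1)[of i "\<lambda>w y. Q w * h (pick d s w) y", OF dep' m])
    ultimately have "(\<integral>w. Q w * h (pick d s w) (w i) \<partial>S)
        = (\<integral>w. (\<integral>y. Q w * h (pick d s w) y \<partial>\<nu>) \<partial>S)"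
      using SN.integral_fst'[of "\<lambda>(w, y). Q w * h (pick d s w) y"] by simp
    then show ?thesis by (simp add: zero)
  qed
  then show ?thesis
    by (simp add: increment_def sum_distrib_left Qint Bochner_Integration.integral_sum)
qed

text \<open>Orthogonality is used with the power \<open>2 * k - 1\<close> of the preceding partial
  sum in the role of \<open>Q\<close>; the partial sum depends only on coordinates before the new
  one.\<close>

lemma increment_martingale:
  assumes zero: "\<And>t. (\<integral>y. h t y \<partial>\<nu>) = 0"
    and B: "\<And>i. m \<le> i \<Longrightarrow> i < n \<Longrightarrow> (\<integral>w. increment d h i w ^ (2 * k) \<partial>S) \<le> B"
  shows "(\<integral>w. (\<Sum>i=m..<n. increment d h i w) ^ (2 * k) \<partial>S) \<le> mart_const k * real (n - m) ^ k * B"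
proof -
  have shift: "(\<Sum>i=m..<n. increment d h i w) = (\<Sum>j<n - m. increment d h (m + j) w)" for w
    by (rule sum.reindex_bij_witness[of _ "\<lambda>j. m + j" "\<lambda>i. i - m"]) auto
  show ?thesis unfolding shift
  proof (rule martingale_moment[OF k])
    fix i assume i: "i < n - m"
    define Q where "Q w = (\<Sum>j<i. increment d h (m + j) w) ^ (2 * k - 1)" for w
    have sint: "integrable S (\<lambda>w. (\<Sum>j<i. increment d h (m + j) w) ^ (2 * k))"
      by (intro integrable_power_sum k integrable_increment) auto
    have "(\<integral>w. Q w * increment d h (m + i) w \<partial>S) = 0"
    proof (rule increment_orthogonal[OF zero])
      show "Q \<in> borel_measurable S" unfolding Q_def[abs_def] by measurable
      show "Q w = Q w'" if "\<And>j. j < m + i \<Longrightarrow> w j = w' j" for w w'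
        unfolding Q_def by (intro arg_cong[where f = "\<lambda>x. x ^ (2 * k - 1)"] sum.cong refl increment_cong that) auto
      show "integrable S (\<lambda>w. Q w * h (pick d s w) (w (m + i)))" if s: "s \<in> increasing_tuples d (m + i)" for s
        using integrable_power_mixed[of "\<lambda>w. \<Sum>j<i. increment d h (m + j) w" S "\<lambda>w. h (pick d s w) (w (m + i))"
            "2 * k - 1" 1] sint integrable_h_pick[OF s] k
        by (simp add: Q_def)
    qed
    then show "(\<integral>x. (\<Sum>j<i. increment d h (m + j) x) ^ (2 * k - 1) * increment d h (m + i) x \<partial>S) = 0"
      by (simp add: Q_def)
  qed (use B integrable_increment in auto)
qed

end

section \<open>Averaging the last argument of a kernel\<close>

definition cond_mean :: "nat \<Rightarrow> ((nat \<Rightarrow> 'b) \<Rightarrow> real) \<Rightarrow> (nat \<Rightarrow> 'b) \<Rightarrow> real" where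
  "cond_mean d g t = (\<integral>y. g (t(Suc d := y)) \<partial>\<nu>)"

definition residual :: "nat \<Rightarrow> ((nat \<Rightarrow> 'b) \<Rightarrow> real) \<Rightarrow> (nat \<Rightarrow> 'b) \<Rightarrow> 'b \<Rightarrow> real" where
  "residual d g t y = g (t(Suc d := y)) - cond_mean d g t"

text \<open>If \<open>g (t(Suc d := _))\<close> is not integrable, both integrals are \<open>0\<close> by convention.\<close>

lemma integral_residual: "(\<integral>y. residual d g t y \<partial>\<nu>) = 0"
proof -
  show ?thesis
  proof (cases "integrable \<nu> (\<lambda>y. g (t(Suc d := y)))")
    case True
    then show ?thesis by (simp add: residual_def cond_mean_def M.prob_space)
  next
    case False
    then have "cond_mean d g t = 0" by (simp add: cond_mean_def not_integrable_integral_eq)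
    with False show ?thesis by (simp add: residual_def not_integrable_integral_eq)
  qed
qed

context
  fixes d :: nat and g :: "(nat \<Rightarrow> 'b) \<Rightarrow> real"
  assumes g [measurable]: "g \<in> borel_measurable (kernel_space (Suc d))"
begin

lemma measurable_kernel_upd [measurable]:
  "(\<lambda>p. g ((fst p)(Suc d := snd p))) \<in> borel_measurable (kernel_space d \<Otimes>\<^sub>M \<nu>)"
  using measurable_compose[OF measurable_upd_last g] by (simp add: split_beta')

lemma measurable_cond_mean [measurable]: "cond_mean d g \<in> borel_measurable (kernel_space d)"
proof -
  show ?thesis unfolding cond_mean_def[abs_def]
    by (rule M.borel_measurable_lebesgue_integral) (simp add: split_beta')
qed

lemma measurable_residual [measurable]:
  "case_prod (residual d g) \<in> borel_measurable (kernel_space d \<Otimes>\<^sub>M \<nu>)"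
  unfolding residual_def[abs_def] split_beta' by measurable

lemma integral_kernel_upd:
  fixes \<phi> :: "real \<Rightarrow> real" assumes [measurable]: "\<phi> \<in> borel_measurable borel"
  shows "(\<integral>p. \<phi> (g ((fst p)(Suc d := snd p))) \<partial>(kernel_space d \<Otimes>\<^sub>M \<nu>)) = (\<integral>t. \<phi> (g t) \<partial>kernel_space (Suc d))"
    and "integrable (kernel_space d \<Otimes>\<^sub>M \<nu>) (\<lambda>p. \<phi> (g ((fst p)(Suc d := snd p)))) \<longleftrightarrow>
      integrable (kernel_space (Suc d)) (\<lambda>t. \<phi> (g t))"
  using integral_distr[OF measurable_upd_last, of "\<lambda>t. \<phi> (g t)" d]
    integrable_distr_eq[OF measurable_upd_last, of "\<lambda>t. \<phi> (g t)" d]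
  unfolding kernel_space_Suc by (simp_all add: split_beta')

lemma integral_kernel_upd_power:
  "(\<integral>p. g ((fst p)(Suc d := snd p)) ^ n \<partial>(kernel_space d \<Otimes>\<^sub>M \<nu>)) = (\<integral>t. g t ^ n \<partial>kernel_space (Suc d))"
  "integrable (kernel_space d \<Otimes>\<^sub>M \<nu>) (\<lambda>p. g ((fst p)(Suc d := snd p)) ^ n) \<longleftrightarrow>
      integrable (kernel_space (Suc d)) (\<lambda>t. g t ^ n)"
  by (rule integral_kernel_upd[of "\<lambda>x. x ^ n"], measurable)+

lemma integral_cond_mean:
  assumes "integrable (kernel_space (Suc d)) g"
  shows "(\<integral>t. cond_mean d g t \<partial>kernel_space d) = (\<integral>t. g t \<partial>kernel_space (Suc d))"
proof -
  interpret KN: pair_prob_space "kernel_space d" \<nu> by (rule pair_prob)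
  have i: "integrable (kernel_space d \<Otimes>\<^sub>M \<nu>) (\<lambda>p. g ((fst p)(Suc d := snd p)))"
    using integral_kernel_upd_power(2)[of 1] assms by simp
  show ?thesis
    using integral_kernel_upd_power(1)[of 1] KN.integral_fst'[OF i] by (simp add: cond_mean_def)
qed

text \<open>Conditional Jensen inequality. Working with nonnegative integrals yields the
  integrability of the power together with its bound.\<close>

lemma cond_mean_power:
  assumes k: "k \<ge> 1" and int: "integrable (kernel_space (Suc d)) (\<lambda>t. g t ^ (2 * k))"
  shows "integrable (kernel_space d) (\<lambda>t. cond_mean d g t ^ (2 * k))"
    and "(\<integral>t. cond_mean d g t ^ (2 * k) \<partial>kernel_space d) \<le> (\<integral>t. g t ^ (2 * k) \<partial>kernel_space (Suc d))"
proof -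
  interpret KN: pair_prob_space "kernel_space d" \<nu> by (rule pair_prob)
  have int': "integrable (kernel_space d \<Otimes>\<^sub>M \<nu>) (\<lambda>p. g ((fst p)(Suc d := snd p)) ^ (2 * k))"
    using int by (simp only: integral_kernel_upd_power)
  have sec: "(\<lambda>y. g (t(Suc d := y))) \<in> borel_measurable \<nu>" if "t \<in> space (kernel_space d)" for t
    using measurable_Pair2[OF measurable_kernel_upd that] unfolding fst_conv snd_conv .
  have le: "(\<integral>\<^sup>+t. ennreal (cond_mean d g t ^ (2 * k)) \<partial>kernel_space d)
      \<le> ennreal (\<integral>t. g t ^ (2 * k) \<partial>kernel_space (Suc d))"
  proof -
    have "(\<integral>\<^sup>+t. ennreal (cond_mean d g t ^ (2 * k)) \<partial>kernel_space d)
        \<le> (\<integral>\<^sup>+t. (\<integral>\<^sup>+y. ennreal (g (t(Suc d := y)) ^ (2 * k)) \<partial>\<nu>) \<partial>kernel_space d)"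
      unfolding cond_mean_def
      by (intro nn_integral_mono M.power_integral_le_nn_integral sec k)
    also have "\<dots> = (\<integral>\<^sup>+p. ennreal (g ((fst p)(Suc d := snd p)) ^ (2 * k)) \<partial>(kernel_space d \<Otimes>\<^sub>M \<nu>))"
      using M.nn_integral_fst[of "\<lambda>p. ennreal (g ((fst p)(Suc d := snd p)) ^ (2 * k))" "kernel_space d"]
      by simp
    also have "\<dots> = ennreal (\<integral>p. g ((fst p)(Suc d := snd p)) ^ (2 * k) \<partial>(kernel_space d \<Otimes>\<^sub>M \<nu>))"
      using int' by (intro nn_integral_eq_integral) (simp_all add: zero_le_even_power)
    also have "\<dots> = ennreal (\<integral>t. g t ^ (2 * k) \<partial>kernel_space (Suc d))"
      by (simp only: integral_kernel_upd_power)
    finally show ?thesis .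
  qed
  show i: "integrable (kernel_space d) (\<lambda>t. cond_mean d g t ^ (2 * k))"
  proof (rule integrableI_nonneg)
    show "(\<integral>\<^sup>+t. ennreal (cond_mean d g t ^ (2 * k)) \<partial>kernel_space d) < \<infinity>"
      using le_less_trans[OF le ennreal_less_top] by simp
  qed (auto simp: zero_le_even_power)
  have "ennreal (\<integral>t. cond_mean d g t ^ (2 * k) \<partial>kernel_space d)
      \<le> ennreal (\<integral>t. g t ^ (2 * k) \<partial>kernel_space (Suc d))"
    using le by (subst nn_integral_eq_integral[symmetric]) (auto simp: i zero_le_even_power)
  then show "(\<integral>t. cond_mean d g t ^ (2 * k) \<partial>kernel_space d) \<le> (\<integral>t. g t ^ (2 * k) \<partial>kernel_space (Suc d))"
    by (subst (asm) ennreal_le_iff) (auto intro!: Bochner_Integration.integral_nonneg simp: zero_le_even_power)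
qed

text \<open>The conditional mean has no larger moments than the kernel, so both terms of the
  difference contribute the same bound.\<close>

lemma residual_power:
  assumes k: "k \<ge> 1" and int: "integrable (kernel_space (Suc d)) (\<lambda>t. g t ^ (2 * k))"
  shows "integrable (kernel_space d \<Otimes>\<^sub>M \<nu>) (\<lambda>(t, y). residual d g t y ^ (2 * k))"
    and "(\<integral>(t, y). residual d g t y ^ (2 * k) \<partial>(kernel_space d \<Otimes>\<^sub>M \<nu>))
      \<le> 2 * 4 ^ k * (\<integral>t. g t ^ (2 * k) \<partial>kernel_space (Suc d))"
proof -
  interpret KN: pair_prob_space "kernel_space d" \<nu> by (rule pair_prob)
  have i1: "integrable (kernel_space d \<Otimes>\<^sub>M \<nu>) (\<lambda>p. g ((fst p)(Suc d := snd p)) ^ (2 * k))"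
    using int by (simp only: integral_kernel_upd_power)
  have i1e: "(\<integral>p. g ((fst p)(Suc d := snd p)) ^ (2 * k) \<partial>(kernel_space d \<Otimes>\<^sub>M \<nu>))
      = (\<integral>t. g t ^ (2 * k) \<partial>kernel_space (Suc d))"
    by (simp only: integral_kernel_upd_power)
  have df: "distr (kernel_space d \<Otimes>\<^sub>M \<nu>) (kernel_space d) fst = kernel_space d"
    using M.distr_pair_fst[of "kernel_space d"] by (simp add: M.emeasure_space_1)
  have i2: "integrable (kernel_space d \<Otimes>\<^sub>M \<nu>) (\<lambda>p. cond_mean d g (fst p) ^ (2 * k))"
    using integrable_distr_eq[of fst "kernel_space d \<Otimes>\<^sub>M \<nu>" "kernel_space d" "\<lambda>t. cond_mean d g t ^ (2 * k)"]
      cond_mean_power(1)[OF k int] by (simp add: df)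
  have i2e: "(\<integral>p. cond_mean d g (fst p) ^ (2 * k) \<partial>(kernel_space d \<Otimes>\<^sub>M \<nu>))
     = (\<integral>t. cond_mean d g t ^ (2 * k) \<partial>kernel_space d)"
    using integral_distr[of fst "kernel_space d \<Otimes>\<^sub>M \<nu>" "kernel_space d" "\<lambda>t. cond_mean d g t ^ (2 * k)"]
    by (simp add: df)
  show i3: "integrable (kernel_space d \<Otimes>\<^sub>M \<nu>) (\<lambda>(t, y). residual d g t y ^ (2 * k))"
    unfolding residual_def split_beta' by (rule integrable_power_add(2)[OF k _ _ i1 i2]) auto
  have "(\<integral>p. residual d g (fst p) (snd p) ^ (2 * k) \<partial>(kernel_space d \<Otimes>\<^sub>M \<nu>))
     \<le> (\<integral>p. 4 ^ k * (g ((fst p)(Suc d := snd p)) ^ (2 * k) + cond_mean d g (fst p) ^ (2 * k)) \<partial>(kernel_space d \<Otimes>\<^sub>M \<nu>))"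
    using i1 i2 i3 unfolding split_beta'
    by (intro integral_mono) (auto simp: residual_def intro!: diff_even_power_le(2)[OF k])
  also have "\<dots> = 4 ^ k * ((\<integral>t. g t ^ (2 * k) \<partial>kernel_space (Suc d)) + (\<integral>t. cond_mean d g t ^ (2 * k) \<partial>kernel_space d))"
    using i1 i2 by (simp add: i1e i2e)
  also have "\<dots> \<le> 4 ^ k * ((\<integral>t. g t ^ (2 * k) \<partial>kernel_space (Suc d)) + (\<integral>t. g t ^ (2 * k) \<partial>kernel_space (Suc d)))"
    by (intro mult_left_mono add_left_mono cond_mean_power(2)[OF k int]) auto
  finally show "(\<integral>(t, y). residual d g t y ^ (2 * k) \<partial>(kernel_space d \<Otimes>\<^sub>M \<nu>))
      \<le> 2 * 4 ^ k * (\<integral>t. g t ^ (2 * k) \<partial>kernel_space (Suc d))"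
    by (simp add: split_beta')
qed

text \<open>The first sum is a martingale, because \<open>residual\<close> integrates to
  \<open>0\<close> in its last argument; the second consists of statistics of lower degree. The
  inductions on the degree run through this identity.\<close>

lemma ustat_decomp:
  "ustat (Suc d) g n w = (\<Sum>i<n. increment d (residual d g) i w) + (\<Sum>i<n. ustat d (cond_mean d g) i w)"
  by (simp add: ustat_Suc increment_def residual_def ustat_def[of d] sum.distrib[symmetric])

lemma ustat_diff_decomp:
  assumes "m \<le> n"
  shows "ustat (Suc d) g n w - ustat (Suc d) g m w
    = (\<Sum>i=m..<n. increment d (residual d g) i w) + (\<Sum>i=m..<n. ustat d (cond_mean d g) i w)"
proof -
  have "sum F {..<n} - sum F {..<m} = sum F {m..<n}" for F :: "nat \<Rightarrow> real"
    using assms sum_diff_nat_ivl[of 0 m n F] by (simp add: lessThan_atLeast0)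
  then show ?thesis unfolding ustat_decomp by (metis (no_types) add_diff_add)
qed

end

lemma integrable_ustat_power:
  assumes "k \<ge> 1" "g \<in> borel_measurable (kernel_space d)" "integrable (kernel_space d) (\<lambda>t. g t ^ (2 * k))"
  shows "integrable S (\<lambda>w. ustat d g n w ^ (2 * k))"
  unfolding ustat_def
proof (rule integrable_power_sum)
  show "integrable S (\<lambda>w. g (pick d s w) ^ (2 * k))" if "s \<in> increasing_tuples d n" for s
    using integral_pick(2)[OF that, of "\<lambda>t. g t ^ (2 * k)"] assms by simp
qed (use assms in \<open>auto intro: measurable_compose[OF measurable_pick]\<close>)

text \<open>The product over the empty index set is a point mass, so a centred kernel of degree
  \<open>0\<close> is zero. This starts the inductions on the degree.\<close>

lemma ustat_0_eq: "(\<integral>t. g t \<partial>kernel_space 0) = 0 \<Longrightarrow> ustat 0 g n w = 0"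
proof -
  assume "(\<integral>t. g t \<partial>kernel_space 0) = 0"
  moreover have "(\<integral>t. g t \<partial>kernel_space 0) = g (\<lambda>_. undefined)"
    using lebesgue_integral_count_space_finite[of "{\<lambda>_. undefined}" g] by (simp add: PiM_empty)
  ultimately show ?thesis by (simp add: ustat_def increasing_tuples_0 pick_def restrict_def)
qed

text \<open>The constant is chosen before the kernel: the induction applies the bound to
  \<open>cond_mean d g\<close>, and \<open>increment_mean_zero_moment\<close> applies it to all
  sections of a kernel at once. For degree \<open>Suc d\<close> an increment of the martingale part
  has moment of order \<open>n ^ (2 * k * d)\<close>, and \<open>increment_martingale\<close> adds
  the factor \<open>(n - m) ^ k\<close>; the part of lower degree is estimated term by term.\<close>

theorem ustat_moment:
  assumes k: "k \<ge> 1"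
  shows "\<exists>C\<ge>0. \<forall>g\<in>borel_measurable (kernel_space d). integrable (kernel_space d) (\<lambda>t. g t ^ (2 * k)) \<longrightarrow>
    (\<integral>t. g t \<partial>kernel_space d) = 0 \<longrightarrow> (\<forall>m n. m \<le> n \<longrightarrow>
      (\<integral>w. (ustat d g n w - ustat d g m w) ^ (2 * k) \<partial>S)
        \<le> C * real (n - m) ^ k * real n ^ (2 * k * (d - 1)) * (\<integral>t. g t ^ (2 * k) \<partial>kernel_space d))"
proof (induction d)
  case 0
  have "(0::real) ^ (2 * k) = 0" using k by (simp add: zero_power)
  then show ?case using ustat_0_eq
    by (intro exI[of _ 0] conjI ballI impI allI) (simp_all only: order_refl diff_self mult_zero_left lebesgue_integral_const, simp)
next
  case (Suc d)
  then obtain C where C: "C \<ge> 0" and IH: "\<And>g m n. g \<in> borel_measurable (kernel_space d) \<Longrightarrow>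
    integrable (kernel_space d) (\<lambda>t. g t ^ (2 * k)) \<Longrightarrow> (\<integral>t. g t \<partial>kernel_space d) = 0 \<Longrightarrow> m \<le> n \<Longrightarrow>
      (\<integral>w. (ustat d g n w - ustat d g m w) ^ (2 * k) \<partial>S)
        \<le> C * real (n - m) ^ k * real n ^ (2 * k * (d - 1)) * (\<integral>t. g t ^ (2 * k) \<partial>kernel_space d)"
    by blast
  have z: "(0::real) ^ (2 * k) = 0" using k by (simp add: zero_power)
  show ?case
  proof (intro exI[of _ "4 ^ k * (mart_const k * (2 * 4 ^ k) + C)"] conjI ballI impI allI)
    show "0 \<le> 4 ^ k * (mart_const k * (2 * 4 ^ k) + C)" using C mart_const_nonneg[of k] by simp
    fix g :: "(nat \<Rightarrow> 'b) \<Rightarrow> real" and m n :: nat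
    assume g [measurable]: "g \<in> borel_measurable (kernel_space (Suc d))"
      and int: "integrable (kernel_space (Suc d)) (\<lambda>t. g t ^ (2 * k))"
      and mean: "(\<integral>t. g t \<partial>kernel_space (Suc d)) = 0" and mn: "m \<le> n"
    interpret K: prob_space "kernel_space (Suc d)" by (rule prob_space_kernel_space)
    define G where "G = (\<integral>t. g t ^ (2 * k) \<partial>kernel_space (Suc d))"
    have G0: "G \<ge> 0" unfolding G_def by (intro Bochner_Integration.integral_nonneg) (auto simp: zero_le_even_power)
    let ?c = "cond_mean d g" and ?h = "residual d g"
    have cm: "?c \<in> borel_measurable (kernel_space d)" by measurable
    note cint = cond_mean_power(1)[OF g k int]
    note hint = residual_power(1)[OF g k int]
    note hm = measurable_residual[OF g]
    have gint: "integrable (kernel_space (Suc d)) g"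
    proof (rule Bochner_Integration.integrable_bound)
      show "integrable (kernel_space (Suc d)) (\<lambda>t. 1 + g t ^ (2 * k))" using int by simp
      show "AE t in kernel_space (Suc d). norm (g t) \<le> norm (1 + g t ^ (2 * k))"
        using abs_mixed_power_le[of 1 "2 * k - 1" _ 1] k
        by (auto simp: power_even_abs zero_le_even_power add_nonneg_nonneg)
    qed simp
    have cmean: "(\<integral>t. ?c t \<partial>kernel_space d) = 0"
      using integral_cond_mean[OF g gint] mean by simp
    define A where "A w = (\<Sum>i=m..<n. increment d ?h i w)" for w
    define B where "B w = (\<Sum>i=m..<n. ustat d ?c i w)" for w
    have Am [measurable]: "A \<in> borel_measurable S"
      unfolding A_def[abs_def] by (intro borel_measurable_sum measurable_increment[OF hm k hint])
    have Bm [measurable]: "B \<in> borel_measurable S"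
      unfolding B_def[abs_def] by (intro borel_measurable_sum measurable_ustat cm)
    have Aint: "integrable S (\<lambda>w. A w ^ (2 * k))" unfolding A_def
      by (intro integrable_power_sum k integrable_increment[OF hm k hint] measurable_increment[OF hm k hint]) auto
    have Uint: "integrable S (\<lambda>w. ustat d ?c i w ^ (2 * k))" for i
      by (rule integrable_ustat_power[OF k cm cint])
    have Bint: "integrable S (\<lambda>w. B w ^ (2 * k))" unfolding B_def
      by (intro integrable_power_sum k Uint measurable_ustat cm) auto
    have "(\<integral>w. A w ^ (2 * k) \<partial>S) \<le> mart_const k * real (n - m) ^ k * (real n ^ (2 * k * d) * (2 * 4 ^ k * G))"
      unfolding A_def
    proof (rule increment_martingale[OF hm k hint integral_residual])
      fix i assume i: "m \<le> i" "i < n"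
      have "(\<integral>w. increment d ?h i w ^ (2 * k) \<partial>S)
        \<le> real i ^ (2 * k * d) * (\<integral>(t, y). ?h t y ^ (2 * k) \<partial>(kernel_space d \<Otimes>\<^sub>M \<nu>))"
        by (rule increment_moment_le[OF hm k hint])
      also have "\<dots> \<le> real n ^ (2 * k * d) * (2 * 4 ^ k * G)"
        unfolding G_def using i residual_power(2)[OF g k int]
        by (intro mult_mono power_mono Bochner_Integration.integral_nonneg) (auto simp: zero_le_even_power)
      finally show "(\<integral>w. increment d ?h i w ^ (2 * k) \<partial>S) \<le> real n ^ (2 * k * d) * (2 * 4 ^ k * G)" .
    qed
    then have Ale: "(\<integral>w. A w ^ (2 * k) \<partial>S) \<le> (mart_const k * (2 * 4 ^ k)) * (real (n - m) ^ k * real n ^ (2 * k * d) * G)"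
      by (simp add: mult_ac)
    have Ble: "(\<integral>w. B w ^ (2 * k) \<partial>S) \<le> C * (real (n - m) ^ k * real n ^ (2 * k * d) * G)"
    \<comment> \<open>For \<open>d = 0\<close> the truncated exponent \<open>d - 1\<close> would
      give a wrong order, but there the statistics of lower degree vanish.\<close>
    proof (cases "d = 0")
      case True
      then have "B w = 0" for w using ustat_0_eq cmean by (simp add: B_def)
      then show ?thesis using C G0 by (simp add: z)
    next
      case False
      have each: "(\<integral>w. ustat d ?c i w ^ (2 * k) \<partial>S) \<le> C * real n ^ (k + 2 * k * (d - 1)) * G" if "i < n" for i
      proof -
        have "(\<integral>w. ustat d ?c i w ^ (2 * k) \<partial>S) = (\<integral>w. (ustat d ?c i w - ustat d ?c 0 w) ^ (2 * k) \<partial>S)"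
          using False by (simp add: ustat_def increasing_tuples_empty)
        also have "\<dots> \<le> C * real (i - 0) ^ k * real i ^ (2 * k * (d - 1)) * (\<integral>t. ?c t ^ (2 * k) \<partial>kernel_space d)"
          by (rule IH[OF cm cint cmean]) simp
        also have "\<dots> = C * real i ^ (k + 2 * k * (d - 1)) * (\<integral>t. ?c t ^ (2 * k) \<partial>kernel_space d)"
          by (simp add: power_add)
        also have "\<dots> \<le> C * real n ^ (k + 2 * k * (d - 1)) * G"
          unfolding G_def using that C
          by (intro mult_mono power_mono cond_mean_power(2)[OF g k int] Bochner_Integration.integral_nonneg)
             (auto simp: zero_le_even_power)
        finally show ?thesis .
      qed
      have "(\<integral>w. B w ^ (2 * k) \<partial>S) \<le> (\<integral>w. real (n - m) ^ (2 * k - 1) * (\<Sum>i=m..<n. ustat d ?c i w ^ (2 * k)) \<partial>S)"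
        using Bint power_sum_le[OF k, of "{m..<n}"]
        by (intro integral_mono Bochner_Integration.integrable_mult_right Bochner_Integration.integrable_sum Uint)
           (auto simp: B_def)
      also have "\<dots> = real (n - m) ^ (2 * k - 1) * (\<Sum>i=m..<n. \<integral>w. ustat d ?c i w ^ (2 * k) \<partial>S)"
        by (simp add: Uint Bochner_Integration.integral_sum)
      also have "\<dots> \<le> real (n - m) ^ (2 * k - 1) * (\<Sum>i=m..<n. C * real n ^ (k + 2 * k * (d - 1)) * G)"
        using each by (intro mult_left_mono sum_mono) auto
      also have "\<dots> = real (n - m) ^ (2 * k) * (C * real n ^ (k + 2 * k * (d - 1)) * G)"
      proof -
        have "2 * k = Suc (2 * k - 1)" using k by simp
        then have "real (n - m) ^ (2 * k) = real (n - m) ^ (2 * k - 1) * real (n - m)"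
          by (metis power_Suc2)
        then show ?thesis by simp
      qed
      also have "real (n - m) ^ (2 * k) = real (n - m) ^ k * real (n - m) ^ k"
        by (simp flip: power_add add: mult_2)
      \<comment> \<open>One factor \<open>(n - m) ^ k\<close> is given up for \<open>n ^ k\<close>,
        which brings this part to the form of the martingale part.\<close>
      also have "\<dots> * (C * real n ^ (k + 2 * k * (d - 1)) * G)
          \<le> (real (n - m) ^ k * real n ^ k) * (C * real n ^ (k + 2 * k * (d - 1)) * G)"
        using C G0 by (intro mult_right_mono mult_left_mono power_mono) auto
      also have "\<dots> = C * (real (n - m) ^ k * (real n ^ (k + (k + 2 * k * (d - 1)))) * G)"
        by (simp only: power_add mult_ac)
      also have "k + (k + 2 * k * (d - 1)) = 2 * k * d"
        using False by (cases d) (auto simp: algebra_simps)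
      finally show ?thesis .
    qed
    have "(\<integral>w. (ustat (Suc d) g n w - ustat (Suc d) g m w) ^ (2 * k) \<partial>S) = (\<integral>w. (A w + B w) ^ (2 * k) \<partial>S)"
      by (simp add: ustat_diff_decomp[OF g mn] A_def B_def)
    also have "\<dots> \<le> (\<integral>w. 4 ^ k * (A w ^ (2 * k) + B w ^ (2 * k)) \<partial>S)"
      using Aint Bint integrable_power_add(1)[OF k Am Bm Aint Bint]
      by (intro integral_mono diff_even_power_le(1)[OF k]) auto
    also have "\<dots> = 4 ^ k * ((\<integral>w. A w ^ (2 * k) \<partial>S) + (\<integral>w. B w ^ (2 * k) \<partial>S))"
      using Aint Bint by simp
    also have "\<dots> \<le> 4 ^ k * ((mart_const k * (2 * 4 ^ k)) * (real (n - m) ^ k * real n ^ (2 * k * d) * G)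
        + C * (real (n - m) ^ k * real n ^ (2 * k * d) * G))"
      by (intro mult_left_mono add_mono Ale Ble) auto
    also have "\<dots> = 4 ^ k * (mart_const k * (2 * 4 ^ k) + C) * real (n - m) ^ k * real n ^ (2 * k * (Suc d - 1)) * G"
      by (simp add: algebra_simps)
    finally show "(\<integral>w. (ustat (Suc d) g n w - ustat (Suc d) g m w) ^ (2 * k) \<partial>S)
      \<le> 4 ^ k * (mart_const k * (2 * 4 ^ k) + C) * real (n - m) ^ k * real n ^ (2 * k * (Suc d - 1))
        * (\<integral>t. g t ^ (2 * k) \<partial>kernel_space (Suc d))"
      by (simp add: G_def)
  qed
qed

end

lemma sum_choose_lessThan: "(\<Sum>r<N. r choose e) = N choose (Suc e)"
  by (induction N) auto

context iid_sequence
begin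

section \<open>Projection of a U-statistic onto linear statistics\<close>

text \<open>All \<open>d\<close> arguments are integrated and argument \<open>j\<close> is
  overwritten by \<open>y\<close>, which keeps one kernel space for every \<open>j\<close>. In
  contrast to \<open>projection\<close>, no mean is subtracted.\<close>

definition proj :: "nat \<Rightarrow> ((nat \<Rightarrow> 'b) \<Rightarrow> real) \<Rightarrow> nat \<Rightarrow> 'b \<Rightarrow> real" where
  "proj d g j y = (\<integral>t. g (t(j := y)) \<partial>kernel_space d)"

context
  fixes d j :: nat and g :: "(nat \<Rightarrow> 'b) \<Rightarrow> real"
  assumes g [measurable]: "g \<in> borel_measurable (kernel_space d)" and j: "j \<in> {1..d}"
begin

lemma measurable_upd_kernel [measurable]:
  "(\<lambda>p. g ((fst p)(j := snd p))) \<in> borel_measurable (kernel_space d \<Otimes>\<^sub>M \<nu>)"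
  using measurable_compose[OF measurable_upd[OF j] g] by (simp add: split_beta')

lemma measurable_upd_kernel_section:
  "y \<in> space \<nu> \<Longrightarrow> (\<lambda>t. g (t(j := y))) \<in> borel_measurable (kernel_space d)"
  using measurable_Pair1[OF measurable_upd_kernel, of y] unfolding fst_conv snd_conv .

lemma measurable_proj [measurable]: "proj d g j \<in> borel_measurable \<nu>"
proof -
  interpret K: prob_space "kernel_space d" by (rule prob_space_kernel_space)
  have "(\<lambda>(y, t). g (t(j := y))) \<in> borel_measurable (\<nu> \<Otimes>\<^sub>M kernel_space d)"
    using measurable_compose[OF measurable_pair_swap' measurable_upd_kernel] by (simp add: split_beta')
  then show ?thesis unfolding proj_def[abs_def]
    by (rule K.borel_measurable_lebesgue_integral)
qed

lemma integral_upd_kernel: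
  fixes \<phi> :: "real \<Rightarrow> real" assumes [measurable]: "\<phi> \<in> borel_measurable borel"
  shows "(\<integral>p. \<phi> (g ((fst p)(j := snd p))) \<partial>(kernel_space d \<Otimes>\<^sub>M \<nu>)) = (\<integral>t. \<phi> (g t) \<partial>kernel_space d)"
    and "integrable (kernel_space d \<Otimes>\<^sub>M \<nu>) (\<lambda>p. \<phi> (g ((fst p)(j := snd p)))) \<longleftrightarrow>
      integrable (kernel_space d) (\<lambda>t. \<phi> (g t))"
  using integral_distr[OF measurable_upd[OF j], of "\<lambda>t. \<phi> (g t)"]
    integrable_distr_eq[OF measurable_upd[OF j], of "\<lambda>t. \<phi> (g t)"]
  unfolding kernel_space_upd[OF j] by (simp_all add: split_beta')

lemma integral_upd_kernel_power:
  "(\<integral>p. g ((fst p)(j := snd p)) ^ n \<partial>(kernel_space d \<Otimes>\<^sub>M \<nu>)) = (\<integral>t. g t ^ n \<partial>kernel_space d)"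
  "integrable (kernel_space d \<Otimes>\<^sub>M \<nu>) (\<lambda>p. g ((fst p)(j := snd p)) ^ n) \<longleftrightarrow>
      integrable (kernel_space d) (\<lambda>t. g t ^ n)"
  by (rule integral_upd_kernel[of "\<lambda>x. x ^ n"], measurable)+

lemma AE_integrable_upd:
  assumes "integrable (kernel_space d) g"
  shows "AE y in \<nu>. integrable (kernel_space d) (\<lambda>t. g (t(j := y)))"
proof -
  interpret KN: pair_prob_space "kernel_space d" \<nu> by (rule pair_prob)
  have "integrable (kernel_space d \<Otimes>\<^sub>M \<nu>) (\<lambda>(t, y). g (t(j := y)))"
    using integral_upd_kernel_power(2)[of 1] assms by (simp add: split_beta')
  from KN.AE_integrable_snd[OF this] show ?thesis by simp
qed

lemma integral_proj:
  assumes "integrable (kernel_space d) g"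
  shows "integrable \<nu> (proj d g j)" "(\<integral>y. proj d g j y \<partial>\<nu>) = (\<integral>t. g t \<partial>kernel_space d)"
proof -
  interpret KN: pair_prob_space "kernel_space d" \<nu> by (rule pair_prob)
  have i: "integrable (kernel_space d \<Otimes>\<^sub>M \<nu>) (\<lambda>(t, y). g (t(j := y)))"
    using integral_upd_kernel_power(2)[of 1] assms by (simp add: split_beta')
  show "integrable \<nu> (proj d g j)"
    using KN.integrable_snd[OF i] by (simp add: proj_def[abs_def])
  show "(\<integral>y. proj d g j y \<partial>\<nu>) = (\<integral>t. g t \<partial>kernel_space d)"
    using KN.integral_snd[OF i] integral_upd_kernel_power(1)[of 1] by (simp add: proj_def split_beta')
qed

lemma proj_power:
  assumes k: "k \<ge> 1" and int: "integrable (kernel_space d) (\<lambda>t. g t ^ (2 * k))"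
  shows "integrable \<nu> (\<lambda>y. proj d g j y ^ (2 * k))"
proof (rule integrableI_nonneg)
  interpret K: prob_space "kernel_space d" by (rule prob_space_kernel_space)
  interpret KN: pair_prob_space "kernel_space d" \<nu> by (rule pair_prob)
  have int': "integrable (kernel_space d \<Otimes>\<^sub>M \<nu>) (\<lambda>p. g ((fst p)(j := snd p)) ^ (2 * k))"
    using int by (simp only: integral_upd_kernel_power)
  have "(\<integral>\<^sup>+y. ennreal (proj d g j y ^ (2 * k)) \<partial>\<nu>)
      \<le> (\<integral>\<^sup>+y. (\<integral>\<^sup>+t. ennreal (g (t(j := y)) ^ (2 * k)) \<partial>kernel_space d) \<partial>\<nu>)"
    unfolding proj_def
    by (intro nn_integral_mono K.power_integral_le_nn_integral measurable_upd_kernel_section k)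
  also have "\<dots> = (\<integral>\<^sup>+p. ennreal (g ((fst p)(j := snd p)) ^ (2 * k)) \<partial>(kernel_space d \<Otimes>\<^sub>M \<nu>))"
    using KN.nn_integral_snd[of "\<lambda>p. ennreal (g ((fst p)(j := snd p)) ^ (2 * k))"] by simp
  also have "\<dots> = ennreal (\<integral>p. g ((fst p)(j := snd p)) ^ (2 * k) \<partial>(kernel_space d \<Otimes>\<^sub>M \<nu>))"
    using int' by (intro nn_integral_eq_integral) (auto simp: zero_le_even_power)
  also have "\<dots> < \<infinity>" by simp
  finally show "(\<integral>\<^sup>+y. ennreal (proj d g j y ^ (2 * k)) \<partial>\<nu>) < \<infinity>" .
  show "(\<lambda>y. proj d g j y ^ (2 * k)) \<in> borel_measurable \<nu>"
    using measurable_proj by (rule borel_measurable_power)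
  show "AE y in \<nu>. 0 \<le> proj d g j y ^ (2 * k)" by (intro AE_I2 zero_le_even_power) simp
qed

end

lemma integrable_of_power:
  assumes "finite_measure N" "g \<in> borel_measurable N" "integrable N (\<lambda>t. g t ^ (2 * k))" "k \<ge> 1"
  shows "integrable N (g :: _ \<Rightarrow> real)"
proof (rule Bochner_Integration.integrable_bound)
  interpret finite_measure N by fact
  show "integrable N (\<lambda>t. 1 + g t ^ (2 * k))" using assms by simp
  show "AE t in N. norm (g t) \<le> norm (1 + g t ^ (2 * k))"
    using abs_mixed_power_le[of 1 "2 * k - 1" _ 1] assms(4)
    by (auto simp: power_even_abs zero_le_even_power add_nonneg_nonneg)
qed fact

text \<open>Integrating over an argument that is then overwritten has no effect.\<close>

lemma proj_Suc_last:
  assumes g: "g \<in> borel_measurable (kernel_space (Suc d))" and y: "y \<in> space \<nu>"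
  shows "proj (Suc d) g (Suc d) y = (\<integral>t. g (t(Suc d := y)) \<partial>kernel_space d)"
proof -
  have m: "(\<lambda>t. g (t(Suc d := y))) \<in> borel_measurable (kernel_space (Suc d))"
    by (rule measurable_upd_kernel_section[OF g _ y]) simp
  have m': "(\<lambda>t. g (t(Suc d := y))) \<in> borel_measurable (kernel_space d)"
    using measurable_Pair1[OF measurable_kernel_upd[OF g] y] unfolding fst_conv snd_conv .
  have df: "distr (kernel_space d \<Otimes>\<^sub>M \<nu>) (kernel_space d) fst = kernel_space d"
    using M.distr_pair_fst[of "kernel_space d"] by (simp add: M.emeasure_space_1)
  have "proj (Suc d) g (Suc d) y
      = (\<integral>t. g (t(Suc d := y)) \<partial>distr (kernel_space d \<Otimes>\<^sub>M \<nu>) (kernel_space (Suc d)) (\<lambda>(t, y). t(Suc d := y)))"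
    by (simp add: proj_def kernel_space_Suc)
  also have "\<dots> = (\<integral>p. g ((fst p)(Suc d := y)) \<partial>(kernel_space d \<Otimes>\<^sub>M \<nu>))"
    using integral_distr[OF measurable_upd_last m] by (simp add: split_beta')
  also have "\<dots> = (\<integral>t. g (t(Suc d := y)) \<partial>distr (kernel_space d \<Otimes>\<^sub>M \<nu>) (kernel_space d) fst)"
    using integral_distr[of fst "kernel_space d \<Otimes>\<^sub>M \<nu>" "kernel_space d", OF _ m'] by simp
  finally show ?thesis by (simp only: df)
qed

text \<open>Fubini for the section with argument \<open>j\<close> fixed at \<open>y\<close>, which
  is integrable only for almost every \<open>y\<close>.\<close>

lemma proj_Suc:
  assumes g: "g \<in> borel_measurable (kernel_space (Suc d))" and int: "integrable (kernel_space (Suc d)) g"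
    and j: "j \<in> {1..d}"
  shows "AE y in \<nu>. proj (Suc d) g j y = proj d (cond_mean d g) j y"
proof -
  have j': "j \<in> {1..Suc d}" using j by auto
  show ?thesis using AE_integrable_upd[OF g j' int] AE_space
  proof eventually_elim
    case (elim y)
    have gy: "(\<lambda>t. g (t(j := y))) \<in> borel_measurable (kernel_space (Suc d))"
      by (rule measurable_upd_kernel_section[OF g j']) (use elim in simp)
    have ne: "j \<noteq> Suc d" using j by auto
    have "cond_mean d (\<lambda>t. g (t(j := y))) t = cond_mean d g (t(j := y))" for t
      using ne by (simp add: cond_mean_def fun_upd_twist)
    then show ?case
      using integral_cond_mean[OF gy] elim by (simp add: proj_def)
  qed
qed

text \<open>The number of increasing \<open>d\<close>-tuples below \<open>n\<close> whose
  \<open>j\<close>-th entry is \<open>i\<close>: there are \<open>j - 1\<close> entries to choose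
  below \<open>i\<close> and \<open>d - j\<close> above it.\<close>

definition lin_weight :: "nat \<Rightarrow> nat \<Rightarrow> nat \<Rightarrow> nat \<Rightarrow> real" where
  "lin_weight d n i j = real (i choose (j - 1)) * real ((n - 1 - i) choose (d - j))"

definition lin_stat :: "nat \<Rightarrow> (nat \<Rightarrow> 'b \<Rightarrow> real) \<Rightarrow> nat \<Rightarrow> (nat \<Rightarrow> 'b) \<Rightarrow> real" where
  "lin_stat d G n w = (\<Sum>i<n. \<Sum>j=1..d. lin_weight d n i j * G j (w i))"

lemma card_increasing_tuples: "card (increasing_tuples d n) = n choose d"
proof (induction d arbitrary: n)
  case 0
  then show ?case by (simp add: increasing_tuples_0)
next
  case (Suc d)
  have "card (increasing_tuples (Suc d) n) = (\<Sum>s\<in>increasing_tuples (Suc d) n. 1)" by simp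
  also have "\<dots> = (\<Sum>i<n. \<Sum>s\<in>increasing_tuples d i. 1)" by (rule sum_increasing_tuples_Suc)
  also have "\<dots> = n choose Suc d" by (simp add: Suc sum_choose_lessThan)
  finally show ?case .
qed

text \<open>The counterpart of \<open>ustat_decomp\<close> for the weights. Either \<open>i\<close>
  is itself the last entry of the tuple, or the last entry is a later index \<open>i'\<close>, and
  summing over \<open>i'\<close> is a hockey-stick identity.\<close>

lemma lin_stat_Suc:
  "lin_stat (Suc d) G n w = (\<Sum>i<n. real (i choose d) * G (Suc d) (w i)) + (\<Sum>i<n. lin_stat d G i w)"
proof -
  have hs: "(\<Sum>i'=Suc i..<n. real ((i' - 1 - i) choose e)) = real ((n - 1 - i) choose Suc e)" for i e
  proof -
    have "(\<Sum>i'=Suc i..<n. real ((i' - 1 - i) choose e)) = (\<Sum>r<n - 1 - i. real (r choose e))"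
      by (rule sum.reindex_bij_witness[of _ "\<lambda>r. r + Suc i" "\<lambda>i'. i' - 1 - i"]) auto
    also have "\<dots> = real (\<Sum>r<n - 1 - i. r choose e)" by simp
    finally show ?thesis by (simp only: sum_choose_lessThan)
  qed
  have swap: "(\<Sum>i'<n. \<Sum>i<i'. F i' i) = (\<Sum>i<n. \<Sum>i'=Suc i..<n. F i' i)" for F :: "nat \<Rightarrow> nat \<Rightarrow> real"
  proof -
    have "(\<Sum>i'<n. \<Sum>i<i'. F i' i) = (\<Sum>(i', i)\<in>Sigma {..<n} (\<lambda>i'. {..<i'}). F i' i)"
      by (rule sum.Sigma) auto
    also have "\<dots> = (\<Sum>(i, i')\<in>Sigma {..<n} (\<lambda>i. {Suc i..<n}). F i' i)"
      by (rule sum.reindex_bij_witness[of _ "\<lambda>(a, b). (b, a)" "\<lambda>(a, b). (b, a)"]) auto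
    also have "\<dots> = (\<Sum>i<n. \<Sum>i'=Suc i..<n. F i' i)"
      by (rule sum.Sigma[symmetric]) auto
    finally show ?thesis .
  qed
  have "(\<Sum>i'<n. lin_stat d G i' w)
     = (\<Sum>i'<n. \<Sum>i<i'. \<Sum>j=1..d. lin_weight d i' i j * G j (w i))"
    by (simp add: lin_stat_def)
  also have "\<dots> = (\<Sum>i<n. \<Sum>i'=Suc i..<n. \<Sum>j=1..d. lin_weight d i' i j * G j (w i))"
    by (rule swap)
  also have "\<dots> = (\<Sum>i<n. \<Sum>j=1..d. \<Sum>i'=Suc i..<n. lin_weight d i' i j * G j (w i))"
    by (intro sum.cong refl sum.swap)
  also have "\<dots> = (\<Sum>i<n. \<Sum>j=1..d. lin_weight (Suc d) n i j * G j (w i))"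
  proof (intro sum.cong refl)
    fix i j assume "j \<in> {1..d}"
    then have "Suc d - j = Suc (d - j)" by auto
    note sd = this
    have "(\<Sum>i'=Suc i..<n. lin_weight d i' i j * G j (w i))
       = (\<Sum>i'=Suc i..<n. (real (i choose (j - 1)) * G j (w i)) * real ((i' - 1 - i) choose (d - j)))"
      by (intro sum.cong refl) (simp only: lin_weight_def mult_ac)
    also have "\<dots> = (real (i choose (j - 1)) * G j (w i)) * real ((n - 1 - i) choose (Suc d - j))"
      by (simp only: sum_distrib_left[symmetric] hs sd)
    finally show "(\<Sum>i'=Suc i..<n. lin_weight d i' i j * G j (w i)) = lin_weight (Suc d) n i j * G j (w i)"
      by (simp only: lin_weight_def mult_ac)
  qed
  finally have eq: "(\<Sum>i'<n. lin_stat d G i' w) = (\<Sum>i<n. \<Sum>j=1..d. lin_weight (Suc d) n i j * G j (w i))" .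
  have at: "{1..Suc d} = insert (Suc d) {1..d}" by auto
  have "lin_stat (Suc d) G n w = (\<Sum>i<n. lin_weight (Suc d) n i (Suc d) * G (Suc d) (w i)
      + (\<Sum>j=1..d. lin_weight (Suc d) n i j * G j (w i)))"
    by (simp add: lin_stat_def at)
  also have "\<dots> = (\<Sum>i<n. lin_weight (Suc d) n i (Suc d) * G (Suc d) (w i)) + (\<Sum>i'<n. lin_stat d G i' w)"
    by (simp only: sum.distrib eq)
  finally show ?thesis by (simp add: lin_weight_def)
qed

lemma measurable_coordinate: "F \<in> borel_measurable \<nu> \<Longrightarrow> (\<lambda>w. F (w i)) \<in> borel_measurable S"
  by (rule measurable_compose[OF measurable_component_singleton]) auto

lemma integral_coordinate:
  fixes F :: "'b \<Rightarrow> 'c :: {banach, second_countable_topology}"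
  assumes "F \<in> borel_measurable \<nu>"
  shows "(\<integral>w. F (w i) \<partial>S) = (\<integral>y. F y \<partial>\<nu>)" "integrable S (\<lambda>w. F (w i)) \<longleftrightarrow> integrable \<nu> F"
proof -
  have c: "distr S \<nu> (\<lambda>w. w i) = \<nu>"
    using distr_PiM_component[of UNIV "\<lambda>_. \<nu>" i] prob_nu by simp
  have m: "(\<lambda>w. w i) \<in> measurable S \<nu>" by (rule measurable_component_singleton) simp
  show "(\<integral>w. F (w i) \<partial>S) = (\<integral>y. F y \<partial>\<nu>)" "integrable S (\<lambda>w. F (w i)) \<longleftrightarrow> integrable \<nu> F"
    using integral_distr[OF m assms] integrable_distr_eq[OF m assms] unfolding c by metis+
qed

lemma measurable_lin_stat:
  assumes "\<And>j. j \<in> {1..d} \<Longrightarrow> G j \<in> borel_measurable \<nu>"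
  shows "lin_stat d G n \<in> borel_measurable S"
  unfolding lin_stat_def[abs_def]
  by (rule borel_measurable_sum, rule borel_measurable_sum,
      rule borel_measurable_times[OF borel_measurable_const measurable_coordinate[OF assms]])

lemma integrable_lin_stat_power:
  assumes "\<And>j. j \<in> {1..d} \<Longrightarrow> G j \<in> borel_measurable \<nu>"
    and "\<And>j. j \<in> {1..d} \<Longrightarrow> integrable \<nu> (\<lambda>y. G j y ^ (2 * k))" and k: "k \<ge> 1"
  shows "integrable S (\<lambda>w. lin_stat d G n w ^ (2 * k))"
  unfolding lin_stat_def
proof (rule integrable_power_sum[OF k])
  fix i
  have m: "(\<lambda>w. lin_weight d n i j * G j (w i)) \<in> borel_measurable S" if "j \<in> {1..d}" for j
    by (rule borel_measurable_times[OF borel_measurable_const measurable_coordinate[OF assms(1)[OF that]]])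
  show "(\<lambda>w. \<Sum>j=1..d. lin_weight d n i j * G j (w i)) \<in> borel_measurable S"
    by (rule borel_measurable_sum[OF m])
  show "integrable S (\<lambda>w. (\<Sum>j=1..d. lin_weight d n i j * G j (w i)) ^ (2 * k))"
  proof (rule integrable_power_sum[OF k _ m])
    fix j assume j: "j \<in> {1..d}"
    have "(\<lambda>y. G j y ^ (2 * k)) \<in> borel_measurable \<nu>" by (rule borel_measurable_power[OF assms(1)[OF j]])
    then show "integrable S (\<lambda>w. (lin_weight d n i j * G j (w i)) ^ (2 * k))"
      using assms(2)[OF j] integral_coordinate(2)[of "\<lambda>y. G j y ^ (2 * k)" i]
      by (simp only: power_mult_distrib integrable_mult_right_iff) simp
  qed simp_all
qed simp

text \<open>With the last argument fixed at \<open>y\<close>, the increment is a centred U-statistic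
  of degree \<open>d\<close> in the first \<open>i\<close> coordinates, so its variance is one power
  of \<open>i\<close> below the general bound of \<open>increment_moment_le\<close>. The case
  \<open>d = 0\<close> is stated separately, because truncation turns the exponent
  \<open>2 * d - 1\<close> into \<open>0\<close> there while the second moment is in fact
  \<open>0\<close>.\<close>

lemma increment_mean_zero_moment:
  assumes hm [measurable]: "case_prod h \<in> borel_measurable (kernel_space d \<Otimes>\<^sub>M \<nu>)"
    and hint: "integrable (kernel_space d \<Otimes>\<^sub>M \<nu>) (\<lambda>(t, y). h t y ^ (2 * 1))"
    and zero: "AE y in \<nu>. (\<integral>t. h t y \<partial>kernel_space d) = 0"
  shows "\<exists>C\<ge>0. \<forall>i. (\<integral>w. increment d h i w ^ (2 * 1) \<partial>S) \<le> C * real i ^ (2 * d - 1) \<and>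
    (d = 0 \<longrightarrow> (\<integral>w. increment d h i w ^ (2 * 1) \<partial>S) = 0)"
proof -
  interpret KN: pair_prob_space "kernel_space d" \<nu> by (rule pair_prob)
  interpret SN: pair_prob_space S \<nu> by (rule pair_prob)
  obtain C where C: "C \<ge> 0" and IH: "\<And>g m n. g \<in> borel_measurable (kernel_space d) \<Longrightarrow>
    integrable (kernel_space d) (\<lambda>t. g t ^ (2 * 1)) \<Longrightarrow> (\<integral>t. g t \<partial>kernel_space d) = 0 \<Longrightarrow> m \<le> n \<Longrightarrow>
      (\<integral>w. (ustat d g n w - ustat d g m w) ^ (2 * 1) \<partial>S)
        \<le> C * real (n - m) ^ 1 * real n ^ (2 * 1 * (d - 1)) * (\<integral>t. g t ^ (2 * 1) \<partial>kernel_space d)"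
    using ustat_moment[of 1 d] by blast
  define H where "H = (\<integral>(t, y). h t y ^ (2 * 1) \<partial>(kernel_space d \<Otimes>\<^sub>M \<nu>))"
  have H: "H \<ge> 0" unfolding H_def by (intro Bochner_Integration.integral_nonneg) (auto simp: zero_le_even_power)
  have sec: "(\<lambda>t. h t y) \<in> borel_measurable (kernel_space d)" if "y \<in> space \<nu>" for y
    using measurable_Pair1[OF hm that] unfolding case_prod_conv .
  have "(\<integral>w. increment d h i w ^ (2 * 1) \<partial>S) \<le> C * H * real i ^ (2 * d - 1)
      \<and> (d = 0 \<longrightarrow> (\<integral>w. increment d h i w ^ (2 * 1) \<partial>S) = 0)" for i
  proof -
    define c where "c = (if d = 0 then 0 else C * real i ^ (2 * d - 1))"
    have c0: "c \<ge> 0" using C by (simp add: c_def)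
    have um: "(\<lambda>(w, y). ustat d (\<lambda>t. h t y) i w) \<in> borel_measurable (S \<Otimes>\<^sub>M \<nu>)"
      unfolding ustat_def split_beta'
      using measurable_compose[OF _ hm, of "\<lambda>p. (pick d _ (fst p), snd p)" "S \<Otimes>\<^sub>M \<nu>"]
      by (intro borel_measurable_sum) simp
    have "ennreal (\<integral>w. increment d h i w ^ (2 * 1) \<partial>S) = (\<integral>\<^sup>+w. ennreal (increment d h i w ^ (2 * 1)) \<partial>S)"
      using integrable_increment[OF hm order_refl hint, of i]
      by (intro nn_integral_eq_integral[symmetric]) auto
    also have "\<dots> = (\<integral>\<^sup>+w. (\<lambda>w y. ennreal (ustat d (\<lambda>t. h t y) i w ^ (2 * 1))) w (w i) \<partial>S)"
      by (simp add: increment_def ustat_def)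
    also have "\<dots> = (\<integral>\<^sup>+p. (case p of (w, y) \<Rightarrow> ennreal (ustat d (\<lambda>t. h t y) i w ^ (2 * 1))) \<partial>(S \<Otimes>\<^sub>M \<nu>))"
    proof (rule fresh_nn_integral)
      fix w w' :: "nat \<Rightarrow> 'b" and y assume "\<And>j. j < i \<Longrightarrow> w j = w' j"
      then show "ennreal (ustat d (\<lambda>t. h t y) i w ^ (2 * 1)) = ennreal (ustat d (\<lambda>t. h t y) i w' ^ (2 * 1))"
        using ustat_cong[of i w w'] by simp
    qed (use um in \<open>simp add: split_beta'\<close>)
    also have "\<dots> = (\<integral>\<^sup>+y. (\<integral>\<^sup>+w. ennreal (ustat d (\<lambda>t. h t y) i w ^ (2 * 1)) \<partial>S) \<partial>\<nu>)"
      using SN.nn_integral_snd[of "\<lambda>p. case p of (w, y) \<Rightarrow> ennreal (ustat d (\<lambda>t. h t y) i w ^ (2 * 1))"] um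
      by (simp add: split_beta')
    also have "\<dots> \<le> (\<integral>\<^sup>+y. ennreal c * (\<integral>\<^sup>+t. ennreal (h t y ^ (2 * 1)) \<partial>kernel_space d) \<partial>\<nu>)"
    proof (rule nn_integral_mono_AE)
      show "AE y in \<nu>. (\<integral>\<^sup>+w. ennreal (ustat d (\<lambda>t. h t y) i w ^ (2 * 1)) \<partial>S)
         \<le> ennreal c * (\<integral>\<^sup>+t. ennreal (h t y ^ (2 * 1)) \<partial>kernel_space d)"
        using zero KN.AE_integrable_snd[OF hint] AE_space
      proof eventually_elim
        case (elim y)
        have m: "(\<lambda>t. h t y) \<in> borel_measurable (kernel_space d)" using elim sec by simp
        have i2: "integrable S (\<lambda>w. ustat d (\<lambda>t. h t y) i w ^ (2 * 1))"
          by (rule integrable_ustat_power[OF _ m]) (use elim in auto)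
        have "(\<integral>w. ustat d (\<lambda>t. h t y) i w ^ (2 * 1) \<partial>S) \<le> c * (\<integral>t. h t y ^ (2 * 1) \<partial>kernel_space d)"
        proof (cases "d = 0")
          case True
          then show ?thesis using ustat_0_eq[of "\<lambda>t. h t y" i] elim by (simp add: c_def)
        next
          case False
          have "ustat d (\<lambda>t. h t y) 0 w = 0" for w using False by (simp add: ustat_def increasing_tuples_empty)
          moreover have "real i * real i ^ (2 * (d - 1)) = real i ^ (2 * d - 1)"
            using False by (cases d) (auto simp flip: power_Suc)
          ultimately show ?thesis
            using IH[OF m, of 0 i] elim False by (simp add: c_def mult.assoc)
        qed
        then have "ennreal (\<integral>w. ustat d (\<lambda>t. h t y) i w ^ (2 * 1) \<partial>S)
            \<le> ennreal c * ennreal (\<integral>t. h t y ^ (2 * 1) \<partial>kernel_space d)"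
          using c0 by (simp flip: ennreal_mult add: ennreal_leI)
        then show ?case
          using i2 elim by (simp add: nn_integral_eq_integral)
      qed
    qed
    also have "\<dots> = ennreal c * (\<integral>\<^sup>+y. (\<integral>\<^sup>+t. ennreal (h t y ^ (2 * 1)) \<partial>kernel_space d) \<partial>\<nu>)"
      using KN.M1.borel_measurable_nn_integral[of "\<lambda>y t. ennreal (h t y ^ (2 * 1))" \<nu>]
        measurable_compose[OF measurable_pair_swap' hm]
      by (intro nn_integral_cmult) (simp add: split_beta')
    also have "(\<integral>\<^sup>+y. (\<integral>\<^sup>+t. ennreal (h t y ^ (2 * 1)) \<partial>kernel_space d) \<partial>\<nu>)
       = (\<integral>\<^sup>+p. ennreal (h (fst p) (snd p) ^ (2 * 1)) \<partial>(kernel_space d \<Otimes>\<^sub>M \<nu>))"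
      using KN.nn_integral_snd[of "\<lambda>p. ennreal (h (fst p) (snd p) ^ (2 * 1))"] hm
      by (simp add: split_beta')
    also have "\<dots> = ennreal H"
      unfolding H_def using hint by (subst nn_integral_eq_integral) (auto simp: split_beta')
    also have "ennreal c * ennreal H = ennreal (c * H)" using c0 H by (simp add: ennreal_mult)
    finally have le: "(\<integral>w. increment d h i w ^ (2 * 1) \<partial>S) \<le> c * H"
      using c0 H by (subst (asm) ennreal_le_iff) auto
    have nn: "0 \<le> (\<integral>w. increment d h i w ^ (2 * 1) \<partial>S)"
      by (intro Bochner_Integration.integral_nonneg) simp
    show ?thesis
    proof (cases "d = 0")
      case True
      then have "c = 0" by (simp add: c_def)
      then have "(\<integral>w. increment d h i w ^ (2 * 1) \<partial>S) \<le> 0" using le by (simp only: mult_zero_left)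
      then have "(\<integral>w. increment d h i w ^ (2 * 1) \<partial>S) = 0" using nn by linarith
      then show ?thesis using C H by (simp only: True) simp
    next
      case False
      then have "c * H = C * H * real i ^ (2 * d - 1)" by (simp add: c_def)
      then show ?thesis using le False by (simp only:) simp
    qed
  qed
  then show ?thesis using C H by (intro exI[of _ "C * H"]) auto
qed

text \<open>Once its last projection is subtracted, the residual integrates to \<open>0\<close> in
  the last argument and also in the others, so its increments are martingale differences of reduced
  size. The resulting mean square error \<open>n ^ (2 * (d - 1))\<close> is one power of
  \<open>n\<close> below the order \<open>n ^ (2 * d - 1)\<close> of the second moment of the
  statistic itself.\<close>

theorem ustat_linearization:
  assumes "g \<in> borel_measurable (kernel_space d)" "integrable (kernel_space d) (\<lambda>t. g t ^ (2 * 1))"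
    and "(\<integral>t. g t \<partial>kernel_space d) = 0"
  shows "\<exists>C\<ge>0. \<forall>n. (\<integral>w. (ustat d g n w - lin_stat d (proj d g) n w) ^ (2 * 1) \<partial>S) \<le> C * real n ^ (2 * (d - 1))"
  using assms
proof (induction d arbitrary: g)
  case 0
  then show ?case using ustat_0_eq by (intro exI[of _ 0]) (simp add: lin_stat_def)
next
  case (Suc d)
  note g [measurable] = Suc.prems(1) and int = Suc.prems(2) and mean = Suc.prems(3)
  let ?c = "cond_mean d g" and ?h = "residual d g" and ?G = "proj (Suc d) g"
  have cm: "?c \<in> borel_measurable (kernel_space d)" by measurable
  note one = order_refl[of "1::nat"]
  note cint = cond_mean_power(1)[OF g one int]
  note hint = residual_power(1)[OF g one int]
  interpret K: prob_space "kernel_space (Suc d)" by (rule prob_space_kernel_space)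
  interpret Kd: prob_space "kernel_space d" by (rule prob_space_kernel_space)
  interpret KN: pair_prob_space "kernel_space d" \<nu> by (rule pair_prob)
  have gint: "integrable (kernel_space (Suc d)) g"
    by (rule integrable_of_power[OF _ g int one]) unfold_locales
  have cint1: "integrable (kernel_space d) ?c"
    by (rule integrable_of_power[OF _ cm cint one]) unfold_locales
  have cmean: "(\<integral>t. ?c t \<partial>kernel_space d) = 0"
    using integral_cond_mean[OF g gint] mean by simp
  obtain C1 where C1: "C1 \<ge> 0" and IH: "\<And>n. (\<integral>w. (ustat d ?c n w - lin_stat d (proj d ?c) n w) ^ (2 * 1) \<partial>S)
      \<le> C1 * real n ^ (2 * (d - 1))"
    using Suc.IH[OF cm cint cmean] by blast
  have sd: "Suc d \<in> {1..Suc d}" by simp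
  have Gm: "?G j \<in> borel_measurable \<nu>" if "j \<in> {1..Suc d}" for j by (rule measurable_proj[OF g that])
  have Gint: "integrable \<nu> (\<lambda>y. ?G j y ^ (2 * 1))" if "j \<in> {1..Suc d}" for j
    by (rule proj_power[OF g that one int])
  define h' where "h' t y = ?h t y - ?G (Suc d) y" for t y
  have ds: "distr (kernel_space d \<Otimes>\<^sub>M \<nu>) \<nu> snd = \<nu>"
  proof (rule measure_eqI)
    fix A assume "A \<in> sets (distr (kernel_space d \<Otimes>\<^sub>M \<nu>) \<nu> snd)"
    then have A: "A \<in> sets \<nu>" by simp
    then have "snd -` A \<inter> space (kernel_space d \<Otimes>\<^sub>M \<nu>) = space (kernel_space d) \<times> A"
      using sets.sets_into_space by (fastforce simp: space_pair_measure)
    then show "emeasure (distr (kernel_space d \<Otimes>\<^sub>M \<nu>) \<nu> snd) A = emeasure \<nu> A"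
      using A by (simp add: emeasure_distr M.emeasure_pair_measure_Times Kd.emeasure_space_1)
  qed simp
  have rm: "(\<lambda>p. ?h (fst p) (snd p)) \<in> borel_measurable (kernel_space d \<Otimes>\<^sub>M \<nu>)"
    using measurable_residual[OF g] unfolding split_beta' .
  have gm2: "(\<lambda>p. ?G (Suc d) (snd p)) \<in> borel_measurable (kernel_space d \<Otimes>\<^sub>M \<nu>)"
    by (rule measurable_compose[OF measurable_snd Gm[OF sd]])
  have h'm: "case_prod h' \<in> borel_measurable (kernel_space d \<Otimes>\<^sub>M \<nu>)"
    unfolding h'_def[abs_def] split_beta' by (rule borel_measurable_diff[OF rm gm2])
  have "integrable (distr (kernel_space d \<Otimes>\<^sub>M \<nu>) \<nu> snd) (\<lambda>y. ?G (Suc d) y ^ (2 * 1))"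
    unfolding ds by (rule Gint[OF sd])
  then have iG: "integrable (kernel_space d \<Otimes>\<^sub>M \<nu>) (\<lambda>p. ?G (Suc d) (snd p) ^ (2 * 1))"
    by (rule integrable_distr[OF measurable_snd])
  have h'int: "integrable (kernel_space d \<Otimes>\<^sub>M \<nu>) (\<lambda>(t, y). h' t y ^ (2 * 1))"
    unfolding h'_def split_beta'
    by (rule integrable_power_add(2)[OF one rm gm2 hint[unfolded split_beta'] iG])
  have Gi: "integrable \<nu> (?G (Suc d))" and Gz: "(\<integral>y. ?G (Suc d) y \<partial>\<nu>) = 0"
    using integral_proj[OF g sd gint] mean by auto
  \<comment> \<open>\<open>increment_martingale\<close> asks for this at every \<open>t\<close>. If
    the section of the residual is not integrable, neither is that of \<open>h'\<close>, and its
    integral is \<open>0\<close> by convention.\<close>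
  have h'z: "(\<integral>y. h' t y \<partial>\<nu>) = 0" for t
  proof (cases "integrable \<nu> (?h t)")
    case True
    then show ?thesis using Gi Gz integral_residual[of d g t] by (simp add: h'_def)
  next
    case False
    have "\<not> integrable \<nu> (h' t)"
    proof
      assume "integrable \<nu> (h' t)"
      then have "integrable \<nu> (\<lambda>y. h' t y + ?G (Suc d) y)" using Gi by simp
      then show False using False by (simp add: h'_def)
    qed
    then show ?thesis by (simp add: not_integrable_integral_eq)
  qed
  have h'z2: "AE y in \<nu>. (\<integral>t. h' t y \<partial>kernel_space d) = 0"
  proof -
    have "integrable (kernel_space d \<Otimes>\<^sub>M \<nu>) (\<lambda>(t, y). g (t(Suc d := y)))"
      using integral_kernel_upd_power(2)[OF g, of 1] gint by (simp add: split_beta' fun_upd_def)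
    from KN.AE_integrable_snd[OF this] show ?thesis using AE_space
    proof eventually_elim
      case (elim y)
      then show ?case using cint1 cmean
        by (simp add: h'_def residual_def proj_Suc_last[OF g] Kd.prob_space fun_upd_def)
    qed
  qed
  obtain C2 where C2: "C2 \<ge> 0" and inc: "\<And>i. (\<integral>w. increment d h' i w ^ (2 * 1) \<partial>S) \<le> C2 * real i ^ (2 * d - 1)"
    and inc0: "\<And>i. d = 0 \<Longrightarrow> (\<integral>w. increment d h' i w ^ (2 * 1) \<partial>S) = 0"
    using increment_mean_zero_moment[OF h'm h'int h'z2] by blast
  have iA: "integrable S (\<lambda>w. increment d h' i w ^ (2 * 1))" for i
    by (rule integrable_increment[OF h'm one h'int])
  have mA: "increment d h' i \<in> borel_measurable S" for i
    by (rule measurable_increment[OF h'm one h'int])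
  have pm: "proj d ?c j \<in> borel_measurable \<nu>" if "j \<in> {1..d}" for j by (rule measurable_proj[OF cm that])
  have pint: "integrable \<nu> (\<lambda>y. proj d ?c j y ^ (2 * 1))" if "j \<in> {1..d}" for j
    by (rule proj_power[OF cm that one cint])
  define D where "D i w = ustat d ?c i w - lin_stat d (proj d ?c) i w" for i w
  have mD: "D i \<in> borel_measurable S" for i
    unfolding D_def[abs_def] by (rule borel_measurable_diff[OF measurable_ustat[OF cm] measurable_lin_stat[OF pm]])
  have iD: "integrable S (\<lambda>w. D i w ^ (2 * 1))" for i
    unfolding D_def
    by (rule integrable_power_add(2)[OF one measurable_ustat[OF cm] measurable_lin_stat[OF pm]
          integrable_ustat_power[OF one cm cint] integrable_lin_stat_power[OF pm pint one]])
  \<comment> \<open>The projections of \<open>g\<close> and of \<open>cond_mean d g\<close> agree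
    only almost everywhere, so countably many null sets, one for each coordinate and position, are
    discarded.\<close>
  have AEeq: "AE w in S. ustat (Suc d) g n w - lin_stat (Suc d) ?G n w
      = (\<Sum>i<n. increment d h' i w) + (\<Sum>i<n. D i w)" for n
  proof -
    have "AE w in S. \<forall>i. \<forall>j\<in>{1..d}. ?G j (w i) = proj d ?c j (w i)"
    proof (subst AE_all_countable, rule allI, rule AE_ball_countable', goal_cases)
      case (1 i j)
      then show ?case using proj_Suc[OF g gint, of j] prob_nu
        by (intro AE_PiM_component) auto
    qed auto
    then show ?thesis
    proof eventually_elim
      case (elim w)
      have L: "lin_stat d ?G i w = lin_stat d (proj d ?c) i w" for i
        unfolding lin_stat_def using elim by (intro sum.cong refl) simp
      have I: "increment d h' i w = increment d ?h i w - real (i choose d) * ?G (Suc d) (w i)" for i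
        by (simp add: increment_def h'_def sum_subtractf card_increasing_tuples)
      show ?case
        unfolding ustat_decomp[OF g] lin_stat_Suc I L D_def by (simp add: sum_subtractf)
    qed
  qed
  show ?case
  proof (intro exI[of _ "4 * (mart_const 1 * C2 + C1)"] conjI allI)
    show "0 \<le> 4 * (mart_const 1 * C2 + C1)" using C1 C2 mart_const_nonneg by simp
    fix n
    define A where "A w = (\<Sum>i<n. increment d h' i w)" for w
    define B where "B w = (\<Sum>i<n. D i w)" for w
    have Am: "A \<in> borel_measurable S" and Bm: "B \<in> borel_measurable S"
      unfolding A_def[abs_def] B_def[abs_def] by (auto intro!: borel_measurable_sum mA mD)
    have Ai: "integrable S (\<lambda>w. A w ^ (2 * 1))" and Bi: "integrable S (\<lambda>w. B w ^ (2 * 1))"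
      unfolding A_def B_def by (rule integrable_power_sum[OF one _ mA iA] integrable_power_sum[OF one _ mD iD]; simp)+
    have "(\<integral>w. A w ^ (2 * 1) \<partial>S) \<le> mart_const 1 * (C2 * real n ^ (2 * d))"
    proof (cases "d = 0")
      case True
      have "(\<integral>w. (\<Sum>i=0..<n. increment d h' i w) ^ (2 * 1) \<partial>S) \<le> mart_const 1 * real (n - 0) ^ 1 * 0"
        by (rule increment_martingale[OF h'm one h'int h'z]) (use inc0 True in auto)
      then have "(\<integral>w. A w ^ (2 * 1) \<partial>S) \<le> 0" by (simp add: A_def lessThan_atLeast0)
      moreover have "0 \<le> mart_const 1 * (C2 * real n ^ (2 * d))" using C2 mart_const_nonneg[of 1] by simp
      ultimately show ?thesis by linarith
    next
      case False
      have "(\<integral>w. (\<Sum>i=0..<n. increment d h' i w) ^ (2 * 1) \<partial>S) \<le> mart_const 1 * real (n - 0) ^ 1 * (C2 * real n ^ (2 * d - 1))"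
      proof (rule increment_martingale[OF h'm one h'int h'z])
        fix i assume "i < n"
        then have "C2 * real i ^ (2 * d - 1) \<le> C2 * real n ^ (2 * d - 1)"
          using C2 by (intro mult_left_mono power_mono) auto
        then show "(\<integral>w. increment d h' i w ^ (2 * 1) \<partial>S) \<le> C2 * real n ^ (2 * d - 1)"
          using inc[of i] by linarith
      qed
      also have "\<dots> = mart_const 1 * (C2 * real n ^ (2 * d))"
        using False by (cases d) (auto simp: mult_ac)
      finally show ?thesis by (simp add: A_def lessThan_atLeast0)
    qed
    moreover have "(\<integral>w. B w ^ (2 * 1) \<partial>S) \<le> C1 * real n ^ (2 * d)"
    proof (cases "d = 0")
      case True
      then have "B w = 0" for w using ustat_0_eq cmean by (simp add: B_def D_def lin_stat_def)
      then show ?thesis using C1 by simp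
    next
      case False
      have "(\<integral>w. B w ^ (2 * 1) \<partial>S) \<le> (\<integral>w. real n ^ (2 * 1 - 1) * (\<Sum>i<n. D i w ^ (2 * 1)) \<partial>S)"
        using Bi power_sum_le[OF one, of "{..<n}"]
        by (intro integral_mono Bochner_Integration.integrable_mult_right Bochner_Integration.integrable_sum iD)
           (auto simp: B_def)
      also have "\<dots> = real n * (\<Sum>i<n. \<integral>w. D i w ^ (2 * 1) \<partial>S)"
        using iD by (simp add: Bochner_Integration.integral_sum)
      also have "\<dots> \<le> real n * (\<Sum>i<n. C1 * real n ^ (2 * (d - 1)))"
      proof (intro mult_left_mono sum_mono)
        fix i assume "i \<in> {..<n}"
        then have "C1 * real i ^ (2 * (d - 1)) \<le> C1 * real n ^ (2 * (d - 1))"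
          using C1 by (intro mult_left_mono power_mono) auto
        then show "(\<integral>w. D i w ^ (2 * 1) \<partial>S) \<le> C1 * real n ^ (2 * (d - 1))"
          using IH[of i] unfolding D_def by linarith
      qed simp
      also have "\<dots> = C1 * real n ^ (2 * d)"
        using False by (cases d) (auto simp: mult_ac)
      finally show ?thesis .
    qed
    moreover have "(\<integral>w. (ustat (Suc d) g n w - lin_stat (Suc d) ?G n w) ^ (2 * 1) \<partial>S) = (\<integral>w. (A w + B w) ^ (2 * 1) \<partial>S)"
    proof (rule integral_cong_AE)
      show "(\<lambda>w. (ustat (Suc d) g n w - lin_stat (Suc d) ?G n w) ^ (2 * 1)) \<in> borel_measurable S"
        by (rule borel_measurable_power[OF borel_measurable_diff[OF measurable_ustat[OF g] measurable_lin_stat[OF Gm]]])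
      show "(\<lambda>w. (A w + B w) ^ (2 * 1)) \<in> borel_measurable S"
        by (rule borel_measurable_power[OF borel_measurable_add[OF Am Bm]])
      show "AE w in S. (ustat (Suc d) g n w - lin_stat (Suc d) ?G n w) ^ (2 * 1) = (A w + B w) ^ (2 * 1)"
        using AEeq[of n] by eventually_elim (simp add: A_def B_def)
    qed
    moreover have "(\<integral>w. (A w + B w) ^ (2 * 1) \<partial>S) \<le> (\<integral>w. 4 ^ 1 * (A w ^ (2 * 1) + B w ^ (2 * 1)) \<partial>S)"
      using Ai Bi integrable_power_add(1)[OF one Am Bm Ai Bi]
      by (intro integral_mono diff_even_power_le(1)[OF one]) auto
    moreover have "(\<integral>w. 4 ^ 1 * (A w ^ (2 * 1) + B w ^ (2 * 1)) \<partial>S) = 4 * ((\<integral>w. A w ^ (2 * 1) \<partial>S) + (\<integral>w. B w ^ (2 * 1) \<partial>S))"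
      using Ai Bi by simp
    ultimately show "(\<integral>w. (ustat (Suc d) g n w - lin_stat (Suc d) ?G n w) ^ (2 * 1) \<partial>S)
        \<le> 4 * (mart_const 1 * C2 + C1) * real n ^ (2 * (Suc d - 1))"
      by (simp add: algebra_simps)
  qed
qed

end

section \<open>A random constant with all moments\<close>

text \<open>The bound \<open>K w \<ge> 1\<close> holds everywhere, so that a higher power of
  \<open>K\<close> is always a weaker bound and two random constants can be merged by
  multiplication.\<close>

definition all_moments :: "'a measure \<Rightarrow> ('a \<Rightarrow> real) \<Rightarrow> bool" where
  "all_moments M K \<longleftrightarrow> K \<in> borel_measurable M \<and> (\<forall>w. K w \<ge> 1) \<and> (\<forall>p::nat. integrable M (\<lambda>w. K w ^ p))"

text \<open>A high even power dominates all lower powers because \<open>K w \<ge> 1\<close>.\<close>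

lemma (in prob_space) all_moments_of_even:
  assumes m: "K \<in> borel_measurable M" and ge: "\<And>w. K w \<ge> 1"
    and int: "\<And>k. k \<ge> k0 \<Longrightarrow> integrable M (\<lambda>w. K w ^ (2 * k))"
  shows "all_moments M K"
  unfolding all_moments_def
proof (intro conjI allI m ge)
  fix p :: nat
  show "integrable M (\<lambda>w. K w ^ p)"
  proof (rule Bochner_Integration.integrable_bound)
    show "integrable M (\<lambda>w. K w ^ (2 * max k0 p))" by (rule int) simp
    show "(\<lambda>w. K w ^ p) \<in> borel_measurable M" by (rule borel_measurable_power[OF m])
    show "AE w in M. norm (K w ^ p) \<le> norm (K w ^ (2 * max k0 p))"
    proof (rule AE_I2)
      fix w
      have "K w ^ p \<le> K w ^ (2 * max k0 p)" by (intro power_increasing ge) auto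
      moreover have "0 \<le> K w ^ p" using ge[of w] by simp
      ultimately show "norm (K w ^ p) \<le> norm (K w ^ (2 * max k0 p))" by simp
    qed
  qed
qed

lemma (in prob_space) all_moments_mult:
  assumes K: "all_moments M K" and L: "all_moments M L"
  shows "all_moments M (\<lambda>w. K w * L w)"
proof (rule all_moments_of_even[where ?k0.0 = 0])
  have m: "K \<in> borel_measurable M" "L \<in> borel_measurable M" using K L by (auto simp: all_moments_def)
  then show "(\<lambda>w. K w * L w) \<in> borel_measurable M" by (rule borel_measurable_times)
  show "K w * L w \<ge> 1" for w
    using K L mult_mono[of 1 "K w" 1 "L w"] by (auto simp: all_moments_def order_trans[OF zero_le_one])
  fix k
  have "integrable M (\<lambda>w. K w ^ (2 * k) * L w ^ (2 * k))"
    using integrable_power_mixed[OF m, of "2 * k" "2 * k"] K L by (auto simp: all_moments_def)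
  then show "integrable M (\<lambda>w. (K w * L w) ^ (2 * k))" by (simp add: power_mult_distrib)
qed

text \<open>The supremum of \<open>h m n\<close> over all pairs, raised to the power
  \<open>2 * k\<close>, is at most the sum of all \<open>h m n ^ (2 * k)\<close>, and the
  expectation of this sum is at most the sum of \<open>n * c k n\<close>. The supremum does not
  depend on \<open>k\<close>, so a single random variable has all its moments finite.\<close>

lemma (in prob_space) uniform_bound_all_moments:
  fixes h :: "nat \<Rightarrow> nat \<Rightarrow> 'a \<Rightarrow> real" and c :: "nat \<Rightarrow> nat \<Rightarrow> real"
  assumes h: "\<And>m n. h m n \<in> borel_measurable M" and nonneg: "\<And>m n w. h m n w \<ge> 0"
    and int: "\<And>k m n. k \<ge> k0 \<Longrightarrow> m < n \<Longrightarrow> integrable M (\<lambda>w. h m n w ^ (2 * k))"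
    and bound: "\<And>k m n. k \<ge> k0 \<Longrightarrow> m < n \<Longrightarrow> (\<integral>w. h m n w ^ (2 * k) \<partial>M) \<le> c k n"
    and sum: "\<And>k. k \<ge> k0 \<Longrightarrow> summable (\<lambda>n. real n * c k n)" and k0: "k0 \<ge> 1"
  shows "\<exists>K. all_moments M K \<and> (AE w in M. \<forall>m n. m < n \<longrightarrow> h m n w \<le> K w)"
proof -
  define F where "F k n w = (\<Sum>m<n. ennreal (h m n w ^ (2 * k)))" for k n w
  define G where "G w = (SUP n. SUP m\<in>{..<n}. ennreal (h m n w))" for w
  \<comment> \<open>\<open>enn2real\<close> sends an infinite supremum to \<open>0\<close>, so
    \<open>K\<close> is a real number at every point; the bound by \<open>K\<close> is claimed only
    almost everywhere, where the supremum is finite.\<close>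
  define K where "K w = 1 + enn2real (G w)" for w
  have Fm: "F k n \<in> borel_measurable M" for k n
    unfolding F_def[abs_def] by (intro borel_measurable_sum measurable_compose[OF borel_measurable_power[OF h] measurable_ennreal])
  have Gm: "G \<in> borel_measurable M"
    unfolding G_def[abs_def]
    by (intro borel_measurable_SUP measurable_compose[OF h measurable_ennreal]) auto
  have Km: "K \<in> borel_measurable M"
    unfolding K_def[abs_def] by (intro borel_measurable_add borel_measurable_const borel_measurable_enn2real[OF Gm])
  have finF: "(\<integral>\<^sup>+w. (\<Sum>n. F k n w) \<partial>M) < \<infinity>" if k: "k \<ge> k0" for k
  proof -
    have c0: "real n * c k n \<ge> 0" for n
    proof (cases "n = 0")
      case False
      have "0 \<le> (\<integral>w. h 0 n w ^ (2 * k) \<partial>M)"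
        by (intro Bochner_Integration.integral_nonneg) (simp add: zero_le_even_power)
      moreover have "0 < n" using False by simp
      ultimately have "0 \<le> c k n" using bound[OF k, of 0 n] by linarith
      then show ?thesis by simp
    qed simp
    have "(\<integral>\<^sup>+w. (\<Sum>n. F k n w) \<partial>M) = (\<Sum>n. \<integral>\<^sup>+w. F k n w \<partial>M)"
      by (rule nn_integral_suminf[OF Fm])
    also have "\<dots> \<le> (\<Sum>n. ennreal (real n * c k n))"
    proof (rule suminf_le)
      fix n
      have "(\<integral>\<^sup>+w. F k n w \<partial>M) = (\<Sum>m<n. \<integral>\<^sup>+w. ennreal (h m n w ^ (2 * k)) \<partial>M)"
        unfolding F_def by (rule nn_integral_sum) (rule measurable_compose[OF borel_measurable_power[OF h] measurable_ennreal])
      also have "\<dots> \<le> (\<Sum>m<n. ennreal (c k n))"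
      proof (rule sum_mono)
        fix m assume "m \<in> {..<n}"
        then have m: "m < n" by simp
        have "(\<integral>\<^sup>+w. ennreal (h m n w ^ (2 * k)) \<partial>M) = ennreal (\<integral>w. h m n w ^ (2 * k) \<partial>M)"
          by (rule nn_integral_eq_integral[OF int[OF k m]]) (simp add: zero_le_even_power)
        also have "\<dots> \<le> ennreal (c k n)" by (rule ennreal_leI[OF bound[OF k m]])
        finally show "(\<integral>\<^sup>+w. ennreal (h m n w ^ (2 * k)) \<partial>M) \<le> ennreal (c k n)" .
      qed
      also have "\<dots> = ennreal (real n * c k n)" by (simp add: ennreal_mult' ennreal_of_nat_eq_real_of_nat)
      finally show "(\<integral>\<^sup>+w. F k n w \<partial>M) \<le> ennreal (real n * c k n)" .
    qed simp_all
    also have "\<dots> = ennreal (\<Sum>n. real n * c k n)"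
      by (rule suminf_ennreal2[OF c0 sum[OF k]])
    also have "\<dots> < \<infinity>" by simp
    finally show ?thesis .
  qed
  have hG: "ennreal (h m n w) \<le> G w" if "m < n" for m n w
    unfolding G_def by (rule SUP_upper2[of n], simp, rule SUP_upper) (use that in simp)
  have pt: "ennreal (enn2real (G w) ^ (2 * k)) \<le> (\<Sum>n. F k n w)" and ptfin: "(\<Sum>n. F k n w) < \<infinity> \<Longrightarrow> G w < \<infinity>"
    if k: "k \<ge> k0" for k w
  proof -
    have main: "G w \<le> ennreal (root (2 * k) s) \<and> enn2real (G w) ^ (2 * k) \<le> s"
      if s: "(\<Sum>n. F k n w) = ennreal s" "s \<ge> 0" for s
    proof -
      have kp: "2 * k > 0" using k k0 by simp
      have "h m n w \<le> root (2 * k) s" if mn: "m < n" for m n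
      proof -
        have "ennreal (h m n w ^ (2 * k)) \<le> F k n w"
          unfolding F_def using mn by (intro member_le_sum[of m "{..<n}" "\<lambda>m. ennreal (h m n w ^ (2 * k))"]) auto
        also have "\<dots> \<le> (\<Sum>n. F k n w)"
          using sum_le_suminf[of "\<lambda>n. F k n w" "{n}"] by simp
        finally have "h m n w ^ (2 * k) \<le> s" using s by (simp add: ennreal_le_iff)
        then have "root (2 * k) (h m n w ^ (2 * k)) \<le> root (2 * k) s"
          using kp by (simp only: real_root_le_iff)
        then show ?thesis using kp nonneg by (simp add: real_root_power_cancel)
      qed
      then have G: "G w \<le> ennreal (root (2 * k) s)"
        unfolding G_def by (intro SUP_least ennreal_leI) simp
      have r0: "root (2 * k) s \<ge> 0" by (rule real_root_ge_zero[OF s(2)])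
      have "enn2real (G w) \<le> root (2 * k) s"
        using G r0 by (rule enn2real_leI[rotated])
      then have "enn2real (G w) ^ (2 * k) \<le> root (2 * k) s ^ (2 * k)"
        by (intro power_mono) auto
      also have "\<dots> = s" using kp s by (intro real_root_pow_pos2) auto
      finally show ?thesis using G by simp
    qed
    show "ennreal (enn2real (G w) ^ (2 * k)) \<le> (\<Sum>n. F k n w)"
    proof (cases "(\<Sum>n. F k n w)" rule: ennreal_cases)
      case (real s)
      then show ?thesis using main[of s] by (simp add: ennreal_leI)
    qed simp
    show "G w < \<infinity>" if "(\<Sum>n. F k n w) < \<infinity>"
    proof (cases "(\<Sum>n. F k n w)" rule: ennreal_cases)
      case (real s)
      then show ?thesis using main[of s] by (auto intro: le_less_trans)
    qed (use that in simp)
  qed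
  have "all_moments M K"
  proof (rule all_moments_of_even[OF Km])
    show "K w \<ge> 1" for w by (simp add: K_def)
    fix k assume k: "k \<ge> k0"
    then have k1: "k \<ge> 1" using k0 by simp
    have gi: "integrable M (\<lambda>w. enn2real (G w) ^ (2 * k))"
    proof (rule integrableI_nonneg)
      show "(\<lambda>w. enn2real (G w) ^ (2 * k)) \<in> borel_measurable M"
        by (intro borel_measurable_power borel_measurable_enn2real[OF Gm])
      show "(\<integral>\<^sup>+w. ennreal (enn2real (G w) ^ (2 * k)) \<partial>M) < \<infinity>"
        by (rule le_less_trans[OF nn_integral_mono[OF pt[OF k]] finF[OF k]])
    qed (simp add: zero_le_even_power)
    show "integrable M (\<lambda>w. K w ^ (2 * k))"
      unfolding K_def
      by (rule integrable_power_add(1)[OF k1 _ borel_measurable_enn2real[OF Gm] _ gi]) simp_all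
  qed
  moreover have "AE w in M. \<forall>m n. m < n \<longrightarrow> h m n w \<le> K w"
  proof -
    have "(\<integral>\<^sup>+w. (\<Sum>n. F k0 n w) \<partial>M) \<noteq> \<infinity>" using finF[of k0] by simp
    then have "AE w in M. (\<Sum>n. F k0 n w) \<noteq> \<infinity>"
      by (intro nn_integral_PInf_AE borel_measurable_suminf_order Fm) auto
    then show ?thesis
    proof eventually_elim
      case (elim w)
      then have "(\<Sum>n. F k0 n w) < \<infinity>" by (simp add: top.not_eq_extremum)
      then have fin: "G w < \<infinity>" by (rule ptfin[OF order_refl])
      show ?case
      proof (intro allI impI)
        fix m n :: nat assume "m < n"
        from hG[OF this, of w] fin have "enn2real (ennreal (h m n w)) \<le> enn2real (G w)"
          by (intro enn2real_mono) auto
        then show "h m n w \<le> K w" using nonneg by (simp add: K_def)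
      qed
    qed
  qed
  ultimately show ?thesis by blast
qed

context iid_sequence
begin

text \<open>The normalization \<open>q\<close> divides out the order found in
  \<open>ustat_moment\<close> and a further \<open>(1 + real n) powr e\<close>. The moments of order
  \<open>2 * k\<close> of the quotient then decay like
  \<open>(1 + real n) powr (- (2 * e * k))\<close>, which for large \<open>k\<close> outweighs the
  number of pairs.\<close>

theorem uniform_increment_bound:
  assumes g: "g \<in> borel_measurable (kernel_space d)"
    and int: "\<And>k. k \<ge> 1 \<Longrightarrow> integrable (kernel_space d) (\<lambda>t. g t ^ (2 * k))"
    and mean: "(\<integral>t. g t \<partial>kernel_space d) = 0" and e: "e > 0"
  shows "\<exists>K. all_moments S K \<and> (AE w in S. \<forall>m n. m \<le> n \<longrightarrow>
    \<bar>ustat d g n w - ustat d g m w\<bar> \<le> K w * sqrt (real (n - m)) * ((1 + real n) ^ (d - 1) * (1 + real n) powr e))"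
proof -
  \<comment> \<open>For \<open>k \<ge> k1 + 1\<close> one has \<open>e * k > 1\<close>, which makes
    \<open>real n powr (1 - 2 * e * k)\<close> summable.\<close>
  obtain k1 :: nat where k1: "real k1 > 1 / e" using reals_Archimedean2 by blast
  define k0 where "k0 = k1 + 1"
  define q where "q m n = sqrt (real (n - m)) * ((1 + real n) ^ (d - 1) * (1 + real n) powr e)" for m n
  have q0: "q m n > 0" if "m < n" for m n using that by (simp add: q_def)
  define h where "h m n w = \<bar>ustat d g n w - ustat d g m w\<bar> / q m n" for m n w
  have dm: "(\<lambda>w. ustat d g n w - ustat d g m w) \<in> borel_measurable S" for m n
    by (rule borel_measurable_diff[OF measurable_ustat[OF g] measurable_ustat[OF g]])
  have di: "integrable S (\<lambda>w. (ustat d g n w - ustat d g m w) ^ (2 * k))" if "k \<ge> 1" for k m n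
    by (rule integrable_power_add(2)[OF that measurable_ustat[OF g] measurable_ustat[OF g]
          integrable_ustat_power[OF that g int[OF that]] integrable_ustat_power[OF that g int[OF that]]])
  have hp: "h m n w ^ (2 * k) = (ustat d g n w - ustat d g m w) ^ (2 * k) / q m n ^ (2 * k)" for k m n w
    by (simp add: h_def power_divide power_even_abs)
  have qp: "q m n ^ (2 * k) = real (n - m) ^ k * (1 + real n) ^ (2 * k * (d - 1)) * (1 + real n) powr (e * real (2 * k))"
    for k m n
  proof -
    have "sqrt (real (n - m)) ^ (2 * k) = real (n - m) ^ k" by (simp add: power_mult)
    moreover have "((1 + real n) ^ (d - 1)) ^ (2 * k) = (1 + real n) ^ (2 * k * (d - 1))"
      by (simp add: mult.commute flip: power_mult)
    moreover have "((1 + real n) powr e) ^ (2 * k) = (1 + real n) powr (e * real (2 * k))"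
      by (simp add: powr_realpow[symmetric] powr_powr)
    ultimately show ?thesis by (simp only: q_def power_mult_distrib mult.assoc)
  qed
  have "\<exists>C\<ge>0. \<forall>m n. m \<le> n \<longrightarrow> (\<integral>w. (ustat d g n w - ustat d g m w) ^ (2 * k) \<partial>S)
      \<le> C * real (n - m) ^ k * real n ^ (2 * k * (d - 1))" if k: "k \<ge> 1" for k
  proof -
    from ustat_moment[OF k, of d] obtain C where C: "C \<ge> 0" and
      le: "\<And>m n. m \<le> n \<Longrightarrow> (\<integral>w. (ustat d g n w - ustat d g m w) ^ (2 * k) \<partial>S)
        \<le> C * real (n - m) ^ k * real n ^ (2 * k * (d - 1)) * (\<integral>t. g t ^ (2 * k) \<partial>kernel_space d)"
      using g int[OF k] mean by blast
    have "0 \<le> (\<integral>t. g t ^ (2 * k) \<partial>kernel_space d)"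
      by (intro Bochner_Integration.integral_nonneg) (simp add: zero_le_even_power)
    then show ?thesis using C le
      by (intro exI[of _ "C * (\<integral>t. g t ^ (2 * k) \<partial>kernel_space d)"]) (auto simp: mult_ac)
  qed
  then have "\<forall>k. \<exists>C. k \<ge> 1 \<longrightarrow> C \<ge> 0 \<and> (\<forall>m n. m \<le> n \<longrightarrow> (\<integral>w. (ustat d g n w - ustat d g m w) ^ (2 * k) \<partial>S)
      \<le> C * real (n - m) ^ k * real n ^ (2 * k * (d - 1)))" by blast
  from choice[OF this] obtain C where CC: "\<forall>k. k \<ge> 1 \<longrightarrow> C k \<ge> 0 \<and> (\<forall>m n. m \<le> n \<longrightarrow>
      (\<integral>w. (ustat d g n w - ustat d g m w) ^ (2 * k) \<partial>S) \<le> C k * real (n - m) ^ k * real n ^ (2 * k * (d - 1)))" ..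
  have C: "\<And>k. k \<ge> 1 \<Longrightarrow> C k \<ge> 0" and mom: "\<And>k m n. k \<ge> 1 \<Longrightarrow> m \<le> n \<Longrightarrow>
      (\<integral>w. (ustat d g n w - ustat d g m w) ^ (2 * k) \<partial>S) \<le> C k * real (n - m) ^ k * real n ^ (2 * k * (d - 1))"
    using CC by blast+
  have "\<exists>K. all_moments S K \<and> (AE w in S. \<forall>m n. m < n \<longrightarrow> h m n w \<le> K w)"
  proof (rule P.uniform_bound_all_moments[where c = "\<lambda>k n. C k * (1 + real n) powr (- (e * real (2 * k)))" and ?k0.0 = k0])
    show "h m n \<in> borel_measurable S" for m n
      unfolding h_def[abs_def] by (rule borel_measurable_divide[OF borel_measurable_abs[OF dm] borel_measurable_const])
    show "h m n w \<ge> 0" for m n w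
      by (simp add: h_def q_def)
    show "1 \<le> k0" by (simp add: k0_def)
    fix k assume "k \<ge> k0"
    then have k: "k \<ge> 1" and kk: "real k \<ge> real k1 + 1" by (auto simp: k0_def)
    show "integrable S (\<lambda>w. h m n w ^ (2 * k))" for m n
      unfolding hp by (rule integrable_divide) (rule di[OF k])
    show "(\<integral>w. h m n w ^ (2 * k) \<partial>S) \<le> C k * (1 + real n) powr (- (e * real (2 * k)))" if mn: "m < n" for m n
    proof -
      have "(\<integral>w. h m n w ^ (2 * k) \<partial>S) = (\<integral>w. (ustat d g n w - ustat d g m w) ^ (2 * k) \<partial>S) / q m n ^ (2 * k)"
        unfolding hp by simp
      also have "\<dots> \<le> (C k * real (n - m) ^ k * real n ^ (2 * k * (d - 1))) / q m n ^ (2 * k)"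
        using mom[OF k, of m n] mn q0[OF mn] by (intro divide_right_mono) auto
      also have "\<dots> \<le> (C k * real (n - m) ^ k * (1 + real n) ^ (2 * k * (d - 1))) / q m n ^ (2 * k)"
        using C[OF k] q0[OF mn] by (intro divide_right_mono mult_left_mono power_mono) auto
      also have "\<dots> = C k * (1 + real n) powr (- (e * real (2 * k)))"
        unfolding qp using mn by (simp add: powr_minus field_simps)
      finally show ?thesis .
    qed
    show "summable (\<lambda>n. real n * (C k * (1 + real n) powr (- (e * real (2 * k)))))"
    proof (rule summable_comparison_test')
      have "1 < e * real k1" using k1 e by (simp add: field_simps)
      moreover have "e * real k \<ge> e * (real k1 + 1)" using kk e by (intro mult_left_mono) auto
      ultimately have "1 - e * real (2 * k) < - 1" using e by (simp add: algebra_simps)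
      then have "summable (\<lambda>n. real n powr (1 - e * real (2 * k)))" by (simp add: summable_real_powr_iff)
      then have "summable (\<lambda>n. real (Suc n) powr (1 - e * real (2 * k)))" by (subst summable_Suc_iff)
      then show "summable (\<lambda>n. C k * real (Suc n) powr (1 - e * real (2 * k)))" by (rule summable_mult)
      fix n :: nat
      have "real n * (1 + real n) powr (- (e * real (2 * k))) \<le> (1 + real n) powr 1 * (1 + real n) powr (- (e * real (2 * k)))"
        by (intro mult_right_mono) auto
      also have "\<dots> = real (Suc n) powr (1 - e * real (2 * k))"
        by (simp only: powr_add[symmetric] of_nat_Suc add.commute[of 1] diff_conv_add_uminus)
      finally have "C k * (real n * (1 + real n) powr (- (e * real (2 * k)))) \<le> C k * real (Suc n) powr (1 - e * real (2 * k))"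
        using C[OF k] by (intro mult_left_mono) auto
      then show "norm (real n * (C k * (1 + real n) powr (- (e * real (2 * k))))) \<le> C k * real (Suc n) powr (1 - e * real (2 * k))"
        using C[OF k] by (simp add: mult_ac)
    qed
  qed
  then obtain K where K: "all_moments S K" and AE: "AE w in S. \<forall>m n. m < n \<longrightarrow> h m n w \<le> K w" by blast
  have "AE w in S. \<forall>m n. m \<le> n \<longrightarrow>
    \<bar>ustat d g n w - ustat d g m w\<bar> \<le> K w * sqrt (real (n - m)) * ((1 + real n) ^ (d - 1) * (1 + real n) powr e)"
    using AE
  proof eventually_elim
    case (elim w)
    show ?case
    proof (intro allI impI)
      fix m n :: nat assume "m \<le> n"
      show "\<bar>ustat d g n w - ustat d g m w\<bar> \<le> K w * sqrt (real (n - m)) * ((1 + real n) ^ (d - 1) * (1 + real n) powr e)"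
      proof (cases "m = n")
        case False
        then have mn: "m < n" using \<open>m \<le> n\<close> by simp
        then have "h m n w \<le> K w" using elim by blast
        then have "\<bar>ustat d g n w - ustat d g m w\<bar> \<le> K w * q m n"
          using q0[OF mn] by (simp add: h_def field_simps)
        then show ?thesis by (simp add: q_def mult.assoc)
      qed simp
    qed
  qed
  then show ?thesis using K by blast
qed

end

section \<open>Approximation at a deterministic time\<close>

text \<open>The gap \<open>x powr (3/4)\<close> dominates the fluctuations of the random walk, which are of order
  \<open>x powr (9/16)\<close> at most, and is negligible in the limit law.\<close>

definition early_time :: "real \<Rightarrow> real \<Rightarrow> nat" where
  "early_time \<mu> x = nat \<lfloor>(x - x powr (3 / 4)) / \<mu>\<rfloor>"

lemma early_time_bounds:
  assumes mu: "\<mu> > 0" and x: "x \<ge> 1"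
  shows "real (early_time \<mu> x) \<le> (x - x powr (3 / 4)) / \<mu>" "(x - x powr (3 / 4)) / \<mu> < real (early_time \<mu> x) + 1"
proof -
  \<comment> \<open>Here \<open>x \<ge> 1\<close> enters: it makes the argument of
    \<open>nat\<close> nonnegative, so that nothing is truncated.\<close>
  have "x powr (3 / 4) \<le> x powr 1" using x by (intro powr_mono) auto
  then have "(x - x powr (3 / 4)) / \<mu> \<ge> 0" using x mu by simp
  then show "real (early_time \<mu> x) \<le> (x - x powr (3 / 4)) / \<mu>" "(x - x powr (3 / 4)) / \<mu> < real (early_time \<mu> x) + 1"
    unfolding early_time_def by linarith+
qed

text \<open>\<open>F\<close> is of order \<open>x powr a\<close>, up to a power of the random constant \<open>K\<close>.\<close>

definition poly_bounded :: "'w set \<Rightarrow> ('w \<Rightarrow> real) \<Rightarrow> real \<Rightarrow> (real \<Rightarrow> 'w \<Rightarrow> real) \<Rightarrow> bool" where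
  "poly_bounded A K a F \<longleftrightarrow> (\<exists>C\<ge>0. \<exists>B::nat. \<forall>x\<ge>1. \<forall>w\<in>A. \<bar>F x w\<bar> \<le> C * K w ^ B * x powr a)"

section \<open>A calculus of orders in \<open>x\<close>, up to powers of the random constant\<close>

context
  fixes A :: "'w set" and K :: "'w \<Rightarrow> real"
  assumes K: "\<And>w. K w \<ge> 1"
begin

abbreviation "pb \<equiv> poly_bounded A K"

lemma pbI: "C \<ge> 0 \<Longrightarrow> (\<And>x w. x \<ge> 1 \<Longrightarrow> w \<in> A \<Longrightarrow> \<bar>F x w\<bar> \<le> C * K w ^ B * x powr a) \<Longrightarrow> pb a F"
  unfolding poly_bounded_def by blast

lemma pb_le:
  assumes "pb a G" "\<And>x w. x \<ge> 1 \<Longrightarrow> w \<in> A \<Longrightarrow> \<bar>F x w\<bar> \<le> \<bar>G x w\<bar>"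
  shows "pb a F"
proof -
  obtain C B where CB: "C \<ge> 0" "\<And>x w. x \<ge> 1 \<Longrightarrow> w \<in> A \<Longrightarrow> \<bar>G x w\<bar> \<le> C * K w ^ B * x powr a"
    using assms(1) unfolding poly_bounded_def by blast
  show ?thesis by (rule pbI[OF CB(1)]) (rule order_trans[OF assms(2) CB(2)])
qed

lemma K_power_mono: "B \<le> B' \<Longrightarrow> K w ^ B \<le> K w ^ B'"
  using K[of w] by (rule power_increasing[rotated])

lemma K_power_ge_0: "K w ^ B \<ge> 0"
  using K[of w] by simp

lemma pb_mono:
  assumes "pb a F" "a \<le> b"
  shows "pb b F"
proof -
  obtain C B where CB: "C \<ge> 0" "\<And>x w. x \<ge> 1 \<Longrightarrow> w \<in> A \<Longrightarrow> \<bar>F x w\<bar> \<le> C * K w ^ B * x powr a"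
    using assms(1) unfolding poly_bounded_def by blast
  show ?thesis
  proof (rule pbI[OF CB(1)])
    fix x :: real and w assume x: "x \<ge> 1" and w: "w \<in> A"
    have "C * K w ^ B * x powr a \<le> C * K w ^ B * x powr b"
      using CB(1) K_power_ge_0[of w B] x assms(2) by (intro mult_left_mono powr_mono) auto
    then show "\<bar>F x w\<bar> \<le> C * K w ^ B * x powr b" using CB(2)[OF x w] by linarith
  qed
qed

lemma pb_mult:
  assumes "pb a F" "pb b G"
  shows "pb (a + b) (\<lambda>x w. F x w * G x w)"
proof -
  obtain C B where CB: "C \<ge> 0" "\<And>x w. x \<ge> 1 \<Longrightarrow> w \<in> A \<Longrightarrow> \<bar>F x w\<bar> \<le> C * K w ^ B * x powr a"
    using assms(1) unfolding poly_bounded_def by blast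
  obtain C' B' where CB': "C' \<ge> 0" "\<And>x w. x \<ge> 1 \<Longrightarrow> w \<in> A \<Longrightarrow> \<bar>G x w\<bar> \<le> C' * K w ^ B' * x powr b"
    using assms(2) unfolding poly_bounded_def by blast
  show ?thesis
  proof (rule pbI[where C = "C * C'" and B = "B + B'"])
    show "0 \<le> C * C'" using CB(1) CB'(1) by simp
    fix x :: real and w assume x: "x \<ge> 1" and w: "w \<in> A"
    have "\<bar>F x w * G x w\<bar> \<le> (C * K w ^ B * x powr a) * (C' * K w ^ B' * x powr b)"
      unfolding abs_mult using CB(1) K_power_ge_0[of w B]
      by (intro mult_mono CB(2)[OF x w] CB'(2)[OF x w]) auto
    then show "\<bar>F x w * G x w\<bar> \<le> C * C' * K w ^ (B + B') * x powr (a + b)"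
      by (simp add: powr_add power_add mult_ac)
  qed
qed

lemma pb_add:
  assumes "pb a F" "pb a G"
  shows "pb a (\<lambda>x w. F x w + G x w)"
proof -
  obtain C B where CB: "C \<ge> 0" "\<And>x w. x \<ge> 1 \<Longrightarrow> w \<in> A \<Longrightarrow> \<bar>F x w\<bar> \<le> C * K w ^ B * x powr a"
    using assms(1) unfolding poly_bounded_def by blast
  obtain C' B' where CB': "C' \<ge> 0" "\<And>x w. x \<ge> 1 \<Longrightarrow> w \<in> A \<Longrightarrow> \<bar>G x w\<bar> \<le> C' * K w ^ B' * x powr a"
    using assms(2) unfolding poly_bounded_def by blast
  show ?thesis
  proof (rule pbI[where C = "C + C'" and B = "B + B'"])
    show "0 \<le> C + C'" using CB(1) CB'(1) by simp
    fix x :: real and w assume x: "x \<ge> 1" and w: "w \<in> A"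
    have "C * K w ^ B * x powr a \<le> C * K w ^ (B + B') * x powr a"
      using CB(1) by (intro mult_right_mono mult_left_mono K_power_mono) auto
    moreover have "C' * K w ^ B' * x powr a \<le> C' * K w ^ (B + B') * x powr a"
      using CB'(1) by (intro mult_right_mono mult_left_mono K_power_mono) auto
    moreover have "\<bar>F x w + G x w\<bar> \<le> \<bar>F x w\<bar> + \<bar>G x w\<bar>" by simp
    ultimately show "\<bar>F x w + G x w\<bar> \<le> (C + C') * K w ^ (B + B') * x powr a"
      using CB(2)[OF x w] CB'(2)[OF x w] by (simp add: distrib_right)
  qed
qed

lemma pb_uminus: "pb a F \<Longrightarrow> pb a (\<lambda>x w. - F x w)"
  by (erule pb_le) simp

lemma pb_diff: "pb a F \<Longrightarrow> pb a G \<Longrightarrow> pb a (\<lambda>x w. F x w - G x w)"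
  using pb_add[OF _ pb_uminus] by fastforce

lemma pb_const: "pb 0 (\<lambda>x w. c)"
  by (rule pbI[where C = "\<bar>c\<bar>" and B = 0]) auto

lemma pb_cmult: "pb a F \<Longrightarrow> pb a (\<lambda>x w. c * F x w)"
  using pb_mult[OF pb_const, of a F c] by simp

lemma pb_K: "pb 0 (\<lambda>x w. K w)"
proof (rule pbI[where C = 1 and B = 1])
  fix x :: real and w assume "x \<ge> 1"
  then show "\<bar>K w\<bar> \<le> 1 * K w ^ 1 * x powr 0" using K[of w] by simp
qed simp

lemma pb_powr_x: "pb a (\<lambda>x w. x powr a)"
  by (rule pbI[where C = 1 and B = 0]) auto

lemma pb_x: "pb 1 (\<lambda>x w. x)"
  by (rule pb_le[OF pb_powr_x]) simp

lemma pb_powr: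
  assumes "pb a F" and r: "r \<ge> 0"
  shows "pb (a * r) (\<lambda>x w. \<bar>F x w\<bar> powr r)"
proof -
  obtain C B where CB: "C \<ge> 0" "\<And>x w. x \<ge> 1 \<Longrightarrow> w \<in> A \<Longrightarrow> \<bar>F x w\<bar> \<le> C * K w ^ B * x powr a"
    using assms(1) unfolding poly_bounded_def by blast
  show ?thesis
  proof (rule pbI[where C = "C powr r" and B = "nat \<lceil>real B * r\<rceil>"])
    fix x :: real and w assume x: "x \<ge> 1" and w: "w \<in> A"
    have "\<bar>F x w\<bar> powr r \<le> (C * K w ^ B * x powr a) powr r"
      by (intro powr_mono2 r CB(2)[OF x w]) auto
    also have "\<dots> = C powr r * (K w ^ B) powr r * x powr (a * r)"
      using CB(1) K_power_ge_0[of w B] by (simp add: powr_mult powr_powr)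
    also have "(K w ^ B) powr r = K w powr (real B * r)"
      using K[of w] by (simp add: powr_realpow[symmetric] powr_powr)
    also have "\<dots> \<le> K w powr real (nat \<lceil>real B * r\<rceil>)"
      using K[of w] by (intro powr_mono) linarith+
    also have "\<dots> = K w ^ nat \<lceil>real B * r\<rceil>" using K[of w] by (intro powr_realpow) linarith
    finally show "\<bar>\<bar>F x w\<bar> powr r\<bar> \<le> C powr r * K w ^ nat \<lceil>real B * r\<rceil> * x powr (a * r)"
      by (simp add: mult_left_mono mult_right_mono)
  qed simp
qed

lemma pb_power:
  assumes "pb a F"
  shows "pb (a * real n) (\<lambda>x w. F x w ^ n)"
proof (induction n)
  case 0
  show ?case using pb_const[of 1] by simp
next
  case (Suc n)
  have "pb (a + a * real n) (\<lambda>x w. F x w * F x w ^ n)" by (rule pb_mult[OF assms Suc])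
  then show ?case by (simp add: algebra_simps)
qed

text \<open>The falling factorial is \<open>fact k\<close> times the number of terms of a
  U-statistic of degree \<open>k\<close>. Each new factor differs from \<tau> by a constant only,
  which costs one order less than the product.\<close>

lemma pb_falling:
  fixes \<tau> :: "real \<Rightarrow> 'w \<Rightarrow> nat"
  assumes pb_real_tau: "pb 1 (\<lambda>x w. real (\<tau> x w))"
  shows "pb (real k) (\<lambda>x w. \<Prod>i<k. real (\<tau> x w) - real i)"
    and "pb (real k - 1) (\<lambda>x w. (\<Prod>i<k. real (\<tau> x w) - real i) - real (\<tau> x w) ^ k)"
proof -
  show P: "pb (real k) (\<lambda>x w. \<Prod>i<k. real (\<tau> x w) - real i)" for k
  proof (induction k)
    case 0
    show ?case using pb_const[of 1] by simp
  next
    case (Suc k)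
    have "pb (real k + 1) (\<lambda>x w. (\<Prod>i<k. real (\<tau> x w) - real i) * (real (\<tau> x w) - real k))"
      by (rule pb_mult[OF Suc pb_diff[OF pb_real_tau pb_mono[OF pb_const]]]) simp
    then show ?case by (simp add: add.commute)
  qed
  show "pb (real k - 1) (\<lambda>x w. (\<Prod>i<k. real (\<tau> x w) - real i) - real (\<tau> x w) ^ k)"
  proof (induction k)
    case 0
    show ?case by (rule pbI[where C = 0]) auto
  next
    case (Suc k)
    have "pb ((real k - 1) + 1) (\<lambda>x w. ((\<Prod>i<k. real (\<tau> x w) - real i) - real (\<tau> x w) ^ k) * real (\<tau> x w))"
      by (rule pb_mult[OF Suc pb_real_tau])
    from pb_diff[OF this, of "\<lambda>x w. real k * (\<Prod>i<k. real (\<tau> x w) - real i)"] pb_cmult[OF P[of k], of "real k"]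
    show ?case by (simp add: algebra_simps)
  qed
qed

section \<open>The centred processes at the renewal time and at the early time\<close>

context
  fixes \<mu> c1 :: real and d :: nat and T Z :: "nat \<Rightarrow> 'w \<Rightarrow> real" and \<tau> :: "real \<Rightarrow> 'w \<Rightarrow> nat"
  assumes mu: "\<mu> > 0" and d: "d \<ge> 1" and T0: "\<And>w. T 0 w = 0"
    and T: "\<And>w m n. w \<in> A \<Longrightarrow> m \<le> n \<Longrightarrow>
      \<bar>T n w - T m w\<bar> \<le> K w * sqrt (real (n - m)) * (1 + real n) powr (1 / 16)"
    and Z: "\<And>w m n. w \<in> A \<Longrightarrow> m \<le> n \<Longrightarrow>
      \<bar>Z n w - Z m w\<bar> \<le> K w * sqrt (real (n - m)) * ((1 + real n) ^ (d - 1) * (1 + real n) powr (1 / 16))"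
    and tau: "\<And>w x. w \<in> A \<Longrightarrow> x \<ge> 1 \<Longrightarrow>
      \<bar>\<mu> * real (\<tau> x w) + T (\<tau> x w) w - x\<bar> \<le> \<mu> + K w * (2 + real (\<tau> x w)) powr (1 / 16)"
begin

text \<open>The times to be compared need not be ordered the same way on every path, so the
  increment bounds are brought into a form symmetric in \<open>m\<close> and
  \<open>n\<close>.\<close>

lemma T_Z_sym:
  assumes w: "w \<in> A"
  shows "\<bar>T n w - T m w\<bar> \<le> K w * \<bar>real n - real m\<bar> powr (1 / 2) * (1 + real n + real m) powr (1 / 16)"
    and "\<bar>Z n w - Z m w\<bar> \<le> K w * \<bar>real n - real m\<bar> powr (1 / 2) *
      ((1 + real n + real m) ^ (d - 1) * (1 + real n + real m) powr (1 / 16))"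
proof -
  have *: "\<bar>T n w - T m w\<bar> \<le> K w * \<bar>real n - real m\<bar> powr (1 / 2) * (1 + real n + real m) powr (1 / 16) \<and>
    \<bar>Z n w - Z m w\<bar> \<le> K w * \<bar>real n - real m\<bar> powr (1 / 2) *
      ((1 + real n + real m) ^ (d - 1) * (1 + real n + real m) powr (1 / 16))" if mn: "m \<le> n" for m n
  proof -
    have s: "sqrt (real (n - m)) = \<bar>real n - real m\<bar> powr (1 / 2)"
      using mn by (simp add: powr_half_sqrt of_nat_diff)
    have p: "(1 + real n) powr (1 / 16) \<le> (1 + real n + real m) powr (1 / 16)"
      by (intro powr_mono2) auto
    have q: "(1 + real n) ^ (d - 1) \<le> (1 + real n + real m) ^ (d - 1)"
      by (intro power_mono) auto
    have k: "0 \<le> K w * \<bar>real n - real m\<bar> powr (1 / 2)" using K[of w] by simp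
    show ?thesis
      using order_trans[OF T[OF w mn, unfolded s] mult_left_mono[OF p k]]
        order_trans[OF Z[OF w mn, unfolded s] mult_left_mono[OF mult_mono[OF q p] k]] by simp
  qed
  show "\<bar>T n w - T m w\<bar> \<le> K w * \<bar>real n - real m\<bar> powr (1 / 2) * (1 + real n + real m) powr (1 / 16)"
    "\<bar>Z n w - Z m w\<bar> \<le> K w * \<bar>real n - real m\<bar> powr (1 / 2) *
      ((1 + real n + real m) ^ (d - 1) * (1 + real n + real m) powr (1 / 16))"
    using *[of m n] *[of n m]
    by (cases "m \<le> n"; simp add: abs_minus_commute add.commute add.left_commute)+
qed

text \<open>The exponent \<open>9 / 16 = 1 / 2 + 1 / 16\<close> is that of the centred walk. The
  right-hand side still contains \<tau>, which is only controlled in \<open>pb_tau\<close>.\<close>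

lemma tau_deviation:
  assumes w: "w \<in> A" and x: "x \<ge> 1"
  shows "\<bar>\<mu> * real (\<tau> x w) - x\<bar> \<le> (2 + \<mu>) * K w * (2 + real (\<tau> x w)) powr (9 / 16)"
proof -
  define s where "s = 2 + real (\<tau> x w)"
  have s: "s \<ge> 1" by (simp add: s_def)
  have K0: "K w \<ge> 0" "K w \<ge> 1" using K[of w] by auto
  have "\<bar>T (\<tau> x w) w\<bar> \<le> K w * real (\<tau> x w) powr (1 / 2) * (1 + real (\<tau> x w)) powr (1 / 16)"
    using T_Z_sym(1)[OF w, of "\<tau> x w" 0] by (simp add: T0)
  also have "\<dots> \<le> K w * s powr (1 / 2) * s powr (1 / 16)"
    using K0 by (intro mult_mono mult_left_mono powr_mono2) (auto simp: s_def)
  also have "\<dots> = K w * s powr (9 / 16)" by (simp add: mult.assoc flip: powr_add)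
  finally have 1: "\<bar>T (\<tau> x w) w\<bar> \<le> K w * s powr (9 / 16)" .
  have "s powr (1 / 16) \<le> s powr (9 / 16)" using s by (intro powr_mono) auto
  then have 2: "K w * s powr (1 / 16) \<le> K w * s powr (9 / 16)" using K0 by (intro mult_left_mono)
  have "1 \<le> s powr (9 / 16)" using s by (simp add: ge_one_powr_ge_zero)
  then have "1 * 1 \<le> K w * s powr (9 / 16)" using K0 by (intro mult_mono) auto
  then have 3: "\<mu> \<le> \<mu> * (K w * s powr (9 / 16))" using mu by simp
  have "\<bar>\<mu> * real (\<tau> x w) - x\<bar> \<le> \<bar>T (\<tau> x w) w\<bar> + (\<mu> + K w * s powr (1 / 16))"
    using tau[OF w x] unfolding s_def by linarith
  also have "\<dots> \<le> 2 * (K w * s powr (9 / 16)) + \<mu> * (K w * s powr (9 / 16))" using 1 2 3 by linarith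
  finally show ?thesis by (simp add: s_def algebra_simps)
qed

text \<open>A bootstrap for \<open>s = 2 + \<tau>\<close>. Either the fluctuation is at most half of
  the drift \<open>\<mu> * s\<close>, and then \<open>s\<close> is of order \<open>x\<close>; or
  \<open>s powr (7 / 16)\<close> is at most a multiple of \<open>K\<close>, and then
  \<open>s\<close> is at most a power of \<open>K\<close> alone. The cube is the first natural power
  above \<open>16 / 7\<close>.\<close>

lemma pb_tau: "pb 1 (\<lambda>x w. 2 + real (\<tau> x w))"
proof -
  define c where "c = 1 + 2 * (2 + \<mu>) / \<mu>"
  have c: "c \<ge> 1" using mu by (simp add: c_def)
  show ?thesis
  proof (rule pb_le)
    show "pb 1 (\<lambda>x w. (2 / \<mu> + 4) * x + c ^ 3 * K w ^ 3)"
    proof (rule pb_add)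
      show "pb 1 (\<lambda>x w. (2 / \<mu> + 4) * x)" by (rule pb_cmult[OF pb_x])
      have "pb 0 (\<lambda>x w. c ^ 3 * K w ^ 3)" using pb_cmult[OF pb_power[OF pb_K, of 3]] by simp
      then show "pb 1 (\<lambda>x w. c ^ 3 * K w ^ 3)" by (rule pb_mono) simp
    qed
    fix x :: real and w assume x: "x \<ge> 1" and w: "w \<in> A"
    define s where "s = 2 + real (\<tau> x w)"
    define q where "q = s powr (9 / 16)"
    have s: "s \<ge> 1" by (simp add: s_def)
    have q: "q > 0" using s by (simp add: q_def)
    have dev: "\<mu> * s \<le> x + 2 * \<mu> + (2 + \<mu>) * K w * q"
      using tau_deviation[OF w x] unfolding s_def q_def by (simp add: algebra_simps)
    have "s \<le> (2 / \<mu> + 4) * x + c ^ 3 * K w ^ 3"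
    proof (cases "(2 + \<mu>) * K w * q \<le> \<mu> * s / 2")
      case True
      then have "\<mu> * s \<le> 2 * x + 4 * \<mu>" using dev by linarith
      then have "s \<le> 2 / \<mu> * x + 4" using mu by (simp add: field_simps)
      also have "\<dots> \<le> (2 / \<mu> + 4) * x" using x mu by (simp add: algebra_simps)
      also have "\<dots> \<le> (2 / \<mu> + 4) * x + c ^ 3 * K w ^ 3" using c K[of w] by simp
      finally show ?thesis .
    next
      case False
      have sq: "s = q * s powr (7 / 16)" using s by (simp add: q_def flip: powr_add)
      have "\<mu> * (q * s powr (7 / 16)) / 2 < (2 + \<mu>) * K w * q" using False sq by simp
      then have "q * (\<mu> * s powr (7 / 16)) < q * (2 * (2 + \<mu>) * K w)" by (simp add: algebra_simps)
      then have "\<mu> * s powr (7 / 16) < 2 * (2 + \<mu>) * K w" using q by (simp only: mult_less_cancel_left_pos)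
      then have "s powr (7 / 16) < 2 * (2 + \<mu>) / \<mu> * K w" using mu by (simp add: field_simps)
      also have "\<dots> \<le> c * K w" using K[of w] unfolding c_def by (intro mult_right_mono) auto
      finally have le: "s powr (7 / 16) \<le> c * K w" by simp
      have cK: "1 \<le> c * K w" using c K[of w] mult_mono[of 1 c 1 "K w"] by simp
      have "s = (s powr (7 / 16)) powr (16 / 7)" using s by (simp add: powr_powr)
      also have "\<dots> \<le> (c * K w) powr (16 / 7)" using le by (intro powr_mono2) auto
      also have "\<dots> \<le> (c * K w) powr real 3" using cK by (intro powr_mono) auto
      also have "\<dots> = (c * K w) ^ 3" using cK by (subst powr_realpow) auto
      also have "\<dots> = c ^ 3 * K w ^ 3" by (simp add: power_mult_distrib)
      also have "\<dots> \<le> (2 / \<mu> + 4) * x + c ^ 3 * K w ^ 3" using x mu by simp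
      finally show ?thesis .
    qed
    then show "\<bar>2 + real (\<tau> x w)\<bar> \<le> \<bar>(2 / \<mu> + 4) * x + c ^ 3 * K w ^ 3\<bar>" by (simp add: s_def)
  qed
qed

lemma pb_tau_powr: "r \<ge> 0 \<Longrightarrow> pb r (\<lambda>x w. (2 + real (\<tau> x w)) powr r)"
  using pb_powr[OF pb_tau, of r] by simp

lemma pb_real_tau: "pb 1 (\<lambda>x w. real (\<tau> x w))"
  by (rule pb_le[OF pb_tau]) simp

lemma pb_delta: "pb (9 / 16) (\<lambda>x w. real (\<tau> x w) - x / \<mu>)"
proof (rule pb_le)
  have "pb (0 + 9 / 16) (\<lambda>x w. K w * (2 + real (\<tau> x w)) powr (9 / 16))"
    by (rule pb_mult[OF pb_K pb_tau_powr]) simp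
  then show "pb (9 / 16) (\<lambda>x w. (2 + \<mu>) / \<mu> * (K w * (2 + real (\<tau> x w)) powr (9 / 16)))"
    by (intro pb_cmult) simp
  fix x :: real and w assume x: "x \<ge> 1" and w: "w \<in> A"
  have "\<bar>real (\<tau> x w) - x / \<mu>\<bar> = \<bar>\<mu> * real (\<tau> x w) - x\<bar> / \<mu>"
  proof -
    have "real (\<tau> x w) - x / \<mu> = (\<mu> * real (\<tau> x w) - x) / \<mu>" using mu by (simp add: field_simps)
    then show ?thesis using mu by (simp only: abs_divide abs_of_pos)
  qed
  also have "\<dots> \<le> ((2 + \<mu>) * K w * (2 + real (\<tau> x w)) powr (9 / 16)) / \<mu>"
    using mu by (intro divide_right_mono tau_deviation[OF w x]) auto
  also have "\<dots> = (2 + \<mu>) / \<mu> * (K w * (2 + real (\<tau> x w)) powr (9 / 16))" by simp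
  finally show "\<bar>real (\<tau> x w) - x / \<mu>\<bar> \<le> \<bar>(2 + \<mu>) / \<mu> * (K w * (2 + real (\<tau> x w)) powr (9 / 16))\<bar>"
    by linarith
qed

lemma pb_early: "pb (3 / 4) (\<lambda>x w. real (early_time \<mu> x) - x / \<mu>)"
proof (rule pb_le)
  show "pb (3 / 4) (\<lambda>x w. 1 / \<mu> * x powr (3 / 4) + 1)"
    by (rule pb_add[OF pb_cmult[OF pb_powr_x] pb_mono[OF pb_const]]) simp
  fix x :: real and w :: 'w assume x: "x \<ge> 1"
  show "\<bar>real (early_time \<mu> x) - x / \<mu>\<bar> \<le> \<bar>1 / \<mu> * x powr (3 / 4) + 1\<bar>"
  proof -
    have "0 \<le> x powr (3 / 4) / \<mu>" using mu by simp
    moreover have "(x - x powr (3 / 4)) / \<mu> = x / \<mu> - x powr (3 / 4) / \<mu>" by (rule diff_divide_distrib)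
    ultimately have "\<bar>real (early_time \<mu> x) - x / \<mu>\<bar> \<le> x powr (3 / 4) / \<mu> + 1"
      using early_time_bounds[OF mu x] by linarith
    then show ?thesis by simp
  qed
qed

lemma pb_real_early: "pb 1 (\<lambda>x w. real (early_time \<mu> x))"
proof -
  have "pb 1 (\<lambda>x w. (real (early_time \<mu> x) - x / \<mu>) + 1 / \<mu> * x)"
    by (rule pb_add[OF pb_mono[OF pb_early] pb_cmult[OF pb_x]]) simp
  then show ?thesis by simp
qed

lemma pb_gap: "pb (3 / 4) (\<lambda>x w. real (\<tau> x w) - real (early_time \<mu> x))"
proof -
  have "pb (3 / 4) (\<lambda>x w. (real (\<tau> x w) - x / \<mu>) - (real (early_time \<mu> x) - x / \<mu>))"
    by (rule pb_diff[OF pb_mono[OF pb_delta] pb_early]) simp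
  then show ?thesis by simp
qed

lemma pb_sum_times: "pb 1 (\<lambda>x w. 1 + real (\<tau> x w) + real (early_time \<mu> x))"
  by (rule pb_add[OF pb_add[OF pb_mono[OF pb_const] pb_real_tau] pb_real_early]) simp

text \<open>The exponent is half of \<open>3 / 4\<close>, from the square root of the gap, plus the
  slack \<open>1 / 16\<close>.\<close>

lemma pb_T_gap: "pb (7 / 16) (\<lambda>x w. T (\<tau> x w) w - T (early_time \<mu> x) w)"
proof (rule pb_le)
  have "pb (0 + 3 / 4 * (1 / 2) + 1 * (1 / 16)) (\<lambda>x w. K w * \<bar>real (\<tau> x w) - real (early_time \<mu> x)\<bar> powr (1 / 2)
      * \<bar>1 + real (\<tau> x w) + real (early_time \<mu> x)\<bar> powr (1 / 16))"
    by (intro pb_mult pb_K pb_powr pb_gap pb_sum_times) auto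
  then show "pb (7 / 16) (\<lambda>x w. K w * \<bar>real (\<tau> x w) - real (early_time \<mu> x)\<bar> powr (1 / 2)
      * \<bar>1 + real (\<tau> x w) + real (early_time \<mu> x)\<bar> powr (1 / 16))" by simp
  fix x :: real and w assume w: "w \<in> A"
  show "\<bar>T (\<tau> x w) w - T (early_time \<mu> x) w\<bar> \<le> \<bar>K w * \<bar>real (\<tau> x w) - real (early_time \<mu> x)\<bar> powr (1 / 2)
      * \<bar>1 + real (\<tau> x w) + real (early_time \<mu> x)\<bar> powr (1 / 16)\<bar>"
  proof -
    have "\<bar>1 + real (\<tau> x w) + real (early_time \<mu> x)\<bar> = 1 + real (\<tau> x w) + real (early_time \<mu> x)" by simp
    then show ?thesis using T_Z_sym(1)[OF w, of "\<tau> x w" "early_time \<mu> x"] abs_ge_self order_trans by metis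
  qed
qed

text \<open>The same count with an additional factor of order \<open>d - 1\<close>. The result lies
  \<open>1 / 16\<close> below the exponent \<open>d - 1 / 2\<close> of the normalization.\<close>

lemma pb_Z_gap: "pb (real d - 9 / 16) (\<lambda>x w. Z (\<tau> x w) w - Z (early_time \<mu> x) w)"
proof (rule pb_le)
  have "pb (0 + 3 / 4 * (1 / 2) + (1 * real (d - 1) + 1 * (1 / 16))) (\<lambda>x w. K w * \<bar>real (\<tau> x w) - real (early_time \<mu> x)\<bar> powr (1 / 2)
      * ((1 + real (\<tau> x w) + real (early_time \<mu> x)) ^ (d - 1) * \<bar>1 + real (\<tau> x w) + real (early_time \<mu> x)\<bar> powr (1 / 16)))"
    by (intro pb_mult pb_K pb_powr pb_power pb_gap pb_sum_times) auto
  then show "pb (real d - 9 / 16) (\<lambda>x w. K w * \<bar>real (\<tau> x w) - real (early_time \<mu> x)\<bar> powr (1 / 2)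
      * ((1 + real (\<tau> x w) + real (early_time \<mu> x)) ^ (d - 1) * \<bar>1 + real (\<tau> x w) + real (early_time \<mu> x)\<bar> powr (1 / 16)))"
    by (rule pb_mono) (use d in \<open>simp add: of_nat_diff\<close>)
  fix x :: real and w assume w: "w \<in> A"
  show "\<bar>Z (\<tau> x w) w - Z (early_time \<mu> x) w\<bar> \<le> \<bar>K w * \<bar>real (\<tau> x w) - real (early_time \<mu> x)\<bar> powr (1 / 2)
      * ((1 + real (\<tau> x w) + real (early_time \<mu> x)) ^ (d - 1) * \<bar>1 + real (\<tau> x w) + real (early_time \<mu> x)\<bar> powr (1 / 16))\<bar>"
  proof -
    have "\<bar>1 + real (\<tau> x w) + real (early_time \<mu> x)\<bar> = 1 + real (\<tau> x w) + real (early_time \<mu> x)" by simp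
    then show ?thesis using T_Z_sym(2)[OF w, of "\<tau> x w" "early_time \<mu> x"] abs_ge_self order_trans by metis
  qed
qed

text \<open>A second-order remainder has order \<open>k - 2 + 2 * (9 / 16) = k - 7 / 8\<close>. In
  the induction it is multiplied by \<tau> and picks up one new term that is quadratic in the
  deviation.\<close>

lemma pb_taylor:
  "pb (real k - 7 / 8) (\<lambda>x w. real (\<tau> x w) ^ k - (x / \<mu>) ^ k - real k * (x / \<mu>) ^ (k - 1) * (real (\<tau> x w) - x / \<mu>))"
proof (induction k)
  case 0
  show ?case by (rule pbI[where C = 0]) auto
next
  case (Suc k)
  define y where "y x = x / \<mu>" for x
  define \<delta> where "\<delta> x w = real (\<tau> x w) - y x" for x w
  define E where "E x w = real (\<tau> x w) ^ k - y x ^ k - real k * y x ^ (k - 1) * \<delta> x w" for x w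
  have 1: "pb ((real k - 7 / 8) + 1) (\<lambda>x w. E x w * real (\<tau> x w))"
    using pb_mult[OF Suc pb_real_tau] by (simp add: E_def \<delta>_def y_def)
  have 2: "pb ((real k - 7 / 8) + 1) (\<lambda>x w. real k * (y x ^ (k - 1) * \<delta> x w ^ 2))"
  proof (cases "k = 0")
    case True
    then show ?thesis by (intro pbI[where C = 0]) auto
  next
    case False
    have "pb 1 (\<lambda>x w. y x)" using pb_cmult[OF pb_x, of "1 / \<mu>"] by (simp add: y_def)
    from pb_mult[OF pb_power[OF this, of "k - 1"] pb_power[OF pb_delta, of 2]]
    have "pb ((real k - 7 / 8) + 1) (\<lambda>x w. y x ^ (k - 1) * \<delta> x w ^ 2)"
      using False by (simp add: \<delta>_def y_def of_nat_diff)
    then show ?thesis by (rule pb_cmult)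
  qed
  have eq: "real (\<tau> x w) ^ Suc k - y x ^ Suc k - real (Suc k) * y x ^ (Suc k - 1) * \<delta> x w
      = E x w * real (\<tau> x w) + real k * (y x ^ (k - 1) * \<delta> x w ^ 2)" for x w
  proof (cases k)
    case (Suc j)
    have t: "real (\<tau> x w) = y x + \<delta> x w" by (simp add: \<delta>_def)
    show ?thesis unfolding E_def t Suc by (simp add: algebra_simps power2_eq_square)
  qed (simp add: E_def \<delta>_def)
  have "pb ((real k - 7 / 8) + 1) (\<lambda>x w. real (\<tau> x w) ^ Suc k - y x ^ Suc k - real (Suc k) * y x ^ (Suc k - 1) * \<delta> x w)"
    unfolding eq by (rule pb_add[OF 1 2])
  then show ?case by (simp only: y_def \<delta>_def of_nat_Suc) (simp add: algebra_simps)
qed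

text \<open>Up to the distance \<open>R\<close> of the walk from \<open>x\<close>, the deviation
  \<open>\<tau> - x / \<mu>\<close> equals \<open>- T / \<mu>\<close>. Multiplied by
  \<open>c1 * (x / \<mu>) ^ (d - 1) / fact (d - 1)\<close>, the derivative of the mean of the
  U-statistic in the time, it gives the correction linear in \<open>T\<close>. The five terms of
  \<open>N\<close> are the errors: \<open>Z\<close> over the gap, binomial coefficient against
  power, Taylor remainder, \<open>R\<close>, and \<open>T\<close> over the gap. The largest of them
  have order \<open>d - 9 / 16\<close>.\<close>

theorem path_approximation:
  "pb (- (1 / 16)) (\<lambda>x w.
    (Z (\<tau> x w) w + c1 * real (\<tau> x w choose d) - c1 / fact d * (x / \<mu>) ^ d) / x powr (real d - 1 / 2)
    - (Z (early_time \<mu> x) w - c1 / (fact (d - 1) * \<mu>) * (x / \<mu>) ^ (d - 1) * T (early_time \<mu> x) w) / x powr (real d - 1 / 2))"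
proof -
  define y where "y x = x / \<mu>" for x
  define R where "R x w = \<mu> * real (\<tau> x w) + T (\<tau> x w) w - x" for x w
  have "pb 1 (\<lambda>x w. y x)" using pb_cmult[OF pb_x, of "1 / \<mu>"] by (simp add: y_def)
  from pb_power[OF this, of "d - 1"] have py: "pb (real d - 1) (\<lambda>x w. y x ^ (d - 1))"
    using d by (simp add: of_nat_diff)
  have k0: "pb (1 / 16) (\<lambda>x w. \<mu>)" by (rule pb_mono[OF pb_const]) simp
  have k1: "pb (1 / 16) (\<lambda>x w. K w * (2 + real (\<tau> x w)) powr (1 / 16))"
    using pb_mult[OF pb_K pb_tau_powr[of "1 / 16"]] by simp
  have "pb (1 / 16) (\<lambda>x w. \<mu> + K w * (2 + real (\<tau> x w)) powr (1 / 16))"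
    by (rule pb_add[OF k0 k1])
  then have pR: "pb (1 / 16) R"
  proof (rule pb_le)
    fix x :: real and w assume x: "x \<ge> 1" and w: "w \<in> A"
    show "\<bar>R x w\<bar> \<le> \<bar>\<mu> + K w * (2 + real (\<tau> x w)) powr (1 / 16)\<bar>"
      using tau[OF w x] unfolding R_def by linarith
  qed
  define N where "N x w = (Z (\<tau> x w) w - Z (early_time \<mu> x) w)
    + c1 / fact d * ((\<Prod>i<d. real (\<tau> x w) - real i) - real (\<tau> x w) ^ d)
    + c1 / fact d * (real (\<tau> x w) ^ d - (x / \<mu>) ^ d - real d * (x / \<mu>) ^ (d - 1) * (real (\<tau> x w) - x / \<mu>))
    + c1 / (fact (d - 1) * \<mu>) * (y x ^ (d - 1) * R x w)
    - c1 / (fact (d - 1) * \<mu>) * (y x ^ (d - 1) * (T (\<tau> x w) w - T (early_time \<mu> x) w))" for x w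
  have pN: "pb (real d - 9 / 16) N"
    unfolding N_def[abs_def]
  proof (rule pb_diff[OF pb_add[OF pb_add[OF pb_add[OF pb_Z_gap pb_cmult] pb_cmult] pb_cmult] pb_cmult])
    show "pb (real d - 9 / 16) (\<lambda>x w. (\<Prod>i<d. real (\<tau> x w) - real i) - real (\<tau> x w) ^ d)"
      by (rule pb_mono[OF pb_falling(2)[OF pb_real_tau]]) simp
    show "pb (real d - 9 / 16) (\<lambda>x w. real (\<tau> x w) ^ d - (x / \<mu>) ^ d - real d * (x / \<mu>) ^ (d - 1) * (real (\<tau> x w) - x / \<mu>))"
      by (rule pb_mono[OF pb_taylor]) simp
    show "pb (real d - 9 / 16) (\<lambda>x w. y x ^ (d - 1) * R x w)"
      by (rule pb_mono[OF pb_mult[OF py pR]]) simp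
    show "pb (real d - 9 / 16) (\<lambda>x w. y x ^ (d - 1) * (T (\<tau> x w) w - T (early_time \<mu> x) w))"
      by (rule pb_mono[OF pb_mult[OF py pb_T_gap]]) simp
  qed
  have "pb ((real d - 9 / 16) + - (real d - 1 / 2)) (\<lambda>x w. N x w * x powr (- (real d - 1 / 2)))"
    by (rule pb_mult[OF pN pb_powr_x])
  moreover have "N x w * x powr (- (real d - 1 / 2)) =
    (Z (\<tau> x w) w + c1 * real (\<tau> x w choose d) - c1 / fact d * (x / \<mu>) ^ d) / x powr (real d - 1 / 2)
    - (Z (early_time \<mu> x) w - c1 / (fact (d - 1) * \<mu>) * (x / \<mu>) ^ (d - 1) * T (early_time \<mu> x) w) / x powr (real d - 1 / 2)"
    for x w
  proof -
    define t where "t = real (\<tau> x w)"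
    have ch: "real (\<tau> x w choose d) = (\<Prod>i<d. t - real i) / fact d"
      by (simp add: t_def binomial_gbinomial gbinomial_prod_rev lessThan_atLeast0)
    have fd: "(fact d :: real) = real d * fact (d - 1)" using d by (simp add: fact_reduce)
    define P where "P = (\<Prod>i<d. t - real i)"
    define f1 :: real where "f1 = fact (d - 1)"
    have f1: "f1 > 0" by (simp add: f1_def)
    have dr: "real d > 0" using d by simp
    have "N x w = Z (\<tau> x w) w + c1 * (P / fact d) - c1 / fact d * (x / \<mu>) ^ d
       - (Z (early_time \<mu> x) w - c1 / (f1 * \<mu>) * (x / \<mu>) ^ (d - 1) * T (early_time \<mu> x) w)"
    proof -
      define Y where "Y = (x / \<mu>) ^ (d - 1)"
      have a1: "c / (r * f) * (r * Y * s) = c / f * (Y * s)" if "r \<noteq> 0" for c r f Y s :: real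
        using that by simp
      have a2: "c / (f * m) * (Y * (m * t + T - x)) = c / f * (Y * (t - x / m)) + c / (f * m) * (Y * T)"
        if "m \<noteq> 0" "f \<noteq> 0" for c f m Y t T x :: real
        using that by (simp add: field_simps)
      have 1: "c1 / fact d * (real d * Y * (t - x / \<mu>)) = c1 / f1 * (Y * (t - x / \<mu>))"
        unfolding fd f1_def[symmetric] using dr by (intro a1) simp
      have 2: "c1 / (f1 * \<mu>) * (Y * R x w) = c1 / f1 * (Y * (t - x / \<mu>)) + c1 / (f1 * \<mu>) * (Y * T (\<tau> x w) w)"
        unfolding R_def t_def[symmetric] using f1 mu by (intro a2) auto
      \<comment> \<open>The bookkeeping of the five errors: the first-order term \<open>g\<close>
        occurs in the Taylor remainder and in the term with \<open>R\<close>, and cancels.\<close>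
      have a3: "z - ze + q * (P - tk) + q * (tk - xk - L) + r * (Y * R) - r * (Y * (S - Se))
          = z + q * P - q * xk - (ze - r * Y * Se)" if "q * L = g" "r * (Y * R) = g + r * (Y * S)"
        for z ze q P tk xk L r Y R S Se g :: real
        using that by (simp add: algebra_simps)
      have "N x w = Z (\<tau> x w) w + c1 / fact d * P - c1 / fact d * (x / \<mu>) ^ d
       - (Z (early_time \<mu> x) w - c1 / (f1 * \<mu>) * Y * T (early_time \<mu> x) w)"
        unfolding N_def y_def t_def[symmetric] P_def[symmetric] Y_def[symmetric] f1_def[symmetric]
        by (rule a3[OF 1 2])
      then show ?thesis by (simp add: Y_def)
    qed
    then show ?thesis
      unfolding ch P_def[symmetric] f1_def[symmetric] diff_divide_distrib[symmetric] powr_minus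
      by (simp only: divide_inverse)
  qed
  ultimately show ?thesis by simp
qed

end

end

section \<open>A central limit theorem for weighted sums\<close>

lemma measurable_iexp_mult:
  assumes [measurable]: "f \<in> borel_measurable M"
  shows "(\<lambda>w. iexp (t * f w)) \<in> borel_measurable M"
  by measurable

text \<open>For factors in the unit disc, the difference of two products is at most the sum of the
  differences of the factors. Each factor is compared with \<open>exp (- u)\<close> through
  \<open>1 - u\<close>, and these two differ by at most \<open>u\<^sup>2\<close> when
  \<open>u \<ge> 0\<close>.\<close>

lemma prod_char_approximation:
  fixes z :: "nat \<Rightarrow> complex" and v :: "nat \<Rightarrow> real" and t :: real
  assumes z: "\<And>i. i < n \<Longrightarrow> cmod (z i) \<le> 1" and v0: "\<And>i. i < n \<Longrightarrow> v i \<ge> 0"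
    and approx: "\<And>i. i < n \<Longrightarrow> cmod (z i - (1 - t\<^sup>2 * v i / 2)) \<le> \<epsilon> i"
  shows "cmod ((\<Prod>i<n. z i) - exp (- (t\<^sup>2 * (\<Sum>i<n. v i) / 2))) \<le> (\<Sum>i<n. \<epsilon> i + (t\<^sup>2 * v i / 2)\<^sup>2)"
proof -
  have e: "exp (- (t\<^sup>2 * (\<Sum>i<n. v i) / 2)) = (\<Prod>i<n. exp (- (t\<^sup>2 * v i / 2)))"
    by (simp add: exp_sum[symmetric] sum_negf sum_divide_distrib sum_distrib_left)
  have "cmod ((\<Prod>i<n. z i) - (\<Prod>i<n. complex_of_real (exp (- (t\<^sup>2 * v i / 2)))))
      \<le> (\<Sum>i<n. cmod (z i - complex_of_real (exp (- (t\<^sup>2 * v i / 2)))))"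
    by (rule norm_prod_diff) (use z v0 in auto)
  also have "\<dots> \<le> (\<Sum>i<n. \<epsilon> i + (t\<^sup>2 * v i / 2)\<^sup>2)"
  proof (rule sum_mono)
    fix i assume "i \<in> {..<n}"
    then have i: "i < n" by simp
    define u where "u = t\<^sup>2 * v i / 2"
    have u: "u \<ge> 0" using v0[OF i] by (simp add: u_def)
    have "\<bar>(1 - u) - exp (- u)\<bar> \<le> u\<^sup>2"
    proof -
      have l: "1 - u \<le> exp (- u)" using exp_ge_add_one_self[of "- u"] by simp
      have "exp (- u) \<le> 1 - u + u\<^sup>2"
      proof -
        have "exp (- u) * (1 + u) \<le> 1"
        proof -
          have "exp (- u) * (1 + u) \<le> exp (- u) * exp u" by (intro mult_left_mono) auto
          then show ?thesis by (simp flip: exp_add)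
        qed
        also have "1 \<le> (1 - u + u\<^sup>2) * (1 + u)"
        proof -
          have "(1 - u + u\<^sup>2) * (1 + u) = 1 + u ^ 3" by (simp add: algebra_simps power2_eq_square power3_eq_cube)
          then show ?thesis using u by simp
        qed
        finally show ?thesis using u by (simp add: mult_le_cancel_right_pos)
      qed
      then show ?thesis using l by linarith
    qed
    then have "cmod (complex_of_real (1 - u) - complex_of_real (exp (- u))) \<le> u\<^sup>2"
      by (metis norm_of_real of_real_diff)
    moreover have "cmod (z i - complex_of_real (1 - u)) \<le> \<epsilon> i"
      using approx[OF i] by (simp add: u_def)
    ultimately have "cmod (z i - complex_of_real (exp (- u))) \<le> \<epsilon> i + u\<^sup>2"
      using norm_triangle_ineq[of "z i - complex_of_real (1 - u)" "complex_of_real (1 - u) - complex_of_real (exp (- u))"]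
      by simp
    then show "cmod (z i - complex_of_real (exp (- (t\<^sup>2 * v i / 2)))) \<le> \<epsilon> i + (t\<^sup>2 * v i / 2)\<^sup>2"
      by (simp add: u_def)
  qed
  finally show ?thesis by (simp add: e)
qed

context iid_sequence
begin

text \<open>By induction on \<open>n\<close>: the last summand uses a fresh coordinate, and Fubini
  factors the integral.\<close>

lemma char_sum_independent:
  fixes F :: "nat \<Rightarrow> 'b \<Rightarrow> real"
  assumes F: "\<And>i. i < n \<Longrightarrow> F i \<in> borel_measurable \<nu>"
  shows "(\<integral>w. iexp (t * (\<Sum>i<n. F i (w i))) \<partial>S) = (\<Prod>i<n. \<integral>y. iexp (t * F i y) \<partial>\<nu>)"
  using F
proof (induction n)
  case 0
  show ?case by (simp add: P.prob_space)
next
  case (Suc n)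
  interpret SN: pair_prob_space S \<nu> by (rule pair_prob)
  define Q where "Q w = iexp (t * (\<Sum>i<n. F i (w i)))" for w
  define H where "H y = iexp (t * F n y)" for y
  have "(\<lambda>w. \<Sum>i<n. F i (w i)) \<in> borel_measurable S"
    by (rule borel_measurable_sum, rule measurable_coordinate, rule Suc.prems) simp
  then have Qm: "Q \<in> borel_measurable S"
    unfolding Q_def[abs_def] by (rule measurable_iexp_mult)
  have Hm: "H \<in> borel_measurable \<nu>"
    unfolding H_def[abs_def] using Suc.prems[OF lessI] by (rule measurable_iexp_mult)
  have m: "(\<lambda>(w, y). Q w * H y) \<in> borel_measurable (S \<Otimes>\<^sub>M \<nu>)"
    unfolding split_beta'
    by (rule borel_measurable_times[OF measurable_compose[OF measurable_fst Qm] measurable_compose[OF measurable_snd Hm]])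
  have dep: "Q w * H y = Q w' * H y" if "\<And>j. j < n \<Longrightarrow> w j = w' j" for w w' y
  proof -
    have "(\<Sum>i<n. F i (w i)) = (\<Sum>i<n. F i (w' i))" using that by (intro sum.cong) auto
    then show ?thesis by (simp add: Q_def)
  qed
  have int: "integrable (S \<Otimes>\<^sub>M \<nu>) (\<lambda>(w, y). Q w * H y)"
    by (rule SN.P.integrable_const_bound[where B = 1, OF _ m]) (auto simp: Q_def H_def norm_mult)
  have "(\<integral>w. iexp (t * (\<Sum>i<Suc n. F i (w i))) \<partial>S) = (\<integral>w. Q w * H (w n) \<partial>S)"
    by (simp add: Q_def H_def distrib_left exp_add)
  also have "\<dots> = (\<integral>(w, y). Q w * H y \<partial>(S \<Otimes>\<^sub>M \<nu>))"
    by (rule fresh_integral(1)[of n "\<lambda>w y. Q w * H y", OF dep m])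
  also have "\<dots> = (\<integral>w. (\<integral>y. Q w * H y \<partial>\<nu>) \<partial>S)"
    by (rule SN.integral_fst'[symmetric, where f = "\<lambda>(w, y). Q w * H y", unfolded split_conv, OF int])
  also have "\<dots> = (\<integral>w. Q w \<partial>S) * (\<integral>y. H y \<partial>\<nu>)"
    by simp
  also have "(\<integral>w. Q w \<partial>S) = (\<Prod>i<n. \<integral>y. iexp (t * F i y) \<partial>\<nu>)"
    unfolding Q_def by (rule Suc.IH[OF Suc.prems[OF less_SucI]])
  finally show ?case by (simp add: H_def)
qed

text \<open>A Lyapunov condition with explicit rate. \<open>b N\<close> is the common size of the
  summands, \<open>m N\<close> times its square stays bounded, and the third moments make the total
  error of order \<open>b N + (b N)\<^sup>2\<close>. The limit variance is allowed to be
  \<open>0\<close>.\<close>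

theorem weighted_sum_clt:
  fixes F :: "nat \<Rightarrow> nat \<Rightarrow> 'b \<Rightarrow> real" and m :: "nat \<Rightarrow> nat" and b :: "nat \<Rightarrow> real"
  assumes F: "\<And>N i. F N i \<in> borel_measurable \<nu>"
    and int2: "\<And>N i. integrable \<nu> (\<lambda>y. (F N i y)\<^sup>2)"
    and int3: "\<And>N i. integrable \<nu> (\<lambda>y. \<bar>F N i y\<bar> ^ 3)"
    and mean: "\<And>N i. (\<integral>y. F N i y \<partial>\<nu>) = 0"
    and var: "(\<lambda>N. \<Sum>i<m N. \<integral>y. (F N i y)\<^sup>2 \<partial>\<nu>) \<longlonglongrightarrow> \<sigma>2"
    and b3: "\<And>N i. i < m N \<Longrightarrow> (\<integral>y. \<bar>F N i y\<bar> ^ 3 \<partial>\<nu>) \<le> C * b N ^ 3"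
    and b2: "\<And>N i. i < m N \<Longrightarrow> (\<integral>y. (F N i y)\<^sup>2 \<partial>\<nu>) \<le> C * b N ^ 2"
    and b0: "\<And>N. b N \<ge> 0" and C: "C \<ge> 0" and mb: "\<And>N. real (m N) * b N ^ 2 \<le> C" and b: "b \<longlonglongrightarrow> 0"
  shows "(\<lambda>N. \<integral>w. iexp (t * (\<Sum>i<m N. F N i (w i))) \<partial>S) \<longlonglongrightarrow> complex_of_real (exp (- (\<sigma>2 * t\<^sup>2 / 2)))"
proof -
  define v where "v N i = (\<integral>y. (F N i y)\<^sup>2 \<partial>\<nu>)" for N i
  define \<epsilon> where "\<epsilon> N i = t\<^sup>2 / 6 * (\<bar>t\<bar> * (\<integral>y. \<bar>F N i y\<bar> ^ 3 \<partial>\<nu>))" for N i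
  have v0: "v N i \<ge> 0" for N i unfolding v_def by (intro Bochner_Integration.integral_nonneg) simp
  have int1: "integrable \<nu> (F N i)" for N i
    by (rule integrable_of_power[where k = 1, OF M.finite_measure_axioms F]) (simp_all only: mult_1_right int2 order_refl)
  have approx: "cmod ((\<integral>y. iexp (t * F N i y) \<partial>\<nu>) - (1 - t\<^sup>2 * v N i / 2)) \<le> \<epsilon> N i" for N i
  proof -
    have "cmod (char (distr \<nu> borel (F N i)) t - (1 - t\<^sup>2 * v N i / 2))
       \<le> (t\<^sup>2 / 6) * (\<integral>y. min (6 * (F N i y)\<^sup>2) (\<bar>t\<bar> * \<bar>F N i y\<bar> ^ 3) \<partial>\<nu>)"
      by (rule M.char_approx3'[OF F int1 int2 mean _ refl]) (simp only: mean v_def diff_0_right)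
    also have "\<dots> \<le> (t\<^sup>2 / 6) * (\<integral>y. \<bar>t\<bar> * \<bar>F N i y\<bar> ^ 3 \<partial>\<nu>)"
    proof (intro mult_left_mono integral_mono)
      show "integrable \<nu> (\<lambda>y. min (6 * (F N i y)\<^sup>2) (\<bar>t\<bar> * \<bar>F N i y\<bar> ^ 3))"
        by (rule Bochner_Integration.integrable_min[OF integrable_mult_right[OF int2] integrable_mult_right[OF int3]])
      show "integrable \<nu> (\<lambda>y. \<bar>t\<bar> * \<bar>F N i y\<bar> ^ 3)" by (rule integrable_mult_right[OF int3])
    qed auto
    also have "char (distr \<nu> borel (F N i)) t = (\<integral>y. iexp (t * F N i y) \<partial>\<nu>)"
      unfolding char_def by (rule integral_distr[OF F measurable_iexp_mult]) simp
    finally show ?thesis by (simp add: \<epsilon>_def)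
  qed
  have le1: "cmod (\<integral>y. iexp (t * F N i y) \<partial>\<nu>) \<le> 1" for N i
  proof -
    have "cmod (\<integral>y. iexp (t * F N i y) \<partial>\<nu>) \<le> (\<integral>y. cmod (iexp (t * F N i y)) \<partial>\<nu>)"
      by (rule integral_norm_bound)
    then show ?thesis by (simp add: M.prob_space)
  qed
  have err: "cmod ((\<integral>w. iexp (t * (\<Sum>i<m N. F N i (w i))) \<partial>S) - exp (- (t\<^sup>2 * (\<Sum>i<m N. v N i) / 2)))
     \<le> C * (t\<^sup>2 / 6 * (\<bar>t\<bar> * C)) * b N + C * ((t\<^sup>2 / 2)\<^sup>2 * C\<^sup>2) * (b N)\<^sup>2" for N
  proof -
    have "cmod ((\<integral>w. iexp (t * (\<Sum>i<m N. F N i (w i))) \<partial>S) - exp (- (t\<^sup>2 * (\<Sum>i<m N. v N i) / 2)))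
       \<le> (\<Sum>i<m N. \<epsilon> N i + (t\<^sup>2 * v N i / 2)\<^sup>2)"
      unfolding char_sum_independent[OF F] by (rule prod_char_approximation[OF le1 v0 approx])
    also have "\<dots> \<le> (\<Sum>i<m N. t\<^sup>2 / 6 * (\<bar>t\<bar> * (C * b N ^ 3)) + (t\<^sup>2 / 2)\<^sup>2 * (C * b N ^ 2)\<^sup>2)"
    proof (intro sum_mono add_mono)
      fix i assume "i \<in> {..<m N}"
      then have i: "i < m N" by simp
      show "\<epsilon> N i \<le> t\<^sup>2 / 6 * (\<bar>t\<bar> * (C * b N ^ 3))"
        unfolding \<epsilon>_def by (intro mult_left_mono b3[OF i]) auto
      have "(v N i)\<^sup>2 \<le> (C * b N ^ 2)\<^sup>2" using b2[OF i] v0[of N i] unfolding v_def by (intro power_mono) auto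
      then have "(t\<^sup>2 / 2)\<^sup>2 * (v N i)\<^sup>2 \<le> (t\<^sup>2 / 2)\<^sup>2 * (C * b N ^ 2)\<^sup>2" by (intro mult_left_mono) auto
      then show "(t\<^sup>2 * v N i / 2)\<^sup>2 \<le> (t\<^sup>2 / 2)\<^sup>2 * (C * b N ^ 2)\<^sup>2" by (simp add: power_mult_distrib power_divide)
    qed
    also have "\<dots> = (real (m N) * b N ^ 2) * ((t\<^sup>2 / 6 * (\<bar>t\<bar> * C)) * b N + ((t\<^sup>2 / 2)\<^sup>2 * C\<^sup>2) * (b N)\<^sup>2)"
    proof -
      have "(\<Sum>i<n. q * (r * (c * z ^ 3)) + u * (c * z ^ 2)\<^sup>2) = (real n * z ^ 2) * ((q * (r * c)) * z + (u * c\<^sup>2) * z\<^sup>2)"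
        for n :: nat and q r c z u :: real
        by (simp add: power2_eq_square power3_eq_cube algebra_simps)
      then show ?thesis .
    qed
    also have "\<dots> \<le> C * ((t\<^sup>2 / 6 * (\<bar>t\<bar> * C)) * b N + ((t\<^sup>2 / 2)\<^sup>2 * C\<^sup>2) * (b N)\<^sup>2)"
      using b0[of N] C by (intro mult_right_mono mb) auto
    finally show ?thesis by (simp only: distrib_left mult.assoc)
  qed
  have "(\<lambda>N. C * (t\<^sup>2 / 6 * (\<bar>t\<bar> * C)) * b N + C * ((t\<^sup>2 / 2)\<^sup>2 * C\<^sup>2) * (b N)\<^sup>2)
     \<longlonglongrightarrow> C * (t\<^sup>2 / 6 * (\<bar>t\<bar> * C)) * 0 + C * ((t\<^sup>2 / 2)\<^sup>2 * C\<^sup>2) * 0\<^sup>2"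
    by (rule tendsto_add[OF tendsto_mult_left[OF b] tendsto_mult_left[OF tendsto_power[OF b]]])
  then have e0: "(\<lambda>N. C * (t\<^sup>2 / 6 * (\<bar>t\<bar> * C)) * b N + C * ((t\<^sup>2 / 2)\<^sup>2 * C\<^sup>2) * (b N)\<^sup>2) \<longlonglongrightarrow> 0" by simp
  define I where "I N = (\<integral>w. iexp (t * (\<Sum>i<m N. F N i (w i))) \<partial>S)" for N
  define E where "E N = complex_of_real (exp (- (t\<^sup>2 * (\<Sum>i<m N. v N i) / 2)))" for N
  have "cmod (I N - E N) \<le> C * (t\<^sup>2 / 6 * (\<bar>t\<bar> * C)) * b N + C * ((t\<^sup>2 / 2)\<^sup>2 * C\<^sup>2) * (b N)\<^sup>2" for N
    unfolding I_def E_def by (rule err)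
  then have "(\<lambda>N. I N - E N) \<longlonglongrightarrow> 0"
    by (intro Lim_null_comparison[OF always_eventually e0] allI)
  moreover have "E \<longlonglongrightarrow> complex_of_real (exp (- (t\<^sup>2 * \<sigma>2 / 2)))"
    unfolding E_def[abs_def] v_def
    by (rule tendsto_of_real[OF tendsto_exp[OF tendsto_minus[OF tendsto_divide[OF tendsto_mult_left[OF var] tendsto_const]]]]) simp
  ultimately have "(\<lambda>N. I N - E N + E N) \<longlonglongrightarrow> 0 + complex_of_real (exp (- (t\<^sup>2 * \<sigma>2 / 2)))"
    by (rule tendsto_add)
  then show ?thesis by (simp add: I_def[abs_def] mult.commute[of \<sigma>2])
qed

end

section \<open>A renewal theorem\<close>

lemma filterlim_int_shift: "filterlim (\<lambda>z::int. z - s) at_top at_top"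
  unfolding filterlim_at_top
proof
  fix Z :: int
  show "eventually (\<lambda>z. Z \<le> z - s) at_top"
    using eventually_ge_at_top[of "Z + s"] by eventually_elim simp
qed

context prob_space
begin

context
  fixes \<xi> :: "'a \<Rightarrow> nat" and a :: "int \<Rightarrow> real" and B :: real and z0 :: int
  assumes xi [measurable]: "\<xi> \<in> measurable M (count_space UNIV)"
    and xi_int: "integrable M (\<lambda>x. real (\<xi> x))"
    and bounded_a: "\<And>z. \<bar>a z\<bar> \<le> B"
    and recursion: "\<And>z. z \<ge> z0 \<Longrightarrow> a z = (\<integral>x. a (z - int (\<xi> x)) \<partial>M)"
begin

lemma integrable_shifted: "integrable M (\<lambda>x. a (z - int (\<xi> x)))"
  by (rule integrable_const_bound[of _ B]) (use bounded_a in auto)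

text \<open>If \<open>L > 0\<close> were the upper limit of \<open>a z - a (z - s)\<close>, the recursion would propagate almost
  maximal differences along arbitrarily many steps of size \<open>s\<close>, and these add up to an
  unbounded difference of values of \<open>a\<close>.\<close>

lemma eventually_difference_le:
  assumes s: "prob {x \<in> space M. \<xi> x = s} > 0" and e: "e > 0"
  shows "eventually (\<lambda>z. a z - a (z - int s) \<le> e) at_top"
proof -
  define D where "D z = a z - a (z - int s)" for z
  define p where "p = prob {x \<in> space M. \<xi> x = s}"
  have p0: "p > 0" using s by (simp add: p_def)
  have B0: "B \<ge> 0" using bounded_a[of 0] by linarith
  have Db: "\<bar>D z\<bar> \<le> 2 * B" for z
    using bounded_a[of z] bounded_a[of "z - int s"] unfolding D_def by linarith
  have Dint: "integrable M (\<lambda>x. D (z - int (\<xi> x)))" for z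
    by (rule integrable_const_bound[of _ "2 * B"]) (use Db in auto)
  have Drec: "D z = (\<integral>x. D (z - int (\<xi> x)) \<partial>M)" if "z \<ge> z0 + int s" for z
  proof -
    have "z \<ge> z0" "z - int s \<ge> z0" using that by auto
    then have "D z = (\<integral>x. a (z - int (\<xi> x)) \<partial>M) - (\<integral>x. a (z - int s - int (\<xi> x)) \<partial>M)"
      unfolding D_def by (simp only: recursion[symmetric])
    also have "\<dots> = (\<integral>x. D (z - int (\<xi> x)) \<partial>M)"
      using integrable_shifted[of z] integrable_shifted[of "z - int s"]
      by (simp add: D_def algebra_simps flip: Bochner_Integration.integral_diff)
    finally show ?thesis .
  qed
  define C where "C = {c. eventually (\<lambda>z. D z \<le> c) at_top}"
  define L where "L = Inf C"
  have "D z \<le> 2 * B" for z using Db[of z] by linarith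
  then have "2 * B \<in> C" by (simp add: C_def)
  have lb: "- (2 * B) \<le> c" if "c \<in> C" for c
  proof -
    have "eventually (\<lambda>z. D z \<le> c) at_top" using that by (simp add: C_def)
    then obtain z where "D z \<le> c" unfolding eventually_at_top_linorder by blast
    then show ?thesis using Db[of z] by linarith
  qed
  have bdd: "bdd_below C" using lb by (rule bdd_belowI)
  have Llb: "L \<ge> - (2 * B)" unfolding L_def using \<open>2 * B \<in> C\<close> lb by (intro cInf_greatest) auto
  have up: "eventually (\<lambda>z. D z \<le> L + \<eta>) at_top" if "\<eta> > 0" for \<eta>
  proof -
    have "C \<noteq> {}" "Inf C < L + \<eta>" using \<open>2 * B \<in> C\<close> that by (auto simp: L_def)
    then have "\<exists>c\<in>C. c < L + \<eta>" by (rule cInf_lessD)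
    then obtain c where "c < L + \<eta>" "eventually (\<lambda>z. D z \<le> c) at_top" by (auto simp: C_def)
    then show ?thesis by (auto elim: eventually_mono)
  qed
  have low: "\<exists>z\<ge>z1. D z > L - \<eta>" if "\<eta> > 0" for \<eta> z1
  proof (rule ccontr)
    assume "\<not> ?thesis"
    then have "eventually (\<lambda>z. D z \<le> L - \<eta>) at_top"
      by (auto simp: eventually_at_top_linorder not_less)
    then have "L - \<eta> \<in> C" by (simp add: C_def)
    then have "L \<le> L - \<eta>" unfolding L_def using bdd by (rule cInf_lower)
    then show False using that by simp
  qed
  have tail: "\<exists>T. prob {x \<in> space M. \<xi> x > T} < \<tau>" if "\<tau> > 0" for \<tau>
  proof -
    have "(\<lambda>T. \<integral>x. indicator {x \<in> space M. \<xi> x > T} x \<partial>M) \<longlonglongrightarrow> (\<integral>x. (0::real) \<partial>M)"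
    proof (rule integral_dominated_convergence[where s = "\<lambda>T. indicator {x \<in> space M. \<xi> x > T}" and f = "\<lambda>_. 0" and w = "\<lambda>_. 1"])
      show "AE x in M. (\<lambda>T. indicator {x \<in> space M. \<xi> x > T} x) \<longlonglongrightarrow> (0::real)"
      proof (rule AE_I2)
        fix x
        have "eventually (\<lambda>T. indicator {x \<in> space M. \<xi> x > T} x = (0::real)) sequentially"
          using eventually_ge_at_top[of "\<xi> x"] by eventually_elim (auto simp: indicator_def)
        then show "(\<lambda>T. indicator {x \<in> space M. \<xi> x > T} x) \<longlonglongrightarrow> (0::real)"
          by (rule tendsto_eventually)
      qed
    qed (auto simp: indicator_def)
    then have "(\<lambda>T. prob {x \<in> space M. \<xi> x > T}) \<longlonglongrightarrow> 0" by simp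
    then have "eventually (\<lambda>T. prob {x \<in> space M. \<xi> x > T} < \<tau>) sequentially"
      using that by (rule order_tendstoD)
    then show ?thesis by (auto simp: eventually_sequentially)
  qed
  \<comment> \<open>At \<open>u\<close> the average of \<open>D (u - \<xi>)\<close> is almost the
    upper limit, no value at a large argument exceeds that limit by much, and \<xi> equals
    \<open>s\<close> with probability \<open>p > 0\<close>. Hence \<open>D (u - s)\<close> has to be
    almost maximal as well.\<close>
  have chain: "\<forall>\<delta>>0. \<forall>z1. \<exists>z\<ge>z1. \<forall>i\<le>J. D (z - int (i * s)) > L - \<delta>" for J
  proof (induction J)
    case 0
    then show ?case using low by simp
  next
    case (Suc J)
    show ?case
    proof (intro allI impI)
      fix \<delta> :: real and z1 assume d: "\<delta> > 0"
      \<comment> \<open>The total loss is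
        \<open>\<delta>' + 2 * \<eta> \<le> 3 * p * \<delta> / 4\<close>, which after division by
        \<open>p\<close> is still below \<delta>.\<close>
      define \<delta>' where "\<delta>' = min \<delta> (p * \<delta> / 4)"
      define \<eta> where "\<eta> = p * \<delta> / 4"
      have d': "\<delta>' > 0" "\<eta> > 0" using d p0 by (auto simp: \<delta>'_def \<eta>_def)
      \<comment> \<open>Jumps beyond \<open>T\<close> may land where \<open>D\<close> is not yet
        controlled. There the crude bound \<open>4 * B\<close> is paid, on an event so unlikely that
        the cost is at most \<eta>.\<close>
      obtain T where T: "prob {x \<in> space M. \<xi> x > T} < \<eta> / (4 * B + 1)"
        using tail[of "\<eta> / (4 * B + 1)"] d' B0 by auto
      obtain z2 where z2: "\<And>z. z \<ge> z2 \<Longrightarrow> D z \<le> L + \<eta>"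
        using up[OF d'(2)] by (auto simp: eventually_at_top_linorder)
      obtain z where z: "z \<ge> max (max z1 (z2 + int T + int (J * s))) (z0 + int s + int (J * s))"
        and zi: "\<And>i. i \<le> J \<Longrightarrow> D (z - int (i * s)) > L - \<delta>'"
        using Suc.IH d'(1) by blast
      define u where "u = z - int (J * s)"
      have u: "u \<ge> z2 + int T" "u \<ge> z0 + int s" using z by (auto simp: u_def)
      have Du: "D u > L - \<delta>'" using zi[of J] by (simp add: u_def)
      define q where "q = prob {x \<in> space M. \<xi> x > T}"
      have pt: "D (u - int (\<xi> x)) \<le> (L + \<eta>)
          + (D (u - int s) - (L + \<eta>)) * indicator {x \<in> space M. \<xi> x = s} x
          + 4 * B * indicator {x \<in> space M. \<xi> x > T} x" if "x \<in> space M" for x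
      proof -
        consider "\<xi> x = s" | "\<xi> x \<noteq> s" "\<xi> x \<le> T" | "\<xi> x \<noteq> s" "\<xi> x > T" by linarith
        then show ?thesis
        proof cases
          case 1
          then show ?thesis using that B0 by (simp add: indicator_def)
        next
          case 2
          then show ?thesis using z2[of "u - int (\<xi> x)"] u by (simp add: indicator_def)
        next
          case 3
          then show ?thesis using that Db[of "u - int (\<xi> x)"] Llb d'(2) by (simp add: indicator_def)
        qed
      qed
      have "D u \<le> (\<integral>x. (L + \<eta>) + (D (u - int s) - (L + \<eta>)) * indicator {x \<in> space M. \<xi> x = s} x
          + 4 * B * indicator {x \<in> space M. \<xi> x > T} x \<partial>M)"
        unfolding Drec[OF u(2)] using pt Dint
        by (intro integral_mono) (auto intro!: integrable_real_indicator simp: emeasure_eq_measure)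
      also have "\<dots> = (L + \<eta>) + (D (u - int s) - (L + \<eta>)) * p + 4 * B * q"
        by (simp add: p_def q_def prob_space emeasure_eq_measure)
      also have "4 * B * q \<le> \<eta>"
      proof -
        have "4 * B * q \<le> (4 * B + 1) * (\<eta> / (4 * B + 1))"
          using T B0 by (intro mult_mono) (auto simp: q_def)
        then show ?thesis using B0 by simp
      qed
      finally have "(L - \<delta>') < (L + \<eta>) + (D (u - int s) - (L + \<eta>)) * p + \<eta>" using Du by linarith
      moreover have "\<delta>' \<le> p * \<delta> / 4" by (simp add: \<delta>'_def)
      ultimately have "(L - D (u - int s)) * p < \<delta> * p"
        using d' mult_pos_pos[OF p0 d] mult_pos_pos[OF d'(2) p0] unfolding \<eta>_def by (simp add: algebra_simps)
      then have "L - D (u - int s) < \<delta>" using p0 mult_less_cancel_right_pos by blast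
      then have last: "D (z - int (Suc J * s)) > L - \<delta>" by (simp add: u_def algebra_simps)
      have "\<forall>i\<le>Suc J. D (z - int (i * s)) > L - \<delta>"
      proof (intro allI impI)
        fix i assume "i \<le> Suc J"
        then consider "i \<le> J" | "i = Suc J" by linarith
        then show "D (z - int (i * s)) > L - \<delta>"
        proof cases
          case 1
          then show ?thesis using zi[of i] by (simp add: \<delta>'_def)
        qed (use last in simp)
      qed
      then show "\<exists>z\<ge>z1. \<forall>i\<le>Suc J. D (z - int (i * s)) > L - \<delta>" using z by auto
    qed
  qed
  have "L \<le> 0"
  proof (rule ccontr)
    assume "\<not> L \<le> 0"
    then have L: "L > 0" by simp
    obtain J :: nat where J: "real J * (L / 2) > 2 * B"
      using reals_Archimedean3[of "L / 2"] L half_gt_zero by blast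
    obtain z where z: "\<And>i. i \<le> J \<Longrightarrow> D (z - int (i * s)) > L - L / 2"
      using chain[of J, rule_format, of "L / 2"] L by (auto simp del: of_nat_mult)
    have "real J * (L / 2) = (\<Sum>i<J. L / 2)" by simp
    also have "\<dots> \<le> (\<Sum>i<J. D (z - int (i * s)))" using z by (intro sum_mono) (auto simp: less_imp_le)
    also have "\<dots> = a z - a (z - int (J * s))"
      by (induction J) (auto simp: D_def algebra_simps)
    also have "\<dots> \<le> 2 * B" using bounded_a[of z] bounded_a[of "z - int (J * s)"] by linarith
    finally show False using J by simp
  qed
  then show ?thesis using up[OF e] by (auto simp: D_def elim!: eventually_mono)
qed

end

context
  fixes \<xi> :: "'a \<Rightarrow> nat" and a :: "int \<Rightarrow> real" and B :: real and z0 :: int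
  assumes xi [measurable]: "\<xi> \<in> measurable M (count_space UNIV)"
    and xi_int: "integrable M (\<lambda>x. real (\<xi> x))"
    and bounded_a: "\<And>z. \<bar>a z\<bar> \<le> B"
    and recursion: "\<And>z. z \<ge> z0 \<Longrightarrow> a z = (\<integral>x. a (z - int (\<xi> x)) \<partial>M)"
begin

text \<open>The one-sided estimate is applied to \<open>a\<close> and to \<open>- a\<close>, which
  satisfies the same recursion.\<close>

lemma difference_tendsto_zero:
  assumes s: "prob {x \<in> space M. \<xi> x = s} > 0"
  shows "((\<lambda>z. a z - a (z - int s)) \<longlongrightarrow> 0) at_top"
proof (rule tendstoI)
  fix e :: real assume e: "e > 0"
  have u: "eventually (\<lambda>z. a z - a (z - int s) \<le> e / 2) at_top"
    by (rule eventually_difference_le[OF xi xi_int bounded_a recursion s]) (use e in auto)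
  have l: "eventually (\<lambda>z. - a z - - a (z - int s) \<le> e / 2) at_top"
    by (rule eventually_difference_le[OF xi xi_int, of "\<lambda>z. - a z" B z0, OF _ _ s])
      (use e bounded_a recursion in auto)
  show "eventually (\<lambda>z. dist (a z - a (z - int s)) 0 < e) at_top"
    using u l by eventually_elim (use e in \<open>simp add: dist_real_def abs_less_iff\<close>)
qed

text \<open>The asymptotic periods of \<open>a\<close> form a subgroup \<open>G\<close> of the
  integers that contains the support of \<xi>; its least positive element \<open>h\<close> serves as
  lattice span. The value of the limit is read off a conserved quantity \<open>W\<close>. If it is
  \<open>0\<close>, conservation forces \<open>a\<close> to vanish from \<open>z0\<close> on, so a
  positive limit along the residue class and exact vanishing are the only two cases.\<close>

theorem renewal_limit:
  assumes pos: "(\<integral>x. real (\<xi> x) \<partial>M) > 0"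
    and init: "\<And>z. z < z0 \<Longrightarrow> a z = (if z = c then 1 else 0)" and c: "c < z0"
    and nonneg: "\<And>z. a z \<ge> 0"
  shows "\<exists>h::nat. \<exists>l::real. h \<ge> 1 \<and> l \<ge> 0 \<and> (AE x in M. h dvd \<xi> x) \<and> (\<forall>z. a z \<noteq> 0 \<longrightarrow> int h dvd z - c) \<and>
    (\<forall>e>0. \<exists>z1. \<forall>z\<ge>z1. int h dvd z - c \<longrightarrow> \<bar>a z - l\<bar> < e) \<and> (l = 0 \<longrightarrow> (\<forall>z\<ge>z0. a z = 0))"
proof -
  define G where "G = {s::int. ((\<lambda>z. a z - a (z - s)) \<longlongrightarrow> 0) at_top}"
  have Gadd: "s + t \<in> G" if "s \<in> G" "t \<in> G" for s t
  proof -
    have "((\<lambda>z. a (z - s) - a (z - s - t)) \<longlongrightarrow> 0) at_top"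
      using that(2) filterlim_int_shift[of s] unfolding G_def
      by (auto intro: filterlim_compose[where f = "\<lambda>z. z - s" and g = "\<lambda>z. a z - a (z - t)"])
    from tendsto_add[OF _ this, of "\<lambda>z. a z - a (z - s)" 0] that(1)
    show ?thesis by (simp add: G_def algebra_simps)
  qed
  have Gneg: "- s \<in> G" if "s \<in> G" for s
  proof -
    have "((\<lambda>z. a (z - (- s)) - a (z - (- s) - s)) \<longlongrightarrow> 0) at_top"
      using that filterlim_int_shift[of "- s"] unfolding G_def
      by (intro filterlim_compose[where f = "\<lambda>z. z - (- s)" and g = "\<lambda>z. a z - a (z - s)"]) auto
    from tendsto_minus[OF this] show ?thesis by (simp add: G_def)
  qed
  have G0: "0 \<in> G" by (simp add: G_def)
  have Gmult: "int n * s \<in> G" if "s \<in> G" for n s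
  proof (induction n)
    case (Suc n)
    have "s + int n * s \<in> G" using that Suc by (rule Gadd)
    then show ?case by (simp add: algebra_simps)
  qed (simp add: G0)
  have supp: "int s \<in> G" if "prob {x \<in> space M. \<xi> x = s} > 0" for s
    using difference_tendsto_zero[OF that] by (simp add: G_def)
  \<comment> \<open>A positive mean puts some positive value into the support, so that
    \<open>G\<close> has a positive element.\<close>
  have "\<exists>s>0. prob {x \<in> space M. \<xi> x = s} > 0"
  proof (rule ccontr)
    assume "\<not> ?thesis"
    then have z: "prob {x \<in> space M. \<xi> x = s} = 0" if "s > 0" for s
      using that measure_nonneg[of M "{x \<in> space M. \<xi> x = s}"] by (metis less_eq_real_def)
    have "AE x in M. \<forall>s. s > 0 \<longrightarrow> \<xi> x \<noteq> s"
    proof (subst AE_all_countable, rule allI)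
      fix s show "AE x in M. s > 0 \<longrightarrow> \<xi> x \<noteq> s"
        using z[of s] by (cases "s > 0") (auto intro!: AE_I'[of "{x \<in> space M. \<xi> x = s}"] simp: null_sets_def emeasure_eq_measure)
    qed
    then have "AE x in M. real (\<xi> x) = 0" by eventually_elim (metis gr0I of_nat_0)
    then have "(\<integral>x. real (\<xi> x) \<partial>M) = 0" by (rule integral_eq_zero_AE)
    then show False using pos by simp
  qed
  then obtain s0 where s0: "s0 > 0" "int s0 \<in> G" using supp by auto
  define h where "h = (LEAST n. n > 0 \<and> int n \<in> G)"
  have h: "h > 0" "int h \<in> G"
    using LeastI[of "\<lambda>n. n > 0 \<and> int n \<in> G" s0] s0 by (auto simp: h_def)
  have hmin: "n \<ge> h" if "n > 0" "int n \<in> G" for n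
    unfolding h_def using that by (intro Least_le) auto
  have hdvd: "h dvd s" if "int s \<in> G" for s
  proof (rule ccontr)
    assume nd: "\<not> h dvd s"
    have "int s + - (int (s div h) * int h) \<in> G" by (intro Gadd Gneg Gmult that h)
    also have "int s + - (int (s div h) * int h) = int (s mod h)"
      by (metis minus_div_mult_eq_mod of_nat_mod uminus_add_conv_diff zdiv_int add.commute)
    finally have "s mod h \<ge> h" using nd by (intro hmin) (auto simp: dvd_eq_mod_eq_0)
    then show False using mod_less_divisor[OF h(1), of s] by linarith
  qed
  have AEdvd: "AE x in M. h dvd \<xi> x"
  proof -
    have "AE x in M. \<forall>s. \<not> h dvd s \<longrightarrow> \<xi> x \<noteq> s"
    proof (subst AE_all_countable, rule allI)
      fix s
      have "\<not> h dvd s \<Longrightarrow> prob {x \<in> space M. \<xi> x = s} = 0"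
        using supp[of s] hdvd[of s] by (metis measure_nonneg less_eq_real_def)
      then show "AE x in M. \<not> h dvd s \<longrightarrow> \<xi> x \<noteq> s"
        by (cases "h dvd s") (auto intro!: AE_I'[of "{x \<in> space M. \<xi> x = s}"] simp: null_sets_def emeasure_eq_measure)
    qed
    then show ?thesis by eventually_elim blast
  qed
  \<comment> \<open>Steps of size \<open>0\<close> are allowed, so the recursion for
    \<open>a z\<close> contains \<open>a z\<close> itself with weight \<open>p0\<close>. It still
    determines \<open>a z\<close>, because \<open>p0 < 1\<close>.\<close>
  define p0 where "p0 = prob {x \<in> space M. \<xi> x = 0}"
  have p0: "p0 < 1"
  proof (rule ccontr)
    assume "\<not> p0 < 1"
    then have "p0 = 1" using prob_le_1 by (simp add: p0_def antisym not_less)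
    then have "AE x in M. x \<in> {x \<in> space M. \<xi> x = 0}" unfolding p0_def by (subst AE_in_set_eq_1) auto
    then have "AE x in M. real (\<xi> x) = 0" by eventually_elim auto
    then have "(\<integral>x. real (\<xi> x) \<partial>M) = 0" by (rule integral_eq_zero_AE)
    then show False using pos by simp
  qed
  have vanish: "a z = 0" if nd: "\<not> int h dvd z - c" for z
  proof -
    have *: "\<forall>z. z < z0 + int n \<longrightarrow> \<not> int h dvd z - c \<longrightarrow> a z = 0" for n
    proof (induction n)
      case 0
      then show ?case using init by auto
    next
      case (Suc n)
      show ?case
      proof (intro allI impI)
        fix z assume z: "z < z0 + int (Suc n)" and nd: "\<not> int h dvd z - c"
        show "a z = 0"
        proof (cases "z < z0 + int n")
          case False
          then have zz: "z = z0 + int n" using z by simp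
          have "AE x in M. a (z - int (\<xi> x)) = a z * indicator {x \<in> space M. \<xi> x = 0} x"
            using AEdvd AE_space
          proof eventually_elim
            case (elim x)
            show ?case
            proof (cases "\<xi> x = 0")
              case False
              have "int h dvd int (\<xi> x)" using elim by simp
              have "\<not> int h dvd z - int (\<xi> x) - c"
              proof
                assume "int h dvd z - int (\<xi> x) - c"
                from dvd_add[OF this \<open>int h dvd int (\<xi> x)\<close>] show False using nd by simp
              qed
              moreover have "z - int (\<xi> x) < z0 + int n" using False zz by simp
              ultimately show ?thesis using Suc.IH False by (simp add: indicator_def)
            qed (use elim in \<open>simp add: indicator_def\<close>)
          qed
          then have "(\<integral>x. a (z - int (\<xi> x)) \<partial>M) = (\<integral>x. a z * indicator {x \<in> space M. \<xi> x = 0} x \<partial>M)"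
            by (intro integral_cong_AE) measurable
          also have "\<dots> = a z * p0" by (simp add: p0_def)
          finally have "(\<integral>x. a (z - int (\<xi> x)) \<partial>M) = a z * p0" .
          moreover have "z \<ge> z0" using zz by simp
          ultimately have "a z = a z * p0" using recursion[of z] by metis
          then show ?thesis using p0 by auto
        qed (use Suc.IH nd in auto)
      qed
    qed
    show ?thesis using *[of "nat (z - z0 + 1)"] nd by auto
  qed
  \<comment> \<open>By telescoping, \<open>W z - W (z - 1)\<close> is the defect of the recursion at
    \<open>z\<close>, so \<open>W\<close> is constant from \<open>z0 - 1\<close> on. Where
    \<open>a\<close> is close to \<open>l\<close> on its residue class, \<open>W\<close> is close to
    \<open>l * m / h\<close>, and this identifies \<open>l\<close>.\<close>
  define W where "W z = (\<integral>x. (\<Sum>i<\<xi> x. a (z - int i)) \<partial>M)" for z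
  have sm: "(\<lambda>x. \<Sum>i<\<xi> x. a (z - int i)) \<in> borel_measurable M" for z
    by (rule measurable_compose[OF xi]) simp
  have sb: "\<bar>\<Sum>i<n. a (z - int i)\<bar> \<le> B * real n" for z n
    using sum_norm_bound[of "{..<n}" "\<lambda>i. a (z - int i)" B] bounded_a by (simp add: mult.commute)
  have si: "integrable M (\<lambda>x. \<Sum>i<\<xi> x. a (z - int i))" for z
    by (rule Bochner_Integration.integrable_bound[of _ "\<lambda>x. B * real (\<xi> x)"])
      (use xi_int sm sb in \<open>auto intro!: AE_I2 order_trans[OF sb]\<close>)
  have Wstep: "W z = W (z - 1)" if "z \<ge> z0" for z
  proof -
    have tele: "(\<Sum>i<n. a (z - int i)) - (\<Sum>i<n. a (z - 1 - int i)) = a z - a (z - int n)" for n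
      by (induction n) (auto simp: algebra_simps)
    have "W z - W (z - 1) = (\<integral>x. a z - a (z - int (\<xi> x)) \<partial>M)"
      unfolding W_def using si by (simp flip: Bochner_Integration.integral_diff add: tele)
    also have "\<dots> = a z - (\<integral>x. a (z - int (\<xi> x)) \<partial>M)"
      using integrable_shifted[where ?z0.0 = z0 and z = z, OF xi xi_int bounded_a recursion] by (simp add: prob_space)
    also have "\<dots> = 0" by (simp only: recursion[OF that, symmetric] diff_self)
    finally show ?thesis by simp
  qed
  have Wconst: "W z = W (z0 - 1)" if "z \<ge> z0 - 1" for z
    using that
  proof (induction z rule: int_ge_induct)
    case (step i)
    then show ?case using Wstep[of "i + 1"] by simp
  qed simp
  define m where "m = (\<integral>x. real (\<xi> x) \<partial>M)"
  define l where "l = real h * W (z0 - 1) / m"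
  have W0: "W z \<ge> 0" for z
    unfolding W_def by (intro Bochner_Integration.integral_nonneg sum_nonneg nonneg)
  have l0: "l \<ge> 0" using W0 pos by (simp add: l_def m_def)
  have B0: "B \<ge> 0" using bounded_a[of 0] by linarith
  define b where "b n = a (c + int h * int n)" for n
  have lim: "b \<longlonglongrightarrow> l"
  proof -
    \<comment> \<open>The error made in \<open>W\<close> when all values of \<open>a\<close> on the
      residue class are replaced by \<open>b n\<close>. It tends to \<open>0\<close> pointwise,
      since it has finitely many summands and multiples of \<open>h\<close> are asymptotic periods,
      and \<open>2 * B * \<xi>\<close> dominates it.\<close>
    define E where "E n x = (\<Sum>j<\<xi> x div h. a (c + int h * int n - int h * int j) - b n)" for n x
    have Em: "E n \<in> borel_measurable M" for n
      unfolding E_def by (rule measurable_compose[OF xi]) simp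
    have Eb: "\<bar>E n x\<bar> \<le> 2 * B * real (\<xi> x)" for n x
    proof -
      have "norm (E n x) \<le> of_nat (card {..<\<xi> x div h}) * (2 * B)"
        unfolding E_def
      proof (rule sum_norm_bound)
        fix j show "norm (a (c + int h * int n - int h * int j) - b n) \<le> 2 * B"
          using bounded_a[of "c + int h * int n - int h * int j"] bounded_a[of "c + int h * int n"]
          unfolding b_def real_norm_def by linarith
      qed
      also have "\<dots> \<le> real (\<xi> x) * (2 * B)" using B0 by (intro mult_right_mono) auto
      finally show ?thesis by (simp add: mult.commute)
    qed
    have Elim: "(\<lambda>n. \<integral>x. E n x \<partial>M) \<longlonglongrightarrow> (\<integral>x. (0::real) \<partial>M)"
    proof (rule integral_dominated_convergence[where w = "\<lambda>x. 2 * B * real (\<xi> x)"])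
      show "AE x in M. (\<lambda>n. E n x) \<longlonglongrightarrow> 0"
      proof (rule AE_I2)
        fix x
        have f: "filterlim (\<lambda>n. c + int h * int n) at_top sequentially"
        proof (rule filterlim_at_top_mono[of "\<lambda>n. int n + c"])
          show "filterlim (\<lambda>n. int n + c) at_top sequentially"
            using filterlim_compose[OF filterlim_int_shift[of "- c"] filterlim_int_sequentially] by simp
          show "eventually (\<lambda>n. int n + c \<le> c + int h * int n) sequentially"
            using h by (intro always_eventually allI) (simp add: mult_le_cancel_right1)
        qed
        have "(\<lambda>n. a (c + int h * int n - int h * int j) - b n) \<longlonglongrightarrow> 0" for j
        proof -
          have "int h * int j \<in> G" using Gmult[OF h(2), of j] by (simp add: mult.commute)
          then have "((\<lambda>z. a z - a (z - int h * int j)) \<longlongrightarrow> 0) at_top" by (simp add: G_def)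
          from tendsto_minus[OF filterlim_compose[OF this f]] show ?thesis by (simp add: b_def)
        qed
        then show "(\<lambda>n. E n x) \<longlonglongrightarrow> 0" unfolding E_def
          by (auto intro!: tendsto_null_sum)
      qed
    qed (use xi_int Em Eb in auto)
    have EW: "eventually (\<lambda>n. (\<integral>x. E n x \<partial>M) = W (z0 - 1) - b n * (m / real h)) sequentially"
    proof -
      have "W z = (\<integral>x. E n x \<partial>M) + b n * (m / real h)" if z: "z = c + int h * int n" for n z
      proof -
        have "AE x in M. (\<Sum>i<\<xi> x. a (z - int i)) = E n x + b n * (real (\<xi> x) / real h)"
          using AEdvd
        proof eventually_elim
          case (elim x)
          then obtain q where q: "\<xi> x = h * q" by (rule dvdE)
          \<comment> \<open>Off the residue class the summands vanish, so that
            \<open>q = \<xi> / h\<close> of them remain.\<close>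
          have "(\<Sum>i<h * q. a (z - int i)) = (\<Sum>i\<in>(\<lambda>j. h * j) ` {..<q}. a (z - int i))"
          proof (rule sum.mono_neutral_right)
            show "(\<lambda>j. h * j) ` {..<q} \<subseteq> {..<h * q}" using h by auto
            show "\<forall>i\<in>{..<h * q} - (\<lambda>j. h * j) ` {..<q}. a (z - int i) = 0"
            proof
              fix i assume i: "i \<in> {..<h * q} - (\<lambda>j. h * j) ` {..<q}"
              have "\<not> h dvd i"
              proof
                assume "h dvd i"
                then obtain r where "i = h * r" by (rule dvdE)
                then show False using i h by auto
              qed
              then have "\<not> int h dvd int i" by simp
              then have "\<not> int h dvd (z - int i) - c"
                using dvd_diff_right_iff[of "int h" "int h * int n" "int i"] by (simp add: z)
              then show "a (z - int i) = 0" by (rule vanish)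
            qed
          qed simp
          also have "\<dots> = (\<Sum>j<q. a (z - int h * int j))"
            by (subst sum.reindex) (use h in \<open>auto simp: inj_on_def\<close>)
          also have "\<dots> = E n x + b n * (real (\<xi> x) / real h)"
            using h by (simp add: E_def q z sum_subtractf)
          finally show ?case by (simp add: q)
        qed
        then have "W z = (\<integral>x. E n x + b n * (real (\<xi> x) / real h) \<partial>M)"
          unfolding W_def using sm Em by (intro integral_cong_AE) auto
        also have "\<dots> = (\<integral>x. E n x \<partial>M) + b n * (m / real h)"
        proof -
          have "integrable M (E n)"
            by (rule Bochner_Integration.integrable_bound[of _ "\<lambda>x. 2 * B * real (\<xi> x)"])
              (use xi_int Em Eb in \<open>auto intro!: AE_I2 order_trans[OF Eb]\<close>)
          then show ?thesis using xi_int by (simp add: m_def)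
        qed
        finally show ?thesis .
      qed
      moreover have "eventually (\<lambda>n. c + int h * int n \<ge> z0 - 1) sequentially"
      proof (rule eventually_sequentiallyI)
        fix n assume n: "n \<ge> nat (z0 - c)"
        have "int n \<le> int h * int n" using h by (simp add: mult_le_cancel_right1)
        then show "c + int h * int n \<ge> z0 - 1" using n by linarith
      qed
      ultimately show ?thesis
      proof (elim eventually_mono, goal_cases)
        case (1 n)
        note W = 1(1)
        from 1(2) show "(\<integral>x. E n x \<partial>M) = W (z0 - 1) - b n * (m / real h)"
          using W[OF refl, of n] Wconst[of "c + int h * int n"] by linarith
      qed
    qed
    have "(\<lambda>n. W (z0 - 1) - b n * (m / real h)) \<longlonglongrightarrow> 0"
      using Elim EW by (simp add: tendsto_cong)
    from tendsto_mult_left[OF tendsto_diff[OF tendsto_const this], of "real h / m" "W (z0 - 1)"]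
    have "(\<lambda>n. (real h / m) * (b n * (m / real h))) \<longlonglongrightarrow> (real h / m) * W (z0 - 1)" by simp
    moreover have "(real h / m) * (b n * (m / real h)) = b n" for n
      using h(1) pos by (simp add: m_def)
    ultimately show ?thesis by (simp add: l_def)
  qed
  have conv: "\<exists>z1. \<forall>z\<ge>z1. int h dvd z - c \<longrightarrow> \<bar>a z - l\<bar> < e" if e: "e > 0" for e
  proof -
    have "\<exists>N. \<forall>n\<ge>N. norm (b n - l) < e" by (rule LIMSEQ_D[OF lim e])
    then obtain N where N: "\<forall>n\<ge>N. norm (b n - l) < e" ..
    show ?thesis
    proof (intro exI[of _ "c + int h * int N"] allI impI)
      fix z assume z: "z \<ge> c + int h * int N" and dv: "int h dvd z - c"
      from dv obtain r where r: "z - c = int h * r" by (rule dvdE)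
      then have "int h * r \<ge> int h * int N" using z by simp
      then have "r \<ge> int N" using h by simp
      then have "z = c + int h * int (nat r)" "nat r \<ge> N" using r by auto
      then show "\<bar>a z - l\<bar> < e" using N[rule_format, of "nat r"] by (simp add: b_def)
    qed
  qed
  \<comment> \<open>The integrand of \<open>W z\<close> is nonnegative and contains the summand
    \<open>a z\<close> whenever \<xi> is nonzero.\<close>
  have zero: "a z = 0" if "l = 0" "z \<ge> z0" for z
  proof -
    have "W (z0 - 1) = 0" using that h pos by (simp add: l_def m_def)
    then have "(\<integral>x. (\<Sum>i<\<xi> x. a (z - int i)) \<partial>M) = 0" using Wconst[of z] that by (simp add: W_def)
    moreover have "a z * (1 - p0) \<le> (\<integral>x. (\<Sum>i<\<xi> x. a (z - int i)) \<partial>M)"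
    proof -
      have "a z * (1 - p0) = (\<integral>x. a z * (1 - indicator {x \<in> space M. \<xi> x = 0} x) \<partial>M)"
        by (simp add: p0_def prob_space emeasure_eq_measure)
      also have "\<dots> \<le> (\<integral>x. (\<Sum>i<\<xi> x. a (z - int i)) \<partial>M)"
      proof (rule integral_mono[OF _ si])
        fix x assume x: "x \<in> space M"
        show "a z * (1 - indicator {x \<in> space M. \<xi> x = 0} x) \<le> (\<Sum>i<\<xi> x. a (z - int i))"
        proof (cases "\<xi> x = 0")
          case False
          have "(\<Sum>i\<in>{0}. a (z - int i)) \<le> (\<Sum>i<\<xi> x. a (z - int i))"
            using False by (intro sum_mono2 nonneg) auto
          then show ?thesis using False by (simp add: indicator_def)
        qed (use x in \<open>simp add: indicator_def\<close>)
      qed (simp add: emeasure_eq_measure)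
      finally show ?thesis .
    qed
    ultimately have "a z * (1 - p0) \<le> 0" by simp
    then show ?thesis using p0 nonneg[of z] by (simp add: mult_le_0_iff)
  qed
  show ?thesis
    using h l0 AEdvd vanish conv zero by (intro exI[of _ h] exI[of _ l]) auto
qed

end

end

section \<open>Convergence of distributions and moments from characteristic functions\<close>

text \<open>Levy's continuity theorem is about sequences. If the limit along the filter failed, bad
  points of \<open>S\<close> could be picked beyond every bound and would form a bad sequence. For a
  bounded \<open>S\<close> there is no such sequence, and the filter is trivial.\<close>

lemma tendsto_at_top_within_sequentially:
  fixes f :: "real \<Rightarrow> 'b::topological_space"
  assumes "\<And>X::nat \<Rightarrow> real. (\<And>n. X n \<in> S) \<Longrightarrow> (\<And>n. X n \<ge> x0) \<Longrightarrow>
    filterlim X at_top sequentially \<Longrightarrow> ((\<lambda>n. f (X n)) \<longlongrightarrow> l) sequentially"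
  shows "(f \<longlongrightarrow> l) (inf at_top (principal S))"
proof (rule topological_tendstoI, rule ccontr)
  fix A assume A: "open A" "l \<in> A" and "\<not> eventually (\<lambda>x. f x \<in> A) (inf at_top (principal S))"
  then have "\<not> (\<exists>y. \<forall>x\<ge>y. x \<in> S \<longrightarrow> f x \<in> A)"
    by (simp add: eventually_inf_principal eventually_at_top_linorder)
  then have "\<forall>n::nat. \<exists>x. x \<ge> max x0 (real n) \<and> x \<in> S \<and> f x \<notin> A" by blast
  then obtain X where X: "\<And>n::nat. X n \<ge> max x0 (real n)" "\<And>n. X n \<in> S" "\<And>n. f (X n) \<notin> A"
    by metis
  have "filterlim X at_top sequentially"
    by (rule filterlim_at_top_mono[OF filterlim_real_sequentially]) (use X(1) in auto)
  then have "(\<lambda>n. f (X n)) \<longlonglongrightarrow> l" using X by (intro assms) auto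
  then have "eventually (\<lambda>n. f (X n) \<in> A) sequentially" using A by (rule topological_tendstoD)
  then have "eventually (\<lambda>n::nat. False) sequentially" by (rule eventually_mono) (use X(3) in simp)
  then show False by simp
qed

section \<open>Bounded moments turn weak convergence into convergence of moments\<close>

context
  fixes \<mu> :: "nat \<Rightarrow> real measure" and L :: "real measure" and C :: "nat \<Rightarrow> real"
  assumes mu: "\<And>n. real_distribution (\<mu> n)" and L: "real_distribution L" and conv: "weak_conv_m \<mu> L"
    and int: "\<And>n p. integrable (\<mu> n) (\<lambda>y. \<bar>y\<bar> ^ p)"
    and bound: "\<And>n p. (\<integral>y. \<bar>y\<bar> ^ p \<partial>\<mu> n) \<le> C p"
begin

definition cutoff :: "real \<Rightarrow> real \<Rightarrow> real" where
  "cutoff R y = max (- R) (min R y)"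

lemma isCont_cutoff: "isCont (cutoff R) y"
  unfolding cutoff_def[abs_def] by (intro continuous_intros)

lemma cutoff_abs_le: "R \<ge> 0 \<Longrightarrow> \<bar>cutoff R y\<bar> \<le> R" "R \<ge> 0 \<Longrightarrow> \<bar>cutoff R y\<bar> \<le> \<bar>y\<bar>"
  by (auto simp: cutoff_def)

lemma cutoff_id: "\<bar>y\<bar> \<le> R \<Longrightarrow> cutoff R y = y"
  by (auto simp: cutoff_def)

lemma integral_cutoff_tendsto:
  assumes g: "\<And>y. isCont g y" and gb: "\<And>y. \<bar>g y\<bar> \<le> 1 + \<bar>y\<bar> ^ q" and R: "R \<ge> 0"
  shows "(\<lambda>n. \<integral>y. g (cutoff R y) \<partial>\<mu> n) \<longlonglongrightarrow> (\<integral>y. g (cutoff R y) \<partial>L)"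
proof (rule weak_conv_imp_integral_bdd_continuous_conv[OF mu L conv])
  show "isCont (\<lambda>y. g (cutoff R y)) x" for x
    by (rule isCont_o2[OF isCont_cutoff g])
  show "norm (g (cutoff R x)) \<le> 1 + R ^ q" for x
    using gb[of "cutoff R x"] power_mono[OF cutoff_abs_le(1)[OF R, of x], of q] by simp
qed

text \<open>Weak convergence handles the moments of the clipped variable; Fatou's lemma removes the
  clipping and carries the bound over to \<open>L\<close>.\<close>

lemma limit_moment:
  "integrable L (\<lambda>y. \<bar>y\<bar> ^ p)" "(\<integral>y. \<bar>y\<bar> ^ p \<partial>L) \<le> C p"
proof -
  interpret L: real_distribution L by (rule L)
  have sets [measurable_cong, simp]: "sets L = sets borel" by simp
  have cm [measurable]: "cutoff R \<in> borel_measurable borel" for R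
    by (intro borel_measurable_continuous_onI continuous_at_imp_continuous_on ballI isCont_cutoff)
  have "0 \<le> (\<integral>y. \<bar>y\<bar> ^ p \<partial>\<mu> 0)" by (intro Bochner_Integration.integral_nonneg) simp
  then have Cp: "C p \<ge> 0" using bound[of 0 p] by linarith
  have ci: "integrable L (\<lambda>y. \<bar>cutoff (real R) y\<bar> ^ p)" for R
    by (rule L.integrable_const_bound[where B = "real R ^ p"])
      (auto intro!: power_mono simp: cutoff_abs_le)
  have cb: "(\<integral>y. \<bar>cutoff (real R) y\<bar> ^ p \<partial>L) \<le> C p" for R
  proof (rule LIMSEQ_le_const2)
    show "(\<lambda>n. \<integral>y. \<bar>cutoff (real R) y\<bar> ^ p \<partial>\<mu> n) \<longlonglongrightarrow> (\<integral>y. \<bar>cutoff (real R) y\<bar> ^ p \<partial>L)"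
      by (rule integral_cutoff_tendsto[of "\<lambda>y. \<bar>y\<bar> ^ p" p]) (auto intro!: continuous_intros)
    have "(\<integral>y. \<bar>cutoff (real R) y\<bar> ^ p \<partial>\<mu> n) \<le> C p" for n
    proof -
      interpret m: real_distribution "\<mu> n" by (rule mu)
      have "(\<integral>y. \<bar>cutoff (real R) y\<bar> ^ p \<partial>\<mu> n) \<le> (\<integral>y. \<bar>y\<bar> ^ p \<partial>\<mu> n)"
      proof (rule integral_mono[OF _ int])
        show "integrable (\<mu> n) (\<lambda>y. \<bar>cutoff (real R) y\<bar> ^ p)"
          by (rule m.integrable_const_bound[where B = "real R ^ p"])
            (auto intro!: power_mono simp: cutoff_abs_le)
      qed (auto intro!: power_mono simp: cutoff_abs_le)
      then show ?thesis using bound[of n p] by linarith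
    qed
    then show "\<exists>N. \<forall>n\<ge>N. (\<integral>y. \<bar>cutoff (real R) y\<bar> ^ p \<partial>\<mu> n) \<le> C p" by blast
  qed
  have lim: "liminf (\<lambda>R. ennreal (\<bar>cutoff (real R) y\<bar> ^ p)) = ennreal (\<bar>y\<bar> ^ p)" for y
  proof (rule lim_imp_Liminf[OF trivial_limit_sequentially tendsto_eventually])
    obtain N :: nat where "\<bar>y\<bar> \<le> real N" using real_arch_simple by blast
    then have "ennreal (\<bar>cutoff (real R) y\<bar> ^ p) = ennreal (\<bar>y\<bar> ^ p)" if "R \<ge> N" for R
      using that by (subst cutoff_id) auto
    then show "eventually (\<lambda>R. ennreal (\<bar>cutoff (real R) y\<bar> ^ p) = ennreal (\<bar>y\<bar> ^ p)) sequentially"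
      by (auto simp: eventually_sequentially)
  qed
  have "(\<integral>\<^sup>+y. ennreal (\<bar>y\<bar> ^ p) \<partial>L) = (\<integral>\<^sup>+y. liminf (\<lambda>R. ennreal (\<bar>cutoff (real R) y\<bar> ^ p)) \<partial>L)"
    by (simp add: lim)
  also have "\<dots> \<le> liminf (\<lambda>R. \<integral>\<^sup>+y. ennreal (\<bar>cutoff (real R) y\<bar> ^ p) \<partial>L)"
    by (rule nn_integral_liminf) auto
  also have "\<dots> \<le> limsup (\<lambda>R. \<integral>\<^sup>+y. ennreal (\<bar>cutoff (real R) y\<bar> ^ p) \<partial>L)"
    by (rule Liminf_le_Limsup) simp
  also have "\<dots> \<le> ennreal (C p)"
  proof (rule Limsup_bounded, rule always_eventually, rule allI)
    fix R
    have "(\<integral>\<^sup>+y. ennreal (\<bar>cutoff (real R) y\<bar> ^ p) \<partial>L) = ennreal (\<integral>y. \<bar>cutoff (real R) y\<bar> ^ p \<partial>L)"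
      by (rule nn_integral_eq_integral[OF ci]) simp
    then show "(\<integral>\<^sup>+y. ennreal (\<bar>cutoff (real R) y\<bar> ^ p) \<partial>L) \<le> ennreal (C p)"
      using cb by (simp add: ennreal_leI)
  qed
  finally have le: "(\<integral>\<^sup>+y. ennreal (\<bar>y\<bar> ^ p) \<partial>L) \<le> ennreal (C p)" .
  show i: "integrable L (\<lambda>y. \<bar>y\<bar> ^ p)"
  proof (rule integrableI_nonneg)
    show "(\<integral>\<^sup>+y. ennreal (\<bar>y\<bar> ^ p) \<partial>L) < \<infinity>" using le_less_trans[OF le ennreal_less_top] by simp
  qed auto
  show "(\<integral>y. \<bar>y\<bar> ^ p \<partial>L) \<le> C p"
    using le Cp by (subst (asm) nn_integral_eq_integral[OF i]) (simp_all add: ennreal_le_iff)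
qed

text \<open>A bounded moment of order \<open>Suc q\<close> gives uniform integrability: clipping at
  \<open>R\<close> changes the integral of \<open>g\<close> by at most a multiple of
  \<open>1 / R\<close>, uniformly over the sequence and its limit.\<close>

lemma integral_tendsto_of_moments:
  assumes g: "\<And>y. isCont g y" and gb: "\<And>y. \<bar>g y\<bar> \<le> 1 + \<bar>y\<bar> ^ q"
  shows "integrable L g" "\<And>n. integrable (\<mu> n) g" "(\<lambda>n. \<integral>y. g y \<partial>\<mu> n) \<longlonglongrightarrow> (\<integral>y. g y \<partial>L)"
proof -
  have gm: "g \<in> borel_measurable borel"
    by (intro borel_measurable_continuous_onI continuous_at_imp_continuous_on ballI g)
  have cm: "cutoff R \<in> borel_measurable borel" for R
    by (intro borel_measurable_continuous_onI continuous_at_imp_continuous_on ballI isCont_cutoff)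
  have gcm: "(\<lambda>y. g (cutoff R y)) \<in> borel_measurable borel" for R
    by (rule measurable_compose[OF cm gm])
  have gi: "integrable \<nu> g" if "real_distribution \<nu>" "integrable \<nu> (\<lambda>y. \<bar>y\<bar> ^ q)" for \<nu>
  proof -
    interpret real_distribution \<nu> by fact
    show ?thesis
      by (rule Bochner_Integration.integrable_bound[of _ "\<lambda>y. 1 + \<bar>y\<bar> ^ q"])
        (use that(2) gm gb in \<open>simp_all add: order_trans[OF gb]\<close>)
  qed
  have tail: "\<bar>(\<integral>y. g y \<partial>\<nu>) - (\<integral>y. g (cutoff R y) \<partial>\<nu>)\<bar> \<le> 4 * C (Suc q) / R"
    if nu: "real_distribution \<nu>" "\<And>p. integrable \<nu> (\<lambda>y. \<bar>y\<bar> ^ p)" "(\<integral>y. \<bar>y\<bar> ^ Suc q \<partial>\<nu>) \<le> C (Suc q)"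
      and R: "R \<ge> 1" for \<nu> R
  proof -
    interpret nu: real_distribution \<nu> by fact
    have gci: "integrable \<nu> (\<lambda>y. g (cutoff R y))"
    proof (rule nu.integrable_const_bound[where B = "1 + R ^ q"])
      show "AE y in \<nu>. norm (g (cutoff R y)) \<le> 1 + R ^ q"
        using gb power_mono[OF cutoff_abs_le(1), of R _ q] R
        by (auto intro!: AE_I2 order_trans[OF gb])
    qed (use gcm in simp)
    \<comment> \<open>For \<open>\<bar>y\<bar> > R \<ge> 1\<close> both values of \<open>g\<close>
      are at most \<open>2 * \<bar>y\<bar> ^ q\<close> in modulus, and a factor
      \<open>\<bar>y\<bar> / R \<ge> 1\<close> raises this to the next moment.\<close>
    have pt: "\<bar>g y - g (cutoff R y)\<bar> \<le> 4 / R * \<bar>y\<bar> ^ Suc q" for y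
    proof (cases "\<bar>y\<bar> \<le> R")
      case True
      then show ?thesis using R by (simp add: cutoff_id)
    next
      case False
      have p1: "1 \<le> \<bar>y\<bar> ^ q" using False R by (intro one_le_power) simp
      have "\<bar>cutoff R y\<bar> ^ q \<le> \<bar>y\<bar> ^ q" using R by (intro power_mono cutoff_abs_le) auto
      then have "\<bar>g y - g (cutoff R y)\<bar> \<le> 4 * \<bar>y\<bar> ^ q"
        using gb[of y] gb[of "cutoff R y"] p1 by linarith
      also have "\<dots> \<le> 4 * (\<bar>y\<bar> ^ q * (\<bar>y\<bar> / R))"
      proof -
        have "1 \<le> \<bar>y\<bar> / R" using False R by simp
        then have "\<bar>y\<bar> ^ q * 1 \<le> \<bar>y\<bar> ^ q * (\<bar>y\<bar> / R)" by (intro mult_left_mono) auto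
        then show ?thesis by simp
      qed
      also have "\<dots> = 4 / R * \<bar>y\<bar> ^ Suc q" by simp
      finally show ?thesis .
    qed
    have "\<bar>(\<integral>y. g y \<partial>\<nu>) - (\<integral>y. g (cutoff R y) \<partial>\<nu>)\<bar> = \<bar>\<integral>y. g y - g (cutoff R y) \<partial>\<nu>\<bar>"
      using gi[OF nu(1,2)] gci by simp
    also have "\<dots> \<le> (\<integral>y. \<bar>g y - g (cutoff R y)\<bar> \<partial>\<nu>)" by (rule integral_abs_bound)
    also have "\<dots> \<le> (\<integral>y. 4 / R * \<bar>y\<bar> ^ Suc q \<partial>\<nu>)"
    proof (rule integral_mono)
      show "integrable \<nu> (\<lambda>y. \<bar>g y - g (cutoff R y)\<bar>)" using gi[OF nu(1,2)] gci by simp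
      show "integrable \<nu> (\<lambda>y. 4 / R * \<bar>y\<bar> ^ Suc q)" using nu(2) by (rule integrable_mult_right)
    qed (rule pt)
    also have "\<dots> = 4 / R * (\<integral>y. \<bar>y\<bar> ^ Suc q \<partial>\<nu>)" by (rule integral_mult_right_zero)
    also have "\<dots> \<le> 4 / R * C (Suc q)" using R nu(3) by (intro mult_left_mono) auto
    finally show ?thesis by simp
  qed
  show "integrable L g" by (rule gi[OF L limit_moment(1)])
  show "integrable (\<mu> n) g" for n by (rule gi[OF mu int])
  show "(\<lambda>n. \<integral>y. g y \<partial>\<mu> n) \<longlonglongrightarrow> (\<integral>y. g y \<partial>L)"
  proof (rule LIMSEQ_I)
    fix e :: real assume e: "e > 0"
    \<comment> \<open>Chosen so that \<open>4 * C (Suc q) / R < e / 3\<close>: clipping on either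
      side costs less than a third of \<open>e\<close>, and weak convergence provides the remaining
      third.\<close>
    define R where "R = max 1 (12 * \<bar>C (Suc q)\<bar> / e + 1)"
    have R: "R \<ge> 1" by (simp add: R_def)
    have "12 * \<bar>C (Suc q)\<bar> / e < R" by (simp add: R_def)
    then have "12 * \<bar>C (Suc q)\<bar> < e * R" using e by (simp add: field_simps)
    then have "12 * C (Suc q) < e * R" by linarith
    then have small: "4 * C (Suc q) / R < e / 3" using R by (simp add: field_simps)
    have "(\<lambda>n. \<integral>y. g (cutoff R y) \<partial>\<mu> n) \<longlonglongrightarrow> (\<integral>y. g (cutoff R y) \<partial>L)"
      by (rule integral_cutoff_tendsto[OF g gb]) (use R in simp)
    from LIMSEQ_D[OF this, of "e / 3"] e obtain N where
      N: "\<And>n. n \<ge> N \<Longrightarrow> \<bar>(\<integral>y. g (cutoff R y) \<partial>\<mu> n) - (\<integral>y. g (cutoff R y) \<partial>L)\<bar> < e / 3" by auto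
    have "norm ((\<integral>y. g y \<partial>\<mu> n) - (\<integral>y. g y \<partial>L)) < e" if "n \<ge> N" for n
      using N[OF that] tail[OF mu int bound R, of n] tail[OF L limit_moment R] small
      unfolding real_norm_def by linarith
    then show "\<exists>N. \<forall>n\<ge>N. norm ((\<integral>y. g y \<partial>\<mu> n) - (\<integral>y. g y \<partial>L)) < e" by blast
  qed
qed

end

lemma isCont_abs_powr: "r > 0 \<Longrightarrow> isCont (\<lambda>y::real. \<bar>y\<bar> powr r) y"
proof -
  assume "r > 0"
  then have "continuous_on UNIV (\<lambda>y::real. \<bar>y\<bar> powr r)"
    by (intro continuous_on_powr' continuous_intros) auto
  then show ?thesis by (simp add: continuous_on_eq_continuous_at)
qed

lemma abs_powr_le: "r > 0 \<Longrightarrow> \<bar>y::real\<bar> powr r \<le> 1 + \<bar>y\<bar> ^ nat \<lceil>r\<rceil>"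
proof -
  assume r: "r > 0"
  show ?thesis
  proof (cases "\<bar>y\<bar> \<le> 1")
    case True
    then have "\<bar>y\<bar> powr r \<le> 1" using r powr_mono2[of r "\<bar>y\<bar>" 1] by simp
    then show ?thesis by (simp add: add_increasing2)
  next
    case False
    have "r \<le> real (nat \<lceil>r\<rceil>)" by linarith
    then have "\<bar>y\<bar> powr r \<le> \<bar>y\<bar> powr real (nat \<lceil>r\<rceil>)" using False by (intro powr_mono) auto
    also have "\<dots> = \<bar>y\<bar> ^ nat \<lceil>r\<rceil>" using False by (intro powr_realpow) auto
    finally show ?thesis by simp
  qed
qed

theorem conv_dist_all_moments_from_char:
  fixes \<mu> :: "real \<Rightarrow> real measure"
  assumes mu: "\<And>x. x \<in> S \<Longrightarrow> x \<ge> x0 \<Longrightarrow> real_distribution (\<mu> x)" and L: "real_distribution L"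
    and int: "\<And>x p. x \<in> S \<Longrightarrow> x \<ge> x0 \<Longrightarrow> integrable (\<mu> x) (\<lambda>y. \<bar>y\<bar> ^ p)"
    and bound: "\<And>x p. x \<in> S \<Longrightarrow> x \<ge> x0 \<Longrightarrow> (\<integral>y. \<bar>y\<bar> ^ p \<partial>\<mu> x) \<le> C p"
    and Lint: "\<And>p. integrable L (\<lambda>y. \<bar>y\<bar> ^ p)"
    and char: "\<And>t. ((\<lambda>x. char (\<mu> x) t) \<longlongrightarrow> char L t) (inf at_top (principal S))"
  shows "conv_dist_all_moments \<mu> L (inf at_top (principal S))"
proof -
  have main: "weak_conv_m (\<lambda>n. \<mu> (X n)) L" if X: "\<And>n. X n \<in> S" "\<And>n. X n \<ge> x0" "filterlim X at_top sequentially"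
    for X :: "nat \<Rightarrow> real"
  proof (rule levy_continuity)
    show "real_distribution (\<mu> (X n))" for n using X by (intro mu)
    show "real_distribution L" by (rule L)
    have "filterlim X (inf at_top (principal S)) sequentially"
      using X by (simp add: filterlim_inf filterlim_principal)
    then show "(\<lambda>n. char (\<mu> (X n)) t) \<longlonglongrightarrow> char L t" for t
      using filterlim_compose[OF char] by blast
  qed
  have mom: "moment_conv_along g \<mu> L (inf at_top (principal S))"
    if g: "\<And>y. isCont g y" "\<And>y. \<bar>g y\<bar> \<le> 1 + \<bar>y\<bar> ^ q" for g q
    unfolding moment_conv_along_def
  proof (intro conjI)
    interpret L: real_distribution L by (rule L)
    have gm: "g \<in> borel_measurable borel"
      by (intro borel_measurable_continuous_onI continuous_at_imp_continuous_on ballI g)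
    show "integrable L g"
      by (rule Bochner_Integration.integrable_bound[of _ "\<lambda>y. 1 + \<bar>y\<bar> ^ q"])
        (use Lint gm in \<open>simp_all add: order_trans[OF g(2)]\<close>)
    show "eventually (\<lambda>x. integrable (\<mu> x) g) (inf at_top (principal S))"
      unfolding eventually_inf_principal
    proof (rule eventually_mono[OF eventually_ge_at_top[of x0]], rule impI)
      fix x assume x: "x0 \<le> x" "x \<in> S"
      interpret real_distribution "\<mu> x" by (rule mu[OF x(2,1)])
      show "integrable (\<mu> x) g"
        by (rule Bochner_Integration.integrable_bound[of _ "\<lambda>y. 1 + \<bar>y\<bar> ^ q"])
          (use int[OF x(2,1)] gm in \<open>simp_all add: order_trans[OF g(2)]\<close>)
    qed
    show "((\<lambda>i. \<integral>y. g y \<partial>\<mu> i) \<longlongrightarrow> (\<integral>y. g y \<partial>L)) (inf at_top (principal S))"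
    proof (rule tendsto_at_top_within_sequentially[where ?x0.0 = x0])
      fix X :: "nat \<Rightarrow> real"
      assume X: "\<And>n. X n \<in> S" "\<And>n. X n \<ge> x0" "filterlim X at_top sequentially"
      show "(\<lambda>n. \<integral>y. g y \<partial>\<mu> (X n)) \<longlonglongrightarrow> (\<integral>y. g y \<partial>L)"
        by (rule integral_tendsto_of_moments(3)[of "\<lambda>n. \<mu> (X n)" L C g q, OF mu L main int bound g]) (rule X)+
    qed
  qed
  show ?thesis unfolding conv_dist_all_moments_def
  proof (intro conjI allI impI)
    show "weak_conv_along \<mu> L (inf at_top (principal S))"
      unfolding weak_conv_along_def
    proof (intro allI impI)
      fix y assume y: "isCont (cdf L) y"
      show "((\<lambda>i. cdf (\<mu> i) y) \<longlongrightarrow> cdf L y) (inf at_top (principal S))"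
        by (rule tendsto_at_top_within_sequentially[where ?x0.0 = x0])
          (use main y in \<open>auto simp: weak_conv_m_def weak_conv_def\<close>)
    qed
    show "moment_conv_along (\<lambda>y. y ^ k) \<mu> L (inf at_top (principal S))" for k
      by (rule mom[where q = k]) (auto intro!: continuous_intros simp: power_abs)
    show "moment_conv_along (\<lambda>y. \<bar>y\<bar> powr r) \<mu> L (inf at_top (principal S))" if "r > 0" for r
      by (rule mom[OF isCont_abs_powr[OF that]]) (use abs_powr_le[OF that] in auto)
  qed
qed

text \<open>Written as the image of the standard normal law under multiplication by
  \<open>sqrt v\<close>, the degenerate law for \<open>v = 0\<close> is treated together with the
  others.\<close>

lemma normal_law_char:
  assumes v: "v \<ge> 0"
  shows "real_distribution (normal_law 0 v)" "char (normal_law 0 v) t = complex_of_real (exp (- (v * t\<^sup>2 / 2)))"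
    and "integrable (normal_law 0 v) (\<lambda>y. \<bar>y\<bar> ^ p)"
proof -
  have d: "normal_law 0 v = distr std_normal_distribution borel (\<lambda>x. sqrt v * x)"
  proof (cases "v > 0")
    case True
    interpret N: prob_space std_normal_distribution
      by (rule prob_space_normal_density) simp
    have "distributed std_normal_distribution lborel (\<lambda>x. x) std_normal_density"
      by (simp add: distributed_def distr_id2)
    from N.normal_density_affine[OF this, of "sqrt v" 0]
    have "distributed std_normal_distribution lborel (\<lambda>x. sqrt v * x) (normal_density 0 (sqrt v))"
      using True by simp
    then show ?thesis using True
      by (simp add: normal_law_def distributed_def cong: distr_cong)
  next
    case False
    then have "v = 0" using v by simp
    interpret N: real_distribution std_normal_distribution by (rule real_dist_normal_dist)
    have "distr std_normal_distribution borel (\<lambda>x. 0 :: real) = return borel 0"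
      by (rule measure_eqI) (auto simp: emeasure_distr N.emeasure_space_1[simplified] indicator_def)
    then show ?thesis by (simp add: normal_law_def \<open>v = 0\<close>)
  qed
  interpret N: real_distribution std_normal_distribution by (rule real_dist_normal_dist)
  show "real_distribution (normal_law 0 v)" unfolding d by (rule N.real_distribution_distr) simp
  have "integrable std_normal_distribution (\<lambda>x. \<bar>x\<bar> ^ p)"
    using integrable_abs[OF integrable_std_normal_distribution_moment[of p]] by (simp add: power_abs)
  then have "integrable std_normal_distribution (\<lambda>x. \<bar>sqrt v * x\<bar> ^ p)"
    by (simp add: abs_mult power_mult_distrib)
  then show "integrable (normal_law 0 v) (\<lambda>y. \<bar>y\<bar> ^ p)"
    unfolding d by (subst integrable_distr_eq) simp_all
  have "char (normal_law 0 v) t = char std_normal_distribution (t * sqrt v)"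
    unfolding d char_def by (subst integral_distr) (simp_all add: mult.assoc)
  also have "\<dots> = complex_of_real (exp (- (v * t\<^sup>2 / 2)))"
    using v by (simp add: char_std_normal_distribution power_mult_distrib mult.commute)
  finally show "char (normal_law 0 v) t = complex_of_real (exp (- (v * t\<^sup>2 / 2)))" .
qed

section \<open>Limits of weight sums\<close>

text \<open>Count the subsets of \<open>{..<m}\<close> with \<open>a + b + 1\<close> elements by
  their element \<open>i\<close> that has exactly \<open>a\<close> elements below it. The formal
  proof is by induction on \<open>m\<close> with Pascal's rule.\<close>

lemma sum_choose_mult_choose:
  "(\<Sum>i<m. (i choose a) * ((m - 1 - i) choose b)) = m choose (a + b + 1)"
proof (induction m arbitrary: b)
  case 0
  then show ?case by simp
next
  case (Suc m)
  show ?case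
  proof (cases b)
    case 0
    have "(\<Sum>i<n. i choose a) = n choose (Suc a)" for n by (induction n) auto
    from this[of "Suc m"] show ?thesis by (simp add: 0 Suc_eq_plus1[symmetric] del: Suc_eq_plus1)
  next
    case (Suc b')
    have "(\<Sum>i<Suc m. (i choose a) * ((Suc m - 1 - i) choose b)) = (\<Sum>i<m. (i choose a) * ((m - i) choose b))"
      by (simp add: Suc)
    also have "\<dots> = (\<Sum>i<m. (i choose a) * ((m - 1 - i) choose b) + (i choose a) * ((m - 1 - i) choose b'))"
    proof (rule sum.cong[OF refl])
      fix i assume "i \<in> {..<m}"
      then have "m - i = Suc (m - 1 - i)" by auto
      then have "(m - i) choose b = ((m - 1 - i) choose b') + ((m - 1 - i) choose b)" by (simp add: Suc)
      then show "(i choose a) * ((m - i) choose b) = (i choose a) * ((m - 1 - i) choose b) + (i choose a) * ((m - 1 - i) choose b')"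
        by (simp add: distrib_left)
    qed
    also have "\<dots> = (m choose (a + b + 1)) + (m choose (a + b' + 1))"
      by (simp only: sum.distrib Suc.IH)
    also have "\<dots> = Suc m choose (a + b + 1)" by (simp add: Suc)
    finally show ?thesis .
  qed
qed

lemma pb_choose:
  fixes \<tau> :: "real \<Rightarrow> 'w \<Rightarrow> nat"
  assumes K: "\<And>w. K w \<ge> 1" and p: "poly_bounded A K 1 (\<lambda>x w. real (\<tau> x w))"
  shows "poly_bounded A K (real a) (\<lambda>x w. real (\<tau> x w choose a))"
    and "poly_bounded A K (real a - 1) (\<lambda>x w. real (\<tau> x w choose a) - real (\<tau> x w) ^ a / fact a)"
proof -
  have c: "real (\<tau> x w choose a) = 1 / fact a * (\<Prod>i<a. real (\<tau> x w) - real i)" for x w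
    by (simp add: binomial_gbinomial gbinomial_prod_rev lessThan_atLeast0)
  show "poly_bounded A K (real a) (\<lambda>x w. real (\<tau> x w choose a))"
    unfolding c by (rule pb_cmult[OF K pb_falling(1)[OF K p]])
  have eq: "real (\<tau> x w choose a) - real (\<tau> x w) ^ a / fact a
      = 1 / fact a * ((\<Prod>i<a. real (\<tau> x w) - real i) - real (\<tau> x w) ^ a)" for x w
    unfolding c by (simp add: right_diff_distrib)
  show "poly_bounded A K (real a - 1) (\<lambda>x w. real (\<tau> x w choose a) - real (\<tau> x w) ^ a / fact a)"
    unfolding eq by (rule pb_cmult[OF K pb_falling(2)[OF K p]])
qed

text \<open>Both sides have the leading term \<open>\<tau> ^ (a + a') / (fact a * fact a')\<close>.
  A single binomial coefficient is the goal because sums of such terms can be evaluated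
  exactly.\<close>

lemma pb_choose_mult:
  fixes \<tau> :: "real \<Rightarrow> 'w \<Rightarrow> nat"
  assumes K: "\<And>w. K w \<ge> 1" and p: "poly_bounded A K 1 (\<lambda>x w. real (\<tau> x w))"
  shows "poly_bounded A K (real a + real a' - 1) (\<lambda>x w. real (\<tau> x w choose a) * real (\<tau> x w choose a')
     - fact (a + a') / (fact a * fact a') * real (\<tau> x w choose (a + a')))"
proof -
  define q where "q x w = real (\<tau> x w)" for x w
  define D where "D a x w = real (\<tau> x w choose a) - q x w ^ a / fact a" for a x w
  have D: "poly_bounded A K (real a - 1) (D a)" for a
    unfolding D_def[abs_def] q_def by (rule pb_choose(2)[OF K p])
  have pw: "poly_bounded A K (real a) (\<lambda>x w. 1 / fact a * q x w ^ a)" for a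
    using pb_cmult[OF K pb_power[OF K p, of a], of "1 / fact a"] by (simp add: q_def)
  have "poly_bounded A K ((real a - 1) + real a') (\<lambda>x w. D a x w * real (\<tau> x w choose a'))"
    by (rule pb_mult[OF K D pb_choose(1)[OF K p]])
  moreover have "poly_bounded A K (real a + (real a' - 1)) (\<lambda>x w. (1 / fact a * q x w ^ a) * D a' x w)"
    by (rule pb_mult[OF K pw D])
  moreover have "poly_bounded A K (real (a + a') - 1) (\<lambda>x w. fact (a + a') / (fact a * fact a') * D (a + a') x w)"
    by (rule pb_cmult[OF K D])
  ultimately have "poly_bounded A K (real a + real a' - 1) (\<lambda>x w. (D a x w * real (\<tau> x w choose a')
      + (1 / fact a * q x w ^ a) * D a' x w) - fact (a + a') / (fact a * fact a') * D (a + a') x w)"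
    by (intro pb_diff[OF K] pb_add[OF K]) (simp_all add: algebra_simps)
  moreover have "(D a x w * real (\<tau> x w choose a')
      + (1 / fact a * q x w ^ a) * D a' x w) - fact (a + a') / (fact a * fact a') * D (a + a') x w
    = real (\<tau> x w choose a) * real (\<tau> x w choose a')
     - fact (a + a') / (fact a * fact a') * real (\<tau> x w choose (a + a'))" for x w
  proof -
    have alg: "((X - s / fa) * Y + (1 / fa * s) * (Y - s' / fa')) - f / (fa * fa') * (Z - (s * s') / f) = X * Y - f / (fa * fa') * Z"
      if "fa \<noteq> 0" "fa' \<noteq> 0" "f \<noteq> 0" for X Y Z s s' fa fa' f :: real
      using that by (simp add: field_simps)
    show ?thesis unfolding D_def power_add by (rule alg) simp_all
  qed
  ultimately show ?thesis by simp
qed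

lemma choose_over_power_tendsto: "(\<lambda>m. real (m choose a) / real m ^ a) \<longlonglongrightarrow> 1 / fact a"
proof -
  \<comment> \<open>The calculus of orders is reused with \<open>1\<close> as random constant and
    the time itself as path. Setting \<tau> to \<open>0\<close> beyond \<open>x\<close> makes it of
    order \<open>x\<close>, and \<open>x = m\<close> recovers the claim.\<close>
  define \<tau> :: "real \<Rightarrow> nat \<Rightarrow> nat" where "\<tau> x w = (if real w \<le> x then w else 0)" for x w
  have p: "poly_bounded (UNIV :: nat set) (\<lambda>_. 1) 1 (\<lambda>x w. real (\<tau> x w))"
    by (rule pb_le[OF _ pb_x]) (auto simp: \<tau>_def)
  have one: "\<And>w::nat. (1::real) \<ge> 1" by simp
  obtain C B where "\<And>x w. x \<ge> 1 \<Longrightarrow>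
      \<bar>real (\<tau> x w choose a) - real (\<tau> x w) ^ a / fact a\<bar> \<le> C * 1 ^ B * x powr (real a - 1)"
    using pb_choose(2)[OF one p, of a] unfolding poly_bounded_def by blast
  from this[of "real m" m for m] have C: "\<bar>real (m choose a) - real m ^ a / fact a\<bar> \<le> C * real m powr (real a - 1)"
    if "m \<ge> 1" for m using that by (simp add: \<tau>_def)
  have "\<bar>real (m choose a) / real m ^ a - 1 / fact a\<bar> \<le> C * (1 / real m)" if m: "m \<ge> 1" for m
  proof -
    have m0: "real m > 0" using m by simp
    have "\<bar>real (m choose a) / real m ^ a - 1 / fact a\<bar> = \<bar>real (m choose a) - real m ^ a / fact a\<bar> / real m ^ a"
    proof -
      have "real (m choose a) / real m ^ a - 1 / fact a = (real (m choose a) - real m ^ a / fact a) / real m ^ a"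
        using m0 by (simp add: diff_divide_distrib)
      then show ?thesis by (simp add: abs_divide)
    qed
    also have "\<dots> \<le> (C * real m powr (real a - 1)) / real m ^ a"
      by (intro divide_right_mono C m) simp
    also have "real m powr (real a - 1) = real m ^ a / real m"
      using m0 by (simp add: powr_diff powr_realpow)
    finally show ?thesis using m0 by simp
  qed
  then have ev: "eventually (\<lambda>m. norm (real (m choose a) / real m ^ a - 1 / fact a) \<le> C * (1 / real m)) sequentially"
    by (auto simp: eventually_sequentially)
  have "(\<lambda>m. C * (1 / real m)) \<longlonglongrightarrow> C * 0" by (rule tendsto_mult_left[OF lim_1_over_n])
  then have "(\<lambda>m. real (m choose a) / real m ^ a - 1 / fact a) \<longlonglongrightarrow> 0"
    by (intro Lim_null_comparison[OF ev]) simp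
  then show ?thesis by (rule LIM_zero_cancel)
qed

text \<open>The Beta integral of \<open>u ^ (i + j - 2) * (1 - u) ^ (2 * d - i - j)\<close> over the
  unit interval, divided by the four factorials: the Riemann-sum limit of products of two
  weights.\<close>

definition weight_limit :: "nat \<Rightarrow> nat \<Rightarrow> nat \<Rightarrow> real" where
  "weight_limit d i j = (fact (i + j - 2) * fact (2 * d - i - j)) /
     (fact (i - 1) * fact (j - 1) * fact (d - i) * fact (d - j) * fact (2 * d - 1))"

context iid_sequence
begin

text \<open>Products of two binomial coefficients in \<open>i\<close>, and of two in
  \<open>m - 1 - i\<close>, are replaced by single ones with an error of order
  \<open>m ^ (2 * d - 3)\<close> per term, hence \<open>m ^ (2 * d - 2)\<close> in total. The
  remaining sum is given by \<open>sum_choose_mult_choose\<close>.\<close>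

lemma weight_product_limit:
  assumes j: "j \<in> {1..d}" and k: "k \<in> {1..d}"
  shows "(\<lambda>m. (\<Sum>i<m. lin_weight d m i j * lin_weight d m i k) / real m ^ (2 * d - 1)) \<longlonglongrightarrow> weight_limit d j k"
proof -
  define a where "a = j - 1"
  define a' where "a' = k - 1"
  define b where "b = d - j"
  define b' where "b' = d - k"
  have ab: "a + b + 1 = d" "a' + b' + 1 = d" using j k by (auto simp: a_def b_def a'_def b'_def)
  have d1: "d \<ge> 1" using j by simp
  define \<kappa> :: real where "\<kappa> = fact (a + a') / (fact a * fact a')"
  define \<kappa>' :: real where "\<kappa>' = fact (b + b') / (fact b * fact b')"
  define \<tau> :: "real \<Rightarrow> nat \<Rightarrow> nat" where "\<tau> x i = (if real i \<le> x then i else 0)" for x i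
  define \<tau>' :: "real \<Rightarrow> nat \<Rightarrow> nat" where "\<tau>' x i = nat \<lfloor>x\<rfloor> - 1 - i" for x i
  let ?pb = "poly_bounded (UNIV :: nat set) (\<lambda>_. 1)"
  have one: "\<And>w::nat. (1::real) \<ge> 1" by simp
  have p: "?pb 1 (\<lambda>x w. real (\<tau> x w))"
    by (rule pb_le[OF _ pb_x]) (auto simp: \<tau>_def)
  have p': "?pb 1 (\<lambda>x w. real (\<tau>' x w))"
  proof (rule pb_le[OF one pb_x[OF one]])
    fix x :: real and w :: nat assume "x \<ge> 1"
    have "real (\<tau>' x w) \<le> real (nat \<lfloor>x\<rfloor>)" by (simp add: \<tau>'_def)
    also have "\<dots> \<le> x" using \<open>x \<ge> 1\<close> by simp
    finally show "\<bar>real (\<tau>' x w)\<bar> \<le> \<bar>x\<bar>" by simp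
  qed
  define D where "D x i = real (\<tau> x i choose a) * real (\<tau> x i choose a') - \<kappa> * real (\<tau> x i choose (a + a'))" for x i
  define D' where "D' x i = real (\<tau>' x i choose b) * real (\<tau>' x i choose b') - \<kappa>' * real (\<tau>' x i choose (b + b'))" for x i
  have pD: "?pb (real a + real a' - 1) D" unfolding D_def[abs_def] \<kappa>_def by (rule pb_choose_mult[OF one p])
  have pD': "?pb (real b + real b' - 1) D'" unfolding D'_def[abs_def] \<kappa>'_def by (rule pb_choose_mult[OF one p'])
  have e1: "?pb ((real a + real a' - 1) + (real b + real b')) (\<lambda>x i. D x i * (real (\<tau>' x i choose b) * real (\<tau>' x i choose b')))"
    by (rule pb_mult[OF one pD pb_mult[OF one pb_choose(1)[OF one p'] pb_choose(1)[OF one p']]])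
  have e2: "?pb (real (a + a') + (real b + real b' - 1)) (\<lambda>x i. (\<kappa> * real (\<tau> x i choose (a + a'))) * D' x i)"
    by (rule pb_mult[OF one pb_cmult[OF one pb_choose(1)[OF one p]] pD'])
  have ex: "(real a + real a' - 1) + (real b + real b') = real (2 * d - 2) - 1"
    "real (a + a') + (real b + real b' - 1) = real (2 * d - 2) - 1"
    using ab d1 by (auto simp: of_nat_diff)
  have "?pb (real (2 * d - 2) - 1) (\<lambda>x i. D x i * (real (\<tau>' x i choose b) * real (\<tau>' x i choose b'))
      + (\<kappa> * real (\<tau> x i choose (a + a'))) * D' x i)"
    by (rule pb_add[OF one e1[unfolded ex] e2[unfolded ex]])
  then obtain C B where C0: "C \<ge> 0" and CC: "\<And>x i. x \<ge> 1 \<Longrightarrow> \<bar>D x i * (real (\<tau>' x i choose b) * real (\<tau>' x i choose b'))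
      + (\<kappa> * real (\<tau> x i choose (a + a'))) * D' x i\<bar> \<le> C * 1 ^ B * x powr (real (2 * d - 2) - 1)"
    unfolding poly_bounded_def by blast
  define w where "w m i = lin_weight d m i j * lin_weight d m i k" for m i
  define v where "v m i = \<kappa> * \<kappa>' * (real (i choose (a + a')) * real ((m - 1 - i) choose (b + b')))" for m i
  have pt: "\<bar>w m i - v m i\<bar> \<le> C * real m powr (real (2 * d - 2) - 1)" if i: "i < m" for m i
  proof -
    have m1: "real m \<ge> 1" using i by simp
    have t: "\<tau> (real m) i = i" "\<tau>' (real m) i = m - 1 - i" using i by (auto simp: \<tau>_def \<tau>'_def)
    have "w m i - v m i = D (real m) i * (real (\<tau>' (real m) i choose b) * real (\<tau>' (real m) i choose b'))
      + (\<kappa> * real (\<tau> (real m) i choose (a + a'))) * D' (real m) i"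
      unfolding w_def v_def D_def D'_def t lin_weight_def a_def[symmetric] a'_def[symmetric] b_def[symmetric] b'_def[symmetric]
      by (simp add: algebra_simps)
    then show ?thesis using CC[OF m1, of i] by simp
  qed
  have sv: "(\<Sum>i<m. v m i) = \<kappa> * \<kappa>' * real (m choose (2 * d - 1))" for m
  proof -
    have "(\<Sum>i<m. v m i) = \<kappa> * \<kappa>' * real (\<Sum>i<m. (i choose (a + a')) * ((m - 1 - i) choose (b + b')))"
      by (simp add: v_def sum_distrib_left)
    moreover have "(a + a') + (b + b') + 1 = 2 * d - 1" using ab by simp
    ultimately show ?thesis by (simp only: sum_choose_mult_choose)
  qed
  have "\<bar>(\<Sum>i<m. w m i) / real m ^ (2 * d - 1) - \<kappa> * \<kappa>' * (real (m choose (2 * d - 1)) / real m ^ (2 * d - 1))\<bar> \<le> C * (1 / real m)"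
    if m: "m \<ge> 1" for m
  proof -
    have m0: "real m > 0" using m by simp
    have "\<bar>(\<Sum>i<m. w m i) - (\<Sum>i<m. v m i)\<bar> = \<bar>\<Sum>i<m. w m i - v m i\<bar>" by (simp add: sum_subtractf)
    also have "\<dots> \<le> (\<Sum>i<m. \<bar>w m i - v m i\<bar>)" by (rule sum_abs)
    also have "\<dots> \<le> (\<Sum>i<m. C * real m powr (real (2 * d - 2) - 1))" by (intro sum_mono pt) simp
    also have "\<dots> = C * (real m * (real m ^ (2 * d - 2) / real m))"
      using m0 by (simp add: powr_diff powr_realpow)
    also have "\<dots> = C * real m ^ (2 * d - 2)" using m0 by simp
    finally have le: "\<bar>(\<Sum>i<m. w m i) - (\<Sum>i<m. v m i)\<bar> \<le> C * real m ^ (2 * d - 2)" .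
    have "\<bar>(\<Sum>i<m. w m i) / real m ^ (2 * d - 1) - \<kappa> * \<kappa>' * (real (m choose (2 * d - 1)) / real m ^ (2 * d - 1))\<bar>
       = \<bar>(\<Sum>i<m. w m i) - (\<Sum>i<m. v m i)\<bar> / real m ^ (2 * d - 1)"
      using m0 by (simp add: sv diff_divide_distrib[symmetric] abs_divide)
    also have "\<dots> \<le> C * real m ^ (2 * d - 2) / real m ^ (2 * d - 1)" by (intro divide_right_mono le) simp
    also have "\<dots> = C * (1 / real m)"
    proof -
      have "2 * d - 1 = Suc (2 * d - 2)" using d1 by simp
      then show ?thesis using m0 by simp
    qed
    finally show ?thesis .
  qed
  then have ev: "eventually (\<lambda>m. norm ((\<Sum>i<m. w m i) / real m ^ (2 * d - 1) - \<kappa> * \<kappa>' * (real (m choose (2 * d - 1)) / real m ^ (2 * d - 1))) \<le> C * (1 / real m)) sequentially"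
    by (auto simp: eventually_sequentially)
  have "(\<lambda>m. C * (1 / real m)) \<longlonglongrightarrow> C * 0" by (rule tendsto_mult_left[OF lim_1_over_n])
  then have z: "(\<lambda>m. (\<Sum>i<m. w m i) / real m ^ (2 * d - 1) - \<kappa> * \<kappa>' * (real (m choose (2 * d - 1)) / real m ^ (2 * d - 1))) \<longlonglongrightarrow> 0"
    by (intro Lim_null_comparison[OF ev]) simp
  have "(\<lambda>m. \<kappa> * \<kappa>' * (real (m choose (2 * d - 1)) / real m ^ (2 * d - 1))) \<longlonglongrightarrow> \<kappa> * \<kappa>' * (1 / fact (2 * d - 1))"
    by (rule tendsto_mult_left[OF choose_over_power_tendsto])
  from tendsto_add[OF z this] have "(\<lambda>m. (\<Sum>i<m. w m i) / real m ^ (2 * d - 1)) \<longlonglongrightarrow> \<kappa> * \<kappa>' * (1 / fact (2 * d - 1))"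
    by simp
  moreover have "\<kappa> * \<kappa>' * (1 / fact (2 * d - 1)) = weight_limit d j k"
  proof -
    have "a + a' = j + k - 2" "b + b' = 2 * d - j - k" using j k by (auto simp: a_def a'_def b_def b'_def)
    then show ?thesis by (simp add: \<kappa>_def \<kappa>'_def weight_limit_def a_def a'_def b_def b'_def mult_ac)
  qed
  ultimately show ?thesis unfolding w_def by simp
qed

lemma sum_lin_weight: "j \<in> {1..d} \<Longrightarrow> (\<Sum>i<m. lin_weight d m i j) = real (m choose d)"
proof -
  assume j: "j \<in> {1..d}"
  have "(\<Sum>i<m. lin_weight d m i j) = real (\<Sum>i<m. (i choose (j - 1)) * ((m - 1 - i) choose (d - j)))"
    by (simp add: lin_weight_def)
  moreover have "(j - 1) + (d - j) + 1 = d" using j by auto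
  ultimately show ?thesis by (simp only: sum_choose_mult_choose)
qed

lemma choose_le_power: "real (n choose k) \<le> real n ^ k"
proof (cases "k \<le> n")
  case True
  then show ?thesis using binomial_le_pow[of k n] by (simp flip: of_nat_power)
qed (simp add: binomial_eq_0)

lemma lin_weight_bound:
  assumes j: "j \<in> {1..d}" and i: "i < m"
  shows "0 \<le> lin_weight d m i j" "lin_weight d m i j \<le> real m ^ (d - 1)"
proof -
  have "lin_weight d m i j \<le> real i ^ (j - 1) * real (m - 1 - i) ^ (d - j)"
    unfolding lin_weight_def by (intro mult_mono choose_le_power) auto
  also have "\<dots> \<le> real m ^ (j - 1) * real m ^ (d - j)"
    using i by (intro mult_mono power_mono) auto
  also have "\<dots> = real m ^ (d - 1)"
  proof -
    have "(j - 1) + (d - j) = d - 1" using j by auto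
    then show ?thesis by (simp flip: power_add)
  qed
  finally show "lin_weight d m i j \<le> real m ^ (d - 1)" .
qed (simp add: lin_weight_def)

text \<open>The sum \<open>H\<close> of the finitely many \<open>\<bar>G j\<bar>\<close> dominates
  all summands up to the factor \<open>C * b N\<close>, which yields the moment bounds of
  \<open>weighted_sum_clt\<close>; the variances are a quadratic form in the weight sums.\<close>

theorem weighted_combination_clt:
  fixes G :: "nat \<Rightarrow> 'b \<Rightarrow> real" and a :: "nat \<Rightarrow> nat \<Rightarrow> nat \<Rightarrow> real" and m :: "nat \<Rightarrow> nat" and b :: "nat \<Rightarrow> real"
  assumes J: "finite J" and G: "\<And>j. j \<in> J \<Longrightarrow> G j \<in> borel_measurable \<nu>"
    and int: "\<And>j. j \<in> J \<Longrightarrow> integrable \<nu> (\<lambda>y. G j y ^ (2 * 2))"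
    and mean: "\<And>j. j \<in> J \<Longrightarrow> (\<integral>y. G j y \<partial>\<nu>) = 0"
    and lim: "\<And>j k. j \<in> J \<Longrightarrow> k \<in> J \<Longrightarrow> (\<lambda>N. \<Sum>i<m N. a N i j * a N i k) \<longlonglongrightarrow> A j k"
    and ab: "\<And>N i j. i < m N \<Longrightarrow> j \<in> J \<Longrightarrow> \<bar>a N i j\<bar> \<le> C * b N"
    and b0: "\<And>N. b N \<ge> 0" and C: "C \<ge> 0" and mb: "\<And>N. real (m N) * b N ^ 2 \<le> C" and b: "b \<longlonglongrightarrow> 0"
  shows "(\<lambda>N. \<integral>w. iexp (t * (\<Sum>i<m N. \<Sum>j\<in>J. a N i j * G j (w i))) \<partial>S) \<longlonglongrightarrow>
    complex_of_real (exp (- ((\<Sum>j\<in>J. \<Sum>k\<in>J. A j k * (\<integral>y. G j y * G k y \<partial>\<nu>)) * t\<^sup>2 / 2)))"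
proof -
  define F where "F N i y = (\<Sum>j\<in>J. (if i < m N then a N i j else 0) * G j y)" for N i y
  define H where "H y = (\<Sum>j\<in>J. \<bar>G j y\<bar>)" for y
  have Fm: "F N i \<in> borel_measurable \<nu>" for N i
    unfolding F_def[abs_def] by (rule borel_measurable_sum[OF borel_measurable_times[OF borel_measurable_const G]])
  have Hm: "H \<in> borel_measurable \<nu>"
    unfolding H_def[abs_def] by (rule borel_measurable_sum[OF borel_measurable_abs[OF G]])
  have H0: "H y \<ge> 0" for y unfolding H_def by (intro sum_nonneg) simp
  have H4: "integrable \<nu> (\<lambda>y. H y ^ (2 * 2))"
    unfolding H_def
  proof (rule integrable_power_sum[OF _ J borel_measurable_abs[OF G]])
    show "integrable \<nu> (\<lambda>y. \<bar>G j y\<bar> ^ (2 * 2))" if "j \<in> J" for j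
      using int[OF that] by (simp add: power_even_abs)
  qed simp_all
  have small: "x ^ p \<le> 1 + x ^ (2 * 2)" if "x \<ge> 0" "p \<le> 4" for x :: real and p :: nat
  proof (cases "x \<le> 1")
    case True
    then have "x ^ p \<le> 1" using that by (intro power_le_one)
    then show ?thesis using that by (simp add: add_increasing2)
  next
    case False
    then have "x ^ p \<le> x ^ 4" using that by (intro power_increasing) auto
    then show ?thesis by simp
  qed
  have Hp: "integrable \<nu> (\<lambda>y. H y ^ p)" if "p \<le> 4" for p
  proof (rule Bochner_Integration.integrable_bound)
    show "integrable \<nu> (\<lambda>y. 1 + H y ^ (2 * 2))" using H4 by simp
    show "(\<lambda>y. H y ^ p) \<in> borel_measurable \<nu>" by (rule borel_measurable_power[OF Hm])
    show "AE y in \<nu>. norm (H y ^ p) \<le> norm (1 + H y ^ (2 * 2))"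
    proof (rule AE_I2)
      fix y show "norm (H y ^ p) \<le> norm (1 + H y ^ (2 * 2))"
        using small[OF H0 that, of y] zero_le_power[OF H0, of y p] by simp
    qed
  qed
  have GH: "\<bar>G j y\<bar> \<le> H y" if "j \<in> J" for j y
    unfolding H_def using that J by (intro member_le_sum[of j J "\<lambda>j. \<bar>G j y\<bar>"]) auto
  have G1: "integrable \<nu> (G j)" if "j \<in> J" for j
    by (rule integrable_of_power[OF M.finite_measure_axioms G[OF that] int[OF that]]) simp
  have GG: "integrable \<nu> (\<lambda>y. G j y * G k y)" if "j \<in> J" "k \<in> J" for j k
  proof (rule Bochner_Integration.integrable_bound[OF Hp[of 2]])
    show "(\<lambda>y. G j y * G k y) \<in> borel_measurable \<nu>" by (rule borel_measurable_times[OF G G]) fact+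
    show "AE y in \<nu>. norm (G j y * G k y) \<le> norm ((H y)\<^sup>2)"
    proof (rule AE_I2)
      fix y show "norm (G j y * G k y) \<le> norm ((H y)\<^sup>2)"
        using mult_mono[OF GH[OF that(1), of y] GH[OF that(2), of y] H0] by (simp add: abs_mult power2_eq_square)
    qed
  qed simp
  have FH: "\<bar>F N i y\<bar> \<le> (C * b N) * H y" for N i y
  proof -
    have "\<bar>F N i y\<bar> \<le> (\<Sum>j\<in>J. \<bar>(if i < m N then a N i j else 0) * G j y\<bar>)" unfolding F_def by (rule sum_abs)
    also have "\<dots> \<le> (\<Sum>j\<in>J. (C * b N) * \<bar>G j y\<bar>)"
    proof (rule sum_mono)
      fix j assume "j \<in> J"
      then have "\<bar>if i < m N then a N i j else 0\<bar> \<le> C * b N" using ab[of i N j] C b0[of N] by auto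
      then show "\<bar>(if i < m N then a N i j else 0) * G j y\<bar> \<le> (C * b N) * \<bar>G j y\<bar>"
        unfolding abs_mult by (intro mult_right_mono) auto
    qed
    finally show ?thesis by (simp add: H_def sum_distrib_left)
  qed
  have Fp: "integrable \<nu> (\<lambda>y. \<bar>F N i y\<bar> ^ p)" "(\<integral>y. \<bar>F N i y\<bar> ^ p \<partial>\<nu>) \<le> (C * b N) ^ p * (\<integral>y. H y ^ p \<partial>\<nu>)"
    if p: "p \<le> 4" for N i p
  proof -
    have le: "\<bar>F N i y\<bar> ^ p \<le> (C * b N) ^ p * H y ^ p" for y
      using power_mono[OF FH, of N i y p] by (simp add: power_mult_distrib)
    show i1: "integrable \<nu> (\<lambda>y. \<bar>F N i y\<bar> ^ p)"
    proof (rule Bochner_Integration.integrable_bound[OF integrable_mult_right[OF Hp[OF p], of "(C * b N) ^ p"]])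
      show "(\<lambda>y. \<bar>F N i y\<bar> ^ p) \<in> borel_measurable \<nu>" by (rule borel_measurable_power[OF borel_measurable_abs[OF Fm]])
      show "AE y in \<nu>. norm (\<bar>F N i y\<bar> ^ p) \<le> norm ((C * b N) ^ p * H y ^ p)"
        by (rule AE_I2) (use le in \<open>simp add: order_trans[OF _ abs_ge_self]\<close>)
    qed
    show "(\<integral>y. \<bar>F N i y\<bar> ^ p \<partial>\<nu>) \<le> (C * b N) ^ p * (\<integral>y. H y ^ p \<partial>\<nu>)"
      using integral_mono[OF i1 integrable_mult_right[OF Hp[OF p], of "(C * b N) ^ p"] le] by simp
  qed
  define C' where "C' = Max {C, C ^ 3 * (\<integral>y. H y ^ 3 \<partial>\<nu>), C ^ 2 * (\<integral>y. H y ^ 2 \<partial>\<nu>)}"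
  have C': "C \<le> C'" "C ^ 3 * (\<integral>y. H y ^ 3 \<partial>\<nu>) \<le> C'" "C ^ 2 * (\<integral>y. H y ^ 2 \<partial>\<nu>) \<le> C'"
    unfolding C'_def by (rule Max_ge; simp)+
  have F2: "(\<integral>y. (F N i y)\<^sup>2 \<partial>\<nu>) = (\<Sum>j\<in>J. \<Sum>k\<in>J. (a N i j * a N i k) * (\<integral>y. G j y * G k y \<partial>\<nu>))" if "i < m N" for N i
  proof -
    have "(F N i y)\<^sup>2 = (\<Sum>j\<in>J. \<Sum>k\<in>J. (a N i j * a N i k) * (G j y * G k y))" for y
      using that by (simp add: F_def power2_eq_square sum_product mult_ac)
    then show ?thesis using GG by (simp add: Bochner_Integration.integral_sum)
  qed
  have "(\<lambda>N. \<integral>w. iexp (t * (\<Sum>i<m N. F N i (w i))) \<partial>S) \<longlonglongrightarrow>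
    complex_of_real (exp (- ((\<Sum>j\<in>J. \<Sum>k\<in>J. A j k * (\<integral>y. G j y * G k y \<partial>\<nu>)) * t\<^sup>2 / 2)))"
  proof (rule weighted_sum_clt[where C = C' and b = b])
    show "F N i \<in> borel_measurable \<nu>" for N i by (rule Fm)
    show "integrable \<nu> (\<lambda>y. (F N i y)\<^sup>2)" for N i using Fp(1)[of 2 N i] by simp
    show "integrable \<nu> (\<lambda>y. \<bar>F N i y\<bar> ^ 3)" for N i using Fp(1)[of 3 N i] by simp
    show "(\<integral>y. F N i y \<partial>\<nu>) = 0" for N i
      unfolding F_def using G1 mean by (simp add: Bochner_Integration.integral_sum)
    have "(\<lambda>N. \<Sum>j\<in>J. \<Sum>k\<in>J. (\<Sum>i<m N. a N i j * a N i k) * (\<integral>y. G j y * G k y \<partial>\<nu>)) \<longlonglongrightarrow>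
      (\<Sum>j\<in>J. \<Sum>k\<in>J. A j k * (\<integral>y. G j y * G k y \<partial>\<nu>))"
      by (rule tendsto_sum, rule tendsto_sum, rule tendsto_mult_right, rule lim)
    moreover have "(\<Sum>i<m N. \<integral>y. (F N i y)\<^sup>2 \<partial>\<nu>) = (\<Sum>j\<in>J. \<Sum>k\<in>J. (\<Sum>i<m N. a N i j * a N i k) * (\<integral>y. G j y * G k y \<partial>\<nu>))" for N
    proof -
      have "(\<Sum>i<m N. \<integral>y. (F N i y)\<^sup>2 \<partial>\<nu>) = (\<Sum>i<m N. \<Sum>j\<in>J. \<Sum>k\<in>J. (a N i j * a N i k) * (\<integral>y. G j y * G k y \<partial>\<nu>))"
        by (intro sum.cong refl F2) simp
      also have "\<dots> = (\<Sum>j\<in>J. \<Sum>i<m N. \<Sum>k\<in>J. (a N i j * a N i k) * (\<integral>y. G j y * G k y \<partial>\<nu>))"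
        by (rule sum.swap)
      also have "\<dots> = (\<Sum>j\<in>J. \<Sum>k\<in>J. \<Sum>i<m N. (a N i j * a N i k) * (\<integral>y. G j y * G k y \<partial>\<nu>))"
        by (intro sum.cong refl sum.swap)
      finally show ?thesis by (simp only: sum_distrib_right)
    qed
    ultimately show "(\<lambda>N. \<Sum>i<m N. \<integral>y. (F N i y)\<^sup>2 \<partial>\<nu>) \<longlonglongrightarrow> (\<Sum>j\<in>J. \<Sum>k\<in>J. A j k * (\<integral>y. G j y * G k y \<partial>\<nu>))"
      by simp
    show "(\<integral>y. \<bar>F N i y\<bar> ^ 3 \<partial>\<nu>) \<le> C' * b N ^ 3" for N i
    proof -
      have "(\<integral>y. \<bar>F N i y\<bar> ^ 3 \<partial>\<nu>) \<le> (C ^ 3 * (\<integral>y. H y ^ 3 \<partial>\<nu>)) * b N ^ 3"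
        using Fp(2)[of 3 N i] by (simp add: power_mult_distrib mult_ac)
      also have "\<dots> \<le> C' * b N ^ 3" using b0 by (intro mult_right_mono C') simp
      finally show ?thesis .
    qed
    show "(\<integral>y. (F N i y)\<^sup>2 \<partial>\<nu>) \<le> C' * b N ^ 2" for N i
    proof -
      have "(\<integral>y. (F N i y)\<^sup>2 \<partial>\<nu>) \<le> (C ^ 2 * (\<integral>y. H y ^ 2 \<partial>\<nu>)) * b N ^ 2"
        using Fp(2)[of 2 N i] by (simp add: power_mult_distrib mult_ac)
      also have "\<dots> \<le> C' * b N ^ 2" by (intro mult_right_mono C') simp
      finally show ?thesis .
    qed
    show "0 \<le> C'" using C C' by linarith
    show "real (m N) * b N ^ 2 \<le> C'" for N using mb[of N] C' by linarith
  qed (rule b0 b)+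
  moreover have "(\<Sum>i<m N. F N i (w i)) = (\<Sum>i<m N. \<Sum>j\<in>J. a N i j * G j (w i))" for N w
    unfolding F_def by (intro sum.cong) auto
  ultimately show ?thesis by simp
qed

end

section \<open>The normalized statistic at the early time\<close>

lemma norm_iexp_diff_le:
  fixes t a b :: real
  shows "norm (iexp (t * a) - iexp (t * b)) \<le> \<bar>t\<bar> * \<bar>a - b\<bar>"
proof -
  define u where "u = t * (a - b)"
  have "t * a = t * b + u" by (simp add: u_def algebra_simps)
  then have "iexp (t * a) - iexp (t * b) = iexp (t * b) * (iexp u - 1)"
    by (simp only: of_real_add distrib_left exp_add right_diff_distrib mult_1_right)
  then have "norm (iexp (t * a) - iexp (t * b)) = norm (iexp u - 1)"
    by (simp only: norm_mult norm_exp_i_times mult_1_left)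
  also have "\<dots> \<le> \<bar>u\<bar>" using iexp_approx1[of u 0] by simp
  finally show ?thesis by (simp only: u_def abs_mult)
qed

locale renewal_ustat = iid_sequence \<nu> for \<nu> :: "'b measure" +
  fixes d :: nat and f :: "'b \<Rightarrow> real" and g :: "(nat \<Rightarrow> 'b) \<Rightarrow> real" and mu mg :: real
  assumes d: "d \<ge> 1"
    and f: "f \<in> borel_measurable \<nu>" and g: "g \<in> borel_measurable (kernel_space d)"
    and f_int: "\<And>k. k \<ge> 1 \<Longrightarrow> integrable \<nu> (\<lambda>y. f y ^ (2 * k))"
    and g_int: "\<And>k. k \<ge> 1 \<Longrightarrow> integrable (kernel_space d) (\<lambda>t. g t ^ (2 * k))"
    and mu_def: "mu = (\<integral>y. f y \<partial>\<nu>)" and mu: "mu > 0"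
    and mg_def: "mg = (\<integral>t. g t \<partial>kernel_space d)"
begin

definition fc :: "'b \<Rightarrow> real" where "fc y = f y - mu"
definition gc :: "(nat \<Rightarrow> 'b) \<Rightarrow> real" where "gc t = g t - mg"
definition T :: "nat \<Rightarrow> (nat \<Rightarrow> 'b) \<Rightarrow> real" where "T n w = (\<Sum>i<n. fc (w i))"
definition Z :: "nat \<Rightarrow> (nat \<Rightarrow> 'b) \<Rightarrow> real" where "Z n w = ustat d gc n w"
text \<open>The coefficient of \<open>(x / mu) ^ (d - 1) * T\<close> in
  \<open>path_approximation\<close> for \<open>c1 = mg\<close>; it accounts for the randomness of
  the renewal time.\<close>

definition cc :: real where "cc = mg / (fact (d - 1) * mu)"
definition Y :: "real \<Rightarrow> (nat \<Rightarrow> 'b) \<Rightarrow> real" where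
  "Y x w = (Z (early_time mu x) w - cc * (x / mu) ^ (d - 1) * T (early_time mu x) w) / x powr (real d - 1 / 2)"

text \<open>The variance as the limit theorem produces it, over the common denominator
  \<open>mu ^ (2 * d - 1)\<close>; \<open>gamma2_eq\<close> brings it into the shape of
  \<open>gamma_sq\<close>.\<close>

definition \<gamma>2 :: real where
  "\<gamma>2 = ((\<Sum>j=1..d. \<Sum>k=1..d. weight_limit d j k * (\<integral>y. proj d gc j y * proj d gc k y \<partial>\<nu>))
    - 2 * cc / fact d * (\<Sum>j=1..d. \<integral>y. fc y * proj d gc j y \<partial>\<nu>)
    + cc\<^sup>2 * (\<integral>y. fc y * fc y \<partial>\<nu>)) / mu ^ (2 * d - 1)"

lemma fc_m: "fc \<in> borel_measurable \<nu>"
  unfolding fc_def[abs_def] by (rule borel_measurable_diff[OF f borel_measurable_const])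

lemma gc_m: "gc \<in> borel_measurable (kernel_space d)"
  unfolding gc_def[abs_def] by (rule borel_measurable_diff[OF g borel_measurable_const])

lemma fc_int: "k \<ge> 1 \<Longrightarrow> integrable \<nu> (\<lambda>y. fc y ^ (2 * k))"
  unfolding fc_def by (rule integrable_power_add(2)[OF _ f borel_measurable_const f_int]) simp_all

lemma gc_int: "k \<ge> 1 \<Longrightarrow> integrable (kernel_space d) (\<lambda>t. gc t ^ (2 * k))"
proof -
  interpret K: prob_space "kernel_space d" by (rule prob_space_kernel_space)
  assume k: "k \<ge> 1"
  show ?thesis
    unfolding gc_def by (rule integrable_power_add(2)[OF k g borel_measurable_const g_int[OF k]]) simp
qed

lemma f_integrable: "integrable \<nu> f"
  by (rule integrable_of_power[OF M.finite_measure_axioms f f_int[OF order_refl] order_refl])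

lemma fc_mean: "(\<integral>y. fc y \<partial>\<nu>) = 0"
  unfolding fc_def using f_integrable by (simp add: M.prob_space mu_def[symmetric])

lemma g_integrable: "integrable (kernel_space d) g"
proof -
  interpret K: prob_space "kernel_space d" by (rule prob_space_kernel_space)
  show ?thesis by (rule integrable_of_power[OF K.finite_measure_axioms g g_int[OF order_refl] order_refl])
qed

lemma gc_mean: "(\<integral>t. gc t \<partial>kernel_space d) = 0"
proof -
  interpret K: prob_space "kernel_space d" by (rule prob_space_kernel_space)
  show ?thesis unfolding gc_def using g_integrable by (simp add: K.prob_space mg_def[symmetric])
qed

lemma gc_integrable: "integrable (kernel_space d) gc"
proof -
  interpret K: prob_space "kernel_space d" by (rule prob_space_kernel_space)
  show ?thesis by (rule integrable_of_power[OF K.finite_measure_axioms gc_m gc_int[OF order_refl] order_refl])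
qed

text \<open>This makes the centred walk a U-statistic of degree \<open>1\<close>, so that the moment
  and increment bounds for U-statistics also serve \<open>T\<close>.\<close>

definition fk :: "(nat \<Rightarrow> 'b) \<Rightarrow> real" where "fk t = fc (t 1)"

lemma fk_m: "fk \<in> borel_measurable (kernel_space 1)"
proof -
  have m: "(\<lambda>t. t 1) \<in> measurable (kernel_space 1) \<nu>" by (rule measurable_component_singleton) simp
  show ?thesis unfolding fk_def[abs_def] by (rule measurable_compose[OF m fc_m])
qed

lemma distr_kernel_1: "distr (kernel_space 1) \<nu> (\<lambda>t. t 1) = \<nu>"
  by (rule distr_PiM_component[of "{1..1}" "\<lambda>_. \<nu>"]) (simp_all add: prob_nu)

lemma fk_int: assumes k: "k \<ge> 1" shows "integrable (kernel_space 1) (\<lambda>t. fk t ^ (2 * k))"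
proof -
  have m: "(\<lambda>t. t 1) \<in> measurable (kernel_space 1) \<nu>" by (rule measurable_component_singleton) simp
  have "integrable (distr (kernel_space 1) \<nu> (\<lambda>t. t 1)) (\<lambda>y. fc y ^ (2 * k))"
    unfolding distr_kernel_1 by (rule fc_int[OF k])
  from integrable_distr[OF m this] show ?thesis by (simp add: fk_def)
qed

lemma fk_mean: "(\<integral>t. fk t \<partial>kernel_space 1) = 0"
proof -
  have m: "(\<lambda>t. t 1) \<in> measurable (kernel_space 1) \<nu>" by (rule measurable_component_singleton) simp
  show ?thesis unfolding fk_def integral_distr[OF m fc_m, symmetric] distr_kernel_1 by (rule fc_mean)
qed

lemma T_ustat: "T n w = ustat 1 fk n w"
  using ustat_Suc[of 0 fk n w] by (simp add: One_nat_def increasing_tuples_0 fk_def T_def)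

lemma T_m: "T n \<in> borel_measurable S"
  unfolding T_def[abs_def] by (rule borel_measurable_sum[OF measurable_coordinate[OF fc_m]])

lemma Z_m: "Z n \<in> borel_measurable S"
  unfolding Z_def[abs_def] by (rule measurable_ustat[OF gc_m])

lemma Y_m: "Y x \<in> borel_measurable S"
  unfolding Y_def[abs_def]
  by (rule borel_measurable_divide[OF borel_measurable_diff[OF Z_m borel_measurable_times[OF borel_measurable_const T_m]] borel_measurable_const])

lemma ustat_centered: "ustat d g n w = Z n w + mg * real (n choose d)"
  unfolding Z_def ustat_def gc_def by (simp add: sum_subtractf card_increasing_tuples mult.commute)

lemma sum_f_eq: "(\<Sum>i<n. f (w i)) = mu * real n + T n w"
  by (simp add: T_def fc_def sum_subtractf)

text \<open>At a time of order \<open>x\<close>, the moments of order \<open>2 * k\<close> of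
  \<open>Z\<close> and of \<open>x ^ (d - 1) * T\<close> are both of order
  \<open>x ^ (k * (2 * d - 1))\<close>, which is the corresponding power of the
  normalization.\<close>

lemma Y_moment_bound:
  assumes k: "k \<ge> 1"
  shows "\<exists>C\<ge>0. \<forall>x\<ge>1. integrable S (\<lambda>w. Y x w ^ (2 * k)) \<and> (\<integral>w. Y x w ^ (2 * k) \<partial>S) \<le> C"
proof -
  have mom: "\<exists>C\<ge>0. \<forall>n. (\<integral>w. ustat e h n w ^ (2 * k) \<partial>S) \<le> C * real n ^ (k * (2 * e - 1))"
    if e: "e \<ge> 1" and h: "h \<in> borel_measurable (kernel_space e)" "integrable (kernel_space e) (\<lambda>t. h t ^ (2 * k))"
      "(\<integral>t. h t \<partial>kernel_space e) = 0" for e h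
  proof -
    obtain C where C: "C \<ge> 0" and le: "\<And>m n. m \<le> n \<Longrightarrow> (\<integral>w. (ustat e h n w - ustat e h m w) ^ (2 * k) \<partial>S)
        \<le> C * real (n - m) ^ k * real n ^ (2 * k * (e - 1)) * (\<integral>t. h t ^ (2 * k) \<partial>kernel_space e)"
      using ustat_moment[OF k, of e] h by blast
    have H: "0 \<le> (\<integral>t. h t ^ (2 * k) \<partial>kernel_space e)"
      by (intro Bochner_Integration.integral_nonneg) (simp add: zero_le_even_power)
    have z: "ustat e h 0 w = 0" for w using e by (simp add: ustat_def increasing_tuples_empty)
    show ?thesis
    proof (intro exI[of _ "C * (\<integral>t. h t ^ (2 * k) \<partial>kernel_space e)"] conjI allI)
      show "0 \<le> C * (\<integral>t. h t ^ (2 * k) \<partial>kernel_space e)" using C H by simp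
      fix n
      have ex: "real n ^ k * real n ^ (2 * k * (e - 1)) = real n ^ (k * (2 * e - 1))"
      proof -
        obtain e' where "e = Suc e'" using e by (cases e) auto
        then have "k + 2 * k * (e - 1) = k * (2 * e - 1)" by (simp add: algebra_simps)
        then show ?thesis by (simp only: power_add[symmetric])
      qed
      have "(\<integral>w. ustat e h n w ^ (2 * k) \<partial>S) \<le> C * real n ^ k * real n ^ (2 * k * (e - 1)) * (\<integral>t. h t ^ (2 * k) \<partial>kernel_space e)"
        using le[of 0 n] by (simp add: z)
      also have "\<dots> = C * (\<integral>t. h t ^ (2 * k) \<partial>kernel_space e) * (real n ^ k * real n ^ (2 * k * (e - 1)))"
        by (simp only: mult_ac)
      finally show "(\<integral>w. ustat e h n w ^ (2 * k) \<partial>S) \<le> C * (\<integral>t. h t ^ (2 * k) \<partial>kernel_space e) * real n ^ (k * (2 * e - 1))"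
        unfolding ex .
    qed
  qed
  obtain C1 where C1: "C1 \<ge> 0" "\<And>n. (\<integral>w. Z n w ^ (2 * k) \<partial>S) \<le> C1 * real n ^ (k * (2 * d - 1))"
    using mom[OF d gc_m gc_int[OF k] gc_mean] unfolding Z_def by blast
  obtain C2 where C2: "C2 \<ge> 0" "\<And>n. (\<integral>w. T n w ^ (2 * k) \<partial>S) \<le> C2 * real n ^ (k * (2 * 1 - 1))"
    using mom[OF order_refl fk_m fk_int[OF k] fk_mean] unfolding T_ustat by blast
  have Zi: "integrable S (\<lambda>w. Z n w ^ (2 * k))" for n
    unfolding Z_def by (rule integrable_ustat_power[OF k gc_m gc_int[OF k]])
  have Ti: "integrable S (\<lambda>w. T n w ^ (2 * k))" for n
    unfolding T_ustat by (rule integrable_ustat_power[OF k fk_m fk_int[OF k]])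
  define D where "D = 4 ^ k * (C1 * (1 / mu) ^ (k * (2 * d - 1)) + (cc * (1 / mu) ^ (d - 1)) ^ (2 * k) * (C2 * (1 / mu) ^ k))"
  show ?thesis
  proof (intro exI[of _ D] conjI allI impI)
    show "0 \<le> D" unfolding D_def using C1 C2 mu by (simp add: zero_le_even_power)
    fix x :: real assume x: "x \<ge> 1"
    define m where "m = early_time mu x"
    define s where "s = cc * (x / mu) ^ (d - 1)"
    define q where "q = x powr (real d - 1 / 2)"
    have sTi: "integrable S (\<lambda>w. (s * T m w) ^ (2 * k))"
      unfolding power_mult_distrib by (rule integrable_mult_right[OF Ti])
    have sTm: "(\<lambda>w. s * T m w) \<in> borel_measurable S" by (rule borel_measurable_times[OF borel_measurable_const T_m])
    have i: "integrable S (\<lambda>w. (Z m w - s * T m w) ^ (2 * k))"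
      by (rule integrable_power_add(2)[OF k Z_m sTm Zi sTi])
    have Yeq: "Y x w ^ (2 * k) = (Z m w - s * T m w) ^ (2 * k) / q ^ (2 * k)" for w
      by (simp add: Y_def m_def s_def q_def power_divide)
    show "integrable S (\<lambda>w. Y x w ^ (2 * k))"
      unfolding Yeq by (rule integrable_divide) (rule i)
    have mx: "real m \<le> 1 / mu * x"
    proof -
      have "real m \<le> (x - x powr (3 / 4)) / mu" unfolding m_def by (rule early_time_bounds[OF mu x])
      also have "\<dots> \<le> x / mu" using mu by (intro divide_right_mono) auto
      finally show ?thesis by simp
    qed
    have qq: "q ^ (2 * k) = x ^ (k * (2 * d - 1))"
    proof -
      have "q ^ (2 * k) = x powr ((real d - 1 / 2) * real (2 * k))"
        using x by (simp add: q_def powr_realpow[symmetric] powr_powr)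
      also have "(real d - 1 / 2) * real (2 * k) = real (k * (2 * d - 1))"
        using d by (simp add: of_nat_diff algebra_simps)
      finally show ?thesis using x by (simp only: powr_realpow)
    qed
    have qpos: "q ^ (2 * k) > 0" unfolding qq using x by simp
    have "(\<integral>w. (Z m w - s * T m w) ^ (2 * k) \<partial>S) \<le> (\<integral>w. 4 ^ k * (Z m w ^ (2 * k) + (s * T m w) ^ (2 * k)) \<partial>S)"
      using i Zi sTi by (intro integral_mono diff_even_power_le(2)[OF k]) auto
    also have "\<dots> = 4 ^ k * ((\<integral>w. Z m w ^ (2 * k) \<partial>S) + s ^ (2 * k) * (\<integral>w. T m w ^ (2 * k) \<partial>S))"
      using Zi sTi Ti by (simp add: power_mult_distrib)
    also have "\<dots> \<le> 4 ^ k * (C1 * (1 / mu * x) ^ (k * (2 * d - 1)) + s ^ (2 * k) * (C2 * (1 / mu * x) ^ k))"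
    proof (intro mult_left_mono add_mono)
      show "(\<integral>w. Z m w ^ (2 * k) \<partial>S) \<le> C1 * (1 / mu * x) ^ (k * (2 * d - 1))"
        by (rule order_trans[OF C1(2)]) (intro mult_left_mono power_mono mx C1(1) of_nat_0_le_iff)
      have "C2 * real m ^ (k * (2 * 1 - 1)) \<le> C2 * (1 / mu * x) ^ (k * (2 * 1 - 1))"
        by (intro mult_left_mono power_mono mx C2(1) of_nat_0_le_iff)
      then show "(\<integral>w. T m w ^ (2 * k) \<partial>S) \<le> C2 * (1 / mu * x) ^ k"
        using C2(2)[of m] by simp
    qed (simp_all add: zero_le_even_power)
    also have "\<dots> = D * q ^ (2 * k)"
    proof -
      have s2: "s ^ (2 * k) * x ^ k = (cc * (1 / mu) ^ (d - 1)) ^ (2 * k) * x ^ (k * (2 * d - 1))"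
      proof -
        obtain d' where d': "d = Suc d'" using d by (cases d) auto
        have "s = cc * (1 / mu) ^ (d - 1) * x ^ (d - 1)" by (simp add: s_def power_divide)
        then have "s ^ (2 * k) * x ^ k = (cc * (1 / mu) ^ (d - 1)) ^ (2 * k) * (x ^ ((d - 1) * (2 * k)) * x ^ k)"
          by (simp only: power_mult_distrib power_mult mult.assoc)
        also have "x ^ ((d - 1) * (2 * k)) * x ^ k = x ^ (k * (2 * d - 1))"
          unfolding power_add[symmetric] d' by (simp add: algebra_simps)
        finally show ?thesis .
      qed
      have "s ^ (2 * k) * (C2 * (1 / mu * x) ^ k) = C2 * (1 / mu) ^ k * (s ^ (2 * k) * x ^ k)"
        by (simp only: power_mult_distrib mult_ac)
      then show ?thesis unfolding qq D_def s2 by (simp only: power_mult_distrib distrib_left distrib_right mult_ac)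
    qed
    finally show "(\<integral>w. Y x w ^ (2 * k) \<partial>S) \<le> D"
      unfolding Yeq using qpos by (simp add: pos_divide_le_eq)
  qed
qed

section \<open>The limit law of \<open>Y\<close> along a sequence of levels\<close>

context
  fixes X :: "nat \<Rightarrow> real"
  assumes X1: "\<And>n. X n \<ge> 1" and X: "filterlim X at_top sequentially"
begin

lemma inverse_powr_tendsto: "r > 0 \<Longrightarrow> (\<lambda>n. X n powr (- r)) \<longlonglongrightarrow> 0"
  by (rule filterlim_compose[OF _ X]) (rule tendsto_neg_powr, simp_all add: filterlim_ident)

lemma early_time_ratio: "(\<lambda>n. real (early_time mu (X n)) / X n) \<longlonglongrightarrow> 1 / mu"
proof -
  have le: "norm (real (early_time mu (X n)) / X n - 1 / mu) \<le> 1 / mu * X n powr (- (1 / 4)) + X n powr (- 1)" for n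
  proof -
    have x: "X n \<ge> 1" by (rule X1)
    have "\<bar>real (early_time mu (X n)) - X n / mu\<bar> \<le> X n powr (3 / 4) / mu + 1"
    proof -
      have "0 \<le> X n powr (3 / 4) / mu" using mu by simp
      moreover have "(X n - X n powr (3 / 4)) / mu = X n / mu - X n powr (3 / 4) / mu" by (rule diff_divide_distrib)
      ultimately show ?thesis using early_time_bounds[OF mu x] by linarith
    qed
    moreover have "real (early_time mu (X n)) / X n - 1 / mu = (real (early_time mu (X n)) - X n / mu) / X n"
      using x by (simp add: diff_divide_distrib)
    ultimately have "norm (real (early_time mu (X n)) / X n - 1 / mu) \<le> (X n powr (3 / 4) / mu + 1) / X n"
      using x by (simp add: abs_divide divide_right_mono)
    also have "\<dots> = 1 / mu * (X n powr (3 / 4) / X n powr 1) + 1 / X n powr 1"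
      using x by (simp add: add_divide_distrib)
    also have "\<dots> = 1 / mu * X n powr (- (1 / 4)) + X n powr (- 1)"
      unfolding powr_diff[symmetric] powr_minus_divide[of _ 1] by simp
    finally show ?thesis .
  qed
  have "(\<lambda>n. 1 / mu * X n powr (- (1 / 4)) + X n powr (- 1)) \<longlonglongrightarrow> 1 / mu * 0 + 0"
    by (rule tendsto_add[OF tendsto_mult_left[OF inverse_powr_tendsto] inverse_powr_tendsto]) simp_all
  then have z: "(\<lambda>n. 1 / mu * X n powr (- (1 / 4)) + X n powr (- 1)) \<longlonglongrightarrow> 0" by simp
  have "(\<lambda>n. real (early_time mu (X n)) / X n - 1 / mu) \<longlonglongrightarrow> 0"
    by (rule Lim_null_comparison[OF always_eventually z]) (rule allI, rule le)
  then show ?thesis by (rule LIM_zero_cancel)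
qed

lemma early_time_at_top: "filterlim (\<lambda>n. early_time mu (X n)) at_top sequentially"
proof -
  have "filterlim (\<lambda>n. (real (early_time mu (X n)) / X n) * X n) at_top sequentially"
    by (rule filterlim_tendsto_pos_mult_at_top[OF early_time_ratio _ X]) (use mu in simp)
  moreover have "(real (early_time mu (X n)) / X n) * X n = real (early_time mu (X n))" for n
    using X1[of n] by simp
  ultimately have "filterlim (\<lambda>n. real (early_time mu (X n))) at_top sequentially" by simp
  then show ?thesis
    unfolding filterlim_at_top
  proof (intro allI)
    fix B :: nat assume "\<forall>B. eventually (\<lambda>n. B \<le> real (early_time mu (X n))) sequentially"
    then have "eventually (\<lambda>n. real B \<le> real (early_time mu (X n))) sequentially" by blast
    then show "eventually (\<lambda>n. B \<le> early_time mu (X n)) sequentially" by eventually_elim simp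
  qed
qed

definition Ylin :: "nat \<Rightarrow> (nat \<Rightarrow> 'b) \<Rightarrow> real" where
  "Ylin n w = (lin_stat d (proj d gc) (early_time mu (X n)) w
    - cc * (X n / mu) ^ (d - 1) * T (early_time mu (X n)) w) / X n powr (real d - 1 / 2)"

text \<open>The error in \<open>ustat_linearization\<close> at a time of order \<open>X n\<close>,
  divided by the squared normalization, is of order \<open>1 / X n\<close>.\<close>

lemma Y_Ylin: "(\<lambda>n. \<integral>w. (Y (X n) w - Ylin n w) ^ (2 * 1) \<partial>S) \<longlonglongrightarrow> 0"
  and Y_Ylin_int: "integrable S (\<lambda>w. (Y (X n) w - Ylin n w) ^ (2 * 1))"
proof -
  obtain C where C: "C \<ge> 0" and le: "\<And>n. (\<integral>w. (ustat d gc n w - lin_stat d (proj d gc) n w) ^ (2 * 1) \<partial>S) \<le> C * real n ^ (2 * (d - 1))"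
    using ustat_linearization[OF gc_m gc_int[OF order_refl] gc_mean] by blast
  have pm: "proj d gc j \<in> borel_measurable \<nu>" if "j \<in> {1..d}" for j by (rule measurable_proj[OF gc_m that])
  have pint: "integrable \<nu> (\<lambda>y. proj d gc j y ^ (2 * 1))" if "j \<in> {1..d}" for j
    by (rule proj_power[OF gc_m that order_refl gc_int[OF order_refl]])
  have i: "integrable S (\<lambda>w. (ustat d gc n w - lin_stat d (proj d gc) n w) ^ (2 * 1))" for n
    by (rule integrable_power_add(2)[OF order_refl measurable_ustat[OF gc_m] measurable_lin_stat[OF pm]
          integrable_ustat_power[OF order_refl gc_m gc_int[OF order_refl]] integrable_lin_stat_power[OF pm pint order_refl]])
  have eq: "(Y (X n) w - Ylin n w) ^ (2 * 1) = (ustat d gc (early_time mu (X n)) w - lin_stat d (proj d gc) (early_time mu (X n)) w) ^ (2 * 1)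
      / (X n powr (real d - 1 / 2)) ^ (2 * 1)" for n w
    unfolding Y_def Ylin_def Z_def diff_divide_distrib[symmetric] power_divide by simp
  show "integrable S (\<lambda>w. (Y (X n) w - Ylin n w) ^ (2 * 1))" for n
    unfolding eq by (rule integrable_divide) (rule i)
  have b: "(\<integral>w. (Y (X n) w - Ylin n w) ^ (2 * 1) \<partial>S) \<le> C * (1 / mu) ^ (2 * (d - 1)) * X n powr (- 1)" for n
  proof -
    have x: "X n \<ge> 1" by (rule X1)
    have q2: "(X n powr (real d - 1 / 2)) ^ (2 * 1) = X n ^ (2 * (d - 1)) * X n"
    proof -
      have "(X n powr (real d - 1 / 2)) ^ (2 * 1) = X n powr ((real d - 1 / 2) + (real d - 1 / 2))"
        unfolding powr_add by (simp add: power2_eq_square)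
      also have "(real d - 1 / 2) + (real d - 1 / 2) = real (2 * (d - 1) + 1)"
        using d by (simp add: of_nat_diff algebra_simps)
      also have "X n powr real (2 * (d - 1) + 1) = X n ^ (2 * (d - 1) + 1)"
        using x by (simp only: powr_realpow)
      finally show ?thesis by (simp add: power_add)
    qed
    have mx: "real (early_time mu (X n)) \<le> 1 / mu * X n"
    proof -
      have "real (early_time mu (X n)) \<le> (X n - X n powr (3 / 4)) / mu" by (rule early_time_bounds[OF mu x])
      also have "\<dots> \<le> X n / mu" using mu by (intro divide_right_mono) auto
      finally show ?thesis by simp
    qed
    have "(\<integral>w. (Y (X n) w - Ylin n w) ^ (2 * 1) \<partial>S) = (\<integral>w. (ustat d gc (early_time mu (X n)) w - lin_stat d (proj d gc) (early_time mu (X n)) w) ^ (2 * 1) \<partial>S)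
       / (X n powr (real d - 1 / 2)) ^ (2 * 1)"
      unfolding eq by (rule integral_divide_zero)
    also have "\<dots> \<le> (C * (1 / mu * X n) ^ (2 * (d - 1))) / (X n powr (real d - 1 / 2)) ^ (2 * 1)"
    proof (intro divide_right_mono)
      show "(\<integral>w. (ustat d gc (early_time mu (X n)) w - lin_stat d (proj d gc) (early_time mu (X n)) w) ^ (2 * 1) \<partial>S) \<le> C * (1 / mu * X n) ^ (2 * (d - 1))"
        by (rule order_trans[OF le]) (intro mult_left_mono power_mono mx C of_nat_0_le_iff)
    qed (simp add: zero_le_even_power)
    also have "\<dots> = C * (1 / mu) ^ (2 * (d - 1)) * X n powr (- 1)"
      unfolding q2 power_mult_distrib using x by (simp add: powr_minus_divide)
    finally show ?thesis .
  qed
  have z: "(\<lambda>n. C * (1 / mu) ^ (2 * (d - 1)) * X n powr (- 1)) \<longlonglongrightarrow> C * (1 / mu) ^ (2 * (d - 1)) * 0"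
    by (rule tendsto_mult_left[OF inverse_powr_tendsto]) simp
  show "(\<lambda>n. \<integral>w. (Y (X n) w - Ylin n w) ^ (2 * 1) \<partial>S) \<longlonglongrightarrow> 0"
  proof (rule Lim_null_comparison[OF always_eventually])
    show "(\<lambda>n. C * (1 / mu) ^ (2 * (d - 1)) * X n powr (- 1)) \<longlonglongrightarrow> 0" using z by simp
    show "\<forall>n. norm (\<integral>w. (Y (X n) w - Ylin n w) ^ (2 * 1) \<partial>S) \<le> C * (1 / mu) ^ (2 * (d - 1)) * X n powr (- 1)"
    proof
      fix n
      have "0 \<le> (\<integral>w. (Y (X n) w - Ylin n w) ^ (2 * 1) \<partial>S)"
        by (rule Bochner_Integration.integral_nonneg) (rule zero_le_even_power, simp)
      then show "norm (\<integral>w. (Y (X n) w - Ylin n w) ^ (2 * 1) \<partial>S) \<le> C * (1 / mu) ^ (2 * (d - 1)) * X n powr (- 1)"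
        using b[of n] unfolding real_norm_def by linarith
    qed
  qed
qed

text \<open>Index \<open>0\<close> carries the walk with a constant weight, and the indices
  \<open>1..d\<close> carry the projections with their binomial weights. Up to powers of
  \<open>mu\<close> and the factor \<open>cc\<close>, the weight sums tend to
  \<open>weight_limit\<close> for two projections and to \<open>1 / fact d\<close> for a mixed pair,
  because the weights of one position add up to \<open>m choose d\<close>.\<close>

lemma Ylin_clt: "(\<lambda>n. \<integral>w. iexp (t * Ylin n w) \<partial>S) \<longlonglongrightarrow> complex_of_real (exp (- (\<gamma>2 * t\<^sup>2 / 2)))"
proof -
  define m where "m n = early_time mu (X n)" for n
  define J where "J = {0..d}"
  define G where "G j = (if j = 0 then fc else proj d gc j)" for j :: nat
  define a where "a n i j = (if j = 0 then - (cc * (X n / mu) ^ (d - 1)) else lin_weight d (m n) i j)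
    / X n powr (real d - 1 / 2)" for n i j :: nat
  define A where "A j k = (if j = 0 then (if k = 0 then cc\<^sup>2 else - cc / fact d)
     else if k = 0 then - cc / fact d else weight_limit d j k) / mu ^ (2 * d - 1)" for j k :: nat
  define b where "b n = X n powr (- (1 / 2))" for n
  \<comment> \<open>The first entry bounds the weights of the projections and of the walk alike,
    whence \<open>max 1 \<bar>cc\<bar>\<close>; the second bounds
    \<open>real (m n) * (b n)\<^sup>2\<close>.\<close>
  define C where "C = max ((1 / mu) ^ (d - 1) * max 1 \<bar>cc\<bar>) (1 / mu)"
  have C0: "C \<ge> 0" unfolding C_def using mu by (simp add: le_max_iff_disj)
  have q2: "X n powr (real d - 1 / 2) * X n powr (real d - 1 / 2) = X n ^ (2 * d - 1)" for n
  proof -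
    have "X n powr (real d - 1 / 2) * X n powr (real d - 1 / 2) = X n powr real (2 * d - 1)"
      using d by (simp add: powr_add[symmetric] of_nat_diff)
    then show ?thesis using X1[of n] by (simp add: powr_realpow)
  qed
  have mx: "real (m n) \<le> 1 / mu * X n" for n
  proof -
    have "real (m n) \<le> (X n - X n powr (3 / 4)) / mu" unfolding m_def by (rule early_time_bounds[OF mu X1])
    also have "\<dots> \<le> X n / mu" using mu by (intro divide_right_mono) auto
    finally show ?thesis by simp
  qed
  have split: "2 * d - 1 = (d - 1) + d" "2 * d - 1 = (d - 1) + (d - 1) + 1" using d by auto
  have r0: "(\<lambda>n. (real (m n) / X n) ^ p) \<longlonglongrightarrow> (1 / mu) ^ p" for p
    unfolding m_def by (rule tendsto_power[OF early_time_ratio])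
  have mtop: "filterlim m at_top sequentially" unfolding m_def by (rule early_time_at_top)
  have m0: "eventually (\<lambda>n. m n \<ge> 1) sequentially" using mtop by (simp add: filterlim_at_top)
  have l11: "(\<lambda>n. \<Sum>i<m n. a n i j * a n i k) \<longlonglongrightarrow> A j k" if j: "j \<in> {1..d}" and k: "k \<in> {1..d}" for j k
  proof -
    have "(\<lambda>n. (\<Sum>i<m n. lin_weight d (m n) i j * lin_weight d (m n) i k) / real (m n) ^ (2 * d - 1) * (real (m n) / X n) ^ (2 * d - 1))
       \<longlonglongrightarrow> weight_limit d j k * (1 / mu) ^ (2 * d - 1)"
      by (rule tendsto_mult[OF filterlim_compose[OF weight_product_limit[OF j k] mtop] r0])
    moreover have "weight_limit d j k * (1 / mu) ^ (2 * d - 1) = A j k"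
      using j k by (simp add: A_def power_divide)
    moreover have "eventually (\<lambda>n. (\<Sum>i<m n. lin_weight d (m n) i j * lin_weight d (m n) i k) / real (m n) ^ (2 * d - 1) * (real (m n) / X n) ^ (2 * d - 1)
       = (\<Sum>i<m n. a n i j * a n i k)) sequentially"
      using m0
    proof eventually_elim
      case (elim n)
      have "a n i j * a n i k = (lin_weight d (m n) i j * lin_weight d (m n) i k) / X n ^ (2 * d - 1)" for i
        using j k by (simp add: a_def q2)
      then have "(\<Sum>i<m n. a n i j * a n i k) = (\<Sum>i<m n. lin_weight d (m n) i j * lin_weight d (m n) i k) / X n ^ (2 * d - 1)"
        by (simp add: sum_divide_distrib)
      then show ?case using elim by (simp add: power_divide)
    qed
    ultimately show ?thesis by (simp add: tendsto_cong)
  qed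
  have l01: "(\<lambda>n. \<Sum>i<m n. a n i 0 * a n i k) \<longlonglongrightarrow> A 0 k" if k: "k \<in> {1..d}" for k
  proof -
    have "(\<lambda>n. - cc * (1 / mu) ^ (d - 1) * (real (m n choose d) / real (m n) ^ d * (real (m n) / X n) ^ d))
       \<longlonglongrightarrow> - cc * (1 / mu) ^ (d - 1) * (1 / fact d * (1 / mu) ^ d)"
      by (rule tendsto_mult_left[OF tendsto_mult[OF filterlim_compose[OF choose_over_power_tendsto mtop] r0]])
    moreover have "- cc * (1 / mu) ^ (d - 1) * (1 / fact d * (1 / mu) ^ d) = A 0 k"
    proof -
      have "mu ^ (2 * d - 1) = mu ^ (d - 1) * mu ^ d" by (simp only: split(1) power_add)
      then show ?thesis using k by (simp add: A_def power_divide)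
    qed
    moreover have "eventually (\<lambda>n. - cc * (1 / mu) ^ (d - 1) * (real (m n choose d) / real (m n) ^ d * (real (m n) / X n) ^ d)
       = (\<Sum>i<m n. a n i 0 * a n i k)) sequentially"
      using m0
    proof eventually_elim
      case (elim n)
      have "a n i 0 * a n i k = - (cc * (X n / mu) ^ (d - 1)) / X n ^ (2 * d - 1) * lin_weight d (m n) i k" for i
        using k by (simp add: a_def q2)
      then have "(\<Sum>i<m n. a n i 0 * a n i k) = - (cc * (X n / mu) ^ (d - 1)) / X n ^ (2 * d - 1) * real (m n choose d)"
        by (simp only: sum_distrib_left[symmetric] sum_lin_weight[OF k])
      also have "\<dots> = - cc * (1 / mu) ^ (d - 1) * (real (m n choose d) / real (m n) ^ d * (real (m n) / X n) ^ d)"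
        using elim X1[of n] unfolding split(1) power_add by (simp add: power_divide)
      finally show ?case by simp
    qed
    ultimately show ?thesis by (simp add: tendsto_cong)
  qed
  have l00: "(\<lambda>n. \<Sum>i<m n. a n i 0 * a n i 0) \<longlonglongrightarrow> A 0 0"
  proof -
    have "(\<lambda>n. cc\<^sup>2 * ((1 / mu) ^ (d - 1) * (1 / mu) ^ (d - 1)) * (real (m n) / X n) ^ 1)
       \<longlonglongrightarrow> cc\<^sup>2 * ((1 / mu) ^ (d - 1) * (1 / mu) ^ (d - 1)) * (1 / mu) ^ 1"
      by (rule tendsto_mult_left[OF r0])
    moreover have "cc\<^sup>2 * ((1 / mu) ^ (d - 1) * (1 / mu) ^ (d - 1)) * (1 / mu) ^ 1 = A 0 0"
    proof -
      have "mu ^ (2 * d - 1) = mu ^ (d - 1) * mu ^ (d - 1) * mu" by (simp only: split(2) power_add power_one_right)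
      then show ?thesis by (simp add: A_def power_divide)
    qed
    moreover have "cc\<^sup>2 * ((1 / mu) ^ (d - 1) * (1 / mu) ^ (d - 1)) * (real (m n) / X n) ^ 1 = (\<Sum>i<m n. a n i 0 * a n i 0)" for n
    proof -
      have "a n i 0 * a n i 0 = (cc * (X n / mu) ^ (d - 1)) * (cc * (X n / mu) ^ (d - 1)) / X n ^ (2 * d - 1)" for i
        by (simp add: a_def q2)
      then have "(\<Sum>i<m n. a n i 0 * a n i 0) = real (m n) * ((cc * (X n / mu) ^ (d - 1)) * (cc * (X n / mu) ^ (d - 1)) / X n ^ (2 * d - 1))"
        by simp
      then show ?thesis using X1[of n] unfolding split(2) power_add by (simp add: power_divide power2_eq_square mult_ac)
    qed
    ultimately show ?thesis by simp
  qed
  have main: "(\<lambda>n. \<integral>w. iexp (t * (\<Sum>i<m n. \<Sum>j\<in>J. a n i j * G j (w i))) \<partial>S) \<longlonglongrightarrow>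
    complex_of_real (exp (- ((\<Sum>j\<in>J. \<Sum>k\<in>J. A j k * (\<integral>y. G j y * G k y \<partial>\<nu>)) * t\<^sup>2 / 2)))"
  proof (rule weighted_combination_clt[where C = C and b = b])
    show "finite J" by (simp add: J_def)
    have Gj: "(j = 0 \<and> G j = fc) \<or> (j \<in> {1..d} \<and> G j = proj d gc j)" if "j \<in> J" for j
      using that unfolding G_def J_def by (cases "j = 0") auto
    show "G j \<in> borel_measurable \<nu>" if "j \<in> J" for j
      using Gj[OF that]
    proof (elim disjE conjE)
      assume "G j = fc" then show ?thesis by (simp only: fc_m)
    next
      assume j: "j \<in> {1..d}" and "G j = proj d gc j"
      then show ?thesis by (simp only: measurable_proj[OF gc_m j])
    qed
    show "integrable \<nu> (\<lambda>y. G j y ^ (2 * 2))" if "j \<in> J" for j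
      using Gj[OF that]
    proof (elim disjE conjE)
      assume G: "G j = fc" show ?thesis unfolding G by (rule fc_int) simp
    next
      assume j: "j \<in> {1..d}" and G: "G j = proj d gc j"
      have two: "(2::nat) \<ge> 1" by simp
      show ?thesis unfolding G by (rule proj_power[OF gc_m j two gc_int[OF two]])
    qed
    show "(\<integral>y. G j y \<partial>\<nu>) = 0" if "j \<in> J" for j
      using Gj[OF that]
    proof (elim disjE conjE)
      assume G: "G j = fc" show ?thesis unfolding G by (rule fc_mean)
    next
      assume j: "j \<in> {1..d}" and G: "G j = proj d gc j"
      show ?thesis unfolding G integral_proj(2)[OF gc_m j gc_integrable] by (rule gc_mean)
    qed
    show "(\<lambda>n. \<Sum>i<m n. a n i j * a n i k) \<longlonglongrightarrow> A j k" if jk: "j \<in> J" "k \<in> J" for j k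
    proof -
      have sym: "A k 0 = A 0 k" "(\<Sum>i<m n. a n i k * a n i 0) = (\<Sum>i<m n. a n i 0 * a n i k)" for n k
        by (simp_all add: A_def mult.commute)
      consider "j = 0" "k = 0" | "j = 0" "k \<in> {1..d}" | "j \<in> {1..d}" "k = 0" | "j \<in> {1..d}" "k \<in> {1..d}"
        using jk by (cases "j = 0"; cases "k = 0") (auto simp: J_def)
      then show ?thesis
      proof cases
        case 1
        show ?thesis unfolding 1 by (rule l00)
      next
        case 2
        show ?thesis unfolding 2(1) by (rule l01[OF 2(2)])
      next
        case 3
        show ?thesis unfolding 3(2) sym by (rule l01[OF 3(1)])
      next
        case 4
        then show ?thesis by (rule l11)
      qed
    qed
    show "\<bar>a n i j\<bar> \<le> C * b n" if i: "i < m n" and j: "j \<in> J" for n i j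
    proof -
      have x: "X n \<ge> 1" by (rule X1)
      define c1 where "c1 = max 1 \<bar>cc\<bar>"
      have "\<bar>if j = 0 then - (cc * (X n / mu) ^ (d - 1)) else lin_weight d (m n) i j\<bar> \<le> c1 * (1 / mu * X n) ^ (d - 1)"
      proof (cases "j = 0")
        case True
        have "0 \<le> (X n / mu) ^ (d - 1)" using x mu by simp
        then have "\<bar>cc\<bar> * (X n / mu) ^ (d - 1) \<le> c1 * (X n / mu) ^ (d - 1)" by (intro mult_right_mono) (simp_all add: c1_def)
        then show ?thesis using True \<open>0 \<le> (X n / mu) ^ (d - 1)\<close> by (simp add: abs_mult)
      next
        case False
        then have j': "j \<in> {1..d}" using j by (simp add: J_def)
        have "lin_weight d (m n) i j \<le> real (m n) ^ (d - 1)" by (rule lin_weight_bound(2)[OF j' i])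
        also have "\<dots> \<le> (1 / mu * X n) ^ (d - 1)" by (intro power_mono mx) simp
        also have "\<dots> = 1 * (1 / mu * X n) ^ (d - 1)" by simp
        also have "\<dots> \<le> c1 * (1 / mu * X n) ^ (d - 1)" using x mu by (intro mult_right_mono) (simp_all add: c1_def)
        finally show ?thesis using False lin_weight_bound(1)[OF j' i] by simp
      qed
      then have "\<bar>a n i j\<bar> \<le> (c1 * (1 / mu * X n) ^ (d - 1)) / X n powr (real d - 1 / 2)"
        unfolding a_def abs_divide by (simp add: divide_right_mono)
      also have "\<dots> = ((1 / mu) ^ (d - 1) * c1) * (X n powr real (d - 1) / X n powr (real d - 1 / 2))"
        using x by (simp add: power_divide powr_realpow)
      also have "X n powr real (d - 1) / X n powr (real d - 1 / 2) = b n"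
        unfolding b_def powr_diff[symmetric] using d by (simp add: of_nat_diff)
      also have "((1 / mu) ^ (d - 1) * c1) * b n \<le> C * b n"
        unfolding C_def c1_def by (intro mult_right_mono) (simp_all add: b_def)
      finally show ?thesis .
    qed
    show "0 \<le> b n" for n by (simp add: b_def)
    show "0 \<le> C" by (rule C0)
    show "real (m n) * b n ^ 2 \<le> C" for n
    proof -
      have x: "X n \<ge> 1" by (rule X1)
      have "b n ^ 2 = 1 / X n" using x by (simp add: b_def power2_eq_square powr_add[symmetric] powr_minus_divide)
      then have "real (m n) * b n ^ 2 \<le> (1 / mu * X n) * (1 / X n)"
        using mx[of n] x by (simp only:) (intro mult_right_mono, simp_all)
      also have "\<dots> = 1 / mu" using x by simp
      also have "\<dots> \<le> C" by (simp add: C_def)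
      finally show ?thesis .
    qed
    show "b \<longlonglongrightarrow> 0" unfolding b_def[abs_def] by (rule inverse_powr_tendsto) simp
  qed
  have J: "J = insert 0 {1..d}" by (auto simp: J_def)
  have Yeq: "Ylin n w = (\<Sum>i<m n. \<Sum>j\<in>J. a n i j * G j (w i))" for n w
  proof -
    have "(\<Sum>j\<in>J. a n i j * G j (w i)) = (- (cc * (X n / mu) ^ (d - 1)) * fc (w i) + (\<Sum>j=1..d. lin_weight d (m n) i j * proj d gc j (w i)))
        / X n powr (real d - 1 / 2)" for i
    proof -
      have "(\<Sum>j=1..d. a n i j * G j (w i)) = (\<Sum>j=1..d. lin_weight d (m n) i j * proj d gc j (w i)) / X n powr (real d - 1 / 2)"
        unfolding sum_divide_distrib by (intro sum.cong refl) (simp add: a_def G_def)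
      then show ?thesis by (simp add: J a_def G_def add_divide_distrib diff_divide_distrib)
    qed
    then have "(\<Sum>i<m n. \<Sum>j\<in>J. a n i j * G j (w i)) = (\<Sum>i<m n. - (cc * (X n / mu) ^ (d - 1)) * fc (w i) + (\<Sum>j=1..d. lin_weight d (m n) i j * proj d gc j (w i)))
        / X n powr (real d - 1 / 2)"
      by (simp only: sum_divide_distrib)
    also have "\<dots> = Ylin n w"
      unfolding Ylin_def lin_stat_def T_def m_def[symmetric] sum.distrib sum_distrib_left[symmetric] by simp
    finally show ?thesis ..
  qed
  have "(\<Sum>j\<in>J. \<Sum>k\<in>J. A j k * (\<integral>y. G j y * G k y \<partial>\<nu>)) = \<gamma>2"
  proof -
    define I where "I j = (\<integral>y. fc y * proj d gc j y \<partial>\<nu>)" for j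
    have s1: "(\<Sum>k=1..d. A 0 k * (\<integral>y. G 0 y * G k y \<partial>\<nu>)) = - cc / fact d * (\<Sum>k=1..d. I k) / mu ^ (2 * d - 1)"
      unfolding sum_distrib_left sum_divide_distrib by (intro sum.cong refl) (simp add: A_def G_def I_def)
    have s2: "(\<Sum>j=1..d. A j 0 * (\<integral>y. G j y * G 0 y \<partial>\<nu>)) = - cc / fact d * (\<Sum>k=1..d. I k) / mu ^ (2 * d - 1)"
      unfolding sum_distrib_left sum_divide_distrib by (intro sum.cong refl) (simp add: A_def G_def I_def mult.commute)
    have s3: "(\<Sum>j=1..d. \<Sum>k=1..d. A j k * (\<integral>y. G j y * G k y \<partial>\<nu>))
      = (\<Sum>j=1..d. \<Sum>k=1..d. weight_limit d j k * (\<integral>y. proj d gc j y * proj d gc k y \<partial>\<nu>)) / mu ^ (2 * d - 1)"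
      unfolding sum_divide_distrib by (intro sum.cong refl) (simp add: A_def G_def)
    have s0: "A 0 0 * (\<integral>y. G 0 y * G 0 y \<partial>\<nu>) = cc\<^sup>2 * (\<integral>y. fc y * fc y \<partial>\<nu>) / mu ^ (2 * d - 1)"
      by (simp add: A_def G_def)
    have "(\<Sum>j\<in>J. \<Sum>k\<in>J. A j k * (\<integral>y. G j y * G k y \<partial>\<nu>))
       = (A 0 0 * (\<integral>y. G 0 y * G 0 y \<partial>\<nu>) + (\<Sum>k=1..d. A 0 k * (\<integral>y. G 0 y * G k y \<partial>\<nu>)))
       + ((\<Sum>j=1..d. A j 0 * (\<integral>y. G j y * G 0 y \<partial>\<nu>)) + (\<Sum>j=1..d. \<Sum>k=1..d. A j k * (\<integral>y. G j y * G k y \<partial>\<nu>)))"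
      by (simp add: J sum.distrib)
    then show ?thesis
      unfolding s0 s1 s2 s3 \<gamma>2_def I_def[symmetric] by (simp add: add_divide_distrib diff_divide_distrib)
  qed
  then show ?thesis using main unfolding Yeq by simp
qed

text \<open>Since \<open>iexp\<close> is Lipschitz, the characteristic functions of \<open>Y\<close>
  and \<open>Ylin\<close> differ by at most \<open>\<bar>t\<bar>\<close> times the distance in mean
  square, which tends to \<open>0\<close>.\<close>

theorem Y_clt: "(\<lambda>n. \<integral>w. iexp (t * Y (X n) w) \<partial>S) \<longlonglongrightarrow> complex_of_real (exp (- (\<gamma>2 * t\<^sup>2 / 2)))"
proof -
  have pm: "proj d gc j \<in> borel_measurable \<nu>" if "j \<in> {1..d}" for j by (rule measurable_proj[OF gc_m that])
  have Lm: "Ylin n \<in> borel_measurable S" for n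
    unfolding Ylin_def[abs_def]
    by (rule borel_measurable_divide[OF borel_measurable_diff[OF measurable_lin_stat[OF pm] borel_measurable_times[OF borel_measurable_const T_m]] borel_measurable_const])
  have Dm: "(\<lambda>w. Y (X n) w - Ylin n w) \<in> borel_measurable S" for n by (rule borel_measurable_diff[OF Y_m Lm])
  have ib: "integrable S (\<lambda>w. iexp (t * h w))" if "h \<in> borel_measurable S" for h
    by (rule P.integrable_const_bound[where B = 1, OF _ measurable_iexp_mult[OF that]]) simp
  have D1: "integrable S (\<lambda>w. Y (X n) w - Ylin n w)" for n
    by (rule integrable_of_power[OF P.finite_measure_axioms Dm Y_Ylin_int order_refl])
  have diff: "norm ((\<integral>w. iexp (t * Y (X n) w) \<partial>S) - (\<integral>w. iexp (t * Ylin n w) \<partial>S))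
     \<le> \<bar>t\<bar> * sqrt (\<integral>w. (Y (X n) w - Ylin n w) ^ (2 * 1) \<partial>S)" for n
  proof -
    have j: "(\<integral>w. \<bar>Y (X n) w - Ylin n w\<bar> \<partial>S) \<le> sqrt (\<integral>w. (Y (X n) w - Ylin n w) ^ (2 * 1) \<partial>S)"
    proof (rule real_le_rsqrt)
      have sq: "\<bar>Y (X n) w - Ylin n w\<bar>\<^sup>2 = (Y (X n) w - Ylin n w) ^ (2 * 1)" for w by (simp only: mult_1_right power2_abs)
      have "(\<integral>w. \<bar>Y (X n) w - Ylin n w\<bar> \<partial>S)\<^sup>2 \<le> (\<integral>w. \<bar>Y (X n) w - Ylin n w\<bar>\<^sup>2 \<partial>S)"
      proof (rule P.jensens_inequality[where I = UNIV and q = "\<lambda>x. x\<^sup>2", OF integrable_abs[OF D1]])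
        show "AE w in S. \<bar>Y (X n) w - Ylin n w\<bar> \<in> UNIV" by (rule AE_I2, rule UNIV_I)
        show "(UNIV :: real set) = {0<..<0} \<or> (UNIV :: real set) = {0<..} \<or> (UNIV :: real set) = {..<0} \<or> (UNIV :: real set) = UNIV"
          by (rule disjI2, rule disjI2, rule disjI2, rule refl)
        show "integrable S (\<lambda>w. \<bar>Y (X n) w - Ylin n w\<bar>\<^sup>2)" unfolding sq by (rule Y_Ylin_int)
        show "convex_on UNIV (\<lambda>x::real. x\<^sup>2)" by (rule convex_power2)
      qed
      then show "(\<integral>w. \<bar>Y (X n) w - Ylin n w\<bar> \<partial>S)\<^sup>2 \<le> (\<integral>w. (Y (X n) w - Ylin n w) ^ (2 * 1) \<partial>S)" unfolding sq .
    qed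
    have e1: "norm ((\<integral>w. iexp (t * Y (X n) w) \<partial>S) - (\<integral>w. iexp (t * Ylin n w) \<partial>S))
       = norm (\<integral>w. iexp (t * Y (X n) w) - iexp (t * Ylin n w) \<partial>S)"
      by (simp only: Bochner_Integration.integral_diff[OF ib[OF Y_m] ib[OF Lm]])
    have e2: "norm (\<integral>w. iexp (t * Y (X n) w) - iexp (t * Ylin n w) \<partial>S) \<le> (\<integral>w. norm (iexp (t * Y (X n) w) - iexp (t * Ylin n w)) \<partial>S)" by (rule integral_norm_bound)
    have e3: "(\<integral>w. norm (iexp (t * Y (X n) w) - iexp (t * Ylin n w)) \<partial>S) \<le> (\<integral>w. \<bar>t\<bar> * \<bar>Y (X n) w - Ylin n w\<bar> \<partial>S)"
    proof (rule integral_mono)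
      show "integrable S (\<lambda>w. norm (iexp (t * Y (X n) w) - iexp (t * Ylin n w)))"
        by (rule integrable_norm[OF Bochner_Integration.integrable_diff[OF ib[OF Y_m] ib[OF Lm]]])
      show "integrable S (\<lambda>w. \<bar>t\<bar> * \<bar>Y (X n) w - Ylin n w\<bar>)"
        by (rule integrable_mult_right[OF integrable_abs[OF D1]])
      fix w
      show "norm (iexp (t * Y (X n) w) - iexp (t * Ylin n w)) \<le> \<bar>t\<bar> * \<bar>Y (X n) w - Ylin n w\<bar>"
        by (rule norm_iexp_diff_le)
    qed
    have e4: "(\<integral>w. \<bar>t\<bar> * \<bar>Y (X n) w - Ylin n w\<bar> \<partial>S) = \<bar>t\<bar> * (\<integral>w. \<bar>Y (X n) w - Ylin n w\<bar> \<partial>S)" by (rule integral_mult_right_zero)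
    have e5: "\<bar>t\<bar> * (\<integral>w. \<bar>Y (X n) w - Ylin n w\<bar> \<partial>S) \<le> \<bar>t\<bar> * sqrt (\<integral>w. (Y (X n) w - Ylin n w) ^ (2 * 1) \<partial>S)"
      by (rule mult_left_mono[OF j abs_ge_zero])
    show ?thesis by (rule order_trans[OF eq_refl[OF e1] order_trans[OF e2 order_trans[OF e3 order_trans[OF eq_refl[OF e4] e5]]]])
  qed
  define I where "I n = (\<integral>w. (Y (X n) w - Ylin n w) ^ (2 * 1) \<partial>S)" for n
  define A where "A n = (\<integral>w. iexp (t * Y (X n) w) \<partial>S)" for n
  define B where "B n = (\<integral>w. iexp (t * Ylin n w) \<partial>S)" for n
  have "I \<longlonglongrightarrow> 0" unfolding I_def[abs_def] by (rule Y_Ylin)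
  from tendsto_mult_left[OF tendsto_real_sqrt[OF this], of "\<bar>t\<bar>"]
  have z: "(\<lambda>n. \<bar>t\<bar> * sqrt (I n)) \<longlonglongrightarrow> 0" by simp
  have le: "norm (A n - B n) \<le> \<bar>t\<bar> * sqrt (I n)" for n
    unfolding A_def B_def I_def by (rule diff)
  have "(\<lambda>n. A n - B n) \<longlonglongrightarrow> 0"
    by (rule Lim_null_comparison[OF always_eventually z]) (rule allI, rule le)
  moreover have "B \<longlonglongrightarrow> complex_of_real (exp (- (\<gamma>2 * t\<^sup>2 / 2)))"
    unfolding B_def[abs_def] by (rule Ylin_clt)
  ultimately have "(\<lambda>n. A n - B n + B n) \<longlonglongrightarrow> 0 + complex_of_real (exp (- (\<gamma>2 * t\<^sup>2 / 2)))"
    by (rule tendsto_add)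
  then show ?thesis unfolding A_def[symmetric] by (simp only: diff_add_cancel add_0_left)
qed

end

end

lemma linear_minus_sublinear_at_top:
  fixes m k :: real
  assumes "m > 0"
  shows "filterlim (\<lambda>n::nat. m * real n - k * (1 + real n) powr (9 / 16)) at_top sequentially"
  using assms by real_asymp

lemma integral_uniform_measure_indicator:
  fixes h :: "'a \<Rightarrow> 'c :: {banach, second_countable_topology}"
  assumes A: "A \<in> sets M" and pos: "measure M A > 0" and h: "h \<in> borel_measurable M" and fin: "emeasure M A \<noteq> \<infinity>"
  shows "(\<integral>x. h x \<partial>uniform_measure M A) = (1 / measure M A) *\<^sub>R (\<integral>x. indicator A x *\<^sub>R h x \<partial>M)"
    and "integrable M h \<Longrightarrow> integrable (uniform_measure M A) h"
proof -
  define p where "p x = indicator A x / measure M A" for x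
  have pm: "p \<in> borel_measurable M" unfolding p_def[abs_def]
    by (rule borel_measurable_divide[OF borel_measurable_indicator[OF A] borel_measurable_const])
  have p0: "AE x in M. 0 \<le> p x" by (rule AE_I2) (simp add: p_def)
  have "indicator A x / emeasure M A = ennreal (p x)" for x
    using pos fin by (simp add: p_def emeasure_eq_ennreal_measure divide_ennreal[symmetric] ennreal_indicator)
  then have U: "uniform_measure M A = density M (\<lambda>x. ennreal (p x))"
    by (simp add: uniform_measure_def)
  have eq: "p x *\<^sub>R h x = (1 / measure M A) *\<^sub>R (indicator A x *\<^sub>R h x)" for x
    by (simp add: p_def)
  show "(\<integral>x. h x \<partial>uniform_measure M A) = (1 / measure M A) *\<^sub>R (\<integral>x. indicator A x *\<^sub>R h x \<partial>M)"
    unfolding U integral_density[OF h pm p0] eq by (rule integral_scaleR_right)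
  show "integrable (uniform_measure M A) h" if "integrable M h"
    unfolding U integrable_density[OF h pm p0] eq
    by (rule integrable_scaleR_right, rule integrable_mult_indicator[OF A that])
qed

context renewal_ustat
begin

section \<open>Approximation at the renewal time\<close>

definition Usum :: "nat \<Rightarrow> (nat \<Rightarrow> 'b) \<Rightarrow> real" where "Usum n w = (\<Sum>i<n. f (w i))"
definition Nm :: "real \<Rightarrow> (nat \<Rightarrow> 'b) \<Rightarrow> nat" where "Nm x w = Sup {n. Usum n w \<le> x}"
definition Np :: "real \<Rightarrow> (nat \<Rightarrow> 'b) \<Rightarrow> nat" where "Np x w = Inf {n. Usum n w > x}"
definition V :: "(real \<Rightarrow> (nat \<Rightarrow> 'b) \<Rightarrow> nat) \<Rightarrow> real \<Rightarrow> (nat \<Rightarrow> 'b) \<Rightarrow> real" where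
  "V \<tau> x w = (ustat d g (\<tau> x w) w - mg / fact d * (x / mu) ^ d) / x powr (real d - 1 / 2)"

text \<open>The pathwise statements are proved on this set. For a suitable \<open>K\<close> it
  contains almost every path, and the exceptional null set does not depend on
  \<open>x\<close>.\<close>

definition good :: "((nat \<Rightarrow> 'b) \<Rightarrow> real) \<Rightarrow> (nat \<Rightarrow> 'b) set" where
  "good K = {w. (\<forall>m n. m \<le> n \<longrightarrow> \<bar>T n w - T m w\<bar> \<le> K w * sqrt (real (n - m)) * (1 + real n) powr (1 / 16)) \<and>
     (\<forall>m n. m \<le> n \<longrightarrow> \<bar>Z n w - Z m w\<bar> \<le> K w * sqrt (real (n - m)) * ((1 + real n) ^ (d - 1) * (1 + real n) powr (1 / 16)))}"

lemma good_T:
  assumes "w \<in> good K" "m \<le> n"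
  shows "\<bar>T n w - T m w\<bar> \<le> K w * sqrt (real (n - m)) * (1 + real n) powr (1 / 16)"
  by (rule assms(1)[unfolded good_def mem_Collect_eq, THEN conjunct1, THEN spec, THEN spec, THEN mp, OF assms(2)])

lemma good_Z:
  assumes "w \<in> good K" "m \<le> n"
  shows "\<bar>Z n w - Z m w\<bar> \<le> K w * sqrt (real (n - m)) * ((1 + real n) ^ (d - 1) * (1 + real n) powr (1 / 16))"
  by (rule assms(1)[unfolded good_def mem_Collect_eq, THEN conjunct2, THEN spec, THEN spec, THEN mp, OF assms(2)])

lemma good_exists: "\<exists>K. all_moments S K \<and> (AE w in S. w \<in> good K)"
proof -
  obtain K1 where K1: "all_moments S K1" and A1: "AE w in S. \<forall>m n. m \<le> n \<longrightarrow>
    \<bar>ustat 1 fk n w - ustat 1 fk m w\<bar> \<le> K1 w * sqrt (real (n - m)) * ((1 + real n) ^ (1 - 1) * (1 + real n) powr (1 / 16))"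
    using uniform_increment_bound[OF fk_m fk_int fk_mean, of "1 / 16"] by auto
  obtain K2 where K2: "all_moments S K2" and A2: "AE w in S. \<forall>m n. m \<le> n \<longrightarrow>
    \<bar>ustat d gc n w - ustat d gc m w\<bar> \<le> K2 w * sqrt (real (n - m)) * ((1 + real n) ^ (d - 1) * (1 + real n) powr (1 / 16))"
    using uniform_increment_bound[OF gc_m gc_int gc_mean, of "1 / 16"] by auto
  have ge: "K1 w \<ge> 1" "K2 w \<ge> 1" for w using K1 K2 by (auto simp: all_moments_def)
  have le: "K1 w \<le> K1 w * K2 w" "K2 w \<le> K1 w * K2 w" for w
    using mult_left_mono[OF ge(2)[of w], of "K1 w"] mult_right_mono[OF ge(1)[of w], of "K2 w"] ge(1)[of w] ge(2)[of w]
    by linarith+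
  have "AE w in S. w \<in> good (\<lambda>w. K1 w * K2 w)"
    using A1 A2
  proof eventually_elim
    case (elim w)
    have "\<bar>T n w - T m w\<bar> \<le> K1 w * K2 w * sqrt (real (n - m)) * (1 + real n) powr (1 / 16)" if "m \<le> n" for m n
    proof -
      have "\<bar>T n w - T m w\<bar> \<le> K1 w * sqrt (real (n - m)) * (1 + real n) powr (1 / 16)"
        using elim(1) that by (simp add: T_ustat)
      also have "\<dots> \<le> K1 w * K2 w * sqrt (real (n - m)) * (1 + real n) powr (1 / 16)"
        by (intro mult_right_mono le) simp_all
      finally show ?thesis .
    qed
    moreover have "\<bar>Z n w - Z m w\<bar> \<le> K1 w * K2 w * sqrt (real (n - m)) * ((1 + real n) ^ (d - 1) * (1 + real n) powr (1 / 16))" if "m \<le> n" for m n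
    proof -
      have "\<bar>Z n w - Z m w\<bar> \<le> K2 w * sqrt (real (n - m)) * ((1 + real n) ^ (d - 1) * (1 + real n) powr (1 / 16))"
        using elim(2) that by (simp add: Z_def)
      also have "\<dots> \<le> K1 w * K2 w * sqrt (real (n - m)) * ((1 + real n) ^ (d - 1) * (1 + real n) powr (1 / 16))"
        by (intro mult_right_mono le) simp_all
      finally show ?thesis .
    qed
    ultimately show ?case by (simp add: good_def)
  qed
  then show ?thesis using P.all_moments_mult[OF K1 K2] by blast
qed

section \<open>The walk and its renewal times on one good path\<close>

context
  fixes K :: "(nat \<Rightarrow> 'b) \<Rightarrow> real" and w :: "nat \<Rightarrow> 'b"
  assumes K1: "K w \<ge> 1" and w: "w \<in> good K"
begin

lemma T_0: "T 0 w = 0" by (simp add: T_def)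

lemma Usum_eq: "Usum n w = mu * real n + T n w"
  by (simp add: Usum_def sum_f_eq)

lemma T_growth: "\<bar>T n w\<bar> \<le> K w * (1 + real n) powr (9 / 16)"
proof -
  have "\<bar>T n w\<bar> \<le> K w * sqrt (real n) * (1 + real n) powr (1 / 16)"
    using good_T[OF w, of 0 n] unfolding T_0 by (simp only: diff_0_right le0 minus_nat.diff_0)
  also have "\<dots> \<le> K w * (1 + real n) powr (1 / 2) * (1 + real n) powr (1 / 16)"
    using K1 by (intro mult_right_mono mult_left_mono) (simp_all add: powr_half_sqrt)
  also have "\<dots> = K w * (1 + real n) powr (9 / 16)" by (simp add: mult.assoc flip: powr_add)
  finally show ?thesis .
qed

text \<open>The drift is linear and the fluctuation of order \<open>9 / 16\<close>, so the walk
  tends to infinity. Therefore \<open>Sup\<close> in \<open>Nm\<close> is a maximum, and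
  \<open>Np\<close> is the least element of a nonempty set.\<close>

lemma Usum_finite: "finite {n. Usum n w \<le> x}"
proof -
  have lim: "filterlim (\<lambda>n::nat. mu * real n - K w * (1 + real n) powr (9 / 16)) at_top sequentially"
    by (rule linear_minus_sublinear_at_top[OF mu])
  then have "eventually (\<lambda>n. mu * real n - K w * (1 + real n) powr (9 / 16) > x) sequentially"
    by (simp add: filterlim_at_top_dense)
  then obtain N where N: "\<And>n. n \<ge> N \<Longrightarrow> mu * real n - K w * (1 + real n) powr (9 / 16) > x"
    by (auto simp: eventually_sequentially)
  have "n < N" if "Usum n w \<le> x" for n
  proof (rule ccontr)
    assume "\<not> n < N"
    then have "mu * real n - K w * (1 + real n) powr (9 / 16) > x" using N by simp
    moreover note T_growth[of n]
    ultimately show False using that unfolding Usum_eq by linarith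
  qed
  then have "{n. Usum n w \<le> x} \<subseteq> {..<N}" by auto
  then show ?thesis by (rule finite_subset) simp
qed

lemma step_bound: "\<bar>Usum (Suc n) w - Usum n w\<bar> \<le> mu + K w * (2 + real n) powr (1 / 16)"
proof -
  have "\<bar>T (Suc n) w - T n w\<bar> \<le> K w * sqrt (real (Suc n - n)) * (1 + real (Suc n)) powr (1 / 16)"
    by (rule good_T[OF w le_SucI[OF order_refl]])
  moreover have "sqrt (real (Suc n - n)) = 1" "1 + real (Suc n) = 2 + real n" by simp_all
  ultimately have t: "\<bar>T (Suc n) w - T n w\<bar> \<le> K w * (2 + real n) powr (1 / 16)" by (simp only: mult_1_right)
  have "Usum (Suc n) w - Usum n w = mu + (T (Suc n) w - T n w)" unfolding Usum_eq by (simp add: distrib_left)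
  then show ?thesis using t mu by linarith
qed

lemma Nm_props:
  assumes "x \<ge> 0"
  shows "Usum (Nm x w) w \<le> x" "x < Usum (Suc (Nm x w)) w" "\<And>n. Usum n w \<le> x \<Longrightarrow> n \<le> Nm x w"
proof -
  have ne: "0 \<in> {n. Usum n w \<le> x}" using assms by (simp add: Usum_def)
  have M: "Nm x w = Max {n. Usum n w \<le> x}"
    unfolding Nm_def Sup_nat_def using ne by auto
  show "Usum (Nm x w) w \<le> x" using Max_in[OF Usum_finite[of x]] ne unfolding M by blast
  show le: "n \<le> Nm x w" if "Usum n w \<le> x" for n unfolding M using Usum_finite that by (intro Max_ge) auto
  show "x < Usum (Suc (Nm x w)) w" using le[of "Suc (Nm x w)"] by fastforce
qed

lemma Np_props:
  assumes "x \<ge> 0"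
  shows "x < Usum (Np x w) w" "Np x w > 0" "Usum (Np x w - 1) w \<le> x" "\<And>n. x < Usum n w \<Longrightarrow> Np x w \<le> n"
proof -
  have "{n. Usum n w > x} \<noteq> {}" using Nm_props(2)[OF assms] by blast
  from Inf_nat_def1[OF this] show 1: "x < Usum (Np x w) w" by (simp add: Np_def)
  show le: "Np x w \<le> n" if "x < Usum n w" for n
    unfolding Np_def using that by (intro cInf_lower) auto
  show 2: "Np x w > 0"
  proof (rule ccontr)
    assume "\<not> Np x w > 0"
    then have "Np x w = 0" by simp
    then have "x < Usum 0 w" using 1 by metis
    then show False using assms by (simp add: Usum_def)
  qed
  show "Usum (Np x w - 1) w \<le> x"
    using le[of "Np x w - 1"] 2 by (meson diff_less linorder_not_less zero_less_one)
qed

text \<open>At either renewal time the level \<open>x\<close> lies between two consecutive values of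
  the walk, so the distance to it is at most one step. The increment bound for \<open>T\<close> with
  time difference \<open>1\<close> controls the size of a step.\<close>

lemma stop_bound:
  assumes "\<tau> = Nm \<or> \<tau> = Np" and x: "x \<ge> 1"
  shows "\<bar>mu * real (\<tau> x w) + T (\<tau> x w) w - x\<bar> \<le> mu + K w * (2 + real (\<tau> x w)) powr (1 / 16)"
proof -
  have x0: "x \<ge> 0" using x by simp
  consider "\<tau> = Nm" | "\<tau> = Np" using assms by blast
  then have "\<bar>Usum (\<tau> x w) w - x\<bar> \<le> mu + K w * (2 + real (\<tau> x w)) powr (1 / 16)"
  proof cases
    case 1
    show ?thesis unfolding 1 using Nm_props[OF x0] step_bound[of "Nm x w"] by linarith
  next
    case 2
    define n where "n = Np x w - 1"
    have n: "Np x w = Suc n" using Np_props(2)[OF x0] by (simp add: n_def)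
    have "(2 + real n) powr (1 / 16) \<le> (2 + real (Suc n)) powr (1 / 16)" by (intro powr_mono2) auto
    then have "K w * (2 + real n) powr (1 / 16) \<le> K w * (2 + real (Suc n)) powr (1 / 16)"
      using K1 by (intro mult_left_mono) auto
    then show ?thesis
      unfolding 2 n using Np_props(1,3)[OF x0] step_bound[of n] unfolding n_def[symmetric] n diff_Suc_1 by linarith
  qed
  then show ?thesis by (simp add: Usum_eq)
qed

end

lemma V_approx:
  assumes tau: "\<tau> = Nm \<or> \<tau> = Np"
  shows "\<exists>K C B. all_moments S K \<and> C \<ge> 0 \<and> (AE w in S. \<forall>x\<ge>1. \<bar>V \<tau> x w - Y x w\<bar> \<le> C * K w ^ B * x powr (- (1 / 16)))"
proof -
  obtain K where K: "all_moments S K" and AE: "AE w in S. w \<in> good K" using good_exists by blast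
  have K1: "K w \<ge> 1" for w using K by (simp add: all_moments_def)
  have "poly_bounded (good K) K (- (1 / 16)) (\<lambda>x w.
    (Z (\<tau> x w) w + mg * real (\<tau> x w choose d) - mg / fact d * (x / mu) ^ d) / x powr (real d - 1 / 2)
    - (Z (early_time mu x) w - mg / (fact (d - 1) * mu) * (x / mu) ^ (d - 1) * T (early_time mu x) w) / x powr (real d - 1 / 2))"
  proof (rule path_approximation[OF K1 mu d])
    show "T 0 w = 0" for w by (simp add: T_def)
    show "\<bar>T n w - T m w\<bar> \<le> K w * sqrt (real (n - m)) * (1 + real n) powr (1 / 16)" if "w \<in> good K" "m \<le> n" for w m n
      by (rule good_T[OF that])
    show "\<bar>Z n w - Z m w\<bar> \<le> K w * sqrt (real (n - m)) * ((1 + real n) ^ (d - 1) * (1 + real n) powr (1 / 16))" if "w \<in> good K" "m \<le> n" for w m n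
      by (rule good_Z[OF that])
    show "\<bar>mu * real (\<tau> x w) + T (\<tau> x w) w - x\<bar> \<le> mu + K w * (2 + real (\<tau> x w)) powr (1 / 16)" if "w \<in> good K" "1 \<le> x" for w x
      by (rule stop_bound[OF K1 that(1) tau that(2)])
  qed
  then have "poly_bounded (good K) K (- (1 / 16)) (\<lambda>x w. V \<tau> x w - Y x w)"
    unfolding V_def Y_def cc_def ustat_centered .
  then obtain C B where C: "C \<ge> 0" and le: "\<And>x w. x \<ge> 1 \<Longrightarrow> w \<in> good K \<Longrightarrow> \<bar>V \<tau> x w - Y x w\<bar> \<le> C * K w ^ B * x powr (- (1 / 16))"
    unfolding poly_bounded_def by blast
  have "AE w in S. \<forall>x\<ge>1. \<bar>V \<tau> x w - Y x w\<bar> \<le> C * K w ^ B * x powr (- (1 / 16))"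
    using AE by eventually_elim (blast intro: le)
  then show ?thesis using K C by blast
qed

lemma Usum_m: "Usum n \<in> borel_measurable S"
  unfolding Usum_def[abs_def] by (rule borel_measurable_sum[OF measurable_coordinate[OF f]])

lemma Nm_m: "Nm x \<in> measurable S (count_space UNIV)"
proof -
  have p: "Measurable.pred S (\<lambda>w. n \<in> {n. Usum n w \<le> x})" for n
    unfolding pred_def mem_Collect_eq by (rule borel_measurable_le[OF Usum_m borel_measurable_const])
  show ?thesis unfolding Nm_def[abs_def] by (rule measurable_Sup_nat) (rule p)
qed

lemma Np_m: "Np x \<in> measurable S (count_space UNIV)"
proof -
  have p: "Measurable.pred S (\<lambda>w. n \<in> {n. Usum n w > x})" for n
    unfolding pred_def mem_Collect_eq by (rule borel_measurable_less[OF borel_measurable_const Usum_m])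
  show ?thesis unfolding Np_def[abs_def] Inf_nat_def by (rule measurable_Least) (rule p)
qed

lemma V_m:
  assumes "\<tau> = Nm \<or> \<tau> = Np"
  shows "V \<tau> x \<in> borel_measurable S"
proof -
  have t: "\<tau> x \<in> measurable S (count_space UNIV)" using assms by (elim disjE) (simp_all only: Nm_m Np_m)
  have u: "(\<lambda>w. ustat d g (\<tau> x w) w) \<in> borel_measurable S"
    by (rule measurable_compose_countable[OF measurable_ustat[OF g] t])
  show ?thesis unfolding V_def[abs_def]
    by (rule borel_measurable_divide[OF borel_measurable_diff[OF u borel_measurable_const] borel_measurable_const])
qed

text \<open>For \<open>x \<ge> 1\<close> the factor \<open>x powr (- (1 / 16))\<close> is at most
  \<open>1\<close>, so \<open>V\<close> is dominated by \<open>Y\<close> and a power of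
  \<open>K\<close>.\<close>

lemma V_moment_bound:
  assumes tau: "\<tau> = Nm \<or> \<tau> = Np"
  shows "\<exists>C\<ge>0. \<forall>x\<ge>1. integrable S (\<lambda>w. \<bar>V \<tau> x w\<bar> ^ p) \<and> (\<integral>w. \<bar>V \<tau> x w\<bar> ^ p \<partial>S) \<le> C"
proof -
  define k where "k = max 1 p"
  have k: "k \<ge> 1" "p \<le> 2 * k" by (auto simp: k_def)
  obtain K C B where K: "all_moments S K" and C: "C \<ge> 0"
    and AE: "AE w in S. \<forall>x\<ge>1. \<bar>V \<tau> x w - Y x w\<bar> \<le> C * K w ^ B * x powr (- (1 / 16))"
    using V_approx[OF tau] by blast
  obtain D where D: "D \<ge> 0" and Yb: "\<And>x. x \<ge> 1 \<Longrightarrow> integrable S (\<lambda>w. Y x w ^ (2 * k)) \<and> (\<integral>w. Y x w ^ (2 * k) \<partial>S) \<le> D"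
    using Y_moment_bound[OF k(1)] by blast
  have Ki: "integrable S (\<lambda>w. K w ^ (B * (2 * k)))" using K by (simp add: all_moments_def)
  define E where "E = (\<integral>w. K w ^ (B * (2 * k)) \<partial>S)"
  define H where "H x w = 1 + 4 ^ k * (Y x w ^ (2 * k) + C ^ (2 * k) * K w ^ (B * (2 * k)))" for x w
  have Hi: "integrable S (H x)" if "x \<ge> 1" for x
    unfolding H_def[abs_def] using Yb[OF that] Ki by simp
  have pt: "AE w in S. \<forall>x\<ge>1. \<bar>V \<tau> x w\<bar> ^ p \<le> H x w"
    using AE
  proof eventually_elim
    case (elim w)
    show ?case
    proof (intro allI impI)
      fix x :: real assume x: "x \<ge> 1"
      have K0: "K w \<ge> 1" using K by (simp add: all_moments_def)
      have "x powr (- (1 / 16)) \<le> x powr 0" using x by (intro powr_mono) auto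
      then have "C * K w ^ B * x powr (- (1 / 16)) \<le> C * K w ^ B * 1"
        using x C K0 by (intro mult_left_mono) auto
      then have VY: "\<bar>V \<tau> x w - Y x w\<bar> \<le> C * K w ^ B" using elim x by fastforce
      have a: "\<bar>V \<tau> x w\<bar> ^ p \<le> 1 + V \<tau> x w ^ (2 * k)"
      proof (cases "\<bar>V \<tau> x w\<bar> \<le> 1")
        case True
        then have "\<bar>V \<tau> x w\<bar> ^ p \<le> 1" by (intro power_le_one) auto
        then show ?thesis by (simp add: add_increasing2 zero_le_even_power)
      next
        case False
        then have "\<bar>V \<tau> x w\<bar> ^ p \<le> \<bar>V \<tau> x w\<bar> ^ (2 * k)" using k by (intro power_increasing) auto
        then show ?thesis by (simp add: power_even_abs)
      qed
      have "V \<tau> x w ^ (2 * k) = (Y x w + (V \<tau> x w - Y x w)) ^ (2 * k)" by simp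
      also have "\<dots> \<le> 4 ^ k * (Y x w ^ (2 * k) + (V \<tau> x w - Y x w) ^ (2 * k))"
        by (rule diff_even_power_le(1)[OF k(1)])
      also have "(V \<tau> x w - Y x w) ^ (2 * k) = \<bar>V \<tau> x w - Y x w\<bar> ^ (2 * k)" by (simp add: power_even_abs)
      also have "4 ^ k * (Y x w ^ (2 * k) + \<bar>V \<tau> x w - Y x w\<bar> ^ (2 * k)) \<le> 4 ^ k * (Y x w ^ (2 * k) + (C * K w ^ B) ^ (2 * k))"
        by (intro mult_left_mono add_left_mono power_mono VY) auto
      also have "(C * K w ^ B) ^ (2 * k) = C ^ (2 * k) * K w ^ (B * (2 * k))"
        by (simp add: power_mult_distrib power_mult)
      finally show "\<bar>V \<tau> x w\<bar> ^ p \<le> H x w" using a unfolding H_def by linarith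
    qed
  qed
  show ?thesis
  proof (intro exI[of _ "1 + 4 ^ k * (D + C ^ (2 * k) * E)"] conjI allI impI)
    have "E \<ge> 0" unfolding E_def using K by (intro Bochner_Integration.integral_nonneg) (simp add: all_moments_def order_trans[OF zero_le_one])
    then show "0 \<le> 1 + 4 ^ k * (D + C ^ (2 * k) * E)" using D C by simp
    fix x :: real assume x: "x \<ge> 1"
    have ptx: "AE w in S. \<bar>V \<tau> x w\<bar> ^ p \<le> H x w" using pt x by (auto elim: eventually_mono)
    show i: "integrable S (\<lambda>w. \<bar>V \<tau> x w\<bar> ^ p)"
    proof (rule Bochner_Integration.integrable_bound[OF Hi[OF x]])
      show "(\<lambda>w. \<bar>V \<tau> x w\<bar> ^ p) \<in> borel_measurable S"
        by (rule borel_measurable_power[OF borel_measurable_abs[OF V_m[OF tau]]])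
      show "AE w in S. norm (\<bar>V \<tau> x w\<bar> ^ p) \<le> norm (H x w)"
        using ptx by eventually_elim (simp add: order_trans[OF _ abs_ge_self])
    qed
    have "(\<integral>w. \<bar>V \<tau> x w\<bar> ^ p \<partial>S) \<le> (\<integral>w. H x w \<partial>S)" by (rule integral_mono_AE[OF i Hi[OF x] ptx])
    also have "\<dots> = 1 + 4 ^ k * ((\<integral>w. Y x w ^ (2 * k) \<partial>S) + C ^ (2 * k) * E)"
      unfolding H_def E_def using Yb[OF x] Ki by (simp add: P.prob_space)
    also have "\<dots> \<le> 1 + 4 ^ k * (D + C ^ (2 * k) * E)"
      using Yb[OF x] by (intro add_left_mono mult_left_mono add_right_mono) auto
    finally show "(\<integral>w. \<bar>V \<tau> x w\<bar> ^ p \<partial>S) \<le> 1 + 4 ^ k * (D + C ^ (2 * k) * E)" .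
  qed
qed

text \<open>A limit of characteristic functions has modulus at most \<open>1\<close>, hence
  \<open>exp (- (\<gamma>2 / 2)) \<le> 1\<close>. This stands in for a positivity argument about the
  explicit quadratic form.\<close>

lemma gamma2_nonneg: "\<gamma>2 \<ge> 0"
proof -
  define X where "X n = real n + 1" for n :: nat
  have X: "\<And>n. X n \<ge> 1" "filterlim X at_top sequentially"
    unfolding X_def by (simp, real_asymp)
  have "(\<lambda>n. \<integral>w. iexp (1 * Y (X n) w) \<partial>S) \<longlonglongrightarrow> complex_of_real (exp (- (\<gamma>2 * 1\<^sup>2 / 2)))"
    by (rule Y_clt[OF X])
  from tendsto_norm[OF this] have "(\<lambda>n. norm (\<integral>w. iexp (1 * Y (X n) w) \<partial>S)) \<longlonglongrightarrow> exp (- (\<gamma>2 / 2))" by simp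
  moreover have "norm (\<integral>w. iexp (1 * Y (X n) w) \<partial>S) \<le> 1" for n
  proof -
    have "norm (\<integral>w. iexp (1 * Y (X n) w) \<partial>S) \<le> (\<integral>w. norm (iexp (1 * Y (X n) w)) \<partial>S)" by (rule integral_norm_bound)
    then show ?thesis by (simp add: P.prob_space)
  qed
  ultimately have "exp (- (\<gamma>2 / 2)) \<le> 1" by (intro LIMSEQ_le_const2) auto
  then show ?thesis by simp
qed

text \<open>Probabilities bounded below by \<delta> let every estimate in mean survive conditioning
  at the price of a factor \<open>1 / \<delta>\<close>: the moments of \<open>V\<close> stay
  bounded, and \<open>V\<close> may be replaced by \<open>Y\<close>. What is left is the
  characteristic function of \<open>Y\<close> on the event. The unconditional case takes the whole
  space as event.\<close>

theorem conv_conditioned: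
  assumes tau: "\<tau> = Nm \<or> \<tau> = Np" and x0: "x0 \<ge> 1" and \<delta>: "\<delta> > 0"
    and E: "\<And>x. x \<in> S' \<Longrightarrow> x \<ge> x0 \<Longrightarrow> E x \<in> sets S" and pE: "\<And>x. x \<in> S' \<Longrightarrow> x \<ge> x0 \<Longrightarrow> measure S (E x) \<ge> \<delta>"
    and char: "\<And>X t. (\<And>n::nat. X n \<in> S') \<Longrightarrow> (\<And>n. X n \<ge> x0) \<Longrightarrow> filterlim X at_top sequentially \<Longrightarrow>
      (\<lambda>n. (1 / measure S (E (X n))) *\<^sub>R (\<integral>w. indicator (E (X n)) w *\<^sub>R iexp (t * Y (X n) w) \<partial>S))
        \<longlonglongrightarrow> complex_of_real (exp (- (\<gamma>2 * t\<^sup>2 / 2)))"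
  shows "conv_dist_all_moments (\<lambda>x. distr (uniform_measure S (E x)) borel (V \<tau> x)) (normal_law 0 \<gamma>2) (inf at_top (principal S'))"
proof -
  have pos: "measure S (E x) > 0" if "x \<in> S'" "x \<ge> x0" for x using pE[OF that] \<delta> by linarith
  have efin: "emeasure S (E x) \<noteq> \<infinity>" for x by simp
  have prob: "prob_space (uniform_measure S (E x))" if "x \<in> S'" "x \<ge> x0" for x
  proof (rule prob_space_uniform_measure)
    show "emeasure S (E x) \<noteq> 0"
    proof
      assume "emeasure S (E x) = 0"
      then have "measure S (E x) = 0" by (simp only: measure_def enn2real_0)
      then show False using pos[OF that] by linarith
    qed
  qed simp
  have Vm: "V \<tau> x \<in> borel_measurable (uniform_measure S (E x))" for x
    using V_m[OF tau] by (simp only: measurable_cong_sets[OF sets_uniform_measure refl])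
  have Um: "(\<lambda>y::real. \<bar>y\<bar> ^ p) \<in> borel_measurable borel" for p by measurable
  have "\<forall>p. \<exists>C. C \<ge> 0 \<and> (\<forall>x\<ge>1. integrable S (\<lambda>w. \<bar>V \<tau> x w\<bar> ^ p) \<and> (\<integral>w. \<bar>V \<tau> x w\<bar> ^ p \<partial>S) \<le> C)"
    using V_moment_bound[OF tau] by blast
  from choice[OF this] obtain C where C: "\<forall>p. C p \<ge> 0 \<and> (\<forall>x\<ge>1. integrable S (\<lambda>w. \<bar>V \<tau> x w\<bar> ^ p) \<and> (\<integral>w. \<bar>V \<tau> x w\<bar> ^ p \<partial>S) \<le> C p)" ..
  have Ci: "integrable S (\<lambda>w. \<bar>V \<tau> x w\<bar> ^ p)" and Cb: "(\<integral>w. \<bar>V \<tau> x w\<bar> ^ p \<partial>S) \<le> C p" if "x \<ge> 1" for x p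
    by (rule conjunct2[OF C[THEN spec, of p], THEN spec, THEN mp, OF that, THEN conjunct1],
        rule conjunct2[OF C[THEN spec, of p], THEN spec, THEN mp, OF that, THEN conjunct2])
  have Vpm: "(\<lambda>w. \<bar>V \<tau> x w\<bar> ^ p) \<in> borel_measurable S" for x p
    by (rule borel_measurable_power[OF borel_measurable_abs[OF V_m[OF tau]]])
  show ?thesis
  proof (rule conv_dist_all_moments_from_char[where ?x0.0 = x0 and C = "\<lambda>p. (1 / \<delta>) * C p"])
    show "real_distribution (distr (uniform_measure S (E x)) borel (V \<tau> x))" if "x \<in> S'" "x0 \<le> x" for x
      by (rule prob_space.real_distribution_distr[OF prob[OF that] Vm])
    show "real_distribution (normal_law 0 \<gamma>2)" by (rule normal_law_char(1)[OF gamma2_nonneg])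
    show "integrable (normal_law 0 \<gamma>2) (\<lambda>y. \<bar>y\<bar> ^ p)" for p by (rule normal_law_char(3)[OF gamma2_nonneg])
    fix x p assume x: "x \<in> S'" "x0 \<le> x"
    have x1: "x \<ge> 1" using x x0 by linarith
    have i: "integrable (uniform_measure S (E x)) (\<lambda>w. \<bar>V \<tau> x w\<bar> ^ p)"
      by (rule integral_uniform_measure_indicator(2)[OF E[OF x] pos[OF x] Vpm efin Ci[OF x1]])
    show "integrable (distr (uniform_measure S (E x)) borel (V \<tau> x)) (\<lambda>y. \<bar>y\<bar> ^ p)"
      unfolding integrable_distr_eq[OF Vm Um] by (rule i)
    have "(\<integral>y. \<bar>y\<bar> ^ p \<partial>distr (uniform_measure S (E x)) borel (V \<tau> x)) = (\<integral>w. \<bar>V \<tau> x w\<bar> ^ p \<partial>uniform_measure S (E x))"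
      by (rule integral_distr[OF Vm Um])
    also have "\<dots> = (1 / measure S (E x)) *\<^sub>R (\<integral>w. indicator (E x) w *\<^sub>R \<bar>V \<tau> x w\<bar> ^ p \<partial>S)"
      by (rule integral_uniform_measure_indicator(1)[OF E[OF x] pos[OF x] Vpm efin])
    also have "\<dots> \<le> (1 / \<delta>) * C p"
    proof -
      note Vi = Ci[OF x1, of p] and Vb = Cb[OF x1, of p]
      have "(\<integral>w. indicator (E x) w *\<^sub>R \<bar>V \<tau> x w\<bar> ^ p \<partial>S) \<le> (\<integral>w. \<bar>V \<tau> x w\<bar> ^ p \<partial>S)"
        by (rule integral_mono[OF integrable_mult_indicator[OF E[OF x] Vi] Vi]) (simp add: indicator_def)
      then have "(\<integral>w. indicator (E x) w *\<^sub>R \<bar>V \<tau> x w\<bar> ^ p \<partial>S) \<le> C p" using Vb by linarith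
      moreover have "0 \<le> (\<integral>w. indicator (E x) w *\<^sub>R \<bar>V \<tau> x w\<bar> ^ p \<partial>S)"
        by (rule Bochner_Integration.integral_nonneg) (simp add: indicator_def)
      moreover have "1 / measure S (E x) \<le> 1 / \<delta>" using pE[OF x] \<delta> by (simp add: frac_le)
      ultimately show ?thesis using \<delta> unfolding real_scaleR_def by (intro mult_mono) auto
    qed
    finally show "(\<integral>y. \<bar>y\<bar> ^ p \<partial>distr (uniform_measure S (E x)) borel (V \<tau> x)) \<le> (1 / \<delta>) * C p" .
  next
    fix t
    show "((\<lambda>x. char (distr (uniform_measure S (E x)) borel (V \<tau> x)) t) \<longlongrightarrow> char (normal_law 0 \<gamma>2) t) (inf at_top (principal S'))"
    proof (rule tendsto_at_top_within_sequentially[where ?x0.0 = x0])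
      fix X :: "nat \<Rightarrow> real" assume X: "\<And>n. X n \<in> S'" "\<And>n. X n \<ge> x0" "filterlim X at_top sequentially"
      have X1: "X n \<ge> 1" for n using X(2)[of n] x0 by linarith
      obtain K C B where K: "all_moments S K" and C: "C \<ge> 0"
        and AE: "AE w in S. \<forall>x\<ge>1. \<bar>V \<tau> x w - Y x w\<bar> \<le> C * K w ^ B * x powr (- (1 / 16))"
        using V_approx[OF tau] by blast
      have Ki: "integrable S (\<lambda>w. K w ^ B)" using K by (simp add: all_moments_def)
      have ib: "integrable S (\<lambda>w. indicator (E (X n)) w *\<^sub>R iexp (t * h w))" if "h \<in> borel_measurable S" for h n
        by (rule integrable_mult_indicator[OF E[OF X(1,2)] P.integrable_const_bound[where B = 1, OF _ measurable_iexp_mult[OF that]]]) simp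
      define I where "I h n = (1 / measure S (E (X n))) *\<^sub>R (\<integral>w. indicator (E (X n)) w *\<^sub>R iexp (t * h n w) \<partial>S)" for h :: "nat \<Rightarrow> (nat \<Rightarrow> 'b) \<Rightarrow> real" and n
      have cV: "char (distr (uniform_measure S (E (X n))) borel (V \<tau> (X n))) t = I (\<lambda>n. V \<tau> (X n)) n" for n
      proof -
        have "char (distr (uniform_measure S (E (X n))) borel (V \<tau> (X n))) t = (\<integral>w. iexp (t * V \<tau> (X n) w) \<partial>uniform_measure S (E (X n)))"
          unfolding char_def by (rule integral_distr[OF Vm measurable_iexp_mult]) simp
        also have "\<dots> = I (\<lambda>n. V \<tau> (X n)) n" unfolding I_def
          by (rule integral_uniform_measure_indicator(1)[OF E[OF X(1,2)] pos[OF X(1,2)] measurable_iexp_mult[OF V_m[OF tau]] efin])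
        finally show ?thesis .
      qed
      have diff: "norm (I (\<lambda>n. V \<tau> (X n)) n - I (\<lambda>n. Y (X n)) n) \<le> (1 / \<delta>) * (\<bar>t\<bar> * C * (\<integral>w. K w ^ B \<partial>S)) * X n powr (- (1 / 16))" for n
      proof -
        define c where "c = \<bar>t\<bar> * C * X n powr (- (1 / 16))"
        have "norm ((\<integral>w. indicator (E (X n)) w *\<^sub>R iexp (t * V \<tau> (X n) w) \<partial>S) - (\<integral>w. indicator (E (X n)) w *\<^sub>R iexp (t * Y (X n) w) \<partial>S))
          = norm (\<integral>w. indicator (E (X n)) w *\<^sub>R iexp (t * V \<tau> (X n) w) - indicator (E (X n)) w *\<^sub>R iexp (t * Y (X n) w) \<partial>S)"
          by (simp only: Bochner_Integration.integral_diff[OF ib[OF V_m[OF tau]] ib[OF Y_m]])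
        also have "\<dots> \<le> (\<integral>w. norm (indicator (E (X n)) w *\<^sub>R iexp (t * V \<tau> (X n) w) - indicator (E (X n)) w *\<^sub>R iexp (t * Y (X n) w)) \<partial>S)"
          by (rule integral_norm_bound)
        also have "\<dots> \<le> (\<integral>w. c * K w ^ B \<partial>S)"
        proof (rule integral_mono_AE)
          show "integrable S (\<lambda>w. norm (indicator (E (X n)) w *\<^sub>R iexp (t * V \<tau> (X n) w) - indicator (E (X n)) w *\<^sub>R iexp (t * Y (X n) w)))"
            by (rule integrable_norm[OF Bochner_Integration.integrable_diff[OF ib[OF V_m[OF tau]] ib[OF Y_m]]])
          show "integrable S (\<lambda>w. c * K w ^ B)" by (rule integrable_mult_right[OF Ki])
          show "AE w in S. norm (indicator (E (X n)) w *\<^sub>R iexp (t * V \<tau> (X n) w) - indicator (E (X n)) w *\<^sub>R iexp (t * Y (X n) w)) \<le> c * K w ^ B"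
            using AE
          proof eventually_elim
            case (elim w)
            define v where "v = V \<tau> (X n) w"
            define y where "y = Y (X n) w"
            have "norm (iexp (t * v) - iexp (t * y)) \<le> \<bar>t\<bar> * \<bar>v - y\<bar>" by (rule norm_iexp_diff_le)
            also have "\<dots> \<le> \<bar>t\<bar> * (C * K w ^ B * X n powr (- (1 / 16)))"
              unfolding v_def y_def by (rule mult_left_mono[OF elim[rule_format, OF X1] abs_ge_zero])
            also have "\<dots> = c * K w ^ B" by (simp add: c_def)
            finally have le: "norm (iexp (t * v) - iexp (t * y)) \<le> c * K w ^ B" .
            have "norm (indicator (E (X n)) w *\<^sub>R iexp (t * v) - indicator (E (X n)) w *\<^sub>R iexp (t * y)) \<le> norm (iexp (t * v) - iexp (t * y))"
              by (cases "w \<in> E (X n)") simp_all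
            then show ?case using le unfolding v_def y_def by linarith
          qed
        qed
        also have "\<dots> = c * (\<integral>w. K w ^ B \<partial>S)" by (rule integral_mult_right_zero)
        finally have n1: "norm ((\<integral>w. indicator (E (X n)) w *\<^sub>R iexp (t * V \<tau> (X n) w) \<partial>S) - (\<integral>w. indicator (E (X n)) w *\<^sub>R iexp (t * Y (X n) w) \<partial>S)) \<le> c * (\<integral>w. K w ^ B \<partial>S)" .
        have p1: "1 / measure S (E (X n)) \<le> 1 / \<delta>" "0 \<le> 1 / measure S (E (X n))" using pE[OF X(1,2), of n] \<delta> by (simp_all add: frac_le)
        have "norm (I (\<lambda>n. V \<tau> (X n)) n - I (\<lambda>n. Y (X n)) n) = (1 / measure S (E (X n))) *
          norm ((\<integral>w. indicator (E (X n)) w *\<^sub>R iexp (t * V \<tau> (X n) w) \<partial>S) - (\<integral>w. indicator (E (X n)) w *\<^sub>R iexp (t * Y (X n) w) \<partial>S))"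
          unfolding I_def scaleR_diff_right[symmetric] norm_scaleR using p1 by simp
        also have "\<dots> \<le> (1 / \<delta>) * (c * (\<integral>w. K w ^ B \<partial>S))" using \<delta> by (intro mult_mono p1 n1) auto
        also have "\<dots> = (1 / \<delta>) * (\<bar>t\<bar> * C * (\<integral>w. K w ^ B \<partial>S)) * X n powr (- (1 / 16))" by (simp add: c_def)
        finally show ?thesis .
      qed
      have "(\<lambda>n. (1 / \<delta>) * (\<bar>t\<bar> * C * (\<integral>w. K w ^ B \<partial>S)) * X n powr (- (1 / 16))) \<longlonglongrightarrow> (1 / \<delta>) * (\<bar>t\<bar> * C * (\<integral>w. K w ^ B \<partial>S)) * 0"
        by (rule tendsto_mult_left[OF inverse_powr_tendsto[OF X1 X(3)]]) simp
      then have z: "(\<lambda>n. (1 / \<delta>) * (\<bar>t\<bar> * C * (\<integral>w. K w ^ B \<partial>S)) * X n powr (- (1 / 16))) \<longlonglongrightarrow> 0" by (simp only: mult_zero_right)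
      have "(\<lambda>n. I (\<lambda>n. V \<tau> (X n)) n - I (\<lambda>n. Y (X n)) n) \<longlonglongrightarrow> 0"
        by (rule Lim_null_comparison[OF always_eventually z]) (rule allI, rule diff)
      moreover have "I (\<lambda>n. Y (X n)) \<longlonglongrightarrow> complex_of_real (exp (- (\<gamma>2 * t\<^sup>2 / 2)))"
        unfolding I_def[abs_def] by (rule char[OF X])
      ultimately have "(\<lambda>n. I (\<lambda>n. V \<tau> (X n)) n - I (\<lambda>n. Y (X n)) n + I (\<lambda>n. Y (X n)) n) \<longlonglongrightarrow> 0 + complex_of_real (exp (- (\<gamma>2 * t\<^sup>2 / 2)))"
        by (rule tendsto_add)
      then show "(\<lambda>n. char (distr (uniform_measure S (E (X n))) borel (V \<tau> (X n))) t) \<longlonglongrightarrow> char (normal_law 0 \<gamma>2) t"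
        unfolding cV normal_law_char(2)[OF gamma2_nonneg] by (simp only: diff_add_cancel add_0_left)
    qed
  qed
qed

end

section \<open>Renewal events\<close>

locale lattice_renewal_ustat = renewal_ustat \<nu> d f g mu mg
  for \<nu> :: "'b measure" and d :: nat and f :: "'b \<Rightarrow> real" and g :: "(nat \<Rightarrow> 'b) \<Rightarrow> real" and mu mg :: real +
  assumes lattice: "AE y in \<nu>. f y \<in> \<int> \<and> f y \<ge> 0"
begin

text \<open>For \<open>k \<ge> 1\<close> and a nondecreasing walk this is the event that the overshoot is \<open>k\<close>; for \<open>k = 0\<close>
  it is the event that the walk visits \<open>x\<close>. In this form it shifts exactly under a first step.\<close>

definition hits :: "nat \<Rightarrow> real \<Rightarrow> (nat \<Rightarrow> 'b) \<Rightarrow> bool" where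
  "hits k x v \<longleftrightarrow> (\<exists>n. Usum n v = x + real k \<and> (n = 0 \<or> Usum (n - 1) v \<le> x))"

definition hit_prob :: "nat \<Rightarrow> int \<Rightarrow> real" where
  "hit_prob k z = measure S {v \<in> space S. hits k (of_int z) v}"

text \<open>A version of \<open>f\<close> with natural values, as the renewal theorem requires; the
  two agree almost everywhere.\<close>

definition step :: "'b \<Rightarrow> nat" where "step y = nat \<lfloor>f y\<rfloor>"

lemma Usum_zero: "Usum 0 v = 0"
  by (simp add: Usum_def)

lemma Usum_Suc: "Usum (Suc n) v = Usum n v + f (v n)"
  by (simp add: Usum_def)

lemma Usum_Suc_case_nat: "Usum (Suc n) (case_nat s v) = f s + Usum n v"
  unfolding Usum_def sum.lessThan_Suc_shift by simp

text \<open>\<open>x + real k > 0\<close> excludes a hit at time \<open>0\<close>, and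
  \<open>x \<ge> 0\<close> makes the condition on the preceding value automatic when the hit is at
  the first step.\<close>

lemma hits_case_nat:
  assumes x: "x \<ge> 0" "x + real k > 0"
  shows "hits k x (case_nat s v) \<longleftrightarrow> hits k (x - f s) v"
proof
  assume "hits k x (case_nat s v)"
  then obtain n where n: "Usum n (case_nat s v) = x + real k" "n = 0 \<or> Usum (n - 1) (case_nat s v) \<le> x"
    unfolding hits_def by blast
  have "n \<noteq> 0"
  proof
    assume "n = 0"
    then have "x + real k = 0" using n(1) by (simp only: Usum_zero)
    then show False using x(2) by linarith
  qed
  then obtain m where m: "n = Suc m" using not0_implies_Suc by blast
  have 1: "Usum m v = x - f s + real k" using n(1) unfolding m Usum_Suc_case_nat by linarith
  have 2: "m = 0 \<or> Usum (m - 1) v \<le> x - f s"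
  proof (cases m)
    case (Suc m')
    have "f s + Usum m' v \<le> x" using n(2) unfolding m Suc diff_Suc_1 Usum_Suc_case_nat by simp
    then show ?thesis unfolding Suc diff_Suc_1 by linarith
  qed simp
  show "hits k (x - f s) v" unfolding hits_def using 1 2 by blast
next
  assume "hits k (x - f s) v"
  then obtain m where m: "Usum m v = x - f s + real k" "m = 0 \<or> Usum (m - 1) v \<le> x - f s"
    unfolding hits_def by blast
  have 1: "Usum (Suc m) (case_nat s v) = x + real k" unfolding Usum_Suc_case_nat using m(1) by linarith
  have 2: "Usum (Suc m - 1) (case_nat s v) \<le> x"
  proof (cases m)
    case 0
    show ?thesis unfolding 0 diff_Suc_1 Usum_zero by (rule x(1))
  next
    case (Suc m')
    have "Usum m' v \<le> x - f s" using m(2) unfolding Suc diff_Suc_1 by simp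
    then show ?thesis unfolding Suc diff_Suc_1 Usum_Suc_case_nat by linarith
  qed
  show "hits k x (case_nat s v)" unfolding hits_def using 1 2 by blast
qed

text \<open>The shift by one step is iterated, which is allowed while the walk is strictly below
  \<open>x\<close>.\<close>

lemma hits_comb_seq:
  assumes "\<And>i. i < m \<Longrightarrow> Usum i u < x"
  shows "hits k x (comb_seq m u v) \<longleftrightarrow> hits k (x - Usum m u) v"
  using assms
proof (induction m arbitrary: v)
  case 0
  show ?case by (simp add: comb_seq_0 Usum_zero)
next
  case (Suc m)
  have lt: "x - Usum m u > 0" using Suc.prems[OF lessI] by linarith
  have "hits k x (comb_seq (Suc m) u v) \<longleftrightarrow> hits k (x - Usum m u) (case_nat (u m) v)"
    unfolding comb_seq_Suc by (rule Suc.IH[OF Suc.prems[OF less_SucI]])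
  also have "\<dots> \<longleftrightarrow> hits k (x - Usum m u - f (u m)) v"
    by (rule hits_case_nat) (use lt in linarith)+
  finally show ?case by (simp only: Usum_Suc diff_diff_eq)
qed

lemma hits_sets: "{v \<in> space S. hits k x v} \<in> sets S"
  unfolding hits_def
  by (intro sets.sets_Collect_countable_Ex sets.sets_Collect_conj sets.sets_Collect_disj sets.sets_Collect_const
      borel_measurable_eq borel_measurable_le borel_measurable_const Usum_m)

lemma AE_steps: "AE v in S. \<forall>i. f (v i) \<in> \<int> \<and> f (v i) \<ge> 0"
proof (subst AE_all_countable, rule allI)
  fix i :: nat
  show "AE v in S. f (v i) \<in> \<int> \<and> f (v i) \<ge> 0"
    by (rule AE_PiM_component[where I = UNIV and M = "\<lambda>_. \<nu>", OF prob_nu UNIV_I lattice])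
qed

lemma comb_seq_section_measurable:
  assumes A: "A \<in> sets S"
  shows "(\<lambda>u. measure S {v \<in> space S. comb_seq m u v \<in> A}) \<in> borel_measurable S"
proof -
  define Q where "Q = (\<lambda>(u, v). comb_seq m u v) -` A \<inter> space (S \<Otimes>\<^sub>M S)"
  have Q: "Q \<in> sets (S \<Otimes>\<^sub>M S)" unfolding Q_def by (rule measurable_sets[OF measurable_comb_seq A])
  have "(\<lambda>u. enn2real (emeasure S (Pair u -` Q))) \<in> borel_measurable S"
    by (rule borel_measurable_enn2real[OF P.measurable_emeasure_Pair[OF Q]])
  then show ?thesis
  proof (rule measurable_cong[THEN iffD1, rotated])
    fix u assume u: "u \<in> space S"
    have "Pair u -` Q = {v \<in> space S. comb_seq m u v \<in> A}"
      using u by (auto simp: Q_def space_pair_measure)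
    then show "enn2real (emeasure S (Pair u -` Q)) = measure S {v \<in> space S. comb_seq m u v \<in> A}"
      by (simp only: measure_def)
  qed
qed

text \<open>The Markov property at time \<open>m\<close>: \<open>h\<close> depends on the first
  \<open>m\<close> coordinates only and comes out of the integral over the future, which leaves the
  conditional probability of \<open>A\<close>.\<close>

lemma integral_comb_seq:
  fixes h :: "(nat \<Rightarrow> 'b) \<Rightarrow> 'c :: {banach, second_countable_topology}"
  assumes h: "h \<in> borel_measurable S" and bound: "\<And>w. norm (h w) \<le> 1"
    and dep: "\<And>u v. h (comb_seq m u v) = h u" and A: "A \<in> sets S"
  shows "(\<integral>w. indicator A w *\<^sub>R h w \<partial>S) = (\<integral>u. measure S {v \<in> space S. comb_seq m u v \<in> A} *\<^sub>R h u \<partial>S)"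
proof -
  interpret SS: pair_prob_space S S by (rule pair_prob)
  have cm: "(\<lambda>(u, v). comb_seq m u v) \<in> measurable (S \<Otimes>\<^sub>M S) S" by (rule measurable_comb_seq)
  have gm: "(\<lambda>w. indicator A w *\<^sub>R h w) \<in> borel_measurable S"
    by (rule borel_measurable_scaleR[OF borel_measurable_indicator[OF A] h])
  have cm1: "comb_seq m u \<in> measurable S S" if "u \<in> space S" for u
    using measurable_compose[OF measurable_Pair[OF measurable_const[OF that] measurable_ident] cm]
    unfolding split_conv id_apply .
  define F where "F = (\<lambda>p. indicator A (case_prod (comb_seq m) p) *\<^sub>R h (case_prod (comb_seq m) p))"
  have Fm: "F \<in> borel_measurable (S \<Otimes>\<^sub>M S)" unfolding F_def by (rule measurable_compose[OF cm gm])
  have Fi: "integrable (S \<Otimes>\<^sub>M S) F"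
  proof (rule SS.P.integrable_const_bound[OF AE_I2 Fm])
    fix p show "norm (F p) \<le> 1" unfolding F_def norm_scaleR using bound by (simp add: indicator_def)
  qed
  have "(\<integral>w. indicator A w *\<^sub>R h w \<partial>S) = (\<integral>w. indicator A w *\<^sub>R h w \<partial>distr (S \<Otimes>\<^sub>M S) S (\<lambda>(u, v). comb_seq m u v))"
    unfolding PiM_comb_seq ..
  also have "\<dots> = (\<integral>p. F p \<partial>(S \<Otimes>\<^sub>M S))" unfolding F_def by (rule integral_distr[OF cm gm])
  also have "\<dots> = (\<integral>u. \<integral>v. F (u, v) \<partial>S \<partial>S)" by (rule SS.integral_fst'[OF Fi, symmetric])
  also have "\<dots> = (\<integral>u. measure S {v \<in> space S. comb_seq m u v \<in> A} *\<^sub>R h u \<partial>S)"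
  proof (rule Bochner_Integration.integral_cong[OF refl])
    fix u assume u: "u \<in> space S"
    have B: "{v \<in> space S. comb_seq m u v \<in> A} \<in> sets S"
      using measurable_sets[OF cm1[OF u] A] by (simp add: vimage_def Int_def conj_commute)
    have "(\<integral>v. F (u, v) \<partial>S) = (\<integral>v. indicator {v \<in> space S. comb_seq m u v \<in> A} v *\<^sub>R h u \<partial>S)"
      unfolding F_def split_conv dep by (intro Bochner_Integration.integral_cong refl arg_cong2[where f = scaleR]) (simp add: indicator_def)
    also have "\<dots> = measure S {v \<in> space S. comb_seq m u v \<in> A} *\<^sub>R h u"
      by (rule has_bochner_integral_integral_eq[OF has_bochner_integral_indicator[OF B]]) (simp add: P.emeasure_eq_measure)
    finally show "(\<integral>v. F (u, v) \<partial>S) = measure S {v \<in> space S. comb_seq m u v \<in> A} *\<^sub>R h u" .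
  qed
  finally show ?thesis .
qed

lemma step_measurable: "step \<in> measurable \<nu> (count_space UNIV)"
proof -
  have "(\<lambda>y. \<lfloor>f y\<rfloor>) \<in> measurable \<nu> (count_space UNIV)" by (rule measurable_compose[OF f measurable_real_floor])
  from measurable_compose[OF this measurable_count_space] show ?thesis unfolding step_def[abs_def] .
qed

lemma step_eq: "AE y in \<nu>. f y = real (step y)"
  using lattice
proof eventually_elim
  case (elim y)
  then obtain j :: int where j: "f y = of_int j" by (auto elim: Ints_cases)
  then show ?case using elim by (simp add: step_def)
qed

lemma step_integral: "integrable \<nu> (\<lambda>y. real (step y))" "(\<integral>y. real (step y) \<partial>\<nu>) = mu"
proof -
  have m: "(\<lambda>y. real (step y)) \<in> borel_measurable \<nu>"
    by (rule measurable_compose[OF step_measurable borel_measurable_count_space])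
  show "integrable \<nu> (\<lambda>y. real (step y))"
    using integrable_cong_AE[OF f m step_eq] f_integrable by (rule iffD1)
  show "(\<integral>y. real (step y) \<partial>\<nu>) = mu" unfolding mu_def by (rule integral_cong_AE[OF f m step_eq, symmetric])
qed

text \<open>Condition on the first step. The range of \<open>z\<close> is that of
  \<open>hits_case_nat\<close>: for \<open>k = 0\<close> the level \<open>0\<close> is already hit
  at time \<open>0\<close> and has to be left out.\<close>

lemma hit_prob_recursion:
  assumes z: "z \<ge> (if k = 0 then 1 else 0)"
  shows "hit_prob k z = (\<integral>y. hit_prob k (z - int (step y)) \<partial>\<nu>)"
proof -
  define A where "A = {v \<in> space S. hits k (of_int z) v}"
  have A: "A \<in> sets S" unfolding A_def by (rule hits_sets)
  have x: "real_of_int z \<ge> 0" "real_of_int z + real k > 0" using z by (auto split: if_splits)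
  have "hit_prob k z = (\<integral>w. indicator A w *\<^sub>R (1::real) \<partial>S)"
    unfolding hit_prob_def A_def[symmetric] using A by simp
  also have "\<dots> = (\<integral>u. measure S {v \<in> space S. comb_seq (Suc 0) u v \<in> A} *\<^sub>R (1::real) \<partial>S)"
    by (rule integral_comb_seq[OF borel_measurable_const _ refl A]) simp
  also have "\<dots> = (\<integral>u. hit_prob k (z - int (step (u 0))) \<partial>S)"
  proof (rule integral_cong_AE)
    show "(\<lambda>u. hit_prob k (z - int (step (u 0)))) \<in> borel_measurable S"
    proof (rule measurable_coordinate[where F = "\<lambda>y. hit_prob k (z - int (step y))"])
      show "(\<lambda>y. hit_prob k (z - int (step y))) \<in> borel_measurable \<nu>"
        by (rule measurable_compose[OF step_measurable borel_measurable_count_space])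
    qed
    show "(\<lambda>u. measure S {v \<in> space S. comb_seq (Suc 0) u v \<in> A} *\<^sub>R (1::real)) \<in> borel_measurable S"
      by (rule borel_measurable_scaleR[OF comb_seq_section_measurable[OF A] borel_measurable_const])
    have st: "AE u in S. f (u 0) = real (step (u 0))"
      by (rule AE_PiM_component[where I = UNIV and M = "\<lambda>_. \<nu>", OF prob_nu UNIV_I step_eq])
    have sp: "AE u in S. u \<in> space S" by (rule AE_space)
    show "AE u in S. measure S {v \<in> space S. comb_seq (Suc 0) u v \<in> A} *\<^sub>R (1::real) = hit_prob k (z - int (step (u 0)))"
      using st sp
    proof eventually_elim
      case (elim u)
      have sp: "case_nat (u 0) v \<in> space S" if "v \<in> space S" for v
      proof -
        have "u 0 \<in> space \<nu>" using elim(2) by (auto simp: space_PiM)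
        then show ?thesis using that by (auto simp: space_PiM PiE_iff split: nat.split)
      qed
      have "comb_seq (Suc 0) u v \<in> A \<longleftrightarrow> hits k (of_int (z - int (step (u 0)))) v" if "v \<in> space S" for v
        using sp[OF that] hits_case_nat[OF x, of "u 0" v] unfolding comb_seq_Suc_0 A_def elim(1) by simp
      then have "{v \<in> space S. comb_seq (Suc 0) u v \<in> A} = {v \<in> space S. hits k (of_int (z - int (step (u 0)))) v}" by blast
      then show ?case unfolding hit_prob_def by simp
    qed
  qed
  also have "\<dots> = (\<integral>y. hit_prob k (z - int (step y)) \<partial>\<nu>)"
    by (rule integral_coordinate(1)[of "\<lambda>y. hit_prob k (z - int (step y))"])
      (rule measurable_compose[OF step_measurable borel_measurable_count_space])
  finally show ?thesis .
qed

lemma Usum_mono: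
  assumes "\<And>i. f (v i) \<ge> 0" "m \<le> n"
  shows "Usum m v \<le> Usum n v"
  unfolding Usum_def using assms by (intro sum_mono2) auto

text \<open>Below the range of the recursion the event reduces, for nonnegative steps, to a hit at
  time \<open>0\<close>, which means \<open>z = - int k\<close>. This single initial value fixes the
  residue class of the admissible levels.\<close>

lemma hit_prob_init:
  assumes z: "z < (if k = 0 then 1 else 0)"
  shows "hit_prob k z = (if z = - int k then 1 else 0)"
proof -
  have "AE v in S. hits k (of_int z) v \<longleftrightarrow> z = - int k"
    using AE_steps
  proof eventually_elim
    case (elim v)
    show ?case
    proof
      assume "z = - int k"
      then have "Usum 0 v = of_int z + real k" by (simp add: Usum_zero)
      then show "hits k (of_int z) v" unfolding hits_def by blast
    next
      assume "hits k (of_int z) v"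
      then obtain n where n: "Usum n v = of_int z + real k" "n = 0 \<or> Usum (n - 1) v \<le> of_int z"
        unfolding hits_def by blast
      show "z = - int k"
      proof (cases "n = 0")
        case True
        then have "real_of_int z + real k = 0" using n(1) by (simp add: Usum_zero)
        then show ?thesis by linarith
      next
        case False
        have "Usum 0 v \<le> Usum (n - 1) v" by (rule Usum_mono) (use elim in auto)
        then have "z \<ge> 0" using n(2) False by (simp add: Usum_zero)
        then show ?thesis using z by (auto split: if_splits)
      qed
    qed
  qed
  then have "hit_prob k z = measure S {v \<in> space S. z = - int k}"
    unfolding hit_prob_def
    by (intro P.finite_measure_eq_AE[OF _ hits_sets sets.sets_Collect_const]) (auto elim: eventually_mono)
  moreover have "{v \<in> space S. z = - int k} = (if z = - int k then space S else {})" by auto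
  ultimately show ?thesis by (simp add: P.prob_space)
qed

lemma hit_prob_limit:
  "\<exists>h::nat. \<exists>l::real. h \<ge> 1 \<and> l \<ge> 0 \<and> (AE y in \<nu>. h dvd step y) \<and> (\<forall>z. hit_prob k z \<noteq> 0 \<longrightarrow> int h dvd z - (- int k)) \<and>
     (\<forall>e>0. \<exists>z1. \<forall>z\<ge>z1. int h dvd z - (- int k) \<longrightarrow> \<bar>hit_prob k z - l\<bar> < e) \<and> (l = 0 \<longrightarrow> (\<forall>z\<ge>(if k = 0 then 1 else 0). hit_prob k z = 0))"
proof (rule M.renewal_limit[where a = "hit_prob k" and B = 1 and c = "- int k", OF step_measurable step_integral(1)])
  show "\<bar>hit_prob k z\<bar> \<le> 1" for z unfolding hit_prob_def abs_of_nonneg[OF measure_nonneg] by (rule P.prob_le_1)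
  show "hit_prob k z \<ge> 0" for z unfolding hit_prob_def by (rule measure_nonneg)
  show "hit_prob k z = (\<integral>y. hit_prob k (z - int (step y)) \<partial>\<nu>)" if "z \<ge> (if k = 0 then 1 else 0)" for z
    by (rule hit_prob_recursion[OF that])
  show "(\<integral>y. real (step y) \<partial>\<nu>) > 0" unfolding step_integral(2) by (rule mu)
  show "hit_prob k z = (if z = - int k then 1 else 0)" if "z < (if k = 0 then 1 else 0)" for z
    by (rule hit_prob_init[OF that])
  show "- int k < (if k = 0 then 1 else 0)" by simp
qed

end

lemma powr_minus_sublinear_at_top:
  fixes m k :: real
  assumes "m > 0"
  shows "filterlim (\<lambda>x::real. x powr (3 / 4) - k * (1 + x / m) powr (9 / 16)) at_top at_top"
  using assms by real_asymp

section \<open>Conditioning on the observations up to the early time\<close>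

context lattice_renewal_ustat
begin

lemma Y_comb_seq: "Y x (comb_seq (early_time mu x) u v) = Y x u"
proof -
  have 1: "Z (early_time mu x) (comb_seq (early_time mu x) u v) = Z (early_time mu x) u"
    unfolding Z_def by (rule ustat_cong) (rule comb_seq_less)
  have 2: "T (early_time mu x) (comb_seq (early_time mu x) u v) = T (early_time mu x) u"
    unfolding T_def by (intro sum.cong refl arg_cong[where f = fc] comb_seq_less) simp
  show ?thesis unfolding Y_def 1 2 ..
qed

text \<open>The gap \<open>X n powr (3 / 4)\<close> exceeds the fluctuation of order
  \<open>9 / 16\<close>, so on a good path the level is eventually arbitrarily far ahead.\<close>

lemma remaining_at_top:
  assumes K: "K w \<ge> 1" and w: "w \<in> good K"
    and X1: "\<And>n. X n \<ge> 1" and X: "filterlim X at_top sequentially"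
  shows "filterlim (\<lambda>n. X n - Usum (early_time mu (X n)) w) at_top sequentially"
proof (rule filterlim_at_top_mono)
  show "filterlim (\<lambda>n. X n powr (3 / 4) - K w * (1 + X n / mu) powr (9 / 16)) at_top sequentially"
    by (rule filterlim_compose[OF _ X, where g = "\<lambda>x. x powr (3 / 4) - K w * (1 + x / mu) powr (9 / 16)"])
      (rule powr_minus_sublinear_at_top[OF mu])
  show "\<forall>\<^sub>F n in sequentially. X n powr (3 / 4) - K w * (1 + X n / mu) powr (9 / 16) \<le> X n - Usum (early_time mu (X n)) w"
  proof (rule always_eventually, rule allI)
    fix n
    define m where "m = early_time mu (X n)"
    have b: "real m \<le> (X n - X n powr (3 / 4)) / mu" unfolding m_def by (rule early_time_bounds(1)[OF mu X1])
    then have b1: "mu * real m \<le> X n - X n powr (3 / 4)" using mu by (simp add: pos_le_divide_eq mult.commute)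
    have "(X n - X n powr (3 / 4)) / mu \<le> X n / mu" using mu by (simp add: divide_right_mono)
    then have "1 + real m \<le> 1 + X n / mu" using b by linarith
    then have "(1 + real m) powr (9 / 16) \<le> (1 + X n / mu) powr (9 / 16)" by (intro powr_mono2) auto
    then have "K w * (1 + real m) powr (9 / 16) \<le> K w * (1 + X n / mu) powr (9 / 16)"
      using K by (intro mult_left_mono) auto
    moreover have "\<bar>T m w\<bar> \<le> K w * (1 + real m) powr (9 / 16)" by (rule T_growth[OF K w])
    moreover have "Usum m w = mu * real m + T m w" by (rule Usum_eq[OF K w])
    ultimately show "X n powr (3 / 4) - K w * (1 + X n / mu) powr (9 / 16) \<le> X n - Usum (early_time mu (X n)) w"
      unfolding m_def[symmetric] using b1 by linarith
  qed
qed

lemma Usum_step: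
  assumes "\<And>i. f (u i) = real (step (u i))"
  shows "Usum n u = real (\<Sum>i<n. step (u i))"
  unfolding Usum_def of_nat_sum by (intro sum.cong refl assms)

text \<open>For a nondecreasing walk, the first passage time is the only positive \<open>n\<close>
  with \<open>Usum (n - 1) w \<le> x\<close> and \<open>x < Usum n w\<close>.\<close>

lemma overshoot_iff_hits:
  assumes K: "K w \<ge> 1" and w: "w \<in> good K" and f0: "\<And>i. f (w i) \<ge> 0" and x: "x \<ge> 0" and k: "k \<ge> 1"
  shows "Usum (Np x w) w - x = real k \<longleftrightarrow> hits k x w"
proof
  assume "Usum (Np x w) w - x = real k"
  then have "Usum (Np x w) w = x + real k" by linarith
  then show "hits k x w" unfolding hits_def using Np_props(3)[OF K w x] by blast
next
  assume "hits k x w"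
  then obtain n where n: "Usum n w = x + real k" "n = 0 \<or> Usum (n - 1) w \<le> x" unfolding hits_def by blast
  have gt: "x < Usum n w" using n(1) k by simp
  have n0: "n \<noteq> 0"
  proof
    assume n: "n = 0"
    show False using gt x unfolding n Usum_zero by linarith
  qed
  have "Np x w \<le> n" by (rule Np_props(4)[OF K w x gt])
  moreover have "\<not> Np x w \<le> n - 1"
  proof
    assume "Np x w \<le> n - 1"
    then have "Usum (Np x w) w \<le> Usum (n - 1) w" by (rule Usum_mono[OF f0])
    then show False using Np_props(1)[OF K w x] n(2) n0 by linarith
  qed
  ultimately have "Np x w = n" using n0 by linarith
  then show "Usum (Np x w) w - x = real k" using n(1) by simp
qed

text \<open>For a nondecreasing walk, the last value not above \<open>x\<close> is also the largest
  such value, so it equals \<open>x\<close> as soon as the walk visits \<open>x\<close>.\<close>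

lemma hit_iff_hits:
  assumes K: "K w \<ge> 1" and w: "w \<in> good K" and f0: "\<And>i. f (w i) \<ge> 0" and x: "x \<ge> 0"
  shows "Usum (Nm x w) w = x \<longleftrightarrow> hits 0 x w"
proof
  assume e: "Usum (Nm x w) w = x"
  have "Usum (Nm x w - 1) w \<le> Usum (Nm x w) w" by (rule Usum_mono[OF f0]) simp
  then show "hits 0 x w" unfolding hits_def using e by auto
next
  assume "hits 0 x w"
  then obtain n where n: "Usum n w = x" unfolding hits_def by auto
  have "n \<le> Nm x w" by (rule Nm_props(3)[OF K w x]) (simp only: n order_refl)
  then have "Usum n w \<le> Usum (Nm x w) w" by (rule Usum_mono[OF f0])
  then show "Usum (Nm x w) w = x" using Nm_props(1)[OF K w x] n by linarith
qed

text \<open>\<open>b n u\<close> is the conditional probability of the event given the first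
  \<open>m n\<close> coordinates. It tends to \<open>l\<close> almost surely, so the event and
  \<open>Y\<close> become asymptotically independent; dividing by the probability of the event,
  which also tends to \<open>l\<close>, leaves the unconditional limit.\<close>

lemma conditional_char_limit:
  assumes X1: "\<And>n::nat. X n \<ge> 1" and X: "filterlim X at_top sequentially" and XZ: "\<And>n. X n \<in> \<int>"
    and pos: "\<And>n. hit_prob k \<lfloor>X n\<rfloor> \<noteq> 0"
    and h: "AE y in \<nu>. h dvd step y" "\<And>z. hit_prob k z \<noteq> 0 \<Longrightarrow> int h dvd z - (- int k)"
    and lim: "\<And>e. e > 0 \<Longrightarrow> \<exists>z1. \<forall>z\<ge>z1. int h dvd z - (- int k) \<longrightarrow> \<bar>hit_prob k z - l\<bar> < e" and l: "l > 0"
  shows "(\<lambda>n. (1 / hit_prob k \<lfloor>X n\<rfloor>) *\<^sub>R (\<integral>w. indicator {v \<in> space S. hits k (X n) v} w *\<^sub>R iexp (t * Y (X n) w) \<partial>S))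
        \<longlonglongrightarrow> complex_of_real (exp (- (\<gamma>2 * t\<^sup>2 / 2)))"
proof -
  define m where "m n = early_time mu (X n)" for n
  define b where "b n u = measure S {v \<in> space S. comb_seq (m n) u v \<in> {v \<in> space S. hits k (X n) v}}" for n u
  define q where "q n = (\<integral>w. indicator {v \<in> space S. hits k (X n) v} w *\<^sub>R iexp (t * Y (X n) w) \<partial>S)" for n
  define c where "c n = (\<integral>w. iexp (t * Y (X n) w) \<partial>S)" for n
  define I where "I n u = iexp (t * Y (X n) u)" for n u
  have Im: "I n \<in> borel_measurable S" for n unfolding I_def[abs_def] by (rule measurable_iexp_mult[OF Y_m])
  have I1: "norm (I n u) = 1" for n u unfolding I_def by (rule norm_exp_i_times)
  have qb: "q n = (\<integral>u. b n u *\<^sub>R I n u \<partial>S)" for n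
    unfolding q_def b_def I_def m_def
    by (rule integral_comb_seq[OF measurable_iexp_mult[OF Y_m] _ _ hits_sets])
      (simp_all only: norm_exp_i_times order_refl Y_comb_seq)
  have bm: "b n \<in> borel_measurable S" for n
    unfolding b_def[abs_def] by (rule comb_seq_section_measurable[OF hits_sets])
  have b1: "0 \<le> b n u" "b n u \<le> 1" for n u unfolding b_def by (rule measure_nonneg, rule P.prob_le_1)
  obtain K where K: "all_moments S K" and good: "AE w in S. w \<in> good K" using good_exists by blast
  have K1: "K w \<ge> 1" for w using K by (simp add: all_moments_def)
  have st: "AE u in S. \<forall>i. f (u i) = real (step (u i)) \<and> h dvd step (u i)"
  proof (subst AE_all_countable, rule allI)
    fix i :: nat
    have "AE y in \<nu>. f y = real (step y) \<and> h dvd step y" using step_eq h(1) by eventually_elim (rule conjI)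
    then show "AE u in S. f (u i) = real (step (u i)) \<and> h dvd step (u i)"
      by (rule AE_PiM_component[where I = UNIV and M = "\<lambda>_. \<nu>", OF prob_nu UNIV_I])
  qed
  have blim: "AE u in S. (\<lambda>n. b n u) \<longlonglongrightarrow> l"
    using good st AE_space
  proof eventually_elim
    case (elim u)
    have fu: "f (u i) = real (step (u i))" and hu: "h dvd step (u i)" for i using elim(2) by blast+
    define z where "z n = \<lfloor>X n\<rfloor> - int (\<Sum>i<m n. step (u i))" for n
    have Xf: "X n = of_int \<lfloor>X n\<rfloor>" for n using XZ[of n] by (simp add: of_int_floor)
    have zx: "real_of_int (z n) = X n - Usum (m n) u" for n
      unfolding z_def Usum_step[OF fu] using Xf[of n] by simp
    have zlim: "filterlim (\<lambda>n. X n - Usum (m n) u) at_top sequentially"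
      unfolding m_def by (rule remaining_at_top[OF K1 elim(1) X1 X])
    \<comment> \<open>The level \<open>X n\<close> is admissible and the steps are multiples of
      \<open>h\<close>, so the remaining level stays in the residue class along which
      \<open>hit_prob\<close> tends to \<open>l\<close>.\<close>
    have dv: "int h dvd z n - (- int k)" for n
    proof -
      have "h dvd (\<Sum>i<m n. step (u i))" using hu by (rule dvd_sum)
      then have "int h dvd int (\<Sum>i<m n. step (u i))" by (simp only: of_nat_dvd_iff)
      then have "int h dvd (\<lfloor>X n\<rfloor> - (- int k)) - int (\<Sum>i<m n. step (u i))" by (rule dvd_diff[OF h(2)[OF pos]])
      then show ?thesis by (simp only: z_def diff_diff_eq add.commute)
    qed
    \<comment> \<open>A positive remaining level keeps all earlier values of the monotone walk below
      \<open>X n\<close>, as \<open>hits_comb_seq\<close> requires.\<close>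
    have beq: "b n u = hit_prob k (z n)" if "X n - Usum (m n) u > 0" for n
    proof -
      have "Usum i u < X n" if "i < m n" for i
      proof -
        have "Usum i u \<le> Usum (m n) u" by (rule Usum_mono) (use that fu in auto)
        then show ?thesis using \<open>X n - Usum (m n) u > 0\<close> by linarith
      qed
      then have hc: "hits k (X n) (comb_seq (m n) u v) \<longleftrightarrow> hits k (X n - Usum (m n) u) v" for v by (rule hits_comb_seq)
      have sp: "comb_seq (m n) u v \<in> space S" if "v \<in> space S" for v
        using elim(3) that by (auto simp: space_PiM PiE_iff split: split_comb_seq)
      have "{v \<in> space S. comb_seq (m n) u v \<in> {v \<in> space S. hits k (X n) v}} = {v \<in> space S. hits k (X n - Usum (m n) u) v}"
        using sp hc by blast
      then show ?thesis unfolding b_def hit_prob_def zx by (simp only:)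
    qed
    show "(\<lambda>n. b n u) \<longlonglongrightarrow> l"
    proof (rule tendstoI)
      fix e :: real assume "e > 0"
      from lim[OF this] obtain z1 where z1: "\<And>z. z \<ge> z1 \<Longrightarrow> int h dvd z - (- int k) \<Longrightarrow> \<bar>hit_prob k z - l\<bar> < e" by blast
      have "\<forall>\<^sub>F n in sequentially. X n - Usum (m n) u \<ge> max 1 (of_int z1)"
        using zlim unfolding filterlim_at_top by blast
      then show "\<forall>\<^sub>F n in sequentially. dist (b n u) l < e"
      proof eventually_elim
        case (elim n)
        then have p: "X n - Usum (m n) u > 0" and "real_of_int z1 \<le> real_of_int (z n)" unfolding zx by linarith+
        then have "z1 \<le> z n" by (simp only: of_int_le_iff)
        then show ?case unfolding beq[OF p] dist_real_def by (rule z1[OF _ dv])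
      qed
    qed
  qed
  have ii: "integrable S (\<lambda>u. (b n u - l) *\<^sub>R I n u)" "integrable S (I n)" "integrable S (\<lambda>u. b n u *\<^sub>R I n u)" for n
  proof -
    show i1: "integrable S (I n)"
      by (rule P.integrable_const_bound[OF AE_I2 Im, where B = 1]) (simp only: I1 order_refl)
    show i2: "integrable S (\<lambda>u. b n u *\<^sub>R I n u)"
    proof (rule P.integrable_const_bound[OF AE_I2 borel_measurable_scaleR[OF bm Im], where B = 1])
      show "norm (b n u *\<^sub>R I n u) \<le> 1" for u unfolding norm_scaleR I1 using b1[of n u] by simp
    qed
    show "integrable S (\<lambda>u. (b n u - l) *\<^sub>R I n u)"
      unfolding scaleR_diff_left by (rule Bochner_Integration.integrable_diff[OF i2 integrable_scaleR_right[OF i1]])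
  qed
  \<comment> \<open>Only \<open>b n - l\<close> has to be small: \<open>I n\<close> has modulus
    \<open>1\<close>, so its own pointwise behaviour does not enter.\<close>
  have d: "(\<lambda>n. \<integral>u. (b n u - l) *\<^sub>R I n u \<partial>S) \<longlonglongrightarrow> (\<integral>u. 0 \<partial>S)"
  proof (rule integral_dominated_convergence[where w = "\<lambda>_. 1 + l"])
    show "(\<lambda>u. 0) \<in> borel_measurable S" by (rule borel_measurable_const)
    show "(\<lambda>u. (b n u - l) *\<^sub>R I n u) \<in> borel_measurable S" for n by (rule borel_measurable_integrable[OF ii(1)])
    show "integrable S (\<lambda>_. 1 + l)" by (rule P.integrable_const)
    show "AE u in S. norm ((b n u - l) *\<^sub>R I n u) \<le> 1 + l" for n
    proof (rule AE_I2)
      show "norm ((b n u - l) *\<^sub>R I n u) \<le> 1 + l" for u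
        unfolding norm_scaleR I1 mult_1_right using b1[of n u] l by linarith
    qed
    show "AE u in S. (\<lambda>n. (b n u - l) *\<^sub>R I n u) \<longlonglongrightarrow> 0"
      using blim
    proof eventually_elim
      case (elim u)
      from tendsto_rabs_zero[OF LIM_zero[OF elim]] have z: "(\<lambda>n. \<bar>b n u - l\<bar>) \<longlonglongrightarrow> 0" .
      show ?case
        by (rule Lim_null_comparison[OF always_eventually z]) (simp only: norm_scaleR I1 mult_1_right order_refl simp_thms)
    qed
  qed
  have qd: "q n = (\<integral>u. (b n u - l) *\<^sub>R I n u \<partial>S) + l *\<^sub>R c n" for n
    unfolding qb scaleR_diff_left Bochner_Integration.integral_diff[OF ii(3) integrable_scaleR_right[OF ii(2)]]
      integral_scaleR_right c_def I_def[symmetric] by (simp only: diff_add_cancel)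
  have cl: "c \<longlonglongrightarrow> complex_of_real (exp (- (\<gamma>2 * t\<^sup>2 / 2)))"
    unfolding c_def[abs_def] by (rule Y_clt[OF X1 X])
  have ql: "q \<longlonglongrightarrow> 0 + l *\<^sub>R complex_of_real (exp (- (\<gamma>2 * t\<^sup>2 / 2)))"
    unfolding qd[abs_def] by (rule tendsto_add[OF _ tendsto_scaleR[OF tendsto_const cl]]) (use d in simp)
  have pl: "(\<lambda>n. hit_prob k \<lfloor>X n\<rfloor>) \<longlonglongrightarrow> l"
  proof (rule tendstoI)
    fix e :: real assume "e > 0"
    from lim[OF this] obtain z1 where z1: "\<And>z. z \<ge> z1 \<Longrightarrow> int h dvd z - (- int k) \<Longrightarrow> \<bar>hit_prob k z - l\<bar> < e" by blast
    have "\<forall>\<^sub>F n in sequentially. X n \<ge> of_int z1" using X unfolding filterlim_at_top by blast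
    then show "\<forall>\<^sub>F n in sequentially. dist (hit_prob k \<lfloor>X n\<rfloor>) l < e"
    proof eventually_elim
      case (elim n)
      then show ?case unfolding dist_real_def by (intro z1 h(2)[OF pos]) (simp add: le_floor_iff)
    qed
  qed
  have "(\<lambda>n. (1 / hit_prob k \<lfloor>X n\<rfloor>) *\<^sub>R q n) \<longlonglongrightarrow> (1 / l) *\<^sub>R (0 + l *\<^sub>R complex_of_real (exp (- (\<gamma>2 * t\<^sup>2 / 2))))"
    by (rule tendsto_scaleR[OF tendsto_divide[OF tendsto_const pl] ql]) (use l in simp)
  then show ?thesis using l unfolding q_def by simp
qed

text \<open>If \<open>l = 0\<close>, no integer from \<open>1\<close> on is admissible, and the
  claim is vacuous. If \<open>l > 0\<close>, the events at admissible levels eventually have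
  probability at least \<open>l / 2\<close>, as \<open>conv_conditioned\<close> asks.\<close>

theorem conditional_limit:
  assumes tau: "\<tau> = Nm \<or> \<tau> = Np"
    and E: "\<And>x. x \<ge> 0 \<Longrightarrow> E x \<in> sets S" and ae: "\<And>x. x \<ge> 0 \<Longrightarrow> AE w in S. w \<in> E x \<longleftrightarrow> hits k x w"
  shows "conv_dist_all_moments (\<lambda>x. distr (uniform_measure S (E x)) borel (V \<tau> x)) (normal_law 0 \<gamma>2)
    (inf at_top (principal {x. x \<in> \<int> \<and> measure S (E x) > 0}))"
proof -
  obtain h l where hl: "h \<ge> (1::nat)" "l \<ge> (0::real)" "AE y in \<nu>. h dvd step y" "\<forall>z. hit_prob k z \<noteq> 0 \<longrightarrow> int h dvd z - (- int k)"
    "\<forall>e>0. \<exists>z1. \<forall>z\<ge>z1. int h dvd z - (- int k) \<longrightarrow> \<bar>hit_prob k z - l\<bar> < e"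
    "l = 0 \<longrightarrow> (\<forall>z\<ge>(if k = 0 then 1 else 0). hit_prob k z = 0)"
    using hit_prob_limit[of k] by blast
  define S' where "S' = {x. x \<in> \<int> \<and> measure S (E x) > 0}"
  have Ep: "measure S (E x) = hit_prob k \<lfloor>x\<rfloor>" if x: "x \<in> \<int>" "x \<ge> 0" for x
  proof -
    have "real_of_int \<lfloor>x\<rfloor> = x" by (rule of_int_floor[OF x(1)])
    then have "hit_prob k \<lfloor>x\<rfloor> = measure S {v \<in> space S. hits k x v}" by (simp only: hit_prob_def)
    also have "\<dots> = measure S (E x)"
      using ae[OF x(2)] AE_space
      by (intro P.finite_measure_eq_AE[OF _ hits_sets E[OF x(2)]]) (auto elim: eventually_elim2)
    finally show ?thesis ..
  qed
  have pos: "hit_prob k \<lfloor>x\<rfloor> > 0" if "x \<in> S'" "x \<ge> 1" for x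
    using that Ep[of x] by (auto simp: S'_def)
  show ?thesis
  proof (cases "l = 0")
    case True
    have no: "False" if "x \<in> S'" "x \<ge> 1" for x
    proof -
      have "\<lfloor>x\<rfloor> \<ge> (if k = 0 then 1 else 0)" using that(2) by (simp add: le_floor_iff)
      then have "hit_prob k \<lfloor>x\<rfloor> = 0" using hl(6) True by blast
      then show False using pos[OF that] by linarith
    qed
    show ?thesis unfolding S'_def[symmetric]
    proof (rule conv_conditioned[OF tau order_refl zero_less_one])
      show "E x \<in> sets S" if "x \<in> S'" "1 \<le> x" for x by (rule E) (use that in linarith)
      show "1 \<le> measure S (E x)" if "x \<in> S'" "1 \<le> x" for x using no[OF that] ..
      show "(\<lambda>n. (1 / measure S (E (X n))) *\<^sub>R (\<integral>w. indicator (E (X n)) w *\<^sub>R iexp (t * Y (X n) w) \<partial>S))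
        \<longlonglongrightarrow> complex_of_real (exp (- (\<gamma>2 * t\<^sup>2 / 2)))" if "\<And>n::nat. X n \<in> S'" "\<And>n. X n \<ge> 1" for X t
        using no[OF that(1)[of 0] that(2)[of 0]] ..
    qed
  next
    case False
    then have l: "l > 0" using hl(2) by simp
    then have "l / 2 > 0" by simp
    then obtain z1 where z1: "\<And>z. z \<ge> z1 \<Longrightarrow> int h dvd z - (- int k) \<Longrightarrow> \<bar>hit_prob k z - l\<bar> < l / 2" using hl(5) by blast
    define x0 where "x0 = max 1 (real_of_int z1)"
    have x0: "x0 \<ge> 1" by (simp add: x0_def)
    show ?thesis unfolding S'_def[symmetric]
    proof (rule conv_conditioned[OF tau x0 \<open>l / 2 > 0\<close>])
      show "E x \<in> sets S" if "x \<in> S'" "x0 \<le> x" for x by (rule E) (use that x0 in linarith)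
      show "l / 2 \<le> measure S (E x)" if "x \<in> S'" "x0 \<le> x" for x
      proof -
        have x1: "x \<ge> 1" using that x0 by linarith
        have xi: "x \<in> \<int>" using that(1) by (simp add: S'_def)
        have "z1 \<le> \<lfloor>x\<rfloor>" using that(2) by (simp add: le_floor_iff x0_def)
        moreover have "int h dvd \<lfloor>x\<rfloor> - (- int k)" using hl(4) pos[OF that(1) x1] less_irrefl by metis
        ultimately have "\<bar>hit_prob k \<lfloor>x\<rfloor> - l\<bar> < l / 2" by (rule z1)
        moreover have "measure S (E x) = hit_prob k \<lfloor>x\<rfloor>" by (rule Ep[OF xi]) (use x1 in linarith)
        ultimately show ?thesis by linarith
      qed
      fix X :: "nat \<Rightarrow> real" and t assume XS: "\<And>n. X n \<in> S'" and Xx: "\<And>n. X n \<ge> x0" and X: "filterlim X at_top sequentially"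
      have X1: "X n \<ge> 1" for n using Xx[of n] x0 by linarith
      have X0: "X n \<ge> 0" for n using X1[of n] by linarith
      have XZ: "X n \<in> \<int>" for n using XS[of n] by (simp add: S'_def)
      have ne: "hit_prob k \<lfloor>X n\<rfloor> \<noteq> 0" for n using pos[OF XS X1] by (rule less_imp_neq[symmetric])
      have eq: "(\<integral>w. indicator (E (X n)) w *\<^sub>R iexp (t * Y (X n) w) \<partial>S) = (\<integral>w. indicator {v \<in> space S. hits k (X n) v} w *\<^sub>R iexp (t * Y (X n) w) \<partial>S)" for n
      proof (rule integral_cong_AE)
        show "(\<lambda>w. indicator (E (X n)) w *\<^sub>R iexp (t * Y (X n) w)) \<in> borel_measurable S"
          by (rule borel_measurable_scaleR[OF borel_measurable_indicator[OF E[OF X0]] measurable_iexp_mult[OF Y_m]])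
        show "(\<lambda>w. indicator {v \<in> space S. hits k (X n) v} w *\<^sub>R iexp (t * Y (X n) w)) \<in> borel_measurable S"
          by (rule borel_measurable_scaleR[OF borel_measurable_indicator[OF hits_sets] measurable_iexp_mult[OF Y_m]])
        show "AE w in S. indicator (E (X n)) w *\<^sub>R iexp (t * Y (X n) w) = indicator {v \<in> space S. hits k (X n) v} w *\<^sub>R iexp (t * Y (X n) w)"
          using ae[OF X0[of n]] AE_space
        proof eventually_elim
          case (elim w)
          then have "indicator (E (X n)) w = (indicator {v \<in> space S. hits k (X n) v} w :: real)" by (simp add: indicator_def)
          then show ?case by (simp only:)
        qed
      qed
      show "(\<lambda>n. (1 / measure S (E (X n))) *\<^sub>R (\<integral>w. indicator (E (X n)) w *\<^sub>R iexp (t * Y (X n) w) \<partial>S))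
        \<longlonglongrightarrow> complex_of_real (exp (- (\<gamma>2 * t\<^sup>2 / 2)))"
        unfolding Ep[OF XZ X0] eq
        by (rule conditional_char_limit[OF X1 X XZ ne hl(3) _ _ l]) (use hl(4,5) in blast)+
    qed
  qed
qed

theorem overshoot_limit:
  assumes tau: "\<tau> = Nm \<or> \<tau> = Np" and k: "k \<ge> 1"
  shows "conv_dist_all_moments (\<lambda>x. distr (uniform_measure S {w \<in> space S. Usum (Np x w) w - x = real k}) borel (V \<tau> x)) (normal_law 0 \<gamma>2)
    (inf at_top (principal {x. x \<in> \<int> \<and> measure S {w \<in> space S. Usum (Np x w) w - x = real k} > 0}))"
proof (rule conditional_limit[OF tau])
  fix x :: real assume x: "x \<ge> 0"
  show "{w \<in> space S. Usum (Np x w) w - x = real k} \<in> sets S"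
    by (rule borel_measurable_eq[OF borel_measurable_diff[OF measurable_compose_countable[OF Usum_m Np_m] borel_measurable_const] borel_measurable_const])
  obtain K where K: "all_moments S K" and good: "AE w in S. w \<in> good K" using good_exists by blast
  have K1: "K w \<ge> 1" for w using K by (simp add: all_moments_def)
  show "AE w in S. w \<in> {w \<in> space S. Usum (Np x w) w - x = real k} \<longleftrightarrow> hits k x w"
    using good AE_steps AE_space
  proof eventually_elim
    case (elim w)
    have "Usum (Np x w) w - x = real k \<longleftrightarrow> hits k x w"
      by (rule overshoot_iff_hits[OF K1 elim(1) _ x k]) (use elim(2) in blast)
    then show ?case using elim(3) by blast
  qed
qed

theorem hit_limit:
  assumes tau: "\<tau> = Nm \<or> \<tau> = Np"
  shows "conv_dist_all_moments (\<lambda>x. distr (uniform_measure S {w \<in> space S. Usum (Nm x w) w = x}) borel (V \<tau> x)) (normal_law 0 \<gamma>2)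
    (inf at_top (principal {x. x \<in> \<int> \<and> measure S {w \<in> space S. Usum (Nm x w) w = x} > 0}))"
proof (rule conditional_limit[OF tau])
  fix x :: real assume x: "x \<ge> 0"
  show "{w \<in> space S. Usum (Nm x w) w = x} \<in> sets S"
    by (rule borel_measurable_eq[OF measurable_compose_countable[OF Usum_m Nm_m] borel_measurable_const])
  obtain K where K: "all_moments S K" and good: "AE w in S. w \<in> good K" using good_exists by blast
  have K1: "K w \<ge> 1" for w using K by (simp add: all_moments_def)
  show "AE w in S. w \<in> {w \<in> space S. Usum (Nm x w) w = x} \<longleftrightarrow> hits 0 x w"
    using good AE_steps AE_space
  proof eventually_elim
    case (elim w)
    have "Usum (Nm x w) w = x \<longleftrightarrow> hits 0 x w"
      by (rule hit_iff_hits[OF K1 elim(1) _ x]) (use elim(2) in blast)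
    then show ?case using elim(3) by blast
  qed
qed

end

context renewal_ustat
begin

theorem unconditional_limit:
  assumes tau: "\<tau> = Nm \<or> \<tau> = Np"
  shows "conv_dist_all_moments (\<lambda>x. distr S borel (V \<tau> x)) (normal_law 0 \<gamma>2) at_top"
proof -
  have U: "uniform_measure S (space S) = S"
  proof (rule measure_eqI)
    fix A assume "A \<in> sets (uniform_measure S (space S))"
    then have A: "A \<in> sets S" by simp
    then have "space S \<inter> A = A" using sets.sets_into_space by blast
    then show "emeasure (uniform_measure S (space S)) A = emeasure S A"
      using A by (simp add: emeasure_uniform_measure P.emeasure_space_1 divide_ennreal_def)
  qed simp
  have "conv_dist_all_moments (\<lambda>x. distr (uniform_measure S (space S)) borel (V \<tau> x)) (normal_law 0 \<gamma>2) (inf at_top (principal UNIV))"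
  proof (rule conv_conditioned[OF tau order_refl zero_less_one])
    show "space S \<in> sets S" for x :: real by (rule sets.top)
    show "1 \<le> measure S (space S)" for x :: real by (simp only: P.prob_space order_refl)
    fix X :: "nat \<Rightarrow> real" and t assume X1: "\<And>n. X n \<ge> 1" and X: "filterlim X at_top sequentially"
    have "(\<integral>w. indicator (space S) w *\<^sub>R iexp (t * Y (X n) w) \<partial>S) = (\<integral>w. iexp (t * Y (X n) w) \<partial>S)" for n
      by (rule Bochner_Integration.integral_cong[OF refl]) simp
    then show "(\<lambda>n. (1 / measure S (space S)) *\<^sub>R (\<integral>w. indicator (space S) w *\<^sub>R iexp (t * Y (X n) w) \<partial>S))
        \<longlonglongrightarrow> complex_of_real (exp (- (\<gamma>2 * t\<^sup>2 / 2)))"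
      unfolding P.prob_space div_by_1 scaleR_one using Y_clt[OF X1 X] by (simp only:)
  qed
  then show ?thesis unfolding U by (simp only: top_eq_principal_UNIV[symmetric] inf_top_right)
qed

end

section \<open>Transfer to the sequence space\<close>

lemma abs_powr_even:
  fixes a :: real
  assumes "k \<ge> 1"
  shows "\<bar>a\<bar> powr real (2 * k) = a ^ (2 * k)"
proof (cases "a = 0")
  case True
  then show ?thesis using assms by simp
next
  case False
  then have "\<bar>a\<bar> powr real (2 * k) = \<bar>a\<bar> ^ (2 * k)" by (intro powr_realpow) simp
  then show ?thesis by (simp only: power_even_abs even_mult_iff even_numeral simp_thms)
qed

text \<open>The map preserves the measure of the conditioning event and of its intersections with
  other preimages; this moves conditional laws between the given probability space and the sequence
  space.\<close>

lemma distr_uniform_measure_distr: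
  assumes \<Phi>: "\<Phi> \<in> measurable M N" and N: "distr M N \<Phi> = N" and A: "A \<in> sets N" and V: "V \<in> borel_measurable N"
  shows "distr (uniform_measure M (\<Phi> -` A \<inter> space M)) borel (\<lambda>\<omega>. V (\<Phi> \<omega>)) = distr (uniform_measure N A) borel V"
proof (rule measure_eqI)
  have em: "emeasure N B = emeasure M (\<Phi> -` B \<inter> space M)" if "B \<in> sets N" for B
    using emeasure_distr[OF \<Phi> that] unfolding N .
  have \<Phi>A: "\<Phi> -` A \<inter> space M \<in> sets M" by (rule measurable_sets[OF \<Phi> A])
  fix B assume "B \<in> sets (distr (uniform_measure M (\<Phi> -` A \<inter> space M)) borel (\<lambda>\<omega>. V (\<Phi> \<omega>)))"
  then have B: "B \<in> sets borel" by simp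
  have V1: "(\<lambda>\<omega>. V (\<Phi> \<omega>)) \<in> borel_measurable M" by (rule measurable_compose[OF \<Phi> V])
  have VB: "V -` B \<inter> space N \<in> sets N" by (rule measurable_sets[OF V B])
  have V1B: "(\<lambda>\<omega>. V (\<Phi> \<omega>)) -` B \<inter> space M \<in> sets M" by (rule measurable_sets[OF V1 B])
  have sp: "\<Phi> \<omega> \<in> space N" if "\<omega> \<in> space M" for \<omega> by (rule measurable_space[OF \<Phi> that])
  have eq: "(\<Phi> -` A \<inter> space M) \<inter> ((\<lambda>\<omega>. V (\<Phi> \<omega>)) -` B \<inter> space M) = \<Phi> -` (A \<inter> (V -` B \<inter> space N)) \<inter> space M"
    using sp by blast
  have "emeasure (distr (uniform_measure M (\<Phi> -` A \<inter> space M)) borel (\<lambda>\<omega>. V (\<Phi> \<omega>))) B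
    = emeasure (uniform_measure M (\<Phi> -` A \<inter> space M)) ((\<lambda>\<omega>. V (\<Phi> \<omega>)) -` B \<inter> space M)"
    using emeasure_distr[of "\<lambda>\<omega>. V (\<Phi> \<omega>)" "uniform_measure M (\<Phi> -` A \<inter> space M)" borel B] V1 B
    by (simp only: measurable_cong_sets[OF sets_uniform_measure refl] space_uniform_measure)
  also have "\<dots> = emeasure M (\<Phi> -` (A \<inter> (V -` B \<inter> space N)) \<inter> space M) / emeasure M (\<Phi> -` A \<inter> space M)"
    unfolding emeasure_uniform_measure[OF \<Phi>A V1B] eq ..
  also have "\<dots> = emeasure N (A \<inter> (V -` B \<inter> space N)) / emeasure N A"
    unfolding em[OF A] em[OF sets.Int[OF A VB]] ..
  also have "\<dots> = emeasure (uniform_measure N A) (V -` B \<inter> space N)"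
    unfolding emeasure_uniform_measure[OF A VB] ..
  also have "\<dots> = emeasure (distr (uniform_measure N A) borel V) B"
    using emeasure_distr[of V "uniform_measure N A" borel B] V B
    by (simp only: measurable_cong_sets[OF sets_uniform_measure refl] space_uniform_measure)
  finally show "emeasure (distr (uniform_measure M (\<Phi> -` A \<inter> space M)) borel (\<lambda>\<omega>. V (\<Phi> \<omega>))) B
    = emeasure (distr (uniform_measure N A) borel V) B" .
qed simp

lemma covariance_distr:
  assumes Q: "Q \<in> measurable M S" and F: "F \<in> borel_measurable S" and G: "G \<in> borel_measurable S"
    and a: "(\<integral>y. F y \<partial>distr M S Q) = a" and b: "(\<integral>y. G y \<partial>distr M S Q) = b"
    and Y: "\<And>\<omega>. \<omega> \<in> space M \<Longrightarrow> Y \<omega> = F (Q \<omega>)" and Z: "\<And>\<omega>. \<omega> \<in> space M \<Longrightarrow> Z \<omega> = G (Q \<omega>)"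
  shows "covariance M Y Z = (\<integral>y. (F y - a) * (G y - b) \<partial>distr M S Q)"
proof -
  have "(\<integral>\<omega>. Y \<omega> \<partial>M) = (\<integral>\<omega>. F (Q \<omega>) \<partial>M)" by (rule Bochner_Integration.integral_cong[OF refl Y])
  also have "\<dots> = a" unfolding a[symmetric] by (rule integral_distr[OF Q F, symmetric])
  finally have 1: "(\<integral>\<omega>. Y \<omega> \<partial>M) = a" .
  have "(\<integral>\<omega>. Z \<omega> \<partial>M) = (\<integral>\<omega>. G (Q \<omega>) \<partial>M)" by (rule Bochner_Integration.integral_cong[OF refl Z])
  also have "\<dots> = b" unfolding b[symmetric] by (rule integral_distr[OF Q G, symmetric])
  finally have 2: "(\<integral>\<omega>. Z \<omega> \<partial>M) = b" .
  have "covariance M Y Z = (\<integral>\<omega>. (F (Q \<omega>) - a) * (G (Q \<omega>) - b) \<partial>M)"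
    unfolding covariance_def 1 2 by (rule Bochner_Integration.integral_cong[OF refl]) (simp only: Y Z)
  also have "\<dots> = (\<integral>y. (F y - a) * (G y - b) \<partial>distr M S Q)"
    by (rule integral_distr[OF Q borel_measurable_times[OF borel_measurable_diff[OF F borel_measurable_const] borel_measurable_diff[OF G borel_measurable_const]], symmetric])
  finally show ?thesis .
qed

text \<open>The entries of the index tuples are shifted by one; the positions \<open>{1..d}\<close>
  inside a tuple stay as they are.\<close>

lemma (in iid_sequence) U_stat_eq_ustat: "U_stat X d g n \<omega> = ustat d g n (\<lambda>i. X (Suc i) \<omega>)"
proof -
  define up where "up s = (\<lambda>j\<in>{1..d}. Suc (s j))" for s :: "nat \<Rightarrow> nat"
  define down where "down s = (\<lambda>j\<in>{1..d}. s j - 1)" for s :: "nat \<Rightarrow> nat"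
  show ?thesis unfolding U_stat_def ustat_def
  proof (rule sum.reindex_bij_witness[where i = up and j = down])
    fix s assume "s \<in> {s \<in> {1..d} \<rightarrow>\<^sub>E {1..n}. strict_mono_on {1..d} s}"
    then have s: "s \<in> {1..d} \<rightarrow>\<^sub>E {1..n}" "strict_mono_on {1..d} s" by blast+
    have pos: "Suc (s j - 1) = s j" "s j - 1 < n" if "j \<in> {1..d}" for j
      using PiE_mem[OF s(1) that] by auto
    show "up (down s) = s"
    proof (rule PiE_ext[of _ "{1..d}" "\<lambda>_. UNIV"])
      show "up (down s) \<in> {1..d} \<rightarrow>\<^sub>E UNIV" by (simp add: up_def)
      show "s \<in> {1..d} \<rightarrow>\<^sub>E UNIV" using s(1) by (auto simp: PiE_iff)
      show "up (down s) j = s j" if "j \<in> {1..d}" for j using pos(1)[OF that] that by (simp add: up_def down_def)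
    qed
    have "strict_mono_on {1..d} (down s)"
    proof (rule strict_mono_onI)
      fix i j assume ij: "i \<in> {1..d}" "j \<in> {1..d}" "i < j"
      then have "s i < s j" by (intro strict_mono_onD[OF s(2) ij(1,2)])
      then show "down s i < down s j" using pos(1)[OF ij(1)] pos(1)[OF ij(2)] ij by (simp add: down_def)
    qed
    moreover have "down s \<in> {1..d} \<rightarrow>\<^sub>E {..<n}" using pos(2) by (auto simp: down_def)
    ultimately show "down s \<in> increasing_tuples d n" by (simp add: increasing_tuples_def)
    have "pick d (down s) (\<lambda>i. X (Suc i) \<omega>) = (\<lambda>j\<in>{1..d}. X (s j) \<omega>)"
    proof
      show "pick d (down s) (\<lambda>i. X (Suc i) \<omega>) j = (\<lambda>j\<in>{1..d}. X (s j) \<omega>) j" for j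
        using pos(1)[of j] by (simp add: pick_def down_def restrict_def)
    qed
    then show "g (pick d (down s) (\<lambda>i. X (Suc i) \<omega>)) = g (\<lambda>j\<in>{1..d}. X (s j) \<omega>)" by (simp only:)
  next
    fix s assume "s \<in> increasing_tuples d n"
    then have s: "s \<in> {1..d} \<rightarrow>\<^sub>E {..<n}" "strict_mono_on {1..d} s" by (auto simp: increasing_tuples_def)
    have lt: "s j < n" if "j \<in> {1..d}" for j using PiE_mem[OF s(1) that] by simp
    show "down (up s) = s"
    proof (rule PiE_ext[of _ "{1..d}" "\<lambda>_. UNIV"])
      show "down (up s) \<in> {1..d} \<rightarrow>\<^sub>E UNIV" by (simp add: down_def)
      show "s \<in> {1..d} \<rightarrow>\<^sub>E UNIV" using s(1) by (auto simp: PiE_iff)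
      show "down (up s) j = s j" if "j \<in> {1..d}" for j using that by (simp add: up_def down_def)
    qed
    have "strict_mono_on {1..d} (up s)"
    proof (rule strict_mono_onI)
      fix i j assume ij: "i \<in> {1..d}" "j \<in> {1..d}" "i < j"
      then have "s i < s j" by (intro strict_mono_onD[OF s(2) ij(1,2)])
      then show "up s i < up s j" using ij by (simp add: up_def)
    qed
    moreover have "up s \<in> {1..d} \<rightarrow>\<^sub>E {1..n}" using lt by (auto simp: up_def Suc_le_eq)
    ultimately show "up s \<in> {s \<in> {1..d} \<rightarrow>\<^sub>E {1..n}. strict_mono_on {1..d} s}" by blast
  qed
qed

context renewal_ustat
begin

text \<open>Linearity of the integral needs an integrable section, hence the restriction to almost
  every \<open>y\<close>.\<close>

lemma proj_gc: "j \<in> {1..d} \<Longrightarrow> AE y in \<nu>. proj d gc j y = proj d g j y - mg"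
proof -
  interpret K: prob_space "kernel_space d" by (rule prob_space_kernel_space)
  assume j: "j \<in> {1..d}"
  from AE_integrable_upd[OF g j g_integrable] show ?thesis
  proof eventually_elim
    case (elim y)
    show ?case unfolding proj_def gc_def Bochner_Integration.integral_diff[OF elim K.integrable_const] by (simp add: K.prob_space)
  qed
qed

lemma proj_mean: "j \<in> {1..d} \<Longrightarrow> (\<integral>y. proj d g j y - mg \<partial>\<nu>) = 0"
proof -
  assume j: "j \<in> {1..d}"
  have "(\<integral>y. proj d g j y - mg \<partial>\<nu>) = (\<integral>y. proj d g j y \<partial>\<nu>) - (\<integral>y. mg \<partial>\<nu>)"
    by (rule Bochner_Integration.integral_diff[OF integral_proj(1)[OF g j g_integrable] M.integrable_const])
  then show ?thesis unfolding integral_proj(2)[OF g j g_integrable] by (simp add: M.prob_space mg_def)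
qed

lemma gamma2_eq:
  "\<gamma>2 = mu powi (1 - 2 * int d) * (\<Sum>i=1..d. \<Sum>j=1..d. weight_limit d i j * (\<integral>y. proj d gc i y * proj d gc j y \<partial>\<nu>))
    - 2 * (mu powi (- 2 * int d) * mg / (fact (d - 1) * fact d)) * (\<Sum>j=1..d. \<integral>y. fc y * proj d gc j y \<partial>\<nu>)
    + mu powi (- 2 * int d - 1) * mg\<^sup>2 / (fact (d - 1))\<^sup>2 * (\<integral>y. fc y * fc y \<partial>\<nu>)"
proof -
  obtain e where e: "d = Suc e" using d by (cases d) auto
  define A where "A = (\<Sum>i=1..d. \<Sum>j=1..d. weight_limit d i j * (\<integral>y. proj d gc i y * proj d gc j y \<partial>\<nu>))"
  define B where "B = (\<Sum>j=1..d. \<integral>y. fc y * proj d gc j y \<partial>\<nu>)"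
  define C where "C = (\<integral>y. fc y * fc y \<partial>\<nu>)"
  define m where "m = mu ^ (2 * d - 1)"
  have m: "m > 0" unfolding m_def using mu by simp
  have i1: "1 - 2 * int d = - int (2 * d - 1)" "- 2 * int d = - int (Suc (2 * d - 1))" "- 2 * int d - 1 = - int (Suc (Suc (2 * d - 1)))"
    unfolding e by simp_all
  have p: "mu powi (1 - 2 * int d) = 1 / m" "mu powi (- 2 * int d) = 1 / (mu * m)" "mu powi (- 2 * int d - 1) = 1 / (mu * (mu * m))"
    unfolding i1(1) i1(3) unfolding i1(2) power_int_minus_divide power_int_of_nat power_Suc m_def by (rule refl)+
  show ?thesis
    unfolding \<gamma>2_def p A_def[symmetric] B_def[symmetric] C_def[symmetric] m_def[symmetric] cc_def
    using mu m by (simp add: field_simps power2_eq_square)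
qed

end

text \<open>Used with \<open>Suc\<close> for the sequence of observations and with the identity on
  \<open>{1..d}\<close> for the arguments of the kernel. Injectivity keeps the selected variables
  distinct, hence independent.\<close>

lemma (in prob_space) distr_iid_reindex:
  fixes X :: "nat \<Rightarrow> 'a \<Rightarrow> 'b" and p :: "nat \<Rightarrow> nat"
  assumes ind: "indep_vars (\<lambda>_. S) X UNIV" and same: "\<And>i. distr M S (X i) = distr M S (X 0)" and inj: "inj_on p I"
  shows "(\<lambda>\<omega>. \<lambda>n\<in>I. X (p n) \<omega>) \<in> measurable M (PiM I (\<lambda>_. distr M S (X 0)))"
    and "distr M (PiM I (\<lambda>_. distr M S (X 0))) (\<lambda>\<omega>. \<lambda>n\<in>I. X (p n) \<omega>) = PiM I (\<lambda>_. distr M S (X 0))"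
proof -
  define \<nu> where "\<nu> = distr M S (X 0)"
  have Xm: "X i \<in> measurable M S" for i using ind unfolding indep_vars_def by blast
  have law: "distr M S (X i) = \<nu>" for i unfolding \<nu>_def by (rule same)
  have sets_eq: "sets (PiM J (\<lambda>_. \<nu>)) = sets (PiM J (\<lambda>_. S))" for J :: "nat set"
    by (rule sets_PiM_cong[OF refl]) (simp add: \<nu>_def)
  have prob: "prob_space \<nu>" unfolding \<nu>_def by (rule prob_space_distr[OF Xm])
  have \<Theta>: "(\<lambda>\<omega>. \<lambda>i\<in>UNIV. X i \<omega>) \<in> measurable M (PiM UNIV (\<lambda>_. S))" by (rule measurable_restrict[OF Xm])
  have joint: "distr M (PiM UNIV (\<lambda>_. S)) (\<lambda>\<omega>. \<lambda>i\<in>UNIV. X i \<omega>) = PiM UNIV (\<lambda>_. \<nu>)"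
    using ind unfolding indep_vars_iff_distr_eq_PiM[where M' = "\<lambda>_. S", OF UNIV_not_empty Xm] law .
  have r: "(\<lambda>w. \<lambda>n\<in>I. w (p n)) \<in> measurable (PiM UNIV (\<lambda>_. S)) (PiM I (\<lambda>_. \<nu>))"
    unfolding measurable_cong_sets[OF refl sets_eq]
    by (rule measurable_restrict, rule measurable_component_singleton[OF UNIV_I])
  show "(\<lambda>\<omega>. \<lambda>n\<in>I. X (p n) \<omega>) \<in> measurable M (PiM I (\<lambda>_. distr M S (X 0)))"
    unfolding \<nu>_def[symmetric] measurable_cong_sets[OF refl sets_eq] by (rule measurable_restrict[OF Xm])
  have "PiM I (\<lambda>_. \<nu>) = distr (PiM UNIV (\<lambda>_. \<nu>)) (PiM I (\<lambda>_. \<nu>)) (\<lambda>w. \<lambda>n\<in>I. w (p n))"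
    by (rule distr_PiM_reindex[where K = UNIV and M = "\<lambda>_. \<nu>", OF prob inj, symmetric]) simp
  also have "\<dots> = distr M (PiM I (\<lambda>_. \<nu>)) ((\<lambda>w. \<lambda>n\<in>I. w (p n)) \<circ> (\<lambda>\<omega>. \<lambda>i\<in>UNIV. X i \<omega>))"
    unfolding joint[symmetric] by (rule distr_distr[OF r \<Theta>])
  finally show "distr M (PiM I (\<lambda>_. distr M S (X 0))) (\<lambda>\<omega>. \<lambda>n\<in>I. X (p n) \<omega>) = PiM I (\<lambda>_. distr M S (X 0))"
    unfolding \<nu>_def[symmetric] by (simp add: comp_def)
qed

theorem theorem3p18:
  fixes M :: "'a measure" and S :: "'b measure"
    and X :: "nat \<Rightarrow> 'a \<Rightarrow> 'b"
    and d :: nat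
    and f :: "'b \<Rightarrow> real" and g :: "(nat \<Rightarrow> 'b) \<Rightarrow> real"
  assumes "prob_space M"
    and "prob_space.indep_vars M (\<lambda>_. S) X UNIV"
    and "\<And>i. distr M S (X i) = distr M S (X 0)"
    and "d \<ge> 1"
    and "f \<in> borel_measurable S"
    and "g \<in> borel_measurable (PiM {1..d} (\<lambda>_. S))"
    and "\<And>p::real. p > 0 \<Longrightarrow> integrable M (\<lambda>\<omega>. \<bar>f (X 0 \<omega>)\<bar> powr p)"
    and "\<And>p::real. p > 0 \<Longrightarrow> integrable M (\<lambda>\<omega>. \<bar>g (\<lambda>j\<in>{1..d}. X j \<omega>)\<bar> powr p)"
    and "mean1 M X f > 0"
  shows
    "(\<forall>N \<in> {N_minus X f, N_plus X f}.
        conv_dist_all_moments (\<lambda>x. distr M borel (V_norm M X d f g N x))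
          (normal_law 0 (gamma_sq M X d f g)) at_top)
     \<and>
     ((AE \<omega> in M. f (X 0 \<omega>) \<in> \<int> \<and> f (X 0 \<omega>) \<ge> 0) \<longrightarrow>
       (\<forall>N \<in> {N_minus X f, N_plus X f}.
          (\<forall>k::int. k \<ge> 1 \<longrightarrow>
             cond_conv_dist_all_moments M (\<lambda>x \<omega>. overshoot X f x \<omega> = real_of_int k)
               (V_norm M X d f g N) (normal_law 0 (gamma_sq M X d f g)))
          \<and>
          cond_conv_dist_all_moments M (\<lambda>x \<omega>. U_sum X f (N_minus X f x \<omega>) \<omega> = x)
            (V_norm M X d f g N) (normal_law 0 (gamma_sq M X d f g))))"
proof -
  interpret prob_space M by fact
  define \<nu> where "\<nu> = distr M S (X 0)"
  define mu where "mu = mean1 M X f"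
  define mg where "mg = mean_tuple M X d g"
  \<comment> \<open>\<open>X 0\<close> is the generic variable, so the observed sequence starts at
    \<open>X 1\<close>.\<close>
  define \<Phi> where "\<Phi> \<omega> = (\<lambda>i. X (Suc i) \<omega>)" for \<omega>
  define \<Psi> where "\<Psi> \<omega> = (\<lambda>j\<in>{1..d}. X j \<omega>)" for \<omega>
  have Xm: "X i \<in> measurable M S" for i using assms(2) unfolding indep_vars_def by blast
  have meas: "measurable \<nu> L = measurable S L" for L :: "real measure" unfolding \<nu>_def by (rule measurable_distr_eq1)
  have sp: "space \<nu> = space S" unfolding \<nu>_def by (rule space_distr)
  have f: "f \<in> borel_measurable \<nu>" unfolding meas by fact
  have sets_eq: "sets (PiM {1..d} (\<lambda>_. \<nu>)) = sets (PiM {1..d} (\<lambda>_. S))"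
    by (rule sets_PiM_cong[OF refl]) (simp add: \<nu>_def)
  have g: "g \<in> borel_measurable (PiM {1..d} (\<lambda>_. \<nu>))"
    unfolding measurable_cong_sets[OF sets_eq refl] by fact
  have \<Phi>: "\<Phi> \<in> measurable M (PiM UNIV (\<lambda>_. \<nu>))" "distr M (PiM UNIV (\<lambda>_. \<nu>)) \<Phi> = PiM UNIV (\<lambda>_. \<nu>)"
    using distr_iid_reindex[OF assms(2,3) inj_Suc[of UNIV]] unfolding \<nu>_def[symmetric] \<Phi>_def[abs_def] restrict_UNIV .
  have inj: "inj_on (\<lambda>j. j) {1..d}" by (rule inj_onI)
  have \<Psi>: "\<Psi> \<in> measurable M (PiM {1..d} (\<lambda>_. \<nu>))" "distr M (PiM {1..d} (\<lambda>_. \<nu>)) \<Psi> = PiM {1..d} (\<lambda>_. \<nu>)"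
    using distr_iid_reindex[OF assms(2,3) inj] unfolding \<nu>_def[symmetric] \<Psi>_def[abs_def] .
  have mu_eq: "mu = (\<integral>y. f y \<partial>\<nu>)"
    unfolding mu_def mean1_def \<nu>_def by (rule integral_distr[OF Xm assms(5), symmetric])
  have mg_eq: "mg = (\<integral>t. g t \<partial>PiM {1..d} (\<lambda>_. \<nu>))"
    unfolding mg_def mean_tuple_def \<Psi>_def[symmetric] using integral_distr[OF \<Psi>(1) g] unfolding \<Psi>(2) by (rule sym)
  have prob_nu: "prob_space \<nu>" unfolding \<nu>_def by (rule prob_space_distr[OF Xm])
  have W: "renewal_ustat \<nu> d f g mu mg"
  proof (intro renewal_ustat.intro renewal_ustat_axioms.intro iid_sequence.intro sequence_space.intro)
    interpret N: prob_space \<nu> by (rule prob_nu)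
    show "product_prob_space (\<lambda>_::nat. \<nu>)" by unfold_locales
    show "1 \<le> d" by fact
    show "f \<in> borel_measurable \<nu>" by (rule f)
    show "g \<in> borel_measurable (PiM {1..d} (\<lambda>_. \<nu>))" by (rule g)
    show "mu = (\<integral>y. f y \<partial>\<nu>)" by (rule mu_eq)
    show "mu > 0" unfolding mu_def by fact
    show "mg = (\<integral>t. g t \<partial>PiM {1..d} (\<lambda>_. \<nu>))" by (rule mg_eq)
    fix k :: nat assume k: "1 \<le> k"
    then have p: "real (2 * k) > 0" by simp
    show "integrable \<nu> (\<lambda>y. f y ^ (2 * k))"
      unfolding \<nu>_def integrable_distr_eq[OF Xm borel_measurable_power[OF assms(5)]]
      using assms(7)[OF p] unfolding abs_powr_even[OF k] .
    have "integrable (distr M (PiM {1..d} (\<lambda>_. \<nu>)) \<Psi>) (\<lambda>t. g t ^ (2 * k))"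
      unfolding integrable_distr_eq[OF \<Psi>(1) borel_measurable_power[OF g]] \<Psi>_def
      using assms(8)[OF p] unfolding abs_powr_even[OF k] .
    then show "integrable (PiM {1..d} (\<lambda>_. \<nu>)) (\<lambda>t. g t ^ (2 * k))" unfolding \<Psi>(2) .
  qed
  interpret W: renewal_ustat \<nu> d f g mu mg by (rule W)
  have Usum: "U_sum X f n \<omega> = W.Usum n (\<Phi> \<omega>)" for n \<omega>
    unfolding U_sum_def W.Usum_def \<Phi>_def One_nat_def by (rule sum.atLeast1_atMost_eq)
  have Nm: "N_minus X f x \<omega> = W.Nm x (\<Phi> \<omega>)" and Np: "N_plus X f x \<omega> = W.Np x (\<Phi> \<omega>)" for x \<omega>
    unfolding N_minus_def N_plus_def W.Nm_def W.Np_def Usum by (rule refl)+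
  have Vn: "V_norm M X d f g N x \<omega> = W.V \<tau> x (\<Phi> \<omega>)" if "\<And>x \<omega>. N x \<omega> = \<tau> x (\<Phi> \<omega>)" for N \<tau> x \<omega>
  proof -
    have "mu powi (- int d) * mg * inverse (fact d) * x ^ d = mg / fact d * (x / mu) ^ d"
      unfolding power_int_minus power_int_of_nat by (simp add: field_simps power_divide)
    then show ?thesis
      unfolding V_norm_def W.V_def W.U_stat_eq_ustat \<Phi>_def[symmetric] that mu_def[symmetric] mg_def[symmetric] by (simp only:)
  qed
  have cases: "\<exists>\<tau>. (\<tau> = W.Nm \<or> \<tau> = W.Np) \<and> (\<forall>x \<omega>. N x \<omega> = \<tau> x (\<Phi> \<omega>))" if "N \<in> {N_minus X f, N_plus X f}" for N
    using that Nm Np by blast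
  have gamma: "gamma_sq M X d f g = W.\<gamma>2"
  proof -
    define h where "h i \<omega> = projection M X d g i (X 0 \<omega>)" for i \<omega>
    \<comment> \<open>\<open>X 0\<close> supplies the free argument and \<open>X 1, ..., X d\<close>
      the averaged ones. Written as an update of \<open>\<Psi>\<close>, the tuple turns the
      expectation into the integral in \<open>proj\<close>.\<close>
    have h: "h i \<omega> = W.proj d g i (X 0 \<omega>) - mg" if i: "i \<in> {1..d}" and \<omega>: "\<omega> \<in> space M" for i \<omega>
    proof -
      define y where "y = X 0 \<omega>"
      have y: "y \<in> space \<nu>" unfolding sp y_def by (rule measurable_space[OF Xm \<omega>])
      have eq: "(\<lambda>j\<in>{1..d}. if j = i then y else X j \<omega>') = (\<Psi> \<omega>')(i := y)" for \<omega>'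
        using i unfolding \<Psi>_def restrict_def by (intro ext) auto
      have "(\<integral>\<omega>'. g (\<lambda>j\<in>{1..d}. if j = i then y else X j \<omega>') \<partial>M) = (\<integral>t. g (t(i := y)) \<partial>distr M (PiM {1..d} (\<lambda>_. \<nu>)) \<Psi>)"
        unfolding eq by (rule integral_distr[OF \<Psi>(1) W.measurable_upd_kernel_section[OF g i y], symmetric])
      then show ?thesis unfolding h_def projection_def W.proj_def \<Psi>(2) y_def[symmetric] mg_def by (simp only:)
    qed
    have pm: "(\<lambda>y. W.proj d g i y - mg) \<in> borel_measurable S" if "i \<in> {1..d}" for i
      using borel_measurable_diff[OF W.measurable_proj[OF g that] borel_measurable_const] unfolding meas .
    have m0: "(\<integral>y. W.proj d g i y - mg \<partial>distr M S (X 0)) = 0" if "i \<in> {1..d}" for i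
      unfolding \<nu>_def[symmetric] by (rule W.proj_mean[OF that])
    have cm: "W.proj d W.gc i \<in> borel_measurable \<nu>" if "i \<in> {1..d}" for i
      by (rule W.measurable_proj[OF W.gc_m that])
    have dm: "(\<lambda>y. W.proj d g i y - mg) \<in> borel_measurable \<nu>" if "i \<in> {1..d}" for i
      unfolding meas by (rule pm[OF that])
    have c1: "covariance M (h i) (h j) = (\<integral>y. W.proj d W.gc i y * W.proj d W.gc j y \<partial>\<nu>)"
      if i: "i \<in> {1..d}" and j: "j \<in> {1..d}" for i j
    proof -
      have "covariance M (h i) (h j) = (\<integral>y. (W.proj d g i y - mg - 0) * (W.proj d g j y - mg - 0) \<partial>distr M S (X 0))"
        by (rule covariance_distr[OF Xm pm[OF i] pm[OF j] m0[OF i] m0[OF j] h[OF i] h[OF j]])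
      also have "\<dots> = (\<integral>y. W.proj d W.gc i y * W.proj d W.gc j y \<partial>\<nu>)"
        unfolding \<nu>_def[symmetric] diff_0_right
      proof (rule integral_cong_AE[OF borel_measurable_times[OF dm[OF i] dm[OF j]] borel_measurable_times[OF cm[OF i] cm[OF j]]])
        show "AE y in \<nu>. (W.proj d g i y - mg) * (W.proj d g j y - mg) = W.proj d W.gc i y * W.proj d W.gc j y"
          using W.proj_gc[OF i] W.proj_gc[OF j] by eventually_elim (simp only:)
      qed
      finally show ?thesis .
    qed
    have fm: "(\<integral>y. f y \<partial>distr M S (X 0)) = mu" unfolding \<nu>_def[symmetric] mu_eq ..
    have c2: "covariance M (\<lambda>\<omega>. f (X 0 \<omega>)) (h j) = (\<integral>y. W.fc y * W.proj d W.gc j y \<partial>\<nu>)" if j: "j \<in> {1..d}" for j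
    proof -
      have "covariance M (\<lambda>\<omega>. f (X 0 \<omega>)) (h j) = (\<integral>y. (f y - mu) * (W.proj d g j y - mg - 0) \<partial>distr M S (X 0))"
        by (rule covariance_distr[OF Xm assms(5) pm[OF j] fm m0[OF j] refl h[OF j]])
      also have "\<dots> = (\<integral>y. W.fc y * W.proj d W.gc j y \<partial>\<nu>)"
        unfolding \<nu>_def[symmetric] diff_0_right W.fc_def[symmetric]
      proof (rule integral_cong_AE[OF borel_measurable_times[OF W.fc_m dm[OF j]] borel_measurable_times[OF W.fc_m cm[OF j]]])
        show "AE y in \<nu>. W.fc y * (W.proj d g j y - mg) = W.fc y * W.proj d W.gc j y"
          using W.proj_gc[OF j] by eventually_elim (simp only:)
      qed
      finally show ?thesis .
    qed
    have c3: "variance (\<lambda>\<omega>. f (X 0 \<omega>)) = (\<integral>y. W.fc y * W.fc y \<partial>\<nu>)"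
    proof -
      have "variance (\<lambda>\<omega>. f (X 0 \<omega>)) = covariance M (\<lambda>\<omega>. f (X 0 \<omega>)) (\<lambda>\<omega>. f (X 0 \<omega>))"
        unfolding covariance_def power2_eq_square ..
      also have "\<dots> = (\<integral>y. (f y - mu) * (f y - mu) \<partial>distr M S (X 0))"
        by (rule covariance_distr[OF Xm assms(5) assms(5) fm fm refl refl])
      finally show ?thesis unfolding \<nu>_def[symmetric] W.fc_def[symmetric] .
    qed
    have s1: "(\<Sum>i=1..d. \<Sum>j=1..d. weight_limit d i j * covariance M (h i) (h j))
      = (\<Sum>i=1..d. \<Sum>j=1..d. weight_limit d i j * (\<integral>y. W.proj d W.gc i y * W.proj d W.gc j y \<partial>\<nu>))"
      by (rule sum.cong[OF refl], rule sum.cong[OF refl]) (simp only: c1)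
    have s2: "(\<Sum>i=1..d. covariance M (\<lambda>\<omega>. f (X 0 \<omega>)) (h i)) = (\<Sum>j=1..d. \<integral>y. W.fc y * W.proj d W.gc j y \<partial>\<nu>)"
      by (rule sum.cong[OF refl c2])
    show ?thesis
      unfolding gamma_sq_def Let_def weight_limit_def[symmetric] h_def[symmetric] mu_def[symmetric] mg_def[symmetric] c3
      unfolding s1 s2 W.gamma2_eq ..
  qed
  show ?thesis
  proof (intro conjI ballI impI allI)
    fix N assume "N \<in> {N_minus X f, N_plus X f}"
    from cases[OF this] obtain \<tau> where \<tau>: "\<tau> = W.Nm \<or> \<tau> = W.Np" and N: "\<forall>x \<omega>. N x \<omega> = \<tau> x (\<Phi> \<omega>)" by blast
    have eq: "distr M borel (V_norm M X d f g N x) = distr (PiM UNIV (\<lambda>_. \<nu>)) borel (W.V \<tau> x)" for x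
    proof -
      have "V_norm M X d f g N x = W.V \<tau> x \<circ> \<Phi>" by (rule ext) (simp only: comp_apply Vn[of N \<tau>, OF N[rule_format]])
      then have "distr M borel (V_norm M X d f g N x) = distr (distr M (PiM UNIV (\<lambda>_. \<nu>)) \<Phi>) borel (W.V \<tau> x)"
        using distr_distr[OF W.V_m[OF \<tau>] \<Phi>(1)] by (simp only:)
      then show ?thesis unfolding \<Phi>(2) .
    qed
    show "conv_dist_all_moments (\<lambda>x. distr M borel (V_norm M X d f g N x)) (normal_law 0 (gamma_sq M X d f g)) at_top"
      unfolding gamma eq by (rule W.unconditional_limit[OF \<tau>])
  next
    assume lat: "AE \<omega> in M. f (X 0 \<omega>) \<in> \<int> \<and> f (X 0 \<omega>) \<ge> 0"
    have P: "{y \<in> space S. f y \<in> \<int> \<and> f y \<ge> 0} \<in> sets S"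
    proof -
      have "f -` (\<int> \<inter> {0..}) \<inter> space S \<in> sets S"
        by (rule measurable_sets[OF assms(5) borel_closed[OF closed_Int[OF closed_Ints closed_atLeast]]])
      moreover have "f -` (\<int> \<inter> {0..}) \<inter> space S = {y \<in> space S. f y \<in> \<int> \<and> f y \<ge> 0}" by auto
      ultimately show ?thesis by (simp only:)
    qed
    have "AE y in \<nu>. f y \<in> \<int> \<and> f y \<ge> 0" unfolding \<nu>_def AE_distr_iff[OF Xm P] by (rule lat)
    then interpret L: lattice_renewal_ustat \<nu> d f g mu mg
      by (intro lattice_renewal_ustat.intro W lattice_renewal_ustat_axioms.intro)
    \<comment> \<open>Both conditional claims have this shape: the event is the preimage under
      \<Phi> of an event in the sequence space, so probabilities and conditional laws
      coincide.\<close>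
    have transfer: "cond_conv_dist_all_moments M A (V_norm M X d f g N) (normal_law 0 (gamma_sq M X d f g))"
      if \<tau>: "\<tau> = W.Nm \<or> \<tau> = W.Np" and N: "\<forall>x \<omega>. N x \<omega> = \<tau> x (\<Phi> \<omega>)"
        and A: "\<And>x \<omega>. A x \<omega> \<longleftrightarrow> B x (\<Phi> \<omega>)" and B: "\<And>x. {w \<in> space (PiM UNIV (\<lambda>_. \<nu>)). B x w} \<in> sets (PiM UNIV (\<lambda>_. \<nu>))"
        and lim: "conv_dist_all_moments (\<lambda>x. distr (uniform_measure (PiM UNIV (\<lambda>_. \<nu>)) {w \<in> space (PiM UNIV (\<lambda>_. \<nu>)). B x w}) borel (W.V \<tau> x))
          (normal_law 0 W.\<gamma>2) (inf at_top (principal {x. x \<in> \<int> \<and> measure (PiM UNIV (\<lambda>_. \<nu>)) {w \<in> space (PiM UNIV (\<lambda>_. \<nu>)). B x w} > 0}))"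
      for \<tau> N A B
    proof -
      have ev: "{\<omega> \<in> space M. A x \<omega>} = \<Phi> -` {w \<in> space (PiM UNIV (\<lambda>_. \<nu>)). B x w} \<inter> space M" for x
        using measurable_space[OF \<Phi>(1)] A by blast
      have m: "measure M {\<omega> \<in> space M. A x \<omega>} = measure (PiM UNIV (\<lambda>_. \<nu>)) {w \<in> space (PiM UNIV (\<lambda>_. \<nu>)). B x w}" for x
        using measure_distr[OF \<Phi>(1) B[of x]] unfolding \<Phi>(2) ev ..
      have V: "V_norm M X d f g N x = (\<lambda>\<omega>. W.V \<tau> x (\<Phi> \<omega>))" for x by (rule ext) (rule Vn[of N \<tau>, OF N[rule_format]])
      have dist: "distr (uniform_measure M {\<omega> \<in> space M. A x \<omega>}) borel (V_norm M X d f g N x)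
        = distr (uniform_measure (PiM UNIV (\<lambda>_. \<nu>)) {w \<in> space (PiM UNIV (\<lambda>_. \<nu>)). B x w}) borel (W.V \<tau> x)" for x
        unfolding V ev by (rule distr_uniform_measure_distr[OF \<Phi> B W.V_m[OF \<tau>]])
      show ?thesis unfolding cond_conv_dist_all_moments_def m dist gamma by (rule lim)
    qed
    fix N assume "N \<in> {N_minus X f, N_plus X f}"
    from cases[OF this] obtain \<tau> where \<tau>: "\<tau> = W.Nm \<or> \<tau> = W.Np" and N: "\<forall>x \<omega>. N x \<omega> = \<tau> x (\<Phi> \<omega>)" by blast
    show "cond_conv_dist_all_moments M (\<lambda>x \<omega>. U_sum X f (N_minus X f x \<omega>) \<omega> = x) (V_norm M X d f g N) (normal_law 0 (gamma_sq M X d f g))"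
    proof (rule transfer[OF \<tau> N])
      show "U_sum X f (N_minus X f x \<omega>) \<omega> = x \<longleftrightarrow> W.Usum (W.Nm x (\<Phi> \<omega>)) (\<Phi> \<omega>) = x" for x \<omega>
        unfolding Usum Nm ..
      show "{w \<in> space (PiM UNIV (\<lambda>_. \<nu>)). W.Usum (W.Nm x w) w = x} \<in> sets (PiM UNIV (\<lambda>_. \<nu>))" for x
        by (rule borel_measurable_eq[OF measurable_compose_countable[OF W.Usum_m W.Nm_m] borel_measurable_const])
    qed (rule L.hit_limit[OF \<tau>])
    fix k :: int assume k: "1 \<le> k"
    then have kn: "nat k \<ge> 1" "real_of_int k = real (nat k)" by simp_all
    show "cond_conv_dist_all_moments M (\<lambda>x \<omega>. overshoot X f x \<omega> = real_of_int k) (V_norm M X d f g N) (normal_law 0 (gamma_sq M X d f g))"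
      unfolding kn(2)
    proof (rule transfer[OF \<tau> N])
      show "overshoot X f x \<omega> = real (nat k) \<longleftrightarrow> W.Usum (W.Np x (\<Phi> \<omega>)) (\<Phi> \<omega>) - x = real (nat k)" for x \<omega>
        unfolding overshoot_def Usum Np ..
      show "{w \<in> space (PiM UNIV (\<lambda>_. \<nu>)). W.Usum (W.Np x w) w - x = real (nat k)} \<in> sets (PiM UNIV (\<lambda>_. \<nu>))" for x
        by (rule borel_measurable_eq[OF borel_measurable_diff[OF measurable_compose_countable[OF W.Usum_m W.Np_m] borel_measurable_const] borel_measurable_const])
    qed (rule L.overshoot_limit[OF \<tau> kn(1)])
  qed
qed

end
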